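(* For any $C^*$-category $\mathcal{A}$, there is an equivalence of $C^*$-categories $\mathcal{M}(\mathcal{K}\mathrm{Hilb}\text{-}\mathcal{A})\cong\mathrm{Hilb}\text{-}\mathcal{A}$, where $\mathcal{M}(-)$ denotes the multiplier category, $\mathrm{Hilb}\text{-}\mathcal{A}$ is the category of right Hilbert $\mathcal{A}$-modules and bounded adjointable operators, and $\mathcal{K}\mathrm{Hilb}\text{-}\mathcal{A}$ is the category of right Hilbert $\mathcal{A}$-modules and compact operators.
   Context: A "category" need not have identities (semicategory). A $C^*$-category is a category $\mathcal{A}$ whose hom-sets are complex Banach spaces, with bilinear composition satisfying $\|fg\|\le\|f\|\|g\|$, and with a conjugate-linear contravariant involution $*$, identity on objects, $f^{**}=f$, such that for every $a\in\mathcal{A}(x,y)$, $\|a^*a\|=\|a\|^2$ and $a^*a$ has spectrum in $[0,\infty)$ in the minimal unitization of $\mathcal{A}(x,x)$. A $C^*$-functor is a $\mathbb{C}$-linear functor preserving involutions; equivalences are via $C^*$-functors inverse up to natural isomorphism. Multiplier category $\mathcal{M}\mathcal{D}$ of a $C^*$-category $\mathcal{D}$: same objects as $\mathcal{D}$; a morphism $x\to y$ is a pair $(L,R)$ of families of bounded maps $L_w:\mathcal{D}(w,x)\to\mathcal{D}(w,y)$ and $R_z:\mathcal{D}(y,z)\to\mathcal{D}(x,z)$ ($w,z\in\mathrm{Ob}\,\mathcal{D}$) with $L_w(f)\circ h=L_{w'}(f\circ h)$, $h\circ R_z(g)=R_{z'}(h\circ g)$ and $R_z(g)\circ f=g\circ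 L_w(f)$ for all composable morphisms; norm $\|(L,R)\|=\|L_x\|=\|R_y\|$, involution $L^*(g)=R(g^* )^*$, $R^*(f)=L(f^* )^*$, composition $(L,R)\circ(L',R')=(L\circ L',R'\circ R)$. It is a unital $C^*$-category. A right Hilbert $\mathcal{A}$-module is a $\mathbb{C}$-linear functor $E:\mathcal{A}^{op}\to\mathrm{Vect}_{\mathbb{C}}$ (write $e\cdot a:=E(a)(e)$) with sesquilinear maps $\langle-,-\rangle:E(y)\times E(x)\to\mathcal{A}(x,y)$ (linear in the second, conjugate-linear in the first argument) such that $\langle e,f\rangle=\langle f,e\rangle^*$, $\langle e,f\rangle\circ g=\langle e,f\cdot g\rangle$, $\langle e,e\rangle$ is positive, $\langle e,e\rangle=0$ only if $e=0$, and each $E(x)$ is complete in the norm $\|e\|=\|\langle e,e\rangle\|^{1/2}$. A bounded adjointable operator $T:E\to F$ is a natural transformation with $\|T\|:=\sup\{\|T(e)\|:x\in\mathrm{Ob}\,\mathcal{A},e\in E(x),\|e\|=1\}<\infty$ having an adjoint $T^*:F\to E$ with $\langle Te,f\rangle=\langle e,T^*f\rangle$. For $e\in E(x)$, $f\in F(x)$ the single-rank operator $\theta^{f,e}:E\to F$ is $e'\mapsto f\cdot\langle e,e'\rangle$; the compact operators are the norm limits of finite linear combinations of single-rank operators. *)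

theory Defs
  imports "HOL-Analysis.Analysis" "HOL-Algebra.Module"
begin

section \<open>Complex normed spaces with explicit carriers\<close>

definition complex_field :: "complex ring" where
  "complex_field = \<lparr>carrier = UNIV, mult = (*), one = 1, zero = 0, add = (+)\<rparr>"

text \<open>A complex vector space is a HOL-Algebra module over \<^const>\<open>complex_field\<close>; the fields
  \<^const>\<open>mult\<close> and \<^const>\<open>one\<close> of the record play no role in it.\<close>

abbreviation complex_vector_space :: "(complex, 'v, 'z) module_scheme \<Rightarrow> bool" where
  "complex_vector_space V \<equiv> Module.module complex_field V"

definition complex_linear ::
    "(complex, 'v, 'y) module_scheme \<Rightarrow> (complex, 'w, 'z) module_scheme \<Rightarrow> ('v \<Rightarrow> 'w) \<Rightarrow> bool" where
  "complex_linear V W T \<longleftrightarrow> T \<in> carrier V \<rightarrow> carrier W \<and>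
     (\<forall>u\<in>carrier V. \<forall>v\<in>carrier V. T (u \<oplus>\<^bsub>V\<^esub> v) = T u \<oplus>\<^bsub>W\<^esub> T v) \<and>
     (\<forall>c. \<forall>u\<in>carrier V. T (c \<odot>\<^bsub>V\<^esub> u) = c \<odot>\<^bsub>W\<^esub> T u)"

definition conjugate_linear ::
    "(complex, 'v, 'y) module_scheme \<Rightarrow> (complex, 'w, 'z) module_scheme \<Rightarrow> ('v \<Rightarrow> 'w) \<Rightarrow> bool" where
  "conjugate_linear V W T \<longleftrightarrow> T \<in> carrier V \<rightarrow> carrier W \<and>
     (\<forall>u\<in>carrier V. \<forall>v\<in>carrier V. T (u \<oplus>\<^bsub>V\<^esub> v) = T u \<oplus>\<^bsub>W\<^esub> T v) \<and>
     (\<forall>c. \<forall>u\<in>carrier V. T (c \<odot>\<^bsub>V\<^esub> u) = cnj c \<odot>\<^bsub>W\<^esub> T u)"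

definition linear_combinations :: "(complex, 'v, 'z) module_scheme \<Rightarrow> 'v set \<Rightarrow> 'v set" where
  "linear_combinations V S = {(\<Oplus>\<^bsub>V\<^esub>s\<in>F. c s \<odot>\<^bsub>V\<^esub> s) | F c. finite F \<and> F \<subseteq> S}"

text \<open>The norm is a separate argument since for Hilbert modules it is derived from the inner product.\<close>

definition complete_wrt :: "(complex, 'v, 'z) module_scheme \<Rightarrow> ('v \<Rightarrow> real) \<Rightarrow> bool" where
  "complete_wrt V n \<longleftrightarrow>
     (\<forall>s :: nat \<Rightarrow> 'v. range s \<subseteq> carrier V \<longrightarrow>
        (\<forall>\<epsilon>>0. \<exists>N. \<forall>i\<ge>N. \<forall>j\<ge>N. n (s i \<ominus>\<^bsub>V\<^esub> s j) < \<epsilon>) \<longrightarrow>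
        (\<exists>l\<in>carrier V. (\<lambda>i. n (s i \<ominus>\<^bsub>V\<^esub> l)) \<longlonglongrightarrow> 0))"

record 'v normed_space = "(complex, 'v) module" +
  nrm :: "'v \<Rightarrow> real"

locale complex_banach_space = Module.module complex_field V
  for V :: "('v, 'z) normed_space_scheme" +
  assumes norm_nonneg: "v \<in> carrier V \<Longrightarrow> 0 \<le> nrm V v"
    and norm_eq_zero: "v \<in> carrier V \<Longrightarrow> nrm V v = 0 \<longleftrightarrow> v = \<zero>\<^bsub>V\<^esub>"
    and norm_smult: "v \<in> carrier V \<Longrightarrow> nrm V (c \<odot>\<^bsub>V\<^esub> v) = cmod c * nrm V v"
    and norm_triangle: "\<lbrakk>u \<in> carrier V; v \<in> carrier V\<rbrakk> \<Longrightarrow> nrm V (u \<oplus>\<^bsub>V\<^esub> v) \<le> nrm V u + nrm V v"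
    and complete: "complete_wrt V (nrm V)"

definition bounded_map ::
    "('v, 'y) normed_space_scheme \<Rightarrow> ('w, 'z) normed_space_scheme \<Rightarrow> ('v \<Rightarrow> 'w) \<Rightarrow> bool" where
  "bounded_map V W T \<longleftrightarrow> complex_linear V W T \<and> (\<exists>K. \<forall>v\<in>carrier V. nrm W (T v) \<le> K * nrm V v)"

definition operator_norm ::
    "('v, 'y) normed_space_scheme \<Rightarrow> ('w, 'z) normed_space_scheme \<Rightarrow> ('v \<Rightarrow> 'w) \<Rightarrow> real" where
  "operator_norm V W T = (SUP v\<in>{v \<in> carrier V. nrm V v \<le> 1}. nrm W (T v))"


section \<open>\<open>C\<^sup>*\<close>-categories\<close>

text \<open>Hom-sets are indexed by source and target, so they need not be disjoint.
  For \<open>f : x \<rightarrow> y\<close> and \<open>g : y \<rightarrow> z\<close> the composite \<open>g \<circ> f\<close> is \<open>comp C x y z g f\<close>;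
  \<open>star C x y\<close> maps \<open>hom C x y\<close> to \<open>hom C y x\<close>.\<close>

record ('o, 'm) star_category =
  Ob :: "'o set"
  homsp :: "'o \<Rightarrow> 'o \<Rightarrow> 'm normed_space"
  comp :: "'o \<Rightarrow> 'o \<Rightarrow> 'o \<Rightarrow> 'm \<Rightarrow> 'm \<Rightarrow> 'm"
  star :: "'o \<Rightarrow> 'o \<Rightarrow> 'm \<Rightarrow> 'm"

abbreviation hom :: "('o, 'm) star_category \<Rightarrow> 'o \<Rightarrow> 'o \<Rightarrow> 'm set" where
  "hom C x y \<equiv> carrier (homsp C x y)"

text \<open>The minimal unitization of the algebra \<open>B = hom C x x\<close>: \<open>B\<close> itself (as \<open>B \<times> {0}\<close>) if \<open>B\<close> has a
  unit, and \<open>B \<oplus> \<complex>\<close> with the unit \<open>(0, 1)\<close> otherwise.\<close>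

definition algebra_unit :: "('o, 'm) star_category \<Rightarrow> 'o \<Rightarrow> 'm \<Rightarrow> bool" where
  "algebra_unit C x u \<longleftrightarrow> u \<in> hom C x x \<and>
     (\<forall>b\<in>hom C x x. comp C x x x u b = b \<and> comp C x x x b u = b)"

definition min_unitization :: "('o, 'm) star_category \<Rightarrow> 'o \<Rightarrow> (complex, 'm \<times> complex) module" where
  "min_unitization C x = (let B = homsp C x x; unital = (\<exists>u. algebra_unit C x u) in
     \<lparr>carrier = (if unital then carrier B \<times> {0} else carrier B \<times> UNIV),
      mult = (\<lambda>(a, k) (b, l). (comp C x x x a b \<oplus>\<^bsub>B\<^esub> (k \<odot>\<^bsub>B\<^esub> b \<oplus>\<^bsub>B\<^esub> l \<odot>\<^bsub>B\<^esub> a), k * l)),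
      one = (if unital then (THE u. algebra_unit C x u, 0) else (\<zero>\<^bsub>B\<^esub>, 1)),
      zero = (\<zero>\<^bsub>B\<^esub>, 0),
      add = (\<lambda>(a, k) (b, l). (a \<oplus>\<^bsub>B\<^esub> b, k + l)),
      smult = (\<lambda>c (a, k). (c \<odot>\<^bsub>B\<^esub> a, c * k))\<rparr>)"

definition algebra_spectrum :: "(complex, 'a, 'z) module_scheme \<Rightarrow> 'a \<Rightarrow> complex set" where
  "algebra_spectrum R a = {l. a \<ominus>\<^bsub>R\<^esub> l \<odot>\<^bsub>R\<^esub> \<one>\<^bsub>R\<^esub> \<notin> Units R}"

definition spectrum :: "('o, 'm) star_category \<Rightarrow> 'o \<Rightarrow> 'm \<Rightarrow> complex set" where
  "spectrum C x a = algebra_spectrum (min_unitization C x) (a, 0)"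

definition positive :: "('o, 'm) star_category \<Rightarrow> 'o \<Rightarrow> 'm \<Rightarrow> bool" where
  "positive C x a \<longleftrightarrow> a \<in> hom C x x \<and> star C x x a = a \<and> spectrum C x a \<subseteq> \<real>\<^sub>\<ge>\<^sub>0"

locale cstar_category =
  fixes C :: "('o, 'm) star_category"
  assumes hom_banach: "\<lbrakk>x \<in> Ob C; y \<in> Ob C\<rbrakk> \<Longrightarrow> complex_banach_space (homsp C x y)"
    and comp_linear_left: "\<lbrakk>x \<in> Ob C; y \<in> Ob C; z \<in> Ob C; f \<in> hom C x y\<rbrakk>
      \<Longrightarrow> complex_linear (homsp C y z) (homsp C x z) (\<lambda>g. comp C x y z g f)"
    and comp_linear_right: "\<lbrakk>x \<in> Ob C; y \<in> Ob C; z \<in> Ob C; g \<in> hom C y z\<rbrakk>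
      \<Longrightarrow> complex_linear (homsp C x y) (homsp C x z) (\<lambda>f. comp C x y z g f)"
    and comp_assoc: "\<lbrakk>w \<in> Ob C; x \<in> Ob C; y \<in> Ob C; z \<in> Ob C;
        f \<in> hom C w x; g \<in> hom C x y; h \<in> hom C y z\<rbrakk>
      \<Longrightarrow> comp C w x z (comp C x y z h g) f = comp C w y z h (comp C w x y g f)"
    and norm_comp_le: "\<lbrakk>x \<in> Ob C; y \<in> Ob C; z \<in> Ob C; f \<in> hom C x y; g \<in> hom C y z\<rbrakk>
      \<Longrightarrow> nrm (homsp C x z) (comp C x y z g f) \<le> nrm (homsp C y z) g * nrm (homsp C x y) f"
    and star_conjugate_linear: "\<lbrakk>x \<in> Ob C; y \<in> Ob C\<rbrakk>
      \<Longrightarrow> conjugate_linear (homsp C x y) (homsp C y x) (star C x y)"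
    and star_star: "\<lbrakk>x \<in> Ob C; y \<in> Ob C; f \<in> hom C x y\<rbrakk> \<Longrightarrow> star C y x (star C x y f) = f"
    and star_comp: "\<lbrakk>x \<in> Ob C; y \<in> Ob C; z \<in> Ob C; f \<in> hom C x y; g \<in> hom C y z\<rbrakk>
      \<Longrightarrow> star C x z (comp C x y z g f) = comp C z y x (star C x y f) (star C y z g)"
    and cstar_identity: "\<lbrakk>x \<in> Ob C; y \<in> Ob C; a \<in> hom C x y\<rbrakk>
      \<Longrightarrow> nrm (homsp C x x) (comp C x y x (star C x y a) a) = (nrm (homsp C x y) a)\<^sup>2"
    and spectrum_star_comp: "\<lbrakk>x \<in> Ob C; y \<in> Ob C; a \<in> hom C x y\<rbrakk>
      \<Longrightarrow> spectrum C x (comp C x y x (star C x y a) a) \<subseteq> \<real>\<^sub>\<ge>\<^sub>0"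


section \<open>Functors and equivalences\<close>

record ('o, 'm, 'p, 'n) functor_data =
  obj_map :: "'o \<Rightarrow> 'p"
  arr_map :: "'o \<Rightarrow> 'o \<Rightarrow> 'm \<Rightarrow> 'n"

locale cstar_functor = source: cstar_category C + target: cstar_category D
  for C :: "('o, 'm) star_category" and D :: "('p, 'n) star_category" +
  fixes F :: "('o, 'm, 'p, 'n) functor_data"
  assumes obj_closed: "x \<in> Ob C \<Longrightarrow> obj_map F x \<in> Ob D"
    and arr_linear: "\<lbrakk>x \<in> Ob C; y \<in> Ob C\<rbrakk>
      \<Longrightarrow> complex_linear (homsp C x y) (homsp D (obj_map F x) (obj_map F y)) (arr_map F x y)"
    and preserves_comp: "\<lbrakk>x \<in> Ob C; y \<in> Ob C; z \<in> Ob C; f \<in> hom C x y; g \<in> hom C y z\<rbrakk>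
      \<Longrightarrow> arr_map F x z (comp C x y z g f) =
        comp D (obj_map F x) (obj_map F y) (obj_map F z) (arr_map F y z g) (arr_map F x y f)"
    and preserves_star: "\<lbrakk>x \<in> Ob C; y \<in> Ob C; f \<in> hom C x y\<rbrakk>
      \<Longrightarrow> arr_map F y x (star C x y f) = star D (obj_map F x) (obj_map F y) (arr_map F x y f)"

definition id_functor :: "('o, 'm, 'o, 'm) functor_data" where
  "id_functor = \<lparr>obj_map = (\<lambda>x. x), arr_map = (\<lambda>x y f. f)\<rparr>"

definition comp_functor ::
    "('p, 'n, 'q, 'k) functor_data \<Rightarrow> ('o, 'm, 'p, 'n) functor_data \<Rightarrow> ('o, 'm, 'q, 'k) functor_data" where
  "comp_functor G F = \<lparr>obj_map = (\<lambda>x. obj_map G (obj_map F x)),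
     arr_map = (\<lambda>x y f. arr_map G (obj_map F x) (obj_map F y) (arr_map F x y f))\<rparr>"

definition identity_arrow :: "('o, 'm) star_category \<Rightarrow> 'o \<Rightarrow> 'm \<Rightarrow> bool" where
  "identity_arrow C x u \<longleftrightarrow> u \<in> hom C x x \<and>
     (\<forall>y\<in>Ob C. (\<forall>f\<in>hom C x y. comp C x x y f u = f) \<and> (\<forall>f\<in>hom C y x. comp C y x x u f = f))"

definition isomorphism :: "('o, 'm) star_category \<Rightarrow> 'o \<Rightarrow> 'o \<Rightarrow> 'm \<Rightarrow> bool" where
  "isomorphism C x y f \<longleftrightarrow> f \<in> hom C x y \<and>
     (\<exists>g\<in>hom C y x. identity_arrow C x (comp C x y x g f) \<and> identity_arrow C y (comp C y x y f g))"

definition naturally_isomorphic ::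
    "('o, 'm) star_category \<Rightarrow> ('p, 'n) star_category \<Rightarrow>
     ('o, 'm, 'p, 'n) functor_data \<Rightarrow> ('o, 'm, 'p, 'n) functor_data \<Rightarrow> bool" where
  "naturally_isomorphic C D F G \<longleftrightarrow>
     (\<exists>\<eta>. (\<forall>x\<in>Ob C. isomorphism D (obj_map F x) (obj_map G x) (\<eta> x)) \<and>
          (\<forall>x\<in>Ob C. \<forall>y\<in>Ob C. \<forall>f\<in>hom C x y.
             comp D (obj_map F x) (obj_map F y) (obj_map G y) (\<eta> y) (arr_map F x y f) =
             comp D (obj_map F x) (obj_map G x) (obj_map G y) (arr_map G x y f) (\<eta> x)))"

definition cstar_equivalent :: "('o, 'm) star_category \<Rightarrow> ('p, 'n) star_category \<Rightarrow> bool" where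
  "cstar_equivalent C D \<longleftrightarrow> cstar_category C \<and> cstar_category D \<and>
     (\<exists>F G. cstar_functor C D F \<and> cstar_functor D C G \<and>
        naturally_isomorphic C C (comp_functor G F) id_functor \<and>
        naturally_isomorphic D D (comp_functor F G) id_functor)"


section \<open>The multiplier category\<close>

text \<open>The families are extensional (\<^const>\<open>undefined\<close> outside their domains), so that equality of
  multipliers is equality on hom-sets.\<close>

definition multipliers ::
    "('o, 'm) star_category \<Rightarrow> 'o \<Rightarrow> 'o \<Rightarrow> (('o \<Rightarrow> 'm \<Rightarrow> 'm) \<times> ('o \<Rightarrow> 'm \<Rightarrow> 'm)) set" where
  "multipliers D x y = {(L, R).
     L \<in> (\<Pi>\<^sub>E w\<in>Ob D. hom D w x \<rightarrow>\<^sub>E hom D w y) \<and>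
     R \<in> (\<Pi>\<^sub>E z\<in>Ob D. hom D y z \<rightarrow>\<^sub>E hom D x z) \<and>
     (\<forall>w\<in>Ob D. bounded_map (homsp D w x) (homsp D w y) (L w)) \<and>
     (\<forall>z\<in>Ob D. bounded_map (homsp D y z) (homsp D x z) (R z)) \<and>
     (\<forall>w\<in>Ob D. \<forall>w'\<in>Ob D. \<forall>f\<in>hom D w x. \<forall>h\<in>hom D w' w.
        comp D w' w y (L w f) h = L w' (comp D w' w x f h)) \<and>
     (\<forall>z\<in>Ob D. \<forall>z'\<in>Ob D. \<forall>g\<in>hom D y z. \<forall>h\<in>hom D z z'.
        comp D x z z' h (R z g) = R z' (comp D y z z' h g)) \<and>
     (\<forall>w\<in>Ob D. \<forall>z\<in>Ob D. \<forall>f\<in>hom D w x. \<forall>g\<in>hom D y z.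
        comp D w x z (R z g) f = comp D w y z g (L w f))}"

definition multiplier_space ::
    "('o, 'm) star_category \<Rightarrow> 'o \<Rightarrow> 'o \<Rightarrow> (('o \<Rightarrow> 'm \<Rightarrow> 'm) \<times> ('o \<Rightarrow> 'm \<Rightarrow> 'm)) normed_space" where
  "multiplier_space D x y =
    \<lparr>carrier = multipliers D x y, mult = undefined, one = undefined,
     zero = (\<lambda>w\<in>Ob D. \<lambda>f\<in>hom D w x. \<zero>\<^bsub>homsp D w y\<^esub>, \<lambda>z\<in>Ob D. \<lambda>g\<in>hom D y z. \<zero>\<^bsub>homsp D x z\<^esub>),
     add = (\<lambda>(L, R) (L', R').
       (\<lambda>w\<in>Ob D. \<lambda>f\<in>hom D w x. L w f \<oplus>\<^bsub>homsp D w y\<^esub> L' w f,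
        \<lambda>z\<in>Ob D. \<lambda>g\<in>hom D y z. R z g \<oplus>\<^bsub>homsp D x z\<^esub> R' z g)),
     smult = (\<lambda>c (L, R).
       (\<lambda>w\<in>Ob D. \<lambda>f\<in>hom D w x. c \<odot>\<^bsub>homsp D w y\<^esub> L w f,
        \<lambda>z\<in>Ob D. \<lambda>g\<in>hom D y z. c \<odot>\<^bsub>homsp D x z\<^esub> R z g)),
     nrm = (\<lambda>(L, R). operator_norm (homsp D x x) (homsp D x y) (L x))\<rparr>"

definition multiplier_category ::
    "('o, 'm) star_category \<Rightarrow> ('o, ('o \<Rightarrow> 'm \<Rightarrow> 'm) \<times> ('o \<Rightarrow> 'm \<Rightarrow> 'm)) star_category" where
  "multiplier_category D =
    \<lparr>Ob = Ob D,
     homsp = multiplier_space D,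
     comp = (\<lambda>x y z (L, R) (L', R').
       (\<lambda>w\<in>Ob D. \<lambda>f\<in>hom D w x. L w (L' w f), \<lambda>v\<in>Ob D. \<lambda>g\<in>hom D z v. R' v (R v g))),
     star = (\<lambda>x y (L, R).
       (\<lambda>w\<in>Ob D. \<lambda>g\<in>hom D w y. star D x w (R w (star D w y g)),
        \<lambda>z\<in>Ob D. \<lambda>f\<in>hom D x z. star D z y (L z (star D x z f))))\<rparr>"


section \<open>Hilbert modules\<close>

text \<open>\<open>fibre E x\<close> is the vector space \<open>E(x)\<close>; for \<open>e \<in> E(y)\<close> and \<open>a : x \<rightarrow> y\<close> the element \<open>e \<cdot> a \<in> E(x)\<close>
  is \<open>act E x y e a\<close>; for \<open>e \<in> E(y)\<close> and \<open>f \<in> E(x)\<close> the inner product \<open>\<langle>e, f\<rangle> : x \<rightarrow> y\<close> is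
  \<open>inn E x y e f\<close>. The type \<open>'e\<close> of elements plays the role of a universe: it bounds the size of
  the modules considered. As usual for records, values outside the carriers are
  arbitrary; modules that differ only there are distinct but isomorphic objects.\<close>

record ('o, 'm, 'e) hilbert_module_data =
  fibre :: "'o \<Rightarrow> (complex, 'e) module"
  act :: "'o \<Rightarrow> 'o \<Rightarrow> 'e \<Rightarrow> 'm \<Rightarrow> 'e"
  inn :: "'o \<Rightarrow> 'o \<Rightarrow> 'e \<Rightarrow> 'e \<Rightarrow> 'm"

abbreviation elts :: "('o, 'm, 'e) hilbert_module_data \<Rightarrow> 'o \<Rightarrow> 'e set" where
  "elts E x \<equiv> carrier (fibre E x)"

definition module_norm ::
    "('o, 'm) star_category \<Rightarrow> ('o, 'm, 'e) hilbert_module_data \<Rightarrow> 'o \<Rightarrow> 'e \<Rightarrow> real" where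
  "module_norm A E x e = sqrt (nrm (homsp A x x) (inn E x x e e))"

locale hilbert_module =
  fixes A :: "('o, 'm) star_category" and E :: "('o, 'm, 'e) hilbert_module_data"
  assumes fibre_vector_space: "x \<in> Ob A \<Longrightarrow> complex_vector_space (fibre E x)"
    and act_linear_elt: "\<lbrakk>x \<in> Ob A; y \<in> Ob A; a \<in> hom A x y\<rbrakk>
      \<Longrightarrow> complex_linear (fibre E y) (fibre E x) (\<lambda>e. act E x y e a)"
    and act_linear_arr: "\<lbrakk>x \<in> Ob A; y \<in> Ob A; e \<in> elts E y\<rbrakk>
      \<Longrightarrow> complex_linear (homsp A x y) (fibre E x) (\<lambda>a. act E x y e a)"
    and act_comp: "\<lbrakk>x \<in> Ob A; y \<in> Ob A; z \<in> Ob A; e \<in> elts E z; a \<in> hom A y z; b \<in> hom A x y\<rbrakk>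
      \<Longrightarrow> act E x z e (comp A x y z a b) = act E x y (act E y z e a) b"
    and inn_linear_right: "\<lbrakk>x \<in> Ob A; y \<in> Ob A; e \<in> elts E y\<rbrakk>
      \<Longrightarrow> complex_linear (fibre E x) (homsp A x y) (\<lambda>f. inn E x y e f)"
    and inn_conjugate_linear_left: "\<lbrakk>x \<in> Ob A; y \<in> Ob A; f \<in> elts E x\<rbrakk>
      \<Longrightarrow> conjugate_linear (fibre E y) (homsp A x y) (\<lambda>e. inn E x y e f)"
    and inn_star: "\<lbrakk>x \<in> Ob A; y \<in> Ob A; e \<in> elts E y; f \<in> elts E x\<rbrakk>
      \<Longrightarrow> inn E x y e f = star A y x (inn E y x f e)"
    and inn_act: "\<lbrakk>w \<in> Ob A; x \<in> Ob A; y \<in> Ob A; e \<in> elts E y; f \<in> elts E x; g \<in> hom A w x\<rbrakk>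
      \<Longrightarrow> comp A w x y (inn E x y e f) g = inn E w y e (act E w x f g)"
    and inn_positive: "\<lbrakk>x \<in> Ob A; e \<in> elts E x\<rbrakk> \<Longrightarrow> positive A x (inn E x x e e)"
    and inn_definite: "\<lbrakk>x \<in> Ob A; e \<in> elts E x; inn E x x e e = \<zero>\<^bsub>homsp A x x\<^esub>\<rbrakk> \<Longrightarrow> e = \<zero>\<^bsub>fibre E x\<^esub>"
    and fibre_complete: "x \<in> Ob A \<Longrightarrow> complete_wrt (fibre E x) (module_norm A E x)"

definition natural_transformations ::
    "('o, 'm) star_category \<Rightarrow> ('o, 'm, 'e) hilbert_module_data \<Rightarrow> ('o, 'm, 'e) hilbert_module_data
      \<Rightarrow> ('o \<Rightarrow> 'e \<Rightarrow> 'e) set" where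
  "natural_transformations A E F =
     {T \<in> (\<Pi>\<^sub>E x\<in>Ob A. elts E x \<rightarrow>\<^sub>E elts F x).
       (\<forall>x\<in>Ob A. complex_linear (fibre E x) (fibre F x) (T x)) \<and>
       (\<forall>x\<in>Ob A. \<forall>y\<in>Ob A. \<forall>e\<in>elts E y. \<forall>a\<in>hom A x y. T x (act E x y e a) = act F x y (T y e) a)}"

definition unit_values ::
    "('o, 'm) star_category \<Rightarrow> ('o, 'm, 'e) hilbert_module_data \<Rightarrow> ('o, 'm, 'e) hilbert_module_data
      \<Rightarrow> ('o \<Rightarrow> 'e \<Rightarrow> 'e) \<Rightarrow> real set" where
  "unit_values A E F T = {module_norm A F x (T x e) | x e. x \<in> Ob A \<and> e \<in> elts E x \<and> module_norm A E x e = 1}"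

text \<open>Inserting \<open>0\<close> makes the supremum \<open>0\<close> when \<open>E = 0\<close>.\<close>

definition module_operator_norm ::
    "('o, 'm) star_category \<Rightarrow> ('o, 'm, 'e) hilbert_module_data \<Rightarrow> ('o, 'm, 'e) hilbert_module_data
      \<Rightarrow> ('o \<Rightarrow> 'e \<Rightarrow> 'e) \<Rightarrow> real" where
  "module_operator_norm A E F T = Sup (insert 0 (unit_values A E F T))"

definition is_adjoint ::
    "('o, 'm) star_category \<Rightarrow> ('o, 'm, 'e) hilbert_module_data \<Rightarrow> ('o, 'm, 'e) hilbert_module_data
      \<Rightarrow> ('o \<Rightarrow> 'e \<Rightarrow> 'e) \<Rightarrow> ('o \<Rightarrow> 'e \<Rightarrow> 'e) \<Rightarrow> bool" where
  "is_adjoint A E F T S \<longleftrightarrow> S \<in> natural_transformations A F E \<and>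
     (\<forall>x\<in>Ob A. \<forall>y\<in>Ob A. \<forall>e\<in>elts E y. \<forall>f\<in>elts F x. inn F x y (T y e) f = inn E x y e (S x f))"

definition adjointable_operators ::
    "('o, 'm) star_category \<Rightarrow> ('o, 'm, 'e) hilbert_module_data \<Rightarrow> ('o, 'm, 'e) hilbert_module_data
      \<Rightarrow> ('o \<Rightarrow> 'e \<Rightarrow> 'e) set" where
  "adjointable_operators A E F =
     {T \<in> natural_transformations A E F. bdd_above (unit_values A E F T) \<and> (\<exists>S. is_adjoint A E F T S)}"

definition adjointable_space ::
    "('o, 'm) star_category \<Rightarrow> ('o, 'm, 'e) hilbert_module_data \<Rightarrow> ('o, 'm, 'e) hilbert_module_data
      \<Rightarrow> ('o \<Rightarrow> 'e \<Rightarrow> 'e) normed_space" where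
  "adjointable_space A E F =
    \<lparr>carrier = adjointable_operators A E F, mult = undefined, one = undefined,
     zero = (\<lambda>x\<in>Ob A. \<lambda>e\<in>elts E x. \<zero>\<^bsub>fibre F x\<^esub>),
     add = (\<lambda>S T. \<lambda>x\<in>Ob A. \<lambda>e\<in>elts E x. S x e \<oplus>\<^bsub>fibre F x\<^esub> T x e),
     smult = (\<lambda>c T. \<lambda>x\<in>Ob A. \<lambda>e\<in>elts E x. c \<odot>\<^bsub>fibre F x\<^esub> T x e),
     nrm = module_operator_norm A E F\<rparr>"

definition Hilb ::
    "('o, 'm) star_category \<Rightarrow> (('o, 'm, 'e) hilbert_module_data, 'o \<Rightarrow> 'e \<Rightarrow> 'e) star_category" where
  "Hilb A =
    \<lparr>Ob = {E. hilbert_module A E},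
     homsp = adjointable_space A,
     comp = (\<lambda>E F G S T. \<lambda>x\<in>Ob A. \<lambda>e\<in>elts E x. S x (T x e)),
     star = (\<lambda>E F T. THE S. is_adjoint A E F T S)\<rparr>"

definition single_rank ::
    "('o, 'm) star_category \<Rightarrow> ('o, 'm, 'e) hilbert_module_data \<Rightarrow> ('o, 'm, 'e) hilbert_module_data
      \<Rightarrow> 'o \<Rightarrow> 'e \<Rightarrow> 'e \<Rightarrow> ('o \<Rightarrow> 'e \<Rightarrow> 'e)" where
  "single_rank A E F x f e = (\<lambda>w\<in>Ob A. \<lambda>e'\<in>elts E w. act F w x f (inn E w x e e'))"

definition compact_operators ::
    "('o, 'm) star_category \<Rightarrow> ('o, 'm, 'e) hilbert_module_data \<Rightarrow> ('o, 'm, 'e) hilbert_module_data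
      \<Rightarrow> ('o \<Rightarrow> 'e \<Rightarrow> 'e) set" where
  "compact_operators A E F = (let V = adjointable_space A E F in
     {T \<in> carrier V. \<exists>s :: nat \<Rightarrow> 'o \<Rightarrow> 'e \<Rightarrow> 'e.
        range s \<subseteq> linear_combinations V
          {single_rank A E F x f e | x f e. x \<in> Ob A \<and> f \<in> elts F x \<and> e \<in> elts E x} \<and>
        (\<lambda>n. nrm V (s n \<ominus>\<^bsub>V\<^esub> T)) \<longlonglongrightarrow> 0})"

definition KHilb ::
    "('o, 'm) star_category \<Rightarrow> (('o, 'm, 'e) hilbert_module_data, 'o \<Rightarrow> 'e \<Rightarrow> 'e) star_category" where
  "KHilb A = (Hilb A)\<lparr>homsp := \<lambda>E F. (adjointable_space A E F)\<lparr>carrier := compact_operators A E F\<rparr>\<rparr>"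

end

theory Submission
  imports Defs
begin

text \<open>An adjointable operator \<open>T : E \<rightarrow> F\<close> acts on compact operators by composition on either side, and compact
operators form an ideal; so \<open>T\<close> defines the multiplier \<open>(K \<mapsto> T K, K \<mapsto> K T)\<close> (\<open>to_multiplier\<close>). This
assignment is the identity on objects, and it turns out to be bijective and isometric on hom-spaces.
Hence the two categories are not only equivalent but isomorphic, and the axioms of a
\<open>C\<^sup>*\<close>-category, once known for Hilbert modules, pass to the multiplier category
(\<open>star_category_isomorphism\<close>).

Bijectivity and isometry come from approximate units (\<open>compact_approximate_unit\<close>). For \<open>f \<in> F(x)\<close> and
\<open>P = \<theta>\<^bsup>f,f\<^esup>\<close>, the operators \<open>K\<^sub>\<epsilon> = P (P + \<epsilon>)\<^sup>-\<^sup>1\<close> are contractions with \<open>K\<^sub>\<epsilon> f \<rightarrow> f\<close>, and \<open>K\<^sub>\<epsilon> = \<theta>\<^bsup>f,u\<^esup>\<close> for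
\<open>u = (P + \<epsilon>)\<^sup>-\<^sup>1 f\<close>, so they are even of rank one. Therefore a vector is determined by its images under
compact operators, and compact contractions recover its norm. Given a multiplier \<open>(L, R)\<close> from \<open>E\<close> to \<open>F\<close>
and \<open>e \<in> E(x)\<close>, there is then exactly one \<open>g \<in> F(x)\<close> with \<open>K g = R(K) e\<close> for all compact \<open>K\<close> on \<open>F\<close>,
namely the limit of \<open>L(K\<^sub>\<epsilon>) e\<close>; the map \<open>e \<mapsto> g\<close> is the operator that \<open>(L, R)\<close> comes from, and the
same construction for the adjoint multiplier gives its adjoint (\<open>adjointable_of_multiplier\<close>).

That Hilbert modules form a \<open>C\<^sup>*\<close>-category needs two things beyond bookkeeping: the Cauchy-Schwarz
inequality, and the invertibility of \<open>H - l\<close> for positive \<open>H\<close> and \<open>l \<notin> [0, \<infinity>)\<close>, where \<open>H = T\<^sup>* T\<close>. Both follow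
from one inequality in the coefficient category: \<open>\<parallel>a\<parallel> \<le> \<parallel>a + b\<parallel>\<close> for positive endomorphisms \<open>a\<close>, \<open>b\<close>
(\<open>norm_mono_positive\<close>). For invertibility, it yields a lower bound for \<open>H - s l\<close> that is linear in \<open>s > 0\<close>, and
the operator is onto for large \<open>s\<close>; the method of continuity brings \<open>s\<close> down to \<open>1\<close>
(\<open>surjective_along_ray\<close>).

Positivity in the coefficient category means that the spectrum lies in \<open>[0, \<infinity>)\<close>, so the inequality
rests on the spectral radius formula for self-adjoint elements. Elements
act by left multiplication on \<open>A(x, x)\<close>, unital or not, and the formula is proved for operators on a
normed space (\<open>norm_bound_from_resolvents\<close>), by an averaging argument that uses neither integrals nor
power series. If \<open>R\<close> is so large that \<open>\<parallel>R - b\<parallel> \<le> R\<close>, then \<open>R + a = (R - b) + (a + b)\<close> has norm at most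
\<open>R + \<parallel>a + b\<parallel>\<close>; since \<open>a\<close> is positive, this confines its spectrum to \<open>[0, \<parallel>a + b\<parallel>]\<close>, and the inequality follows.\<close>

section \<open>Complex vector spaces and norms on carriers\<close>

lemma complex_field_simps [simp]:
  "carrier complex_field = UNIV" "\<zero>\<^bsub>complex_field\<^esub> = 0" "\<one>\<^bsub>complex_field\<^esub> = 1"
  "a \<oplus>\<^bsub>complex_field\<^esub> b = a + b" "a \<otimes>\<^bsub>complex_field\<^esub> b = a * b"
  by (simp_all add: complex_field_def)

lemma cring_complex_field: "cring complex_field"
proof (rule cringI)
  show "abelian_group complex_field"
  proof (rule abelian_groupI)
    show "\<exists>y\<in>carrier complex_field. y \<oplus>\<^bsub>complex_field\<^esub> x = \<zero>\<^bsub>complex_field\<^esub>"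
      for x by (rule bexI[of _ "- x"]) auto
  qed auto
  show "Group.comm_monoid complex_field" by (rule comm_monoidI) auto
qed (auto simp: algebra_simps)

locale complex_space = Module.module complex_field V for V (structure)
begin

lemma smult_mem [simp]: "v \<in> carrier V \<Longrightarrow> c \<odot> v \<in> carrier V"
  using smult_closed[of c v] by simp

lemma smult_add_left: "v \<in> carrier V \<Longrightarrow> (a + b) \<odot> v = a \<odot> v \<oplus> b \<odot> v"
  using smult_l_distr[of a b v] by simp

lemma smult_add_right: "u \<in> carrier V \<Longrightarrow> v \<in> carrier V \<Longrightarrow> a \<odot> (u \<oplus> v) = a \<odot> u \<oplus> a \<odot> v"
  using smult_r_distr[of a u v] by simp

lemma smult_smult: "v \<in> carrier V \<Longrightarrow> a \<odot> (b \<odot> v) = (a * b) \<odot> v"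
  using smult_assoc1[of a b v] by simp

lemma smult_1 [simp]: "v \<in> carrier V \<Longrightarrow> 1 \<odot> v = v"
  using smult_one[of v] by simp

lemma smult_0 [simp]: "v \<in> carrier V \<Longrightarrow> 0 \<odot> v = \<zero>"
  using smult_l_null[of v] by simp

lemma smult_zero [simp]: "c \<odot> \<zero> = \<zero>"
  using smult_r_null[of c] by simp

lemma uminus_eq: "v \<in> carrier V \<Longrightarrow> \<ominus> v = (-1) \<odot> v"
proof -
  assume v: "v \<in> carrier V"
  have "(-1) \<odot> v \<oplus> v = (-1 + 1) \<odot> v"
    using v by (subst smult_add_left) auto
  also have "\<dots> = \<zero>" using v by simp
  finally show ?thesis using v by (simp add: M.minus_equality)
qed

text \<open>Membership side conditions keep the simplifier from collecting the coefficients of a vector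
identity. Writing all vectors involved as values of one coordinate map \<open>l\<close> reduces such an identity to
complex arithmetic; this lemma and its two special cases are used for that purpose throughout.\<close>

lemma linear_identity4:
  assumes "p \<in> carrier V" "q \<in> carrier V" "r \<in> carrier V" "s \<in> carrier V"
  obtains l where "p = l 1 0 0 0" "q = l 0 1 0 0" "r = l 0 0 1 0" "s = l 0 0 0 1"
    "\<zero> = l 0 0 0 0"
    "\<And>a b c d a' b' c' d'. l a b c d \<oplus> l a' b' c' d' = l (a+a') (b+b') (c+c') (d+d')"
    "\<And>a b c d a' b' c' d'. l a b c d \<ominus> l a' b' c' d' = l (a-a') (b-b') (c-c') (d-d')"
    "\<And>a b c d. \<ominus> l a b c d = l (-a) (-b) (-c) (-d)"
    "\<And>k a b c d. k \<odot> l a b c d = l (k*a) (k*b) (k*c) (k*d)"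
    "\<And>a b c d. l a b c d \<in> carrier V"
proof -
  define l where "l a b c d = a \<odot> p \<oplus> (b \<odot> q \<oplus> (c \<odot> r \<oplus> d \<odot> s))" for a b c d
  have add: "l a b c d \<oplus> l a' b' c' d' = l (a+a') (b+b') (c+c') (d+d')" for a b c d a' b' c' d'
    using assms by (simp add: l_def smult_add_left M.a_ac)
  have sm: "k \<odot> l a b c d = l (k*a) (k*b) (k*c) (k*d)" for k a b c d
    using assms by (simp add: l_def smult_add_right smult_smult)
  have cl: "l a b c d \<in> carrier V" for a b c d using assms by (simp add: l_def)
  have neg: "\<ominus> l a b c d = l (-a) (-b) (-c) (-d)" for a b c d
    using cl by (simp add: uminus_eq sm)
  show ?thesis
  proof (rule that[of l])
    show "p = l 1 0 0 0" "q = l 0 1 0 0" "r = l 0 0 1 0" "s = l 0 0 0 1" "\<zero> = l 0 0 0 0"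
      using assms by (simp_all add: l_def)
    show "l a b c d \<ominus> l a' b' c' d' = l (a-a') (b-b') (c-c') (d-d')" for a b c d a' b' c' d'
      unfolding M.minus_eq neg add by simp
  qed (fact add sm neg cl)+
qed

lemma linear_identity3:
  assumes "p \<in> carrier V" "q \<in> carrier V" "r \<in> carrier V"
  obtains l where "p = l 1 0 0" "q = l 0 1 0" "r = l 0 0 1"
    "\<zero> = l 0 0 0"
    "\<And>a b c a' b' c'. l a b c \<oplus> l a' b' c' = l (a+a') (b+b') (c+c')"
    "\<And>a b c a' b' c'. l a b c \<ominus> l a' b' c' = l (a-a') (b-b') (c-c')"
    "\<And>a b c. \<ominus> l a b c = l (-a) (-b) (-c)"
    "\<And>k a b c. k \<odot> l a b c = l (k*a) (k*b) (k*c)"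
    "\<And>a b c. l a b c \<in> carrier V"
proof -
  show ?thesis
  proof (rule linear_identity4[OF assms M.zero_closed])
    fix l assume l: 
    "p = l 1 0 0 0" "q = l 0 1 0 0" "r = l 0 0 1 0" 
    "\<zero> = l 0 0 0 0"
    "\<And>a b c d a' b' c' d'. l a b c d \<oplus> l a' b' c' d' = l (a+a') (b+b') (c+c') (d+d')"
    "\<And>a b c d a' b' c' d'. l a b c d \<ominus> l a' b' c' d' = l (a-a') (b-b') (c-c') (d-d')"
    "\<And>a b c d. \<ominus> l a b c d = l (-a) (-b) (-c) (-d)"
    "\<And>k a b c d. k \<odot> l a b c d = l (k*a) (k*b) (k*c) (k*d)"
    "\<And>a b c d. l a b c d \<in> carrier V"
    show thesis by (rule that[of "\<lambda>a b c. l a b c 0"]) (simp_all add: l)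
  qed
qed

lemma linear_identity2:
  assumes "p \<in> carrier V" "q \<in> carrier V"
  obtains l where "p = l 1 0" "q = l 0 1" "\<zero> = l 0 0"
    "\<And>a b a' b'. l a b \<oplus> l a' b' = l (a+a') (b+b')"
    "\<And>a b a' b'. l a b \<ominus> l a' b' = l (a-a') (b-b')"
    "\<And>a b. \<ominus> l a b = l (-a) (-b)"
    "\<And>k a b. k \<odot> l a b = l (k*a) (k*b)"
    "\<And>a b. l a b \<in> carrier V"
proof -
  show ?thesis
  proof (rule linear_identity4[OF assms M.zero_closed M.zero_closed])
    fix l assume l: 
    "p = l 1 0 0 0" "q = l 0 1 0 0"  
    "\<zero> = l 0 0 0 0"
    "\<And>a b c d a' b' c' d'. l a b c d \<oplus> l a' b' c' d' = l (a+a') (b+b') (c+c') (d+d')"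
    "\<And>a b c d a' b' c' d'. l a b c d \<ominus> l a' b' c' d' = l (a-a') (b-b') (c-c') (d-d')"
    "\<And>a b c d. \<ominus> l a b c d = l (-a) (-b) (-c) (-d)"
    "\<And>k a b c d. k \<odot> l a b c d = l (k*a) (k*b) (k*c) (k*d)"
    "\<And>a b c d. l a b c d \<in> carrier V"
    show thesis by (rule that[of "\<lambda>a b. l a b 0 0"]) (simp_all add: l)
  qed
qed

lemma diff_add_cancel: "u \<in> carrier V \<Longrightarrow> v \<in> carrier V \<Longrightarrow> (u \<ominus> v) \<oplus> v = u"
  by (rule linear_identity2[of u v]) simp_all

lemma diff_eq_zero_iff: "u \<in> carrier V \<Longrightarrow> v \<in> carrier V \<Longrightarrow> u \<ominus> v = \<zero> \<longleftrightarrow> u = v"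
  using diff_add_cancel[of u v] by (auto simp: M.minus_eq M.r_neg)

end

lemma complex_spaceI: "complex_vector_space V \<Longrightarrow> complex_space V"
  by (rule complex_space.intro)

lemma complex_linearD:
  assumes "complex_linear V W T"
  shows "u \<in> carrier V \<Longrightarrow> T u \<in> carrier W"
    "u \<in> carrier V \<Longrightarrow> v \<in> carrier V \<Longrightarrow> T (u \<oplus>\<^bsub>V\<^esub> v) = T u \<oplus>\<^bsub>W\<^esub> T v"
    "u \<in> carrier V \<Longrightarrow> T (c \<odot>\<^bsub>V\<^esub> u) = c \<odot>\<^bsub>W\<^esub> T u"
  using assms by (auto simp: complex_linear_def)

lemma complex_linear_diff:
  assumes "complex_vector_space V" "complex_vector_space W" "complex_linear V W T"
    and "u \<in> carrier V" "v \<in> carrier V"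
  shows "T (u \<ominus>\<^bsub>V\<^esub> v) = T u \<ominus>\<^bsub>W\<^esub> T v"
proof -
  interpret V: complex_space V using assms by (simp add: complex_spaceI)
  interpret W: complex_space W using assms by (simp add: complex_spaceI)
  show ?thesis using assms
    by (simp add: V.M.minus_eq W.M.minus_eq V.uminus_eq W.uminus_eq complex_linearD[OF assms(3)])
qed

lemma complex_linear_zero:
  assumes "complex_vector_space V" "complex_vector_space W" "complex_linear V W T"
  shows "T \<zero>\<^bsub>V\<^esub> = \<zero>\<^bsub>W\<^esub>"
proof -
  interpret V: complex_space V using assms by (simp add: complex_spaceI)
  interpret W: complex_space W using assms by (simp add: complex_spaceI)
  have "T \<zero>\<^bsub>V\<^esub> = T (0 \<odot>\<^bsub>V\<^esub> \<zero>\<^bsub>V\<^esub>)" by simp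
  also have "\<dots> = \<zero>\<^bsub>W\<^esub>" using complex_linearD[OF assms(3)] by (metis V.M.zero_closed W.smult_0)
  finally show ?thesis .
qed

locale carrier_normed_space = complex_space V for V (structure) +
  fixes n
  assumes nonneg: "v \<in> carrier V \<Longrightarrow> 0 \<le> n v"
    and eq_zero: "v \<in> carrier V \<Longrightarrow> n v = 0 \<longleftrightarrow> v = \<zero>"
    and scale: "v \<in> carrier V \<Longrightarrow> n (c \<odot> v) = cmod c * n v"
    and triangle: "u \<in> carrier V \<Longrightarrow> v \<in> carrier V \<Longrightarrow> n (u \<oplus> v) \<le> n u + n v"
begin

lemma norm_zero [simp]: "n \<zero> = 0" by (simp add: eq_zero)

lemma norm_uminus: "v \<in> carrier V \<Longrightarrow> n (\<ominus> v) = n v"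
  by (simp add: uminus_eq scale)

lemma norm_diff_le: "u \<in> carrier V \<Longrightarrow> v \<in> carrier V \<Longrightarrow> n (u \<ominus> v) \<le> n u + n v"
  using triangle[of u "\<ominus> v"] by (simp add: M.minus_eq norm_uminus)

lemma norm_diff_commute: "u \<in> carrier V \<Longrightarrow> v \<in> carrier V \<Longrightarrow> n (u \<ominus> v) = n (v \<ominus> u)"
proof -
  assume a: "u \<in> carrier V" "v \<in> carrier V"
  have "u \<ominus> v = \<ominus> (v \<ominus> u)" using a by - (rule linear_identity2[of u v]; simp)
  thus ?thesis using a by (simp add: norm_uminus)
qed

lemma dist_triangle: "u \<in> carrier V \<Longrightarrow> v \<in> carrier V \<Longrightarrow> w \<in> carrier V
  \<Longrightarrow> n (u \<ominus> w) \<le> n (u \<ominus> v) + n (v \<ominus> w)"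
proof -
  assume a: "u \<in> carrier V" "v \<in> carrier V" "w \<in> carrier V"
  have "u \<ominus> w = (u \<ominus> v) \<oplus> (v \<ominus> w)" using a by - (rule linear_identity3[of u v w]; simp)
  thus ?thesis using a by (metis M.minus_closed triangle)
qed

lemma norm_le_diff: "u \<in> carrier V \<Longrightarrow> v \<in> carrier V \<Longrightarrow> n u \<le> n v + n (u \<ominus> v)"
proof -
  assume a: "u \<in> carrier V" "v \<in> carrier V"
  have "u = v \<oplus> (u \<ominus> v)" using a by - (rule linear_identity2[of u v]; simp)
  thus ?thesis using a by (metis M.minus_closed triangle)
qed

lemma dist_eq_zero: "u \<in> carrier V \<Longrightarrow> v \<in> carrier V \<Longrightarrow> n (u \<ominus> v) = 0 \<longleftrightarrow> u = v"
  by (simp add: eq_zero diff_eq_zero_iff)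

definition dst where "dst u v = (if u \<in> carrier V \<and> v \<in> carrier V then n (u \<ominus> v) else 0)"

lemma metric: "Metric_space (carrier V) dst"
  by unfold_locales (auto simp: dst_def nonneg dist_eq_zero dist_triangle norm_diff_commute)

lemma limit_unique:
  assumes "\<And>i. s i \<in> carrier V" "l \<in> carrier V" "l' \<in> carrier V"
    and "(\<lambda>i::nat. n (s i \<ominus> l)) \<longlonglongrightarrow> 0" "(\<lambda>i. n (s i \<ominus> l')) \<longlonglongrightarrow> 0"
  shows "l = l'"
proof -
  have "n (l \<ominus> l') \<le> 0"
  proof (rule LIMSEQ_le)
    show "(\<lambda>i. n (s i \<ominus> l) + n (s i \<ominus> l')) \<longlonglongrightarrow> 0"
      using tendsto_add[OF assms(4,5)] by simp
    show "(\<lambda>i::nat. n (l \<ominus> l')) \<longlonglongrightarrow> n (l \<ominus> l')" by simp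
    show "\<exists>N. \<forall>i\<ge>N. n (l \<ominus> l') \<le> n (s i \<ominus> l) + n (s i \<ominus> l')"
      using dist_triangle[OF assms(2,1,3)] norm_diff_commute[OF assms(2) assms(1)] by auto
  qed
  thus ?thesis using assms nonneg[of "l \<ominus> l'"] dist_eq_zero[of l l'] by simp
qed

text \<open>The equations solved below are affine, so contractivity is a condition on differences.\<close>

lemma contraction_fixed_point:
  assumes comp: "complete_wrt V n"
    and f: "\<And>v. v \<in> carrier V \<Longrightarrow> f v \<in> carrier V"
    and q: "q < 1" "\<And>u v. u \<in> carrier V \<Longrightarrow> v \<in> carrier V \<Longrightarrow> n (f u \<ominus> f v) \<le> q * n (u \<ominus> v)"
  shows "\<exists>v\<in>carrier V. f v = v"
proof -
  interpret Metric_space "carrier V" dst by (rule metric)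
  have "mcomplete"
    unfolding mcomplete_def
  proof safe
    fix s assume s: "MCauchy s"
    hence r: "range s \<subseteq> carrier V" and c: "\<forall>\<epsilon>>0. \<exists>N. \<forall>i\<ge>N. \<forall>j\<ge>N. dst (s i) (s j) < \<epsilon>"
      by (auto simp: MCauchy_def)
    have "dst (s i) (s j) = n (s i \<ominus> s j)" for i j using r by (auto simp: dst_def)
    hence "\<forall>\<epsilon>>0. \<exists>N. \<forall>i\<ge>N. \<forall>j\<ge>N. n (s i \<ominus> s j) < \<epsilon>" using c by simp
    with r comp obtain l where l: "l \<in> carrier V" "(\<lambda>i. n (s i \<ominus> l)) \<longlonglongrightarrow> 0"
      unfolding complete_wrt_def by blast
    have "dst (s i) l = n (s i \<ominus> l)" for i using r l by (auto simp: dst_def)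
    with l r show "\<exists>x. limitin mtopology s x sequentially"
      by (auto simp: limitin_metric_dist_null intro!: exI[of _ l] always_eventually)
  qed
  then show ?thesis
    by (rule Banach_fixedpoint_thm[of f q, THEN exE])
       (use f q in \<open>auto simp: dst_def intro: M.zero_closed\<close>)
qed

end

section \<open>The spectral radius formula by averaging resolvents\<close>

context carrier_normed_space
begin

abbreviation "endo T \<equiv> complex_linear V V T"

lemma space: "complex_vector_space V" by unfold_locales

lemma bound_mono: "x \<le> a * n v \<Longrightarrow> a \<le> b \<Longrightarrow> v \<in> carrier V \<Longrightarrow> x \<le> b * n v"
  using mult_right_mono[of a b "n v"] nonneg[of v] by linarith

lemma endo_diff: "endo T \<Longrightarrow> u \<in> carrier V \<Longrightarrow> v \<in> carrier V \<Longrightarrow> T (u \<ominus> v) = T u \<ominus> T v"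
  by (rule complex_linear_diff[OF space space])

text \<open>The bound says that the inverse of \<open>1 - c S\<close> has norm at most \<open>M\<close>; stated as a lower bound for
\<open>1 - c S\<close>, it needs no name for the inverse and contains injectivity.\<close>

definition invertible_with :: "real \<Rightarrow> complex \<Rightarrow> ('a \<Rightarrow> 'a) \<Rightarrow> bool" where
  "invertible_with M c S \<longleftrightarrow> (\<forall>w\<in>carrier V. \<exists>v\<in>carrier V. v \<ominus> c \<odot> S v = w) \<and>
     (\<forall>v\<in>carrier V. n v \<le> M * n (v \<ominus> c \<odot> S v))"

lemma resolvent_square_identity:
  assumes S: "endo S" and p: "p \<in> carrier V" "p \<ominus> c \<odot> S p = w"
  shows "(c * c) \<odot> S (S p) = (p \<ominus> w) \<ominus> c \<odot> S w"
proof -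
  note [simp] = complex_linearD[OF S] endo_diff[OF S]
  have w: "w \<in> carrier V" using p by auto
  have *: "c \<odot> S p = p \<ominus> w"
    unfolding p(2)[symmetric] using p(1) by - (rule linear_identity2[of p "S p"]; simp)
  have "(c * c) \<odot> S (S p) = c \<odot> S (c \<odot> S p)"
    using p by (simp add: smult_smult)
  also have "\<dots> = c \<odot> (S p \<ominus> S w)" using p w by (simp add: *)
  also have "\<dots> = c \<odot> S p \<ominus> c \<odot> S w" using p w by - (rule linear_identity2[of "S p" "S w"]; simp add: algebra_simps)
  finally show ?thesis by (simp only: *)
qed

text \<open>The identity \<open>(1 - x\<^sup>2)\<^sup>-\<^sup>1 = ((1 - x)\<^sup>-\<^sup>1 + (1 + x)\<^sup>-\<^sup>1) / 2\<close> for \<open>x = c S\<close>, applied to \<open>w\<close>. It is the engine of the spectral radius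
formula: being an average, the left side obeys every norm bound that both terms on the right obey,
so nothing is lost in passing from \<open>S\<close> to \<open>S\<^sup>2\<close>.\<close>

lemma resolvent_average:
  assumes S: "endo S" and p: "p \<in> carrier V" "p \<ominus> c \<odot> S p = w"
    and q: "q \<in> carrier V" "q \<ominus> (- c) \<odot> S q = w"
  defines "r \<equiv> (1/2) \<odot> (p \<oplus> q)"
  shows "r \<in> carrier V" "r \<ominus> (c * c) \<odot> S (S r) = w"
proof -
  note [simp] = complex_linearD[OF S] endo_diff[OF S]
  have w: "w \<in> carrier V" using p by auto
  show "r \<in> carrier V" using p q by (simp add: r_def)
  have "S (S r) = (1/2) \<odot> (S (S p) \<oplus> S (S q))" using p q by (simp add: r_def)
  hence "(c * c) \<odot> S (S r) = (1/2) \<odot> ((c * c) \<odot> S (S p) \<oplus> (c * c) \<odot> S (S q))"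
    using p q by (simp add: smult_add_right smult_smult mult.commute)
  also have "(c * c) \<odot> S (S q) = (q \<ominus> w) \<ominus> (- c) \<odot> S w"
    using resolvent_square_identity[OF S q] by simp
  also have "(c * c) \<odot> S (S p) = (p \<ominus> w) \<ominus> c \<odot> S w"
    by (rule resolvent_square_identity[OF S p])
  finally have 1: "(c * c) \<odot> S (S r) = (1/2) \<odot> (((p \<ominus> w) \<ominus> c \<odot> S w) \<oplus> ((q \<ominus> w) \<ominus> (- c) \<odot> S w))" .
  have 2: "(1/2) \<odot> (((p \<ominus> w) \<ominus> c \<odot> x) \<oplus> ((q \<ominus> w) \<ominus> (- c) \<odot> x)) = r \<ominus> w"
    if "x \<in> carrier V" for x
    unfolding r_def using p(1) q(1) w that by - (rule linear_identity4[of p q w x]; simp)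
  show "r \<ominus> (c * c) \<odot> S (S r) = w"
    unfolding 1 using w \<open>r \<in> carrier V\<close> by (subst 2) (simp, (rule linear_identity2[of r w]; simp))
qed

text \<open>Because \<open>1 - c\<^sup>2 S\<^sup>2 = (1 - c S) (1 + c S)\<close>.\<close>

lemma square_injective:
  assumes S: "endo S" and g: "invertible_with M c S" "invertible_with M (-c) S"
    and r: "r \<in> carrier V" "r' \<in> carrier V" "r \<ominus> (c * c) \<odot> S (S r) = r' \<ominus> (c * c) \<odot> S (S r')"
  shows "r = r'"
proof -
  note [simp] = complex_linearD[OF S] endo_diff[OF S]
  define d where "d = r \<ominus> r'"
  have d: "d \<in> carrier V" using r by (simp add: d_def)
  have inj: "v = \<zero>" if "invertible_with M c S" "v \<in> carrier V" "v \<ominus> c \<odot> S v = \<zero>" for v c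
    using that nonneg[of v] eq_zero[of v] by (auto simp: invertible_with_def)
  have "\<And>a b x y. a \<in> carrier V \<Longrightarrow> b \<in> carrier V \<Longrightarrow> x \<in> carrier V \<Longrightarrow> y \<in> carrier V \<Longrightarrow>
      (a \<ominus> b) \<ominus> (c * c) \<odot> (x \<ominus> y) = (a \<ominus> (c * c) \<odot> x) \<ominus> (b \<ominus> (c * c) \<odot> y)"
    subgoal for a b x y by (rule linear_identity4[of a b x y]; simp add: algebra_simps) done
  hence "d \<ominus> (c * c) \<odot> S (S d) = \<zero>"
    using r by (simp add: d_def diff_eq_zero_iff)
  moreover define y where "y = d \<ominus> (-c) \<odot> S d"
  have y: "y \<in> carrier V" using d by (simp add: y_def)
  have Sy: "S y = S d \<ominus> (-c) \<odot> S (S d)" using d by (simp add: y_def)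
  have "(d \<ominus> (-c) \<odot> x) \<ominus> c \<odot> (x \<ominus> (-c) \<odot> z) = d \<ominus> (c * c) \<odot> z"
    if "x \<in> carrier V" "z \<in> carrier V" for x z
    using d that by - (rule linear_identity3[of d x z]; simp add: algebra_simps)
  from this[of "S d" "S (S d)"] have "y \<ominus> c \<odot> S y = d \<ominus> (c * c) \<odot> S (S d)"
    unfolding Sy unfolding y_def using d by simp
  ultimately have "y = \<zero>" using inj[OF g(1) y] by simp
  hence "d = \<zero>" using inj[OF g(2) d] by (simp add: y_def)
  thus ?thesis using r by (simp add: d_def diff_eq_zero_iff)
qed

lemma norm_half_sum: "a \<in> carrier V \<Longrightarrow> b \<in> carrier V \<Longrightarrow> n a \<le> K \<Longrightarrow> n b \<le> K \<Longrightarrow> n ((1/2) \<odot> (a \<oplus> b)) \<le> K"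
  using triangle[of a b] by (simp add: scale)

lemma invertible_with_square:
  assumes S: "endo S" and g: "invertible_with M c S" "invertible_with M (-c) S"
  shows "invertible_with M (c * c) (\<lambda>v. S (S v))"
proof -
  have sol: "\<exists>r\<in>carrier V. r \<ominus> (c * c) \<odot> S (S r) = w \<and> n r \<le> M * n w" if w: "w \<in> carrier V" for w
  proof -
    obtain p where p: "p \<in> carrier V" "p \<ominus> c \<odot> S p = w" "n p \<le> M * n w"
      using g(1) w unfolding invertible_with_def by metis
    obtain q where q: "q \<in> carrier V" "q \<ominus> (- c) \<odot> S q = w" "n q \<le> M * n w"
      using g(2) w unfolding invertible_with_def by metis
    show ?thesis
      using resolvent_average[OF S p(1,2) q(1,2)] norm_half_sum[OF p(1) q(1) p(3) q(3)] by blast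
  qed
  show ?thesis
    unfolding invertible_with_def
  proof (intro conjI ballI)
    show "\<exists>v\<in>carrier V. v \<ominus> (c * c) \<odot> S (S v) = w" if "w \<in> carrier V" for w
      using sol[OF that] by blast
    fix v assume v: "v \<in> carrier V"
    define w where "w = v \<ominus> (c * c) \<odot> S (S v)"
    have w: "w \<in> carrier V" using v by (simp add: w_def complex_linearD[OF S])
    then obtain r where r: "r \<in> carrier V" "r \<ominus> (c * c) \<odot> S (S r) = w" "n r \<le> M * n w"
      using sol by blast
    have "r = v" by (rule square_injective[OF S g r(1) v]) (simp add: r w_def)
    thus "n v \<le> M * n (v \<ominus> (c * c) \<odot> S (S v))" using r by (simp add: w_def)
  qed
qed

text \<open>In terms of resolvents, \<open>\<parallel>(1 - c S)\<^sup>-\<^sup>1 - (1 - c' S)\<^sup>-\<^sup>1\<parallel> \<le> K\<close>.\<close>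

definition resolvent_lipschitz :: "real \<Rightarrow> complex \<Rightarrow> complex \<Rightarrow> ('a \<Rightarrow> 'a) \<Rightarrow> bool" where
  "resolvent_lipschitz K c c' S \<longleftrightarrow> (\<forall>v\<in>carrier V. \<forall>v'\<in>carrier V.
     v \<ominus> c \<odot> S v = v' \<ominus> c' \<odot> S v' \<longrightarrow> n (v \<ominus> v') \<le> K * n (v \<ominus> c \<odot> S v))"

lemma resolvent_lipschitz_square:
  assumes S: "endo S" and g: "invertible_with M c S" "invertible_with M (-c) S"
    and g': "invertible_with M c' S" "invertible_with M (-c') S"
    and l: "resolvent_lipschitz K c c' S" "resolvent_lipschitz K (-c) (-c') S"
  shows "resolvent_lipschitz K (c * c) (c' * c') (\<lambda>v. S (S v))"
  unfolding resolvent_lipschitz_def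
proof (intro ballI impI)
  fix v v' assume v: "v \<in> carrier V" "v' \<in> carrier V"
    and e: "v \<ominus> (c * c) \<odot> S (S v) = v' \<ominus> (c' * c') \<odot> S (S v')"
  define w where "w = v \<ominus> (c * c) \<odot> S (S v)"
  have w: "w \<in> carrier V" using v by (simp add: w_def complex_linearD[OF S])
  obtain p where p: "p \<in> carrier V" "p \<ominus> c \<odot> S p = w"
    using g(1) w unfolding invertible_with_def by metis
  obtain q where q: "q \<in> carrier V" "q \<ominus> (- c) \<odot> S q = w"
    using g(2) w unfolding invertible_with_def by metis
  obtain p' where p': "p' \<in> carrier V" "p' \<ominus> c' \<odot> S p' = w"
    using g'(1) w unfolding invertible_with_def by metis
  obtain q' where q': "q' \<in> carrier V" "q' \<ominus> (- c') \<odot> S q' = w"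
    using g'(2) w unfolding invertible_with_def by metis
  have 1: "(1/2) \<odot> (p \<oplus> q) = v"
    by (rule square_injective[OF S g resolvent_average(1)[OF S p q] v(1)])
       (simp add: resolvent_average(2)[OF S p q] w_def)
  have 2: "(1/2) \<odot> (p' \<oplus> q') = v'"
    by (rule square_injective[OF S g' resolvent_average(1)[OF S p' q'] v(2)])
       (simp add: resolvent_average(2)[OF S p' q'] w_def e)
  have "v \<ominus> v' = (1/2) \<odot> ((p \<ominus> p') \<oplus> (q \<ominus> q'))"
    unfolding 1[symmetric] 2[symmetric] using p(1) q(1) p'(1) q'(1)
    by - (rule linear_identity4[of p q p' q']; simp add: algebra_simps)
  moreover have "n (p \<ominus> p') \<le> K * n w"
    using l(1) p p' unfolding resolvent_lipschitz_def by metis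
  moreover have "n (q \<ominus> q') \<le> K * n w"
    using l(2) q q' unfolding resolvent_lipschitz_def by metis
  ultimately show "n (v \<ominus> v') \<le> K * n (v \<ominus> (c * c) \<odot> S (S v))"
    using p q p' q' by (simp add: norm_half_sum flip: w_def)
qed

text \<open>A lower bound for \<open>1 - z T\<close> persists, up to a factor \<open>2\<close>, for all parameters near \<open>z\<close>. Compactness of the
disc then gives one bound for all parameters.\<close>

lemma uniform_resolvent_bound:
  assumes T: "endo T" and m: "\<And>v. v \<in> carrier V \<Longrightarrow> n (T v) \<le> m * n v"
    and inv: "\<And>z. cmod z \<le> \<rho> \<Longrightarrow> \<exists>K. invertible_with K z T"
  shows "\<exists>M>0. \<forall>z. cmod z \<le> \<rho> \<longrightarrow> invertible_with M z T"
proof -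
  \<comment> \<open>A positive bound is needed as a divisor.\<close>
  define m' where "m' = max m 1"
  have m': "m' > 0" "\<And>v. v \<in> carrier V \<Longrightarrow> n (T v) \<le> m' * n v"
    using bound_mono[OF m] by (auto simp: m'_def)
  have "\<forall>z\<in>cball 0 \<rho>. \<exists>K>0. invertible_with K z T"
  proof
    fix z :: complex assume "z \<in> cball 0 \<rho>"
    then obtain K where K: "invertible_with K z T" using inv by auto
    have "invertible_with (max K 1) z T"
      unfolding invertible_with_def
    proof (intro conjI ballI)
      show "\<exists>v\<in>carrier V. v \<ominus> z \<odot> T v = w" if "w \<in> carrier V" for w
        using K that by (simp add: invertible_with_def)
      fix v assume v: "v \<in> carrier V"
      have "n v \<le> K * n (v \<ominus> z \<odot> T v)" using K v by (simp add: invertible_with_def)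
      also have "\<dots> \<le> max K 1 * n (v \<ominus> z \<odot> T v)"
        using v by (intro mult_right_mono nonneg) (auto simp: complex_linearD[OF T])
      finally show "n v \<le> max K 1 * n (v \<ominus> z \<odot> T v)" .
    qed
    thus "\<exists>K>0. invertible_with K z T" by (intro exI[of _ "max K 1"]) auto
  qed
  then obtain K where K: "\<And>z. z \<in> cball 0 \<rho> \<Longrightarrow> K z > 0 \<and> invertible_with (K z) z T" by metis
  \<comment> \<open>Within this radius the perturbation costs at most half of the lower bound at \<open>z\<close>.\<close>
  define r where "r z = 1 / (2 * K z * m')" for z
  have r: "r z > 0" if "z \<in> cball 0 \<rho>" for z using K[OF that] m' by (simp add: r_def)
  have "cball 0 \<rho> \<subseteq> (\<Union>z\<in>cball 0 \<rho>. ball z (r z))" using r by force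
  then obtain F where F: "F \<subseteq> cball 0 \<rho>" "finite F" "cball 0 \<rho> \<subseteq> (\<Union>z\<in>F. ball z (r z))"
    using compactE_image[of "cball 0 \<rho>" "cball 0 \<rho>" "\<lambda>z. ball z (r z)"] by auto
  define M where "M = (\<Sum>z\<in>F. 2 * K z) + 1"
  have pos: "0 \<le> 2 * K z" if "z \<in> F" for z using K that F(1) by (smt (verit) subsetD)
  have M: "M > 0" using pos by (simp add: M_def sum_nonneg add_nonneg_pos)
  have "invertible_with M z' T" if z': "cmod z' \<le> \<rho>" for z'
    unfolding invertible_with_def
  proof (intro conjI ballI)
    show "\<exists>v\<in>carrier V. v \<ominus> z' \<odot> T v = w" if "w \<in> carrier V" for w
      using inv[OF z'] that by (auto simp: invertible_with_def)
    fix v assume v: "v \<in> carrier V"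
    have Tv: "T v \<in> carrier V" using v complex_linearD[OF T] by simp
    obtain z where z: "z \<in> F" "dist z z' < r z" using z' F(3) by force
    have Kz: "K z > 0" "n v \<le> K z * n (v \<ominus> z \<odot> T v)" using K[of z] z F(1) v by (auto simp: invertible_with_def)
    have "n (v \<ominus> z \<odot> T v) \<le> n (v \<ominus> z' \<odot> T v) + n ((z' - z) \<odot> T v)"
    proof -
      have "v \<ominus> z \<odot> T v = (v \<ominus> z' \<odot> T v) \<oplus> (z' - z) \<odot> T v"
        using v Tv by - (rule linear_identity2[of v "T v"]; simp add: algebra_simps)
      thus ?thesis using triangle[of "v \<ominus> z' \<odot> T v" "(z' - z) \<odot> T v"] v Tv by simp
    qed
    also have "n ((z' - z) \<odot> T v) = cmod (z' - z) * n (T v)" using Tv by (simp add: scale)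
    also have "\<dots> \<le> r z * (m' * n v)"
      using z m' v Tv r[of z] F(1) by (intro mult_mono nonneg) (auto simp: dist_norm norm_minus_commute)
    also have "r z * (m' * n v) = n v / (2 * K z)" using m' by (simp add: r_def)
    finally have "K z * n (v \<ominus> z \<odot> T v) \<le> K z * (n (v \<ominus> z' \<odot> T v) + n v / (2 * K z))"
      using Kz by simp
    also have "K z * (n (v \<ominus> z' \<odot> T v) + n v / (2 * K z)) = K z * n (v \<ominus> z' \<odot> T v) + n v / 2"
      using Kz(1) by (simp add: distrib_left)
    finally have "n v \<le> 2 * K z * n (v \<ominus> z' \<odot> T v)" using Kz(2) by simp
    also have "\<dots> \<le> M * n (v \<ominus> z' \<odot> T v)"
    proof (rule mult_right_mono)
      have "2 * K z \<le> (\<Sum>z\<in>F. 2 * K z)" by (rule member_le_sum) (use z F pos in auto)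
      thus "2 * K z \<le> M" by (simp add: M_def)
    qed (use v Tv in \<open>auto intro: nonneg\<close>)
    finally show "n v \<le> M * n (v \<ominus> z' \<odot> T v)" .
  qed
  with M show ?thesis by blast
qed

lemma endo_funpow: "endo T \<Longrightarrow> endo (T ^^ k)"
proof (induction k)
  case (Suc k)
  thus ?case using complex_linearD[OF Suc.prems] complex_linearD[OF Suc.IH[OF Suc.prems]]
    by (auto simp: complex_linear_def)
qed (auto simp: complex_linear_def)

lemma funpow_bound:
  assumes "endo T" "0 \<le> m" "\<And>v. v \<in> carrier V \<Longrightarrow> n (T v) \<le> m * n v" "v \<in> carrier V"
  shows "n ((T ^^ k) v) \<le> m ^ k * n v"
proof (induction k)
  case (Suc k)
  have "(T ^^ k) v \<in> carrier V" using complex_linearD[OF endo_funpow[OF assms(1)]] assms by blast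
  hence "n (T ((T ^^ k) v)) \<le> m * n ((T ^^ k) v)" using assms by blast
  also have "\<dots> \<le> m * (m ^ k * n v)" using Suc assms by (simp add: mult_left_mono)
  finally show ?case by (simp add: mult.assoc)
qed simp

text \<open>Induction on \<open>k\<close>. In the step, \<open>\<zeta>\<close> is replaced by its square roots \<open>\<plusminus>\<eta>\<close>, so that
\<open>1 - t\<^bsup>2N\<^esup> \<zeta> T\<^bsup>2N\<^esup>\<close> splits into \<open>1 - t\<^sup>N \<eta> T\<^sup>N\<close> and \<open>1 + t\<^sup>N \<eta> T\<^sup>N\<close>; this is why the statement ranges
over all \<open>\<zeta>\<close> of modulus at most \<open>1\<close> although only \<open>\<zeta> = 1\<close> is wanted in the end. The point is that the
constants \<open>M\<close> and \<open>K t t'\<close> do not depend on \<open>k\<close>.\<close>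

lemma dyadic_resolvents:
  assumes T: "endo T" and M: "M > 0" "\<And>z. cmod z \<le> \<rho> \<Longrightarrow> invertible_with M z T"
    and L: "\<And>t t' \<zeta>. \<lbrakk>0 \<le> t; t \<le> \<rho>; 0 \<le> t'; t' \<le> \<rho>; cmod \<zeta> \<le> 1\<rbrakk>
      \<Longrightarrow> resolvent_lipschitz (K t t') (of_real t * \<zeta>) (of_real t' * \<zeta>) T"
    and \<zeta>: "cmod \<zeta> \<le> 1" and t: "0 \<le> t" "t \<le> \<rho>" "0 \<le> t'" "t' \<le> \<rho>"
  shows "invertible_with M (of_real t ^ (2^k) * \<zeta>) (T ^^ (2^k))"
    and "resolvent_lipschitz (K t t') (of_real t ^ (2^k) * \<zeta>) (of_real t' ^ (2^k) * \<zeta>) (T ^^ (2^k))"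
proof -
  have "\<forall>\<zeta>. cmod \<zeta> \<le> 1 \<longrightarrow> invertible_with M (of_real t ^ (2^k) * \<zeta>) (T ^^ (2^k)) \<and>
     invertible_with M (of_real t' ^ (2^k) * \<zeta>) (T ^^ (2^k)) \<and>
     resolvent_lipschitz (K t t') (of_real t ^ (2^k) * \<zeta>) (of_real t' ^ (2^k) * \<zeta>) (T ^^ (2^k))"
  proof (induction k)
    case 0
    show ?case
    proof (intro allI impI)
      fix \<zeta> :: complex assume "cmod \<zeta> \<le> 1"
      hence "cmod (of_real t * \<zeta>) \<le> \<rho>" "cmod (of_real t' * \<zeta>) \<le> \<rho>"
        using t mult_mono[of t \<rho> "cmod \<zeta>" 1] mult_mono[of t' \<rho> "cmod \<zeta>" 1] by (auto simp: norm_mult)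
      thus "invertible_with M (of_real t ^ 2 ^ 0 * \<zeta>) (T ^^ 2 ^ 0) \<and>
         invertible_with M (of_real t' ^ 2 ^ 0 * \<zeta>) (T ^^ 2 ^ 0) \<and>
         resolvent_lipschitz (K t t') (of_real t ^ 2 ^ 0 * \<zeta>) (of_real t' ^ 2 ^ 0 * \<zeta>) (T ^^ 2 ^ 0)"
        using M L t \<open>cmod \<zeta> \<le> 1\<close> by simp
    qed
  next
    case (Suc k)
    show ?case
    proof (intro allI impI)
      fix \<zeta> :: complex assume \<zeta>: "cmod \<zeta> \<le> 1"
      define \<eta> where "\<eta> = csqrt \<zeta>"
      have \<eta>: "\<eta> * \<eta> = \<zeta>" using power2_csqrt[of \<zeta>] by (simp add: \<eta>_def power2_eq_square)
      hence "cmod \<eta> * cmod \<eta> \<le> 1" using \<zeta> by (simp flip: norm_mult)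
      hence n\<eta>: "cmod \<eta> \<le> 1" "cmod (-\<eta>) \<le> 1"
        using mult_le_one[of "cmod \<eta>"] by (auto simp: abs_square_le_1 power2_eq_square[symmetric])
      define S where "S = T ^^ (2^k)"
      have S: "endo S" using T by (simp add: S_def endo_funpow)
      have TS: "T ^^ (2 ^ Suc k) = (\<lambda>v. S (S v))"
        by (simp add: S_def funpow_add mult_2 fun_eq_iff)
      have c: "of_real s ^ (2 ^ Suc k) * \<zeta> = (of_real s ^ (2^k) * \<eta>) * (of_real s ^ (2^k) * \<eta>)" for s
        unfolding \<eta>[symmetric] by (simp add: mult_2 power_add algebra_simps)
      note IH = Suc.IH[rule_format, OF n\<eta>(1), folded S_def]
      note IH' = Suc.IH[rule_format, OF n\<eta>(2), folded S_def, unfolded mult_minus_right]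
      show "invertible_with M (of_real t ^ 2 ^ Suc k * \<zeta>) (T ^^ 2 ^ Suc k) \<and>
         invertible_with M (of_real t' ^ 2 ^ Suc k * \<zeta>) (T ^^ 2 ^ Suc k) \<and>
         resolvent_lipschitz (K t t') (of_real t ^ 2 ^ Suc k * \<zeta>) (of_real t' ^ 2 ^ Suc k * \<zeta>) (T ^^ 2 ^ Suc k)"
        unfolding c TS using IH IH' S
        by (metis invertible_with_square resolvent_lipschitz_square)
    qed
  qed
  with \<zeta> show "invertible_with M (of_real t ^ (2^k) * \<zeta>) (T ^^ (2^k))"
    and "resolvent_lipschitz (K t t') (of_real t ^ (2^k) * \<zeta>) (of_real t' ^ (2^k) * \<zeta>) (T ^^ (2^k))"
    by blast+
qed

text \<open>The hypothesis on squares is what self-adjointness gives in a \<open>C\<^sup>*\<close>-algebra; it makes the \<open>N\<close>-th root of the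
norm of \<open>T\<^sup>N\<close> equal to the norm of \<open>T\<close> when \<open>N\<close> is a power of two.\<close>

lemma dyadic_power_bound_descent:
  assumes T: "endo T" and c: "0 \<le> c"
    and sq: "\<And>k v. v \<in> carrier V \<Longrightarrow> (n ((T ^^ (2^k)) v))\<^sup>2 \<le> n v * n ((T ^^ (2^Suc k)) v)"
    and b: "\<And>v. v \<in> carrier V \<Longrightarrow> n ((T ^^ (2^k)) v) \<le> c ^ (2^k) * n v"
  shows "v \<in> carrier V \<Longrightarrow> n (T v) \<le> c * n v"
  using b
proof (induction k arbitrary: v)
  case 0
  thus ?case by simp
next
  case (Suc k)
  have "n ((T ^^ (2^k)) u) \<le> c ^ (2^k) * n u" if u: "u \<in> carrier V" for u
  proof -
    have "(n ((T ^^ (2^k)) u))\<^sup>2 \<le> n u * n ((T ^^ (2^Suc k)) u)" by (rule sq[OF u])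
    also have "\<dots> \<le> n u * (c ^ (2^Suc k) * n u)" using Suc.prems(2)[OF u] nonneg[OF u] by (intro mult_left_mono)
    also have "\<dots> = (c ^ (2^k) * n u)\<^sup>2" by (simp add: power2_eq_square mult_2 power_add)
    finally show ?thesis using c nonneg[OF u] power2_le_imp_le by (metis mult_nonneg_nonneg zero_le_power)
  qed
  thus ?case using Suc.IH Suc.prems(1) by blast
qed

text \<open>The resolvent identity \<open>(1 - c T)\<^sup>-\<^sup>1 - (1 - c' T)\<^sup>-\<^sup>1 = (c - c') (1 - c T)\<^sup>-\<^sup>1 T (1 - c' T)\<^sup>-\<^sup>1\<close>.\<close>

lemma resolvent_lipschitz_base:
  assumes T: "endo T" and m: "0 \<le> m" "\<And>v. v \<in> carrier V \<Longrightarrow> n (T v) \<le> m * n v"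
    and M: "M > 0" and g: "invertible_with M c T" "invertible_with M c' T"
  shows "resolvent_lipschitz (M * M * m * cmod (c - c')) c c' T"
  unfolding resolvent_lipschitz_def
proof (intro ballI impI)
  fix v v' assume v: "v \<in> carrier V" "v' \<in> carrier V" and e: "v \<ominus> c \<odot> T v = v' \<ominus> c' \<odot> T v'"
  have Tv: "T v \<in> carrier V" "T v' \<in> carrier V" using v complex_linearD[OF T] by simp_all
  have 1: "(v \<ominus> v') \<ominus> c \<odot> T (v \<ominus> v') = (c - c') \<odot> T v'"
  proof -
    have "(v \<ominus> v') \<ominus> c \<odot> (x \<ominus> x') = ((v \<ominus> c \<odot> x) \<ominus> (v' \<ominus> c' \<odot> x')) \<oplus> (c - c') \<odot> x'"
      if "x \<in> carrier V" "x' \<in> carrier V" for x x'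
      using v that by - (rule linear_identity4[of v v' x x']; simp add: algebra_simps)
    from this[OF Tv] show ?thesis unfolding e endo_diff[OF T v] using v Tv by (simp add: diff_eq_zero_iff)
  qed
  have "n (v \<ominus> v') \<le> M * n ((c - c') \<odot> T v')"
    using g(1) v unfolding 1[symmetric] invertible_with_def by simp
  also have "n ((c - c') \<odot> T v') = cmod (c - c') * n (T v')" using Tv by (simp add: scale)
  finally have 2: "n (v \<ominus> v') \<le> M * (cmod (c - c') * n (T v'))" .
  have "n (T v') \<le> m * n v'" using m v by simp
  also have "m * n v' \<le> m * (M * n (v \<ominus> c \<odot> T v))"
    using g(2) v e m by (intro mult_left_mono) (simp_all add: invertible_with_def)
  finally have "M * (cmod (c - c') * n (T v')) \<le> M * (cmod (c - c') * (m * (M * n (v \<ominus> c \<odot> T v))))"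
    using M by (intro mult_left_mono) auto
  with 2 show "n (v \<ominus> v') \<le> M * M * m * cmod (c - c') * n (v \<ominus> c \<odot> T v)"
    by (simp add: mult_ac)
qed

text \<open>If \<open>t m < 1\<close>, then \<open>t\<^sup>N T\<^sup>N\<close> tends to \<open>0\<close>, so \<open>(1 - t\<^sup>N T\<^sup>N)\<^sup>-\<^sup>1\<close> is close to \<open>1\<close> for a large power of two \<open>N\<close>. By the Lipschitz bound,
which is uniform in \<open>N\<close>, the same is roughly true at \<open>t'\<close>, as long as \<open>t' - t\<close> is small compared with a
constant independent of \<open>N\<close>. This forces \<open>\<parallel>t'\<^sup>N T\<^sup>N\<parallel> \<le> 1\<close>, hence \<open>t' \<parallel>T\<parallel> \<le> 1\<close>.\<close>

lemma spectral_bound_improve: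
  assumes T: "endo T"
    and sq: "\<And>k v. v \<in> carrier V \<Longrightarrow> (n ((T ^^ (2^k)) v))\<^sup>2 \<le> n v * n ((T ^^ (2^Suc k)) v)"
    and m: "m > 0" "\<And>v. v \<in> carrier V \<Longrightarrow> n (T v) \<le> m * n v"
    and M: "M > 0" "\<And>z. cmod z \<le> \<rho> \<Longrightarrow> invertible_with M z T"
    and t: "0 \<le> t" "t * m < 1" "t \<le> t'" "t' \<le> \<rho>" "M * M * m * (t' - t) \<le> 1/4" "0 < t'"
    and v: "v \<in> carrier V"
  shows "n (T v) \<le> 1 / t' * n v"
proof -
  have L: "resolvent_lipschitz (M * M * m * \<bar>t - t'\<bar>) (of_real t * \<zeta>) (of_real t' * \<zeta>) T"
    if "0 \<le> t" "t \<le> \<rho>" "0 \<le> t'" "t' \<le> \<rho>" "cmod \<zeta> \<le> 1" for t t' \<zeta>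
  proof -
    have "cmod (of_real t * \<zeta>) \<le> \<rho>" "cmod (of_real t' * \<zeta>) \<le> \<rho>"
      using that mult_mono[of t \<rho> "cmod \<zeta>" 1] mult_mono[of t' \<rho> "cmod \<zeta>" 1] by (auto simp: norm_mult)
    hence *: "resolvent_lipschitz (M * M * m * cmod (of_real t * \<zeta> - of_real t' * \<zeta>)) (of_real t * \<zeta>) (of_real t' * \<zeta>) T"
      using resolvent_lipschitz_base[OF T _ m(2) M(1)] m(1) M(2) by simp
    have "cmod (of_real t * \<zeta> - of_real t' * \<zeta>) = \<bar>t - t'\<bar> * cmod \<zeta>"
      by (simp add: norm_mult flip: left_diff_distrib of_real_diff)
    also have "\<dots> \<le> \<bar>t - t'\<bar>" using that by (simp add: mult_left_le)
    finally have "M * M * m * cmod (of_real t * \<zeta> - of_real t' * \<zeta>) \<le> M * M * m * \<bar>t - t'\<bar>"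
      using M m by simp
    thus ?thesis using * unfolding resolvent_lipschitz_def
      by (meson M.minus_closed complex_linearD(1)[OF T] smult_mem nonneg mult_right_mono order_trans)
  qed
  have tr: "t \<le> \<rho>" "0 \<le> t'" using t by auto
  have "(\<lambda>N. (t * m) ^ N) \<longlonglongrightarrow> 0" using t m by (intro LIMSEQ_realpow_zero) auto
  hence "eventually (\<lambda>N. (t * m) ^ N < 1 / (4 * M)) sequentially"
    using M by (intro order_tendstoD) auto
  then obtain k0 where "\<And>N. N \<ge> k0 \<Longrightarrow> (t * m) ^ N < 1 / (4 * M)" by (auto simp: eventually_sequentially)
  moreover have "k0 \<le> 2 ^ k0" by (simp add: less_imp_le)
  ultimately obtain k where k: "(t * m) ^ (2 ^ k) < 1 / (4 * M)" by blast
  let ?S = "T ^^ (2^k)" and ?N = "2^k :: nat"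
  note S = endo_funpow[OF T, of ?N]
  have one: "cmod 1 \<le> 1" by simp
  have inv: "invertible_with M (of_real t ^ ?N) ?S"
    using dyadic_resolvents(1)[OF T M L one t(1) tr(1) tr(2) t(4), of k] by simp
  have lip: "resolvent_lipschitz (M * M * m * \<bar>t - t'\<bar>) (of_real t ^ ?N) (of_real t' ^ ?N) ?S"
    using dyadic_resolvents(2)[OF T M L one t(1) tr(1) tr(2) t(4), of k] by simp
  have main: "n (?S u) \<le> (1/t') ^ ?N * n u" if u: "u \<in> carrier V" for u
  proof -
    have Su: "?S u \<in> carrier V" using u complex_linearD[OF S] by blast
    define w where "w = u \<ominus> (of_real t' ^ ?N) \<odot> ?S u"
    have w: "w \<in> carrier V" using u Su by (simp add: w_def)
    obtain p where p: "p \<in> carrier V" "p \<ominus> (of_real t ^ ?N) \<odot> ?S p = w"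
      using inv w unfolding invertible_with_def by metis
    have Sp: "?S p \<in> carrier V" using p complex_linearD[OF S] by blast
    have "n (p \<ominus> u) \<le> (M * M * m * \<bar>t - t'\<bar>) * n w"
      using lip p u unfolding resolvent_lipschitz_def w_def by metis
    also have "\<dots> \<le> 1/4 * n w" using t nonneg[OF w] by (intro mult_right_mono) auto
    finally have 1: "n (p \<ominus> u) \<le> 1/4 * n w" .
    have pw: "p \<ominus> w = (of_real t ^ ?N) \<odot> ?S p"
      unfolding p(2)[symmetric] using p(1) Sp by - (rule linear_identity2[of p "?S p"]; simp)
    have "n (p \<ominus> w) = t ^ ?N * n (?S p)" unfolding pw using Sp t by (simp add: scale norm_power)
    also have "\<dots> \<le> t ^ ?N * (m ^ ?N * n p)"
      using funpow_bound[OF T _ m(2) p(1)] m t by (intro mult_left_mono) auto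
    also have "\<dots> = (t * m) ^ ?N * n p" by (simp add: power_mult_distrib)
    also have "\<dots> \<le> 1 / (4 * M) * (M * n w)"
    proof (rule mult_mono)
      show "n p \<le> M * n w" using inv p by (auto simp: invertible_with_def)
    qed (use k M p nonneg in auto)
    also have "\<dots> = 1/4 * n w" using M by simp
    finally have 2: "n (p \<ominus> w) \<le> 1/4 * n w" .
    have "n (u \<ominus> w) \<le> n (u \<ominus> p) + n (p \<ominus> w)" by (rule dist_triangle[OF u p(1) w])
    \<comment> \<open>The difference is at most half the norm of \<open>w\<close>, so the norms of \<open>u\<close> and \<open>w\<close> are comparable.\<close>
    with 1 2 have 3: "n (u \<ominus> w) \<le> 1/2 * n w" using norm_diff_commute[OF u p(1)] by simp
    have "n w \<le> n u + n (u \<ominus> w)" using norm_le_diff[OF w u] norm_diff_commute[OF w u] by simp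
    with 3 have 4: "n (u \<ominus> w) \<le> n u" by simp
    have uw: "u \<ominus> w = (of_real t' ^ ?N) \<odot> ?S u"
      unfolding w_def using u Su by - (rule linear_identity2[of u "?S u"]; simp)
    have "t' ^ ?N * n (?S u) \<le> n u" using 4 unfolding uw using Su t by (simp add: scale norm_power)
    thus ?thesis using t(6) by (simp add: field_simps power_divide)
  qed
  show ?thesis
    using dyadic_power_bound_descent[OF T _ sq main v] t by simp
qed

text \<open>Let \<open>c\<close> be the least bound of \<open>T\<close> that is at least \<open>1 / \<rho>\<close>. If \<open>c > 1 / \<rho>\<close>, the previous lemma applies with \<open>t\<close> just
below and \<open>t'\<close> just above \<open>1 / c\<close>, and produces a bound smaller than \<open>c\<close>.\<close>

theorem spectral_radius_bound:
  assumes T: "endo T"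
    and sq: "\<And>k v. v \<in> carrier V \<Longrightarrow> (n ((T ^^ (2^k)) v))\<^sup>2 \<le> n v * n ((T ^^ (2^Suc k)) v)"
    and m: "\<And>v. v \<in> carrier V \<Longrightarrow> n (T v) \<le> m * n v"
    and \<rho>: "\<rho> > 0" and inv: "\<And>z. cmod z \<le> \<rho> \<Longrightarrow> \<exists>K. invertible_with K z T"
    and v: "v \<in> carrier V"
  shows "\<rho> * n (T v) \<le> n v"
proof -
  obtain M where M: "M > 0" "\<And>z. cmod z \<le> \<rho> \<Longrightarrow> invertible_with M z T"
    using uniform_resolvent_bound[OF T m inv] by blast
  define B where "B = {c. c \<ge> 1/\<rho> \<and> (\<forall>v\<in>carrier V. n (T v) \<le> c * n v)}"
  define c where "c = Inf B"
  have "max m (1/\<rho>) \<in> B"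
    unfolding B_def using bound_mono[OF m] by auto
  hence B: "B \<noteq> {}" by blast
  have bdd: "bdd_below B" by (rule bdd_belowI[of _ "1/\<rho>"]) (simp add: B_def)
  have c: "1/\<rho> \<le> c" unfolding c_def by (rule cInf_greatest[OF B]) (simp add: B_def)
  have c0: "c > 0" using c \<rho> by (smt (verit) divide_pos_pos)
  have cb: "n (T u) \<le> c * n u" if u: "u \<in> carrier V" for u
  proof (cases "n u = 0")
    case True
    thus ?thesis using m[OF u] by simp
  next
    case False
    hence nu: "n u > 0" using nonneg[OF u] by simp
    have "n (T u) / n u \<le> c" unfolding c_def
      by (rule cInf_greatest[OF B]) (use u nu in \<open>auto simp: B_def field_simps\<close>)
    thus ?thesis using nu by (simp add: field_simps)
  qed
  have "c \<le> 1/\<rho>"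
  proof (rule ccontr)
    assume "\<not> ?thesis"
    hence gt: "1/c < \<rho>" using c0 \<rho> by (simp add: field_simps)
    \<comment> \<open>The constraints keep both parameters in \<open>[0, \<rho>]\<close>, and their distance \<open>2 d\<close> within the reach of the
      Lipschitz constant \<open>M\<^sup>2 c\<close>.\<close>
    define d where "d = min (min (\<rho> - 1/c) (1/c)) (1 / (8 * (M * M * c)))"
    have MM: "M * M * c > 0" using M c0 by simp
    have d: "d > 0" "d \<le> \<rho> - 1/c" "d \<le> 1/c" "d \<le> 1 / (8 * (M * M * c))"
      using gt c0 MM by (auto simp: d_def)
    have 5: "M * M * c * d \<le> 1/8" using d(4) MM by (simp add: field_simps)
    have t1: "0 \<le> 1/c - d" using d by simp
    have t2: "(1/c - d) * c < 1" using d c0 by (simp add: field_simps)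
    have t3: "1/c - d \<le> 1/c + d" using d by simp
    have t4: "1/c + d \<le> \<rho>" using d by simp
    have t5: "M * M * c * ((1/c + d) - (1/c - d)) \<le> 1/4" using 5 by (simp add: algebra_simps)
    have t6: "0 < 1/c + d" using d c0 by (simp add: add_pos_pos)
    have "\<forall>u\<in>carrier V. n (T u) \<le> 1 / (1/c + d) * n u"
      using spectral_bound_improve[OF T sq c0 cb M t1 t2 t3 t4 t5 t6] by blast
    moreover have "1/\<rho> \<le> 1 / (1/c + d)" using t4 t6 \<rho> by (simp add: frac_le)
    ultimately have "1 / (1/c + d) \<in> B" by (simp add: B_def)
    hence "c \<le> 1 / (1/c + d)" unfolding c_def using bdd by (rule cInf_lower)
    hence "c * (1/c + d) \<le> 1" using t6 by (simp add: field_simps)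
    hence "c * d \<le> 0" using c0 by (simp add: algebra_simps)
    thus False using c0 d(1) by (simp add: mult_le_0_iff)
  qed
  hence "c * n v \<le> 1/\<rho> * n v" using nonneg[OF v] by (rule mult_right_mono)
  with cb[OF v] have "n (T v) \<le> 1/\<rho> * n v" by linarith
  thus ?thesis using \<rho> by (simp add: field_simps)
qed

end

section \<open>Positive elements of a \<open>C\<^sup>*\<close>-category\<close>

context carrier_normed_space
begin

text \<open>The operator \<open>T - l\<close> is a bijection with bounded inverse.\<close>

definition resolvable :: "('a \<Rightarrow> 'a) \<Rightarrow> complex \<Rightarrow> bool" where
  "resolvable T l \<longleftrightarrow> (\<forall>w\<in>carrier V. \<exists>v\<in>carrier V. T v \<ominus> l \<odot> v = w) \<and>
     (\<exists>K. \<forall>v\<in>carrier V. n v \<le> K * n (T v \<ominus> l \<odot> v))"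

lemma resolvable_imp_invertible:
  assumes T: "endo T" and z: "z \<noteq> 0" and r: "resolvable T (1 / z)"
  shows "\<exists>K. invertible_with K z T"
proof -
  have e: "v \<ominus> z \<odot> T v = (- z) \<odot> (T v \<ominus> (1 / z) \<odot> v)" if "v \<in> carrier V" for v
    using that complex_linearD(1)[OF T that] z by - (rule linear_identity2[of v "T v"]; simp add: algebra_simps)
  obtain K where K: "\<And>v. v \<in> carrier V \<Longrightarrow> n v \<le> K * n (T v \<ominus> (1 / z) \<odot> v)"
    using r by (auto simp: resolvable_def)
  show ?thesis
    unfolding invertible_with_def
  proof (intro exI conjI ballI)
    fix w assume w: "w \<in> carrier V"
    then obtain v where v: "v \<in> carrier V" "T v \<ominus> (1 / z) \<odot> v = (- 1 / z) \<odot> w"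
      using r unfolding resolvable_def by (meson smult_mem)
    have "v \<ominus> z \<odot> T v = w" unfolding e[OF v(1)] v(2) using w z by (simp add: smult_smult)
    thus "\<exists>v\<in>carrier V. v \<ominus> z \<odot> T v = w" using v by blast
  next
    fix v assume v: "v \<in> carrier V"
    show "n v \<le> (K / cmod z) * n (v \<ominus> z \<odot> T v)"
      unfolding e[OF v] using K[OF v] z v complex_linearD(1)[OF T v] by (simp add: scale)
  qed
qed

lemma norm_bound_from_resolvents:
  assumes T: "endo T"
    and sq: "\<And>k v. v \<in> carrier V \<Longrightarrow> (n ((T ^^ (2^k)) v))\<^sup>2 \<le> n v * n ((T ^^ (2^Suc k)) v)"
    and m: "\<And>v. v \<in> carrier V \<Longrightarrow> n (T v) \<le> m * n v"
    and r: "0 \<le> r" and res: "\<And>l. cmod l > r \<Longrightarrow> resolvable T l"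
    and v: "v \<in> carrier V"
  shows "n (T v) \<le> r * n v"
proof -
  have "n (T v) \<le> (r + e) * n v" if e: "e > 0" for e
  proof -
    have "1 / (r + e) * n (T v) \<le> n v"
    proof (rule spectral_radius_bound[OF T sq m _ _ v])
      show "0 < 1 / (r + e)" using r e by simp
      fix z :: complex assume z: "cmod z \<le> 1 / (r + e)"
      show "\<exists>K. invertible_with K z T"
      proof (cases "z = 0")
        case True
        have "v \<ominus> z \<odot> T v = v" if "v \<in> carrier V" for v
          unfolding True smult_0[OF complex_linearD(1)[OF T that]]
          using that by - (rule linear_identity2[of v v]; simp)
        hence "invertible_with 1 z T" by (auto simp: invertible_with_def)
        thus ?thesis by blast
      next
        case False
        have "r < r + e" using e by simp
        also have "\<dots> \<le> cmod (1 / z)" using z False r e by (simp add: norm_divide field_simps)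
        finally show ?thesis using resolvable_imp_invertible[OF T False] res by blast
      qed
    qed
    thus ?thesis using r e by (simp add: field_simps)
  qed
  hence "\<forall>e>0. n (T v) \<le> r * n v + e * n v" by (simp add: distrib_right)
  show ?thesis
  proof (rule field_le_epsilon)
    fix e :: real assume e: "e > 0"
    have "n (T v) \<le> (r + e / (n v + 1)) * n v" using \<open>\<And>e. e > 0 \<Longrightarrow> _\<close> e nonneg[OF v] by simp
    also have "\<dots> = r * n v + e * (n v / (n v + 1))" by (simp add: distrib_right)
    also have "\<dots> \<le> r * n v + e" using e nonneg[OF v] by (intro add_left_mono mult_left_le) (auto simp: divide_le_eq)
    finally show "n (T v) \<le> r * n v + e" .
  qed
qed

text \<open>The Neumann series, in the guise of the fixed point of \<open>v \<mapsto> (T v - w) / l\<close>.\<close>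

lemma resolvable_outside_bound:
  assumes comp: "complete_wrt V n" and T: "endo T"
    and m: "\<And>v. v \<in> carrier V \<Longrightarrow> n (T v) \<le> m * n v" and l: "cmod l > m" "l \<noteq> 0"
  shows "resolvable T l"
  unfolding resolvable_def
proof (intro conjI ballI exI)
  note [simp] = complex_linearD[OF T] endo_diff[OF T]
  fix w assume w: "w \<in> carrier V"
  define f where "f v = (1 / l) \<odot> (T v \<ominus> w)" for v
  have l0: "cmod l > 0" using l(2) by simp
  have "\<exists>v\<in>carrier V. f v = v"
  proof (rule contraction_fixed_point[OF comp])
    show "f v \<in> carrier V" if "v \<in> carrier V" for v using that w by (simp add: f_def)
    show "m / cmod l < 1" using l l0 by simp
    fix u v assume uv: "u \<in> carrier V" "v \<in> carrier V"
    have "f u \<ominus> f v = (1 / l) \<odot> T (u \<ominus> v)"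
      unfolding f_def endo_diff[OF T uv] using uv w by - (rule linear_identity3[of "T u" "T v" w]; simp add: field_simps)
    thus "n (f u \<ominus> f v) \<le> m / cmod l * n (u \<ominus> v)"
      using m[of "u \<ominus> v"] uv l0 by (simp add: scale norm_divide divide_right_mono del: endo_diff)
  qed
  then obtain v where v: "v \<in> carrier V" "f v = v" by blast
  have "l \<odot> v = l \<odot> ((1 / l) \<odot> (T v \<ominus> w))" using v(2) by (simp add: f_def)
  hence "l \<odot> v = T v \<ominus> w" using v(1) w l(2) by (simp add: smult_smult)
  hence "T v \<ominus> l \<odot> v = w" using v w by - (rule linear_identity2[of "T v" w]; simp)
  thus "\<exists>v\<in>carrier V. T v \<ominus> l \<odot> v = w" using v by blast
next
  fix v assume v: "v \<in> carrier V"
  have Tv: "T v \<in> carrier V" using v complex_linearD[OF T] by simp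
  have "l \<odot> v = T v \<ominus> (T v \<ominus> l \<odot> v)" using v Tv by - (rule linear_identity2[of v "T v"]; simp)
  hence "n (l \<odot> v) \<le> n (T v) + n (T v \<ominus> l \<odot> v)"
    using v Tv by (metis norm_diff_le smult_mem M.minus_closed)
  hence "(cmod l - m) * n v \<le> n (T v \<ominus> l \<odot> v)" using m[OF v] v by (simp add: scale algebra_simps)
  thus "n v \<le> (1 / (cmod l - m)) * n (T v \<ominus> l \<odot> v)" using l by (simp add: field_simps)
qed

lemma resolvable_reflect:
  assumes T: "endo T" and r: "resolvable T (R - l)"
  shows "resolvable (\<lambda>v. R \<odot> v \<ominus> T v) l"
proof -
  have e: "(R \<odot> v \<ominus> T v) \<ominus> l \<odot> v = (- 1) \<odot> (T v \<ominus> (R - l) \<odot> v)" if "v \<in> carrier V" for v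
    using that complex_linearD(1)[OF T that] by - (rule linear_identity2[of v "T v"]; simp)
  obtain K where K: "\<And>v. v \<in> carrier V \<Longrightarrow> n v \<le> K * n (T v \<ominus> (R - l) \<odot> v)"
    using r by (auto simp: resolvable_def)
  show ?thesis
    unfolding resolvable_def
  proof (intro exI conjI ballI)
    fix w assume w: "w \<in> carrier V"
    then obtain v where v: "v \<in> carrier V" "T v \<ominus> (R - l) \<odot> v = (- 1) \<odot> w"
      using r unfolding resolvable_def by (meson smult_mem)
    have "(R \<odot> v \<ominus> T v) \<ominus> l \<odot> v = w" unfolding e[OF v(1)] v(2) using w by (simp add: smult_smult)
    thus "\<exists>v\<in>carrier V. (R \<odot> v \<ominus> T v) \<ominus> l \<odot> v = w" using v by blast
  next
    fix v assume v: "v \<in> carrier V"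
    show "n v \<le> K * n ((R \<odot> v \<ominus> T v) \<ominus> l \<odot> v)"
      unfolding e[OF v] using K[OF v] v complex_linearD(1)[OF T v] by (simp add: scale)
  qed
qed

lemma resolvable_shift:
  assumes T: "endo T" and r: "resolvable (\<lambda>v. T v \<oplus> R \<odot> v) (l + R)"
  shows "resolvable T l"
proof -
  have e: "(T v \<oplus> R \<odot> v) \<ominus> (l + R) \<odot> v = T v \<ominus> l \<odot> v" if "v \<in> carrier V" for v
    using that complex_linearD(1)[OF T that] by - (rule linear_identity2[of v "T v"]; simp)
  show ?thesis using r e by (auto simp: resolvable_def)
qed

end

lemma min_unitization_abelian_group:
  assumes "complex_vector_space (homsp C x x)"
  shows "abelian_group (min_unitization C x)"
proof -
  interpret B: complex_space "homsp C x x" using assms by (rule complex_spaceI)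
  show ?thesis
  proof (rule abelian_groupI)
    fix p assume "p \<in> carrier (min_unitization C x)"
    thus "\<exists>y\<in>carrier (min_unitization C x). y \<oplus>\<^bsub>min_unitization C x\<^esub> p = \<zero>\<^bsub>min_unitization C x\<^esub>"
      by (intro bexI[of _ "(\<ominus>\<^bsub>homsp C x x\<^esub> fst p, - snd p)"])
         (auto simp: min_unitization_def Let_def B.M.l_neg split: if_splits)
  qed (auto simp: min_unitization_def Let_def B.M.a_ac split: if_splits)
qed

lemma spectrum_unital:
  assumes B: "complex_vector_space (homsp C x x)"
    and L: "\<And>f. f \<in> hom C x x \<Longrightarrow> complex_linear (homsp C x x) (homsp C x x) (\<lambda>g. comp C x x x g f)"
    and u: "algebra_unit C x u" and a: "a \<in> hom C x x"
  shows "l \<in> spectrum C x a \<longleftrightarrow> \<not> (\<exists>c\<in>hom C x x.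
    comp C x x x c (a \<ominus>\<^bsub>homsp C x x\<^esub> l \<odot>\<^bsub>homsp C x x\<^esub> u) = u \<and>
    comp C x x x (a \<ominus>\<^bsub>homsp C x x\<^esub> l \<odot>\<^bsub>homsp C x x\<^esub> u) c = u)"
proof -
  interpret B: complex_space "homsp C x x" using B by (rule complex_spaceI)
  interpret R: abelian_group "min_unitization C x" by (rule min_unitization_abelian_group[OF B])
  have unital: "\<exists>u. algebra_unit C x u" using u by blast
  have U: "(THE u. algebra_unit C x u) = u"
  proof (rule the_equality)
    show "u' = u" if "algebra_unit C x u'" for u' using u that by (metis algebra_unit_def)
  qed (rule u)
  have uB: "u \<in> hom C x x" using u by (simp add: algebra_unit_def)
  have neg: "\<ominus>\<^bsub>min_unitization C x\<^esub> (p, 0) = (\<ominus>\<^bsub>homsp C x x\<^esub> p, 0)" if "p \<in> hom C x x" for p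
    by (rule R.minus_equality) (use that unital in \<open>auto simp: min_unitization_def Let_def B.M.l_neg\<close>)
  have cl: "comp C x x x g f \<in> hom C x x" if "f \<in> hom C x x" "g \<in> hom C x x" for f g
    using complex_linearD(1)[OF L[OF that(1)] that(2)] .
  have 1: "(a, 0) \<ominus>\<^bsub>min_unitization C x\<^esub> l \<odot>\<^bsub>min_unitization C x\<^esub> \<one>\<^bsub>min_unitization C x\<^esub> =
      (a \<ominus>\<^bsub>homsp C x x\<^esub> l \<odot>\<^bsub>homsp C x x\<^esub> u, 0)"
    unfolding R.minus_eq B.M.minus_eq using uB neg[of "l \<odot>\<^bsub>homsp C x x\<^esub> u"] unital
    by (simp add: min_unitization_def Let_def U)
  let ?e = "a \<ominus>\<^bsub>homsp C x x\<^esub> l \<odot>\<^bsub>homsp C x x\<^esub> u"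
  have e: "?e \<in> hom C x x" using a uB by simp
  show ?thesis
    unfolding spectrum_def algebra_spectrum_def mem_Collect_eq 1 Units_def
    using e unital cl by (auto simp: min_unitization_def Let_def U)
qed

text \<open>The pair \<open>(c, k)\<close> is the inverse of \<open>(a, - l)\<close> in the unitization, spelled out componentwise.\<close>

lemma spectrum_nonunital:
  assumes B: "complex_vector_space (homsp C x x)"
    and L: "\<And>f. f \<in> hom C x x \<Longrightarrow> complex_linear (homsp C x x) (homsp C x x) (\<lambda>g. comp C x x x g f)"
    and u: "\<not> (\<exists>u. algebra_unit C x u)" and a: "a \<in> hom C x x" and l: "l \<notin> spectrum C x a"
  shows "\<exists>c\<in>hom C x x. \<exists>k. k * l = - 1 \<and>
    comp C x x x c a \<oplus>\<^bsub>homsp C x x\<^esub> (k \<odot>\<^bsub>homsp C x x\<^esub> a \<oplus>\<^bsub>homsp C x x\<^esub> (- l) \<odot>\<^bsub>homsp C x x\<^esub> c) = \<zero>\<^bsub>homsp C x x\<^esub> \<and>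
    comp C x x x a c \<oplus>\<^bsub>homsp C x x\<^esub> (k \<odot>\<^bsub>homsp C x x\<^esub> a \<oplus>\<^bsub>homsp C x x\<^esub> (- l) \<odot>\<^bsub>homsp C x x\<^esub> c) = \<zero>\<^bsub>homsp C x x\<^esub>"
proof -
  interpret B: complex_space "homsp C x x" using B by (rule complex_spaceI)
  interpret R: abelian_group "min_unitization C x" by (rule min_unitization_abelian_group[OF B])
  have neg: "\<ominus>\<^bsub>min_unitization C x\<^esub> (p, k) = (\<ominus>\<^bsub>homsp C x x\<^esub> p, - k)" if "p \<in> hom C x x" for p k
    by (rule R.minus_equality) (use that u in \<open>auto simp: min_unitization_def Let_def B.M.l_neg\<close>)
  have "l \<odot>\<^bsub>min_unitization C x\<^esub> \<one>\<^bsub>min_unitization C x\<^esub> = (\<zero>\<^bsub>homsp C x x\<^esub>, l)"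
    using u by (simp add: min_unitization_def Let_def)
  hence 1: "(a, 0) \<ominus>\<^bsub>min_unitization C x\<^esub> l \<odot>\<^bsub>min_unitization C x\<^esub> \<one>\<^bsub>min_unitization C x\<^esub> = (a, - l)"
    unfolding R.minus_eq using neg[of "\<zero>\<^bsub>homsp C x x\<^esub>" l] u a
    by (simp add: min_unitization_def Let_def)
  have "(a, - l) \<in> Units (min_unitization C x)"
    using l unfolding spectrum_def algebra_spectrum_def mem_Collect_eq 1 by simp
  then obtain c k where "(c, k) \<in> carrier (min_unitization C x)"
    "(c, k) \<otimes>\<^bsub>min_unitization C x\<^esub> (a, - l) = \<one>\<^bsub>min_unitization C x\<^esub>"
    "(a, - l) \<otimes>\<^bsub>min_unitization C x\<^esub> (c, k) = \<one>\<^bsub>min_unitization C x\<^esub>"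
    by (auto simp: Units_def)
  hence ck: "c \<in> hom C x x" "k * l = - 1"
    "comp C x x x c a \<oplus>\<^bsub>homsp C x x\<^esub> (k \<odot>\<^bsub>homsp C x x\<^esub> a \<oplus>\<^bsub>homsp C x x\<^esub> (- l) \<odot>\<^bsub>homsp C x x\<^esub> c) = \<zero>\<^bsub>homsp C x x\<^esub>"
    "comp C x x x a c \<oplus>\<^bsub>homsp C x x\<^esub> ((- l) \<odot>\<^bsub>homsp C x x\<^esub> c \<oplus>\<^bsub>homsp C x x\<^esub> k \<odot>\<^bsub>homsp C x x\<^esub> a) = \<zero>\<^bsub>homsp C x x\<^esub>"
    using u by (auto simp: min_unitization_def Let_def minus_equation_iff)
  from ck(4) have "comp C x x x a c \<oplus>\<^bsub>homsp C x x\<^esub> (k \<odot>\<^bsub>homsp C x x\<^esub> a \<oplus>\<^bsub>homsp C x x\<^esub> (- l) \<odot>\<^bsub>homsp C x x\<^esub> c) = \<zero>\<^bsub>homsp C x x\<^esub>"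
    using ck(1) a by (simp add: B.M.a_comm)
  with ck show ?thesis by blast
qed

lemma (in complex_banach_space) normed_space: "carrier_normed_space V (nrm V)"
  by unfold_locales (simp_all add: norm_nonneg norm_eq_zero norm_smult norm_triangle)

context cstar_category
begin

lemma hom_normed: "x \<in> Ob C \<Longrightarrow> y \<in> Ob C \<Longrightarrow> carrier_normed_space (homsp C x y) (nrm (homsp C x y))"
  by (rule complex_banach_space.normed_space[OF hom_banach])

lemma hom_space: "x \<in> Ob C \<Longrightarrow> y \<in> Ob C \<Longrightarrow> complex_vector_space (homsp C x y)"
  using hom_banach complex_banach_space.axioms(1) by blast

lemma hom_complete: "x \<in> Ob C \<Longrightarrow> y \<in> Ob C \<Longrightarrow> complete_wrt (homsp C x y) (nrm (homsp C x y))"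
  using hom_banach complex_banach_space.complete by blast

lemma comp_closed [simp]: "\<lbrakk>x \<in> Ob C; y \<in> Ob C; z \<in> Ob C; f \<in> hom C x y; g \<in> hom C y z\<rbrakk>
    \<Longrightarrow> comp C x y z g f \<in> hom C x z"
  using complex_linearD(1)[OF comp_linear_left] .

lemma star_closed [simp]: "\<lbrakk>x \<in> Ob C; y \<in> Ob C; f \<in> hom C x y\<rbrakk> \<Longrightarrow> star C x y f \<in> hom C y x"
  using star_conjugate_linear[of x y] by (auto simp: conjugate_linear_def)

lemma star_add: "\<lbrakk>x \<in> Ob C; y \<in> Ob C; f \<in> hom C x y; g \<in> hom C x y\<rbrakk> \<Longrightarrow>
    star C x y (f \<oplus>\<^bsub>homsp C x y\<^esub> g) = star C x y f \<oplus>\<^bsub>homsp C y x\<^esub> star C x y g"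
  using star_conjugate_linear[of x y] by (auto simp: conjugate_linear_def)

lemma star_smult: "\<lbrakk>x \<in> Ob C; y \<in> Ob C; f \<in> hom C x y\<rbrakk> \<Longrightarrow>
    star C x y (c \<odot>\<^bsub>homsp C x y\<^esub> f) = cnj c \<odot>\<^bsub>homsp C y x\<^esub> star C x y f"
  using star_conjugate_linear[of x y] by (auto simp: conjugate_linear_def)

lemma norm_star_le: "\<lbrakk>x \<in> Ob C; y \<in> Ob C; a \<in> hom C x y\<rbrakk> \<Longrightarrow> nrm (homsp C x y) a \<le> nrm (homsp C y x) (star C x y a)"
proof -
  assume a: "x \<in> Ob C" "y \<in> Ob C" "a \<in> hom C x y"
  interpret N: carrier_normed_space "homsp C x y" "nrm (homsp C x y)" by (rule hom_normed[OF a(1,2)])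
  interpret N': carrier_normed_space "homsp C y x" "nrm (homsp C y x)" by (rule hom_normed[OF a(2,1)])
  have "(nrm (homsp C x y) a)\<^sup>2 \<le> nrm (homsp C y x) (star C x y a) * nrm (homsp C x y) a"
    using norm_comp_le[of x y x a "star C x y a"] cstar_identity[of x y a] a by simp
  thus ?thesis using N.nonneg[OF a(3)] N'.nonneg[OF star_closed[OF a]]
    by (cases "nrm (homsp C x y) a = 0") (auto simp: power2_eq_square)
qed

lemma norm_star: "\<lbrakk>x \<in> Ob C; y \<in> Ob C; a \<in> hom C x y\<rbrakk> \<Longrightarrow> nrm (homsp C y x) (star C x y a) = nrm (homsp C x y) a"
  using norm_star_le[of x y a] norm_star_le[of y x "star C x y a"] star_star[of x y a] by fastforce

text \<open>Membership of \<open>l\<close> in the spectrum refers to two different algebras, depending on whether a unit exists. In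
both cases an inverse of \<open>a - l\<close> has the form \<open>c + k\<close> and acts on \<open>hom C x x\<close> from the left; everything later
only uses this action, so that the case distinction disappears here.\<close>

lemma resolvable_left_multiplication:
  assumes x: "x \<in> Ob C" and a: "a \<in> hom C x x" and l: "l \<notin> spectrum C x a"
  shows "carrier_normed_space.resolvable (homsp C x x) (nrm (homsp C x x)) (comp C x x x a) l"
proof -
  let ?m = "comp C x x x"
  let ?B = "homsp C x x"
  interpret B: carrier_normed_space "?B" "nrm (?B)" by (rule hom_normed[OF x x])
  note L = comp_linear_left[OF x x x] and R = comp_linear_right[OF x x x]
  note Ls = complex_linearD[OF L] and Rs = complex_linearD[OF R]
  note Ld = complex_linear_diff[OF B.space B.space L] and Rd = complex_linear_diff[OF B.space B.space R]
  have "\<exists>c\<in>hom C x x. \<exists>k. \<forall>b\<in>hom C x x.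
      (?m c (?m a b \<ominus>\<^bsub>?B\<^esub> l \<odot>\<^bsub>?B\<^esub> b)
        \<oplus>\<^bsub>?B\<^esub> k \<odot>\<^bsub>?B\<^esub> (?m a b \<ominus>\<^bsub>?B\<^esub> l \<odot>\<^bsub>?B\<^esub> b) = b) \<and>
      (?m a (?m c b \<oplus>\<^bsub>?B\<^esub> k \<odot>\<^bsub>?B\<^esub> b)
        \<ominus>\<^bsub>?B\<^esub> l \<odot>\<^bsub>?B\<^esub> (?m c b \<oplus>\<^bsub>?B\<^esub> k \<odot>\<^bsub>?B\<^esub> b) = b)"
  proof (cases "\<exists>u. algebra_unit C x u")
    case True
    then obtain u where u: "algebra_unit C x u" by blast
    hence uB: "u \<in> hom C x x" and ub: "\<And>b. b \<in> hom C x x \<Longrightarrow> ?m u b = b"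
      by (auto simp: algebra_unit_def)
    obtain c where c: "c \<in> hom C x x"
      "?m c (a \<ominus>\<^bsub>?B\<^esub> l \<odot>\<^bsub>?B\<^esub> u) = u"
      "?m (a \<ominus>\<^bsub>?B\<^esub> l \<odot>\<^bsub>?B\<^esub> u) c = u"
      using l spectrum_unital[OF B.space L u a] by blast
    have e: "?m (a \<ominus>\<^bsub>?B\<^esub> l \<odot>\<^bsub>?B\<^esub> u) b = ?m a b \<ominus>\<^bsub>?B\<^esub> l \<odot>\<^bsub>?B\<^esub> b"
      if "b \<in> hom C x x" for b
      using that a uB x by (simp add: Ld Ls ub)
    have eB: "a \<ominus>\<^bsub>?B\<^esub> l \<odot>\<^bsub>?B\<^esub> u \<in> hom C x x" using a uB by simp
    show ?thesis
    proof (intro bexI[OF _ c(1)] exI[of _ 0] ballI)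
      fix b assume b: "b \<in> hom C x x"
      have 1: "?m c (?m a b \<ominus>\<^bsub>?B\<^esub> l \<odot>\<^bsub>?B\<^esub> b) = b"
        using comp_assoc[OF x x x x b eB c(1)] b by (simp add: e c ub)
      have 2: "?m a (?m c b) \<ominus>\<^bsub>?B\<^esub> l \<odot>\<^bsub>?B\<^esub> ?m c b = b"
        using comp_assoc[OF x x x x b c(1) eB] b c(1) x by (simp add: e[OF comp_closed] c ub)
      show "(?m c (?m a b \<ominus>\<^bsub>?B\<^esub> l \<odot>\<^bsub>?B\<^esub> b)
        \<oplus>\<^bsub>?B\<^esub> 0 \<odot>\<^bsub>?B\<^esub> (?m a b \<ominus>\<^bsub>?B\<^esub> l \<odot>\<^bsub>?B\<^esub> b) = b) \<and>
      (?m a (?m c b \<oplus>\<^bsub>?B\<^esub> 0 \<odot>\<^bsub>?B\<^esub> b)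
        \<ominus>\<^bsub>?B\<^esub> l \<odot>\<^bsub>?B\<^esub> (?m c b \<oplus>\<^bsub>?B\<^esub> 0 \<odot>\<^bsub>?B\<^esub> b) = b)"
        using a b c(1) x 1 2 by simp
    qed
  next
    case False
    obtain c k where c: "c \<in> hom C x x" and k: "k * l = - 1"
      and 1: "?m c a \<oplus>\<^bsub>?B\<^esub> (k \<odot>\<^bsub>?B\<^esub> a \<oplus>\<^bsub>?B\<^esub> (- l) \<odot>\<^bsub>?B\<^esub> c) = \<zero>\<^bsub>?B\<^esub>"
      and 2: "?m a c \<oplus>\<^bsub>?B\<^esub> (k \<odot>\<^bsub>?B\<^esub> a \<oplus>\<^bsub>?B\<^esub> (- l) \<odot>\<^bsub>?B\<^esub> c) = \<zero>\<^bsub>?B\<^esub>"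
      using spectrum_nonunital[OF B.space L False a l] by blast
    show ?thesis
    proof (intro bexI[OF _ c] exI[of _ k] ballI)
      fix b assume b: "b \<in> hom C x x"
      have z: "?m \<zero>\<^bsub>?B\<^esub> b = \<zero>\<^bsub>?B\<^esub>"
        by (rule complex_linear_zero[OF B.space B.space L[OF b]])
      have 3: "?m c (?m a b) \<oplus>\<^bsub>?B\<^esub>
          (k \<odot>\<^bsub>?B\<^esub> ?m a b \<oplus>\<^bsub>?B\<^esub> (- l) \<odot>\<^bsub>?B\<^esub> ?m c b) = \<zero>\<^bsub>?B\<^esub>"
        using arg_cong[OF 1, of "\<lambda>t. ?m t b"] a b c x
        by (simp add: Ls z comp_assoc[OF x x x x b])
      have 4: "?m a (?m c b) \<oplus>\<^bsub>?B\<^esub>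
          (k \<odot>\<^bsub>?B\<^esub> ?m a b \<oplus>\<^bsub>?B\<^esub> (- l) \<odot>\<^bsub>?B\<^esub> ?m c b) = \<zero>\<^bsub>?B\<^esub>"
        using arg_cong[OF 2, of "\<lambda>t. ?m t b"] a b c x
        by (simp add: Ls z comp_assoc[OF x x x x b])
      have k': "l * k = - 1" using k by (simp add: mult.commute)
      have fin1: "(p \<ominus>\<^bsub>?B\<^esub> l \<odot>\<^bsub>?B\<^esub> q) \<oplus>\<^bsub>?B\<^esub> k \<odot>\<^bsub>?B\<^esub> (r \<ominus>\<^bsub>?B\<^esub> l \<odot>\<^bsub>?B\<^esub> b) =
         (p \<oplus>\<^bsub>?B\<^esub> (k \<odot>\<^bsub>?B\<^esub> r \<oplus>\<^bsub>?B\<^esub> (- l) \<odot>\<^bsub>?B\<^esub> q)) \<oplus>\<^bsub>?B\<^esub> b"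
        if "p \<in> hom C x x" "q \<in> hom C x x" "r \<in> hom C x x" for p q r
        using that b k by - (rule B.linear_identity4[of p q r b]; simp add: algebra_simps)
      have fin2: "(p \<oplus>\<^bsub>?B\<^esub> k \<odot>\<^bsub>?B\<^esub> r) \<ominus>\<^bsub>?B\<^esub> l \<odot>\<^bsub>?B\<^esub> (q \<oplus>\<^bsub>?B\<^esub> k \<odot>\<^bsub>?B\<^esub> b) =
         (p \<oplus>\<^bsub>?B\<^esub> (k \<odot>\<^bsub>?B\<^esub> r \<oplus>\<^bsub>?B\<^esub> (- l) \<odot>\<^bsub>?B\<^esub> q)) \<oplus>\<^bsub>?B\<^esub> b"
        if "p \<in> hom C x x" "q \<in> hom C x x" "r \<in> hom C x x" for p q r
        using that b k' by - (rule B.linear_identity4[of p q r b]; simp add: algebra_simps)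
      show "(?m c (?m a b \<ominus>\<^bsub>?B\<^esub> l \<odot>\<^bsub>?B\<^esub> b)
        \<oplus>\<^bsub>?B\<^esub> k \<odot>\<^bsub>?B\<^esub> (?m a b \<ominus>\<^bsub>?B\<^esub> l \<odot>\<^bsub>?B\<^esub> b) = b) \<and>
      (?m a (?m c b \<oplus>\<^bsub>?B\<^esub> k \<odot>\<^bsub>?B\<^esub> b)
        \<ominus>\<^bsub>?B\<^esub> l \<odot>\<^bsub>?B\<^esub> (?m c b \<oplus>\<^bsub>?B\<^esub> k \<odot>\<^bsub>?B\<^esub> b) = b)"
        using a b c x 3 4 by (simp add: Rd Rs fin1 fin2)
    qed
  qed
  then obtain c k where c: "c \<in> hom C x x" and ck: "\<And>b. b \<in> hom C x x \<Longrightarrow>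
      ?m c (?m a b \<ominus>\<^bsub>?B\<^esub> l \<odot>\<^bsub>?B\<^esub> b)
        \<oplus>\<^bsub>?B\<^esub> k \<odot>\<^bsub>?B\<^esub> (?m a b \<ominus>\<^bsub>?B\<^esub> l \<odot>\<^bsub>?B\<^esub> b) = b"
     "\<And>b. b \<in> hom C x x \<Longrightarrow> ?m a (?m c b \<oplus>\<^bsub>?B\<^esub> k \<odot>\<^bsub>?B\<^esub> b)
        \<ominus>\<^bsub>?B\<^esub> l \<odot>\<^bsub>?B\<^esub> (?m c b \<oplus>\<^bsub>?B\<^esub> k \<odot>\<^bsub>?B\<^esub> b) = b"
    by blast
  show ?thesis
    unfolding B.resolvable_def
  proof (intro conjI ballI exI)
    fix w assume w: "w \<in> hom C x x"
    thus "\<exists>v\<in>hom C x x. ?m a v \<ominus>\<^bsub>?B\<^esub> l \<odot>\<^bsub>?B\<^esub> v = w"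
      using ck(2)[OF w] c x
      by (intro bexI[of _ "?m c w \<oplus>\<^bsub>?B\<^esub> k \<odot>\<^bsub>?B\<^esub> w"]) auto
  next
    fix b assume b: "b \<in> hom C x x"
    define t where "t = ?m a b \<ominus>\<^bsub>?B\<^esub> l \<odot>\<^bsub>?B\<^esub> b"
    have t: "t \<in> hom C x x" using a b x by (simp add: t_def)
    have "nrm (?B) b = nrm (?B) (?m c t \<oplus>\<^bsub>?B\<^esub> k \<odot>\<^bsub>?B\<^esub> t)"
      using ck(1)[OF b] by (simp add: t_def)
    also have "\<dots> \<le> nrm (?B) (?m c t) + nrm (?B) (k \<odot>\<^bsub>?B\<^esub> t)"
      using c t x by (intro B.triangle) auto
    also have "\<dots> \<le> nrm (?B) c * nrm (?B) t + cmod k * nrm (?B) t"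
      using norm_comp_le[OF x x x t c] t by (simp add: B.scale)
    also have "\<dots> = (nrm (?B) c + cmod k) * nrm (?B) t" by (simp add: algebra_simps)
    finally show "nrm (?B) b \<le> (nrm (?B) c + cmod k) *
        nrm (?B) (?m a b \<ominus>\<^bsub>?B\<^esub> l \<odot>\<^bsub>?B\<^esub> b)" by (simp add: t_def)
  qed
qed

text \<open>For symmetric \<open>S\<close>, the \<open>C\<^sup>*\<close>-identity gives \<open>\<parallel>S v\<parallel>\<^sup>2 = \<parallel>(S v)\<^sup>* (S v)\<parallel> = \<parallel>v\<^sup>* (S S v)\<parallel>\<close>.\<close>

lemma symmetric_square_bound:
  assumes x: "x \<in> Ob C"
    and T: "\<And>v. v \<in> hom C x x \<Longrightarrow> T v \<in> hom C x x"
    and sym: "\<And>v w. v \<in> hom C x x \<Longrightarrow> w \<in> hom C x x \<Longrightarrow>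
      comp C x x x (star C x x (T v)) w = comp C x x x (star C x x v) (T w)"
    and v: "v \<in> hom C x x"
  shows "(nrm (homsp C x x) ((T ^^ (2^k)) v))\<^sup>2 \<le> nrm (homsp C x x) v * nrm (homsp C x x) ((T ^^ (2^Suc k)) v)"
proof -
  let ?n = "nrm (homsp C x x)"
  have cl: "(T ^^ j) v \<in> hom C x x" if "v \<in> hom C x x" for j v
    by (induction j) (use T that in auto)
  have s: "comp C x x x (star C x x ((T ^^ j) v)) w = comp C x x x (star C x x v) ((T ^^ j) w)"
    if "v \<in> hom C x x" "w \<in> hom C x x" for j v w
    using that(2)
  proof (induction j arbitrary: w)
    case (Suc j)
    have "comp C x x x (star C x x ((T ^^ Suc j) v)) w = comp C x x x (star C x x ((T ^^ j) v)) (T w)"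
      using sym[OF cl[OF that(1)] Suc.prems] by simp
    also have "\<dots> = comp C x x x (star C x x v) ((T ^^ j) (T w))" using Suc.IH[OF T[OF Suc.prems]] .
    finally show ?case by (simp add: funpow_swap1)
  qed simp
  let ?j = "2 ^ k"
  have "(?n ((T ^^ ?j) v))\<^sup>2 = ?n (comp C x x x (star C x x ((T ^^ ?j) v)) ((T ^^ ?j) v))"
    using cstar_identity[OF x x cl[OF v]] by simp
  also have "\<dots> = ?n (comp C x x x (star C x x v) ((T ^^ (2 ^ Suc k)) v))"
    by (simp add: s[OF v cl[OF v]] mult_2 funpow_add)
  also have "\<dots> \<le> ?n (star C x x v) * ?n ((T ^^ (2 ^ Suc k)) v)"
    by (rule norm_comp_le) (use x v cl in auto)
  finally show ?thesis using norm_star[OF x x v] by simp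
qed

text \<open>For self-adjoint \<open>b\<close> in a \<open>C\<^sup>*\<close>-algebra, \<open>\<parallel>R - b\<parallel> \<le> R\<close> for some \<open>R\<close> is equivalent to \<open>b\<close> being positive. In contrast
to the spectral condition, this one is visibly stable under sums.\<close>

definition norm_positive :: "'o \<Rightarrow> 'm \<Rightarrow> bool" where
  "norm_positive x b \<longleftrightarrow> b \<in> hom C x x \<and> (\<exists>R\<ge>0. \<forall>v\<in>hom C x x.
     nrm (homsp C x x) (complex_of_real R \<odot>\<^bsub>homsp C x x\<^esub> v \<ominus>\<^bsub>homsp C x x\<^esub> comp C x x x b v) \<le> R * nrm (homsp C x x) v)"

lemma norm_positive_add:
  assumes x: "x \<in> Ob C" and a: "norm_positive x a" and b: "norm_positive x b"
  shows "norm_positive x (a \<oplus>\<^bsub>homsp C x x\<^esub> b)"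
proof -
  let ?m = "comp C x x x"
  let ?B = "homsp C x x"
  interpret B: carrier_normed_space "?B" "nrm (?B)" by (rule hom_normed[OF x x])
  obtain R where R: "R \<ge> 0" "\<And>v. v \<in> hom C x x \<Longrightarrow>
      nrm (?B) (complex_of_real R \<odot>\<^bsub>?B\<^esub> v \<ominus>\<^bsub>?B\<^esub> ?m a v) \<le> R * nrm (?B) v"
    using a by (auto simp: norm_positive_def)
  obtain S where S: "S \<ge> 0" "\<And>v. v \<in> hom C x x \<Longrightarrow>
      nrm (?B) (complex_of_real S \<odot>\<^bsub>?B\<^esub> v \<ominus>\<^bsub>?B\<^esub> ?m b v) \<le> S * nrm (?B) v"
    using b by (auto simp: norm_positive_def)
  have ab: "a \<in> hom C x x" "b \<in> hom C x x" using a b by (auto simp: norm_positive_def)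
  have "nrm (?B) (complex_of_real (R + S) \<odot>\<^bsub>?B\<^esub> v \<ominus>\<^bsub>?B\<^esub> ?m (a \<oplus>\<^bsub>?B\<^esub> b) v)
      \<le> (R + S) * nrm (?B) v" if v: "v \<in> hom C x x" for v
  proof -
    have "complex_of_real (R + S) \<odot>\<^bsub>?B\<^esub> v \<ominus>\<^bsub>?B\<^esub> (p \<oplus>\<^bsub>?B\<^esub> q) =
        (complex_of_real R \<odot>\<^bsub>?B\<^esub> v \<ominus>\<^bsub>?B\<^esub> p) \<oplus>\<^bsub>?B\<^esub> (complex_of_real S \<odot>\<^bsub>?B\<^esub> v \<ominus>\<^bsub>?B\<^esub> q)"
      if "p \<in> hom C x x" "q \<in> hom C x x" for p q
      using that v by - (rule B.linear_identity3[of p q v]; simp)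
    from this[of "?m a v" "?m b v"]
    show ?thesis using R(2)[OF v] S(2)[OF v] v ab x
      B.triangle[of "complex_of_real R \<odot>\<^bsub>?B\<^esub> v \<ominus>\<^bsub>?B\<^esub> ?m a v"
        "complex_of_real S \<odot>\<^bsub>?B\<^esub> v \<ominus>\<^bsub>?B\<^esub> ?m b v"]
      by (simp add: complex_linearD[OF comp_linear_left[OF x x x v]] distrib_right)
  qed
  thus ?thesis using R(1) S(1) ab unfolding norm_positive_def
    by (intro conjI exI[of _ "R + S"]) auto
qed

lemma left_multiplication_symmetric:
  assumes x: "x \<in> Ob C" and a: "a \<in> hom C x x" "star C x x a = a"
    and v: "v \<in> hom C x x" "w \<in> hom C x x"
  shows "comp C x x x (star C x x (comp C x x x a v)) w = comp C x x x (star C x x v) (comp C x x x a w)"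
  using assms by (simp add: star_comp comp_assoc[OF x x x x])

text \<open>With \<open>R = \<parallel>b\<parallel>\<close>: the spectrum of \<open>b\<close> lies in \<open>[0, R]\<close>, so that of \<open>R - b\<close> lies in \<open>[0, R]\<close> as well, and the spectral radius
formula applies.\<close>

lemma positive_imp_norm_positive:
  assumes x: "x \<in> Ob C" and b: "positive C x b"
  shows "norm_positive x b"
proof -
  let ?m = "comp C x x x"
  let ?B = "homsp C x x"
  interpret B: carrier_normed_space "?B" "nrm (?B)" by (rule hom_normed[OF x x])
  have bB: "b \<in> hom C x x" "star C x x b = b" "spectrum C x b \<subseteq> \<real>\<^sub>\<ge>\<^sub>0"
    using b by (auto simp: positive_def)
  define R where "R = nrm (?B) b"
  have R: "R \<ge> 0" using B.nonneg[OF bB(1)] by (simp add: R_def)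
  define T where "T v = complex_of_real R \<odot>\<^bsub>?B\<^esub> v \<ominus>\<^bsub>?B\<^esub> ?m b v" for v
  note L = comp_linear_right[OF x x x bB(1)]
  note Ls = complex_linearD[OF L]
  have Tcl: "T v \<in> hom C x x" if "v \<in> hom C x x" for v using that Ls by (simp add: T_def)
  have T: "B.endo T"
    unfolding complex_linear_def
  proof (intro conjI ballI allI)
    show "T \<in> hom C x x \<rightarrow> hom C x x" using Tcl by blast
    fix u c assume u: "u \<in> hom C x x"
    show "T (c \<odot>\<^bsub>?B\<^esub> u) = c \<odot>\<^bsub>?B\<^esub> T u"
      unfolding T_def Ls(3)[OF u] using u Ls(1)[OF u]
      by - (rule B.linear_identity2[of u "?m b u"]; simp add: mult.commute)
    fix v assume v: "v \<in> hom C x x"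
    show "T (u \<oplus>\<^bsub>?B\<^esub> v) = T u \<oplus>\<^bsub>?B\<^esub> T v"
      unfolding T_def Ls(2)[OF u v] using u v Ls(1)[OF u] Ls(1)[OF v]
      by - (rule B.linear_identity4[of u "?m b u" v "?m b v"]; simp add: algebra_simps)
  qed
  have bb: "nrm (?B) (?m b v) \<le> R * nrm (?B) v" if "v \<in> hom C x x" for v
    using norm_comp_le[OF x x x that bB(1)] by (simp add: R_def)
  have sym: "?m (star C x x (T v)) w = ?m (star C x x v) (T w)"
    if v: "v \<in> hom C x x" and w: "w \<in> hom C x x" for v w
  proof -
    note Lw = comp_linear_left[OF x x x w] and Rv = comp_linear_right[OF x x x star_closed[OF x x v]]
    have "star C x x (T v) = complex_of_real R \<odot>\<^bsub>?B\<^esub> star C x x v \<ominus>\<^bsub>?B\<^esub> star C x x (?m b v)"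
      unfolding T_def B.M.minus_eq using v x bB by (simp add: B.uminus_eq star_add star_smult)
    hence "?m (star C x x (T v)) w = complex_of_real R \<odot>\<^bsub>?B\<^esub> ?m (star C x x v) w
        \<ominus>\<^bsub>?B\<^esub> ?m (star C x x (?m b v)) w"
      using v w x bB(1) by (simp add: complex_linear_diff[OF B.space B.space Lw] complex_linearD[OF Lw])
    also have "\<dots> = ?m (star C x x v) (T w)"
      unfolding left_multiplication_symmetric[OF x bB(1,2) v w] T_def using v w x bB(1)
      by (simp add: complex_linear_diff[OF B.space B.space Rv] complex_linearD[OF Rv])
    finally show ?thesis .
  qed
  have "nrm (?B) (T v) \<le> R * nrm (?B) v" if v: "v \<in> hom C x x" for v
  proof (rule B.norm_bound_from_resolvents[OF T _ _ R _ v])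
    show "(nrm (?B) ((T ^^ 2 ^ k) v))\<^sup>2 \<le> nrm (?B) v * nrm (?B) ((T ^^ 2 ^ Suc k) v)"
      if "v \<in> hom C x x" for k v using symmetric_square_bound[OF x Tcl sym that] .
    show "nrm (?B) (T v) \<le> (2 * R) * nrm (?B) v" if v: "v \<in> hom C x x" for v
    proof -
      have "nrm (?B) (T v) \<le> nrm (?B) (complex_of_real R \<odot>\<^bsub>?B\<^esub> v) + nrm (?B) (?m b v)"
        unfolding T_def using v Ls by (intro B.norm_diff_le) auto
      thus ?thesis using bb[OF v] v R by (simp add: B.scale)
    qed
    fix l assume l: "cmod l > R"
    have "B.resolvable (?m b) (complex_of_real R - l)"
    proof (cases "complex_of_real R - l \<in> \<real>\<^sub>\<ge>\<^sub>0")
      case False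
      thus ?thesis using bB resolvable_left_multiplication[OF x bB(1)] by blast
    next
      case True
      then obtain s where s: "complex_of_real R - l = complex_of_real s" "s \<ge> 0" by (auto elim: nonneg_Reals_cases)
      hence "l = complex_of_real (R - s)" by (simp add: algebra_simps)
      hence "cmod l = \<bar>R - s\<bar>" using norm_of_real[of "R - s", where 'a = complex] by simp
      hence "\<bar>R - s\<bar> > R" using l by simp
      hence "s > R" "s > 0" using R s(2) by linarith+
      thus ?thesis unfolding s(1) by (intro B.resolvable_outside_bound[OF hom_complete[OF x x] L bb]) auto
    qed
    thus "B.resolvable T l" unfolding T_def by (rule B.resolvable_reflect[OF L])
  qed
  thus ?thesis using R bB(1) unfolding norm_positive_def T_def by blast
qed

text \<open>Put \<open>r = \<parallel>a + b\<parallel>\<close>. As \<open>R + a = (R - b) + (a + b)\<close> has norm at most \<open>R + r\<close>, the point \<open>l\<close> is not in the spectrum of \<open>a\<close> if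
\<open>l > r\<close>; positivity of \<open>a\<close> excludes all \<open>l\<close> outside \<open>[0, \<infinity>)\<close>. Thus the spectral radius of \<open>a\<close> is at most \<open>r\<close>.\<close>

theorem norm_mono_positive:
  assumes x: "x \<in> Ob C" and a: "positive C x a" and b: "norm_positive x b"
  shows "nrm (homsp C x x) a \<le> nrm (homsp C x x) (a \<oplus>\<^bsub>homsp C x x\<^esub> b)"
proof -
  let ?m = "comp C x x x"
  let ?B = "homsp C x x"
  interpret B: carrier_normed_space "?B" "nrm (?B)" by (rule hom_normed[OF x x])
  have aB: "a \<in> hom C x x" "star C x x a = a" "spectrum C x a \<subseteq> \<real>\<^sub>\<ge>\<^sub>0"
    using a by (auto simp: positive_def)
  have bB: "b \<in> hom C x x" using b by (simp add: norm_positive_def)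
  obtain R where R: "R \<ge> 0" "\<And>v. v \<in> hom C x x \<Longrightarrow>
      nrm (?B) (complex_of_real R \<odot>\<^bsub>?B\<^esub> v \<ominus>\<^bsub>?B\<^esub> ?m b v) \<le> R * nrm (?B) v"
    using b by (auto simp: norm_positive_def)
  define r where "r = nrm (?B) (a \<oplus>\<^bsub>?B\<^esub> b)"
  have r: "r \<ge> 0" using B.nonneg aB bB by (simp add: r_def)
  note L = comp_linear_right[OF x x x aB(1)]
  note Ls = complex_linearD[OF L]
  have shift: "nrm (?B) (?m a v \<oplus>\<^bsub>?B\<^esub> complex_of_real R \<odot>\<^bsub>?B\<^esub> v) \<le> (r + R) * nrm (?B) v"
    if v: "v \<in> hom C x x" for v
  proof -
    have "p \<oplus>\<^bsub>?B\<^esub> complex_of_real R \<odot>\<^bsub>?B\<^esub> v =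
       (complex_of_real R \<odot>\<^bsub>?B\<^esub> v \<ominus>\<^bsub>?B\<^esub> q) \<oplus>\<^bsub>?B\<^esub> (p \<oplus>\<^bsub>?B\<^esub> q)"
      if "p \<in> hom C x x" "q \<in> hom C x x" for p q
      using that v by - (rule B.linear_identity3[of p q v]; simp)
    from this[of "?m a v" "?m b v"]
    have e: "?m a v \<oplus>\<^bsub>?B\<^esub> complex_of_real R \<odot>\<^bsub>?B\<^esub> v =
       (complex_of_real R \<odot>\<^bsub>?B\<^esub> v \<ominus>\<^bsub>?B\<^esub> ?m b v) \<oplus>\<^bsub>?B\<^esub>
         ?m (a \<oplus>\<^bsub>?B\<^esub> b) v"
      using v aB bB x by (simp add: complex_linearD[OF comp_linear_left[OF x x x v]])
    have "nrm (?B) (?m (a \<oplus>\<^bsub>?B\<^esub> b) v) \<le> r * nrm (?B) v"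
      unfolding r_def using aB bB v x by (intro norm_comp_le) auto
    moreover have "nrm (?B) (?m a v \<oplus>\<^bsub>?B\<^esub> complex_of_real R \<odot>\<^bsub>?B\<^esub> v) \<le>
       nrm (?B) (complex_of_real R \<odot>\<^bsub>?B\<^esub> v \<ominus>\<^bsub>?B\<^esub> ?m b v) +
       nrm (?B) (?m (a \<oplus>\<^bsub>?B\<^esub> b) v)"
      unfolding e using aB bB v x by (intro B.triangle) auto
    ultimately show ?thesis using R(2)[OF v] by (simp add: distrib_right)
  qed
  have shift_lin: "B.endo (\<lambda>v. ?m a v \<oplus>\<^bsub>?B\<^esub> complex_of_real R \<odot>\<^bsub>?B\<^esub> v)"
    unfolding complex_linear_def
    using Ls by (auto simp: B.smult_add_right B.smult_smult B.M.a_ac mult.commute)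
  have "nrm (?B) (?m a v) \<le> r * nrm (?B) v" if v: "v \<in> hom C x x" for v
  proof (rule B.norm_bound_from_resolvents[OF L _ _ r _ v])
    show "(nrm (?B) ((?m a ^^ 2 ^ k) v))\<^sup>2 \<le> nrm (?B) v * nrm (?B) ((?m a ^^ 2 ^ Suc k) v)"
      if "v \<in> hom C x x" for k v
      by (rule symmetric_square_bound[OF x Ls(1) left_multiplication_symmetric[OF x aB(1,2)] that])
    show "nrm (?B) (?m a v) \<le> nrm (?B) a * nrm (?B) v" if "v \<in> hom C x x" for v
      by (rule norm_comp_le[OF x x x that aB(1)])
    fix l assume l: "cmod l > r"
    show "B.resolvable (?m a) l"
    proof (cases "l \<in> \<real>\<^sub>\<ge>\<^sub>0")
      case False
      thus ?thesis using aB resolvable_left_multiplication[OF x aB(1)] by blast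
    next
      case True
      then obtain s where s: "l = complex_of_real s" "s \<ge> 0" by (auto elim: nonneg_Reals_cases)
      have "cmod (l + complex_of_real R) = s + R" using s R(1) by (simp flip: of_real_add)
      hence "cmod (l + complex_of_real R) > r + R" using l s by simp
      moreover from this have "l + complex_of_real R \<noteq> 0" using r R(1) by (metis add_nonneg_nonneg norm_zero not_less)
      ultimately show ?thesis
        by (intro B.resolvable_shift[OF L, of "complex_of_real R"] B.resolvable_outside_bound[OF hom_complete[OF x x] shift_lin shift])
    qed
  qed
  from this[OF aB(1)] have "(nrm (?B) a)\<^sup>2 \<le> r * nrm (?B) a"
    using cstar_identity[OF x x aB(1)] aB(2) by simp
  thus ?thesis using B.nonneg[OF aB(1)] r unfolding r_def[symmetric]
    by (cases "nrm (?B) a = 0") (auto simp: power2_eq_square)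
qed

end

section \<open>The Cauchy-Schwarz inequality in Hilbert modules\<close>

lemma conjugate_linearD:
  assumes "conjugate_linear V W T"
  shows "u \<in> carrier V \<Longrightarrow> T u \<in> carrier W"
    "u \<in> carrier V \<Longrightarrow> v \<in> carrier V \<Longrightarrow> T (u \<oplus>\<^bsub>V\<^esub> v) = T u \<oplus>\<^bsub>W\<^esub> T v"
    "u \<in> carrier V \<Longrightarrow> T (c \<odot>\<^bsub>V\<^esub> u) = cnj c \<odot>\<^bsub>W\<^esub> T u"
  using assms by (auto simp: conjugate_linear_def)

lemma conjugate_linear_diff:
  assumes "complex_vector_space V" "complex_vector_space W" "conjugate_linear V W T"
    and "u \<in> carrier V" "v \<in> carrier V"
  shows "T (u \<ominus>\<^bsub>V\<^esub> v) = T u \<ominus>\<^bsub>W\<^esub> T v"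
proof -
  interpret V: complex_space V using assms by (simp add: complex_spaceI)
  interpret W: complex_space W using assms by (simp add: complex_spaceI)
  show ?thesis using assms
    by (simp add: V.M.minus_eq W.M.minus_eq V.uminus_eq W.uminus_eq conjugate_linearD[OF assms(3)])
qed

lemma conjugate_linear_zero:
  assumes "complex_vector_space V" "complex_vector_space W" "conjugate_linear V W T"
  shows "T \<zero>\<^bsub>V\<^esub> = \<zero>\<^bsub>W\<^esub>"
proof -
  interpret V: complex_space V using assms by (simp add: complex_spaceI)
  interpret W: complex_space W using assms by (simp add: complex_spaceI)
  have "T \<zero>\<^bsub>V\<^esub> = T (0 \<odot>\<^bsub>V\<^esub> \<zero>\<^bsub>V\<^esub>)" by simp
  also have "\<dots> = \<zero>\<^bsub>W\<^esub>" using conjugate_linearD[OF assms(3)] by (metis V.M.zero_closed W.smult_0 complex_cnj_zero)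
  finally show ?thesis .
qed

lemma (in cstar_category) positive_star_comp:
  assumes "x \<in> Ob C" "y \<in> Ob C" "a \<in> hom C x y"
  shows "positive C x (comp C x y x (star C x y a) a)"
  using assms spectrum_star_comp[OF assms] by (simp add: positive_def star_comp star_star)

locale hilbert_cstar_module = cstar_category A + hilbert_module A E
  for A :: "('o, 'm) star_category" and E :: "('o, 'm, 'e) hilbert_module_data"
begin

lemma fibre_space: "x \<in> Ob A \<Longrightarrow> complex_space (fibre E x)"
  by (rule complex_spaceI[OF fibre_vector_space])

lemma act_closed [simp]: "\<lbrakk>x \<in> Ob A; y \<in> Ob A; e \<in> elts E y; a \<in> hom A x y\<rbrakk> \<Longrightarrow> act E x y e a \<in> elts E x"
  using complex_linearD(1)[OF act_linear_elt] .

lemma inn_closed [simp]: "\<lbrakk>x \<in> Ob A; y \<in> Ob A; e \<in> elts E y; f \<in> elts E x\<rbrakk> \<Longrightarrow> inn E x y e f \<in> hom A x y"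
  using complex_linearD(1)[OF inn_linear_right] .

lemmas inn_add_right = complex_linearD(2)[OF inn_linear_right]
  and inn_smult_right = complex_linearD(3)[OF inn_linear_right]
  and inn_add_left = conjugate_linearD(2)[OF inn_conjugate_linear_left]
  and inn_smult_left = conjugate_linearD(3)[OF inn_conjugate_linear_left]

lemma inn_diff_right: "\<lbrakk>x \<in> Ob A; y \<in> Ob A; e \<in> elts E y; f \<in> elts E x; g \<in> elts E x\<rbrakk>
    \<Longrightarrow> inn E x y e (f \<ominus>\<^bsub>fibre E x\<^esub> g) = inn E x y e f \<ominus>\<^bsub>homsp A x y\<^esub> inn E x y e g"
  by (rule complex_linear_diff[OF fibre_vector_space hom_space inn_linear_right])

lemma inn_diff_left: "\<lbrakk>x \<in> Ob A; y \<in> Ob A; e \<in> elts E y; f \<in> elts E x; g \<in> elts E y\<rbrakk>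
    \<Longrightarrow> inn E x y (e \<ominus>\<^bsub>fibre E y\<^esub> g) f = inn E x y e f \<ominus>\<^bsub>homsp A x y\<^esub> inn E x y g f"
  by (rule conjugate_linear_diff[OF fibre_vector_space hom_space inn_conjugate_linear_left])

lemma inn_act_left:
  assumes "w \<in> Ob A" "x \<in> Ob A" "y \<in> Ob A" "e \<in> elts E y" "f \<in> elts E x" "a \<in> hom A w y"
  shows "inn E x w (act E w y e a) f = comp A x y w (star A w y a) (inn E x y e f)"
proof -
  have "inn E x w (act E w y e a) f = star A w x (inn E w x f (act E w y e a))"
    using assms by (intro inn_star) auto
  also have "inn E w x f (act E w y e a) = comp A w y x (inn E y x f e) a"
    using assms by (simp add: inn_act)
  also have "star A w x (comp A w y x (inn E y x f e) a) = comp A x y w (star A w y a) (star A y x (inn E y x f e))"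
    using assms by (intro star_comp) auto
  also have "star A y x (inn E y x f e) = inn E x y e f"
    using assms by (intro inn_star[symmetric]) auto
  finally show ?thesis .
qed

lemma module_norm_nonneg [simp]: "x \<in> Ob A \<Longrightarrow> e \<in> elts E x \<Longrightarrow> 0 \<le> module_norm A E x e"
  unfolding module_norm_def using carrier_normed_space.nonneg[OF hom_normed] by simp

lemma module_norm_square: "x \<in> Ob A \<Longrightarrow> e \<in> elts E x \<Longrightarrow> (module_norm A E x e)\<^sup>2 = nrm (homsp A x x) (inn E x x e e)"
  unfolding module_norm_def using carrier_normed_space.nonneg[OF hom_normed] by simp

lemma module_norm_eq_zero: "x \<in> Ob A \<Longrightarrow> e \<in> elts E x \<Longrightarrow> module_norm A E x e = 0 \<longleftrightarrow> e = \<zero>\<^bsub>fibre E x\<^esub>"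
proof -
  assume x: "x \<in> Ob A" "e \<in> elts E x"
  interpret B: carrier_normed_space "homsp A x x" "nrm (homsp A x x)" by (rule hom_normed[OF x(1,1)])
  interpret V: complex_space "fibre E x" by (rule fibre_space[OF x(1)])
  have "inn E x x \<zero>\<^bsub>fibre E x\<^esub> \<zero>\<^bsub>fibre E x\<^esub> = \<zero>\<^bsub>homsp A x x\<^esub>"
    using x by (intro complex_linear_zero[OF fibre_vector_space hom_space inn_linear_right]) auto
  thus ?thesis using x inn_definite[OF x] B.eq_zero[of "inn E x x e e"]
    by (auto simp: module_norm_def)
qed

lemma module_norm_smult: "x \<in> Ob A \<Longrightarrow> e \<in> elts E x \<Longrightarrow> module_norm A E x (c \<odot>\<^bsub>fibre E x\<^esub> e) = cmod c * module_norm A E x e"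
proof -
  assume x: "x \<in> Ob A" "e \<in> elts E x"
  interpret B: carrier_normed_space "homsp A x x" "nrm (homsp A x x)" by (rule hom_normed[OF x(1,1)])
  interpret V: complex_space "fibre E x" by (rule fibre_space[OF x(1)])
  have "inn E x x (c \<odot>\<^bsub>fibre E x\<^esub> e) (c \<odot>\<^bsub>fibre E x\<^esub> e) = (cnj c * c) \<odot>\<^bsub>homsp A x x\<^esub> inn E x x e e"
    using x by (simp add: inn_smult_left inn_smult_right B.smult_smult mult.commute)
  thus ?thesis using x by (simp add: module_norm_def B.scale norm_mult real_sqrt_mult)
qed

lemma inn_zero_left: "x \<in> Ob A \<Longrightarrow> y \<in> Ob A \<Longrightarrow> f \<in> elts E x \<Longrightarrow> inn E x y \<zero>\<^bsub>fibre E y\<^esub> f = \<zero>\<^bsub>homsp A x y\<^esub>"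
  by (rule conjugate_linear_zero[OF fibre_vector_space hom_space inn_conjugate_linear_left])

text \<open>With \<open>c = \<langle>e, f\<rangle>\<close> and a real number \<open>t\<close>, expanding the square of \<open>f - t (e \<cdot> c)\<close> gives
\<open>2 t c\<^sup>* c + \<langle>f - t (e \<cdot> c), f - t (e \<cdot> c)\<rangle> = \<langle>f, f\<rangle> + t\<^sup>2 c\<^sup>* \<langle>e, e\<rangle> c\<close>. Monotonicity of the norm drops the second summand
on the left, so \<open>2 t \<parallel>c\<parallel>\<^sup>2 \<le> \<parallel>f\<parallel>\<^sup>2 + t\<^sup>2 \<parallel>c\<parallel>\<^sup>2 \<parallel>e\<parallel>\<^sup>2\<close>, and \<open>t = \<parallel>e\<parallel>\<^sup>-\<^sup>2\<close> is the best choice.\<close>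

theorem cauchy_schwarz:
  assumes x: "x \<in> Ob A" and y: "y \<in> Ob A" and e: "e \<in> elts E y" and f: "f \<in> elts E x"
  shows "nrm (homsp A x y) (inn E x y e f) \<le> module_norm A E y e * module_norm A E x f"
proof (cases "module_norm A E y e = 0")
  case True
  interpret B: carrier_normed_space "homsp A x y" "nrm (homsp A x y)" by (rule hom_normed[OF x y])
  have "e = \<zero>\<^bsub>fibre E y\<^esub>" using module_norm_eq_zero[OF y e] True by simp
  thus ?thesis using True inn_zero_left[OF x y f] by simp
next
  case False
  let ?B' = "homsp A x y"
  let ?B = "homsp A x x"
  interpret B: carrier_normed_space "?B" "nrm (?B)" by (rule hom_normed[OF x x])
  interpret B': carrier_normed_space "?B'" "nrm (?B')" by (rule hom_normed[OF x y])
  interpret V: complex_space "fibre E x" by (rule fibre_space[OF x])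
  define c where "c = inn E x y e f"
  have c: "c \<in> hom A x y" using x y e f by (simp add: c_def)
  have sc: "star A x y c = inn E y x f e" using inn_star[OF y x f e] by (simp add: c_def)
  define d where "d = act E x y e c"
  have d: "d \<in> elts E x" using x y e c by (simp add: d_def)
  define p where "p = comp A x y x (star A x y c) c"
  have p: "p \<in> hom A x x" using x y c by (simp add: p_def)
  have fd: "inn E x x f d = p"
    unfolding d_def p_def sc using x y e f c by (simp add: inn_act)
  have df: "inn E x x d f = p"
    unfolding d_def p_def using x y e f c by (simp add: inn_act_left c_def)
  have "inn E x x d d = comp A x y x (star A x y c) (comp A x y y (inn E y y e e) c)"
    unfolding d_def using x y e c by (simp add: inn_act_left comp_assoc flip: inn_act)
  hence "nrm (?B) (inn E x x d d) \<le> nrm (homsp A y x) (star A x y c) * nrm (?B') (comp A x y y (inn E y y e e) c)"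
    using x y e c by (simp add: norm_comp_le)
  also have "\<dots> \<le> nrm (?B') c * (nrm (homsp A y y) (inn E y y e e) * nrm (?B') c)"
    using x y e c norm_comp_le[OF x y y c, of "inn E y y e e"] B'.nonneg[OF c] by (simp add: norm_star mult_left_mono)
  finally have dd: "nrm (?B) (inn E x x d d) \<le> (nrm (?B') c)\<^sup>2 * (module_norm A E y e)\<^sup>2"
    using y e by (simp add: module_norm_square power2_eq_square[of "nrm (?B') c"] mult_ac)
  define N where "N = (module_norm A E y e)\<^sup>2"
  have N: "N > 0" using False by (simp add: N_def)
  define t where "t = 1 / N"
  \<comment> \<open>Needed to exhibit \<open>2 t c\<^sup>* c\<close> as an element of the form \<open>a\<^sup>* a\<close>.\<close>
  define s where "s = complex_of_real (sqrt (2 * t))"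
  have t: "t > 0" using N by (simp add: t_def)
  have ss: "cnj s * s = complex_of_real (2 * t)"
    unfolding s_def using t by (simp flip: of_real_mult)
  define g where "g = f \<ominus>\<^bsub>fibre E x\<^esub> complex_of_real t \<odot>\<^bsub>fibre E x\<^esub> d"
  have g: "g \<in> elts E x" using f d by (simp add: g_def)
  have "inn E x x g g = inn E x x f f \<ominus>\<^bsub>?B\<^esub> complex_of_real t \<odot>\<^bsub>?B\<^esub> p
     \<ominus>\<^bsub>?B\<^esub> complex_of_real t \<odot>\<^bsub>?B\<^esub> (p \<ominus>\<^bsub>?B\<^esub> complex_of_real t \<odot>\<^bsub>?B\<^esub> inn E x x d d)"
    unfolding g_def using x f d
    by (simp add: inn_diff_left inn_diff_right inn_smult_left inn_smult_right fd df)
  hence gg: "complex_of_real (2 * t) \<odot>\<^bsub>?B\<^esub> p \<oplus>\<^bsub>?B\<^esub> inn E x x g g =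
     inn E x x f f \<oplus>\<^bsub>?B\<^esub> complex_of_real (t * t) \<odot>\<^bsub>?B\<^esub> inn E x x d d"
  proof -
    have "complex_of_real (2 * t) \<odot>\<^bsub>?B\<^esub> p \<oplus>\<^bsub>?B\<^esub> (u \<ominus>\<^bsub>?B\<^esub> complex_of_real t \<odot>\<^bsub>?B\<^esub> p
      \<ominus>\<^bsub>?B\<^esub> complex_of_real t \<odot>\<^bsub>?B\<^esub> (p \<ominus>\<^bsub>?B\<^esub> complex_of_real t \<odot>\<^bsub>?B\<^esub> v)) =
      u \<oplus>\<^bsub>?B\<^esub> complex_of_real (t * t) \<odot>\<^bsub>?B\<^esub> v"
      if "u \<in> hom A x x" "v \<in> hom A x x" for u v
      using that p by - (rule B.linear_identity3[of u v p]; simp)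
    thus ?thesis using \<open>inn E x x g g = _\<close> x f d by simp
  qed
  have "comp A x y x (star A x y (s \<odot>\<^bsub>?B'\<^esub> c)) (s \<odot>\<^bsub>?B'\<^esub> c) = complex_of_real (2 * t) \<odot>\<^bsub>?B\<^esub> p"
    unfolding ss[symmetric] p_def using x y c
    by (simp add: star_smult B.smult_smult complex_linearD[OF comp_linear_left[OF x y x]]
        complex_linearD[OF comp_linear_right[OF x y x]] mult.commute)
  hence "positive A x (complex_of_real (2 * t) \<odot>\<^bsub>?B\<^esub> p)"
    using positive_star_comp[OF x y, of "s \<odot>\<^bsub>?B'\<^esub> c"] c by simp
  from norm_mono_positive[OF x this positive_imp_norm_positive[OF x inn_positive[OF x g]], unfolded gg]
  have "nrm (?B) (complex_of_real (2 * t) \<odot>\<^bsub>?B\<^esub> p) \<le>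
      nrm (?B) (inn E x x f f \<oplus>\<^bsub>?B\<^esub> complex_of_real (t * t) \<odot>\<^bsub>?B\<^esub> inn E x x d d)" .
  also have "\<dots> \<le> nrm (?B) (inn E x x f f) + nrm (?B) (complex_of_real (t * t) \<odot>\<^bsub>?B\<^esub> inn E x x d d)"
    using x f d by (intro B.triangle) auto
  finally have "2 * t * nrm (?B) p \<le> (module_norm A E x f)\<^sup>2 + t * t * nrm (?B) (inn E x x d d)"
    using t x p f d by (simp add: B.scale module_norm_square norm_mult)
  moreover have "nrm (?B) p = (nrm (?B') c)\<^sup>2" unfolding p_def by (rule cstar_identity[OF x y c])
  moreover have "t * t * nrm (?B) (inn E x x d d) \<le> t * (nrm (?B') c)\<^sup>2"
  proof -
    have "t * t * nrm (?B) (inn E x x d d) \<le> t * t * ((nrm (?B') c)\<^sup>2 * N)"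
      using dd by (intro mult_left_mono) (auto simp: N_def)
    also have "\<dots> = t * (nrm (?B') c)\<^sup>2" using N by (simp add: t_def)
    finally show ?thesis .
  qed
  ultimately have "t * (nrm (?B') c)\<^sup>2 \<le> (module_norm A E x f)\<^sup>2"
    by (simp add: mult.assoc)
  hence "(nrm (?B') c)\<^sup>2 \<le> N * (module_norm A E x f)\<^sup>2" using N by (simp add: t_def field_simps)
  hence "(nrm (?B') c)\<^sup>2 \<le> (module_norm A E y e * module_norm A E x f)\<^sup>2"
    by (simp add: N_def power_mult_distrib)
  thus ?thesis unfolding c_def[symmetric]
    by (rule power2_le_imp_le) (use x y e f in auto)
qed

lemma module_norm_triangle:
  assumes x: "x \<in> Ob A" and e: "e \<in> elts E x" and f: "f \<in> elts E x"
  shows "module_norm A E x (e \<oplus>\<^bsub>fibre E x\<^esub> f) \<le> module_norm A E x e + module_norm A E x f"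
proof -
  interpret B: carrier_normed_space "homsp A x x" "nrm (homsp A x x)" by (rule hom_normed[OF x x])
  interpret V: complex_space "fibre E x" by (rule fibre_space[OF x])
  let ?n = "nrm (homsp A x x)"
  have "inn E x x (e \<oplus>\<^bsub>fibre E x\<^esub> f) (e \<oplus>\<^bsub>fibre E x\<^esub> f) =
    (inn E x x e e \<oplus>\<^bsub>homsp A x x\<^esub> inn E x x f e) \<oplus>\<^bsub>homsp A x x\<^esub> (inn E x x e f \<oplus>\<^bsub>homsp A x x\<^esub> inn E x x f f)"
    using x e f by (simp add: inn_add_left inn_add_right)
  hence "(module_norm A E x (e \<oplus>\<^bsub>fibre E x\<^esub> f))\<^sup>2 = ?n \<dots>" using x e f by (simp add: module_norm_square)
  also have "\<dots> \<le> (?n (inn E x x e e) + ?n (inn E x x f e)) + (?n (inn E x x e f) + ?n (inn E x x f f))"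
    using x e f by (intro order_trans[OF B.triangle] add_mono B.triangle) auto
  also have "\<dots> \<le> (module_norm A E x e + module_norm A E x f)\<^sup>2"
    using cauchy_schwarz[OF x x e f] cauchy_schwarz[OF x x f e] x e f
    by (simp add: power2_sum mult_ac flip: module_norm_square)
  finally show ?thesis by (rule power2_le_imp_le) (use x e f in auto)
qed

lemma fibre_normed: "x \<in> Ob A \<Longrightarrow> carrier_normed_space (fibre E x) (module_norm A E x)"
  by (intro carrier_normed_space.intro carrier_normed_space_axioms.intro fibre_space
      module_norm_nonneg module_norm_eq_zero module_norm_smult module_norm_triangle)

lemma module_norm_act:
  assumes "x \<in> Ob A" "y \<in> Ob A" "e \<in> elts E y" "a \<in> hom A x y"
  shows "module_norm A E x (act E x y e a) \<le> module_norm A E y e * nrm (homsp A x y) a"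
proof -
  interpret B': carrier_normed_space "homsp A x y" "nrm (homsp A x y)" by (rule hom_normed[OF assms(1,2)])
  have n: "0 \<le> nrm (homsp A x y) a" by (rule B'.nonneg[OF assms(4)])
  have "inn E x x (act E x y e a) (act E x y e a) = comp A x y x (star A x y a) (comp A x y y (inn E y y e e) a)"
    using assms by (simp add: inn_act_left comp_assoc flip: inn_act)
  hence "(module_norm A E x (act E x y e a))\<^sup>2 = nrm (homsp A x x) \<dots>" using assms by (simp add: module_norm_square)
  also have "\<dots> \<le> nrm (homsp A y x) (star A x y a) * nrm (homsp A x y) (comp A x y y (inn E y y e e) a)"
    using assms by (intro norm_comp_le) auto
  also have "\<dots> \<le> nrm (homsp A x y) a * (nrm (homsp A y y) (inn E y y e e) * nrm (homsp A x y) a)"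
    using assms norm_comp_le[of x y y a "inn E y y e e"] n by (simp add: norm_star mult_left_mono)
  also have "\<dots> = (module_norm A E y e * nrm (homsp A x y) a)\<^sup>2"
    using assms by (simp add: module_norm_square power2_eq_square[of "nrm (homsp A x y) a"] power_mult_distrib)
  finally show ?thesis by (rule power2_le_imp_le) (use assms n in auto)
qed

lemma norm_positive_inn: "x \<in> Ob A \<Longrightarrow> e \<in> elts E x \<Longrightarrow> norm_positive x (inn E x x e e)"
  by (rule positive_imp_norm_positive[OF _ inn_positive])

lemma module_norm_le_of_inn:
  assumes "x \<in> Ob A" "e \<in> elts E x" "norm_positive x b" "r \<ge> 0"
    and "nrm (homsp A x x) (inn E x x e e \<oplus>\<^bsub>homsp A x x\<^esub> b) \<le> r\<^sup>2"
  shows "module_norm A E x e \<le> r"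
proof -
  have "nrm (homsp A x x) (inn E x x e e) \<le> r\<^sup>2"
    using norm_mono_positive[OF assms(1) inn_positive[OF assms(1,2)] assms(3)] assms(5) by linarith
  hence "(module_norm A E x e)\<^sup>2 \<le> r\<^sup>2" using assms by (simp add: module_norm_square)
  thus ?thesis using assms(4) by (rule power2_le_imp_le)
qed

lemma inn_right_eqI:
  assumes "x \<in> Ob A" "e \<in> elts E x" "f \<in> elts E x"
    and "\<And>g. g \<in> elts E x \<Longrightarrow> inn E x x g e = inn E x x g f"
  shows "e = f"
proof -
  interpret B: carrier_normed_space "homsp A x x" "nrm (homsp A x x)" by (rule hom_normed[OF assms(1,1)])
  interpret V: complex_space "fibre E x" by (rule fibre_space[OF assms(1)])
  have "inn E x x (e \<ominus>\<^bsub>fibre E x\<^esub> f) (e \<ominus>\<^bsub>fibre E x\<^esub> f) = \<zero>\<^bsub>homsp A x x\<^esub>"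
    using assms by (simp add: inn_diff_right B.diff_eq_zero_iff)
  hence "e \<ominus>\<^bsub>fibre E x\<^esub> f = \<zero>\<^bsub>fibre E x\<^esub>" using inn_definite assms by simp
  thus ?thesis using assms V.diff_eq_zero_iff by simp
qed

lemma inn_left_eqI:
  assumes "x \<in> Ob A" "e \<in> elts E x" "f \<in> elts E x"
    and "\<And>g. g \<in> elts E x \<Longrightarrow> inn E x x e g = inn E x x f g"
  shows "e = f"
  using assms by (intro inn_right_eqI) (auto simp: inn_star[of x x _ e] inn_star[of x x _ f])

lemma inn_tendsto_right:
  assumes "x \<in> Ob A" "y \<in> Ob A" "e \<in> elts E y" "\<And>i. s i \<in> elts E x" "l \<in> elts E x"
    and "(\<lambda>i. module_norm A E x (s i \<ominus>\<^bsub>fibre E x\<^esub> l)) \<longlonglongrightarrow> 0"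
  shows "(\<lambda>i. nrm (homsp A x y) (inn E x y e (s i) \<ominus>\<^bsub>homsp A x y\<^esub> inn E x y e l)) \<longlonglongrightarrow> 0"
proof (rule tendsto_sandwich[OF _ _ tendsto_const])
  interpret B': carrier_normed_space "homsp A x y" "nrm (homsp A x y)" by (rule hom_normed[OF assms(1,2)])
  interpret V: complex_space "fibre E x" by (rule fibre_space[OF assms(1)])
  show "eventually (\<lambda>i. 0 \<le> nrm (homsp A x y) (inn E x y e (s i) \<ominus>\<^bsub>homsp A x y\<^esub> inn E x y e l)) sequentially"
    using assms by (intro always_eventually allI B'.nonneg) auto
  show "(\<lambda>i. module_norm A E y e * module_norm A E x (s i \<ominus>\<^bsub>fibre E x\<^esub> l)) \<longlonglongrightarrow> 0"
    using tendsto_mult_right_zero[OF assms(6)] .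
  show "eventually (\<lambda>i. nrm (homsp A x y) (inn E x y e (s i) \<ominus>\<^bsub>homsp A x y\<^esub> inn E x y e l) \<le>
      module_norm A E y e * module_norm A E x (s i \<ominus>\<^bsub>fibre E x\<^esub> l)) sequentially"
    using assms cauchy_schwarz by (intro always_eventually allI) (simp flip: inn_diff_right)
qed

lemma inn_tendsto_left:
  assumes "x \<in> Ob A" "y \<in> Ob A" "e \<in> elts E x" "\<And>i. s i \<in> elts E y" "l \<in> elts E y"
    and "(\<lambda>i. module_norm A E y (s i \<ominus>\<^bsub>fibre E y\<^esub> l)) \<longlonglongrightarrow> 0"
  shows "(\<lambda>i. nrm (homsp A x y) (inn E x y (s i) e \<ominus>\<^bsub>homsp A x y\<^esub> inn E x y l e)) \<longlonglongrightarrow> 0"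
proof (rule tendsto_sandwich[OF _ _ tendsto_const])
  interpret B': carrier_normed_space "homsp A x y" "nrm (homsp A x y)" by (rule hom_normed[OF assms(1,2)])
  interpret V: complex_space "fibre E y" by (rule fibre_space[OF assms(2)])
  show "eventually (\<lambda>i. 0 \<le> nrm (homsp A x y) (inn E x y (s i) e \<ominus>\<^bsub>homsp A x y\<^esub> inn E x y l e)) sequentially"
    using assms by (intro always_eventually allI B'.nonneg) auto
  show "(\<lambda>i. module_norm A E y (s i \<ominus>\<^bsub>fibre E y\<^esub> l) * module_norm A E x e) \<longlonglongrightarrow> 0"
    using tendsto_mult_left_zero[OF assms(6)] .
  show "eventually (\<lambda>i. nrm (homsp A x y) (inn E x y (s i) e \<ominus>\<^bsub>homsp A x y\<^esub> inn E x y l e) \<le>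
      module_norm A E y (s i \<ominus>\<^bsub>fibre E y\<^esub> l) * module_norm A E x e) sequentially"
    using assms cauchy_schwarz by (intro always_eventually allI) (simp flip: inn_diff_left)
qed

end

section \<open>Adjointable operators\<close>

context cstar_category
begin

lemma hilbert_cstar_moduleI: "hilbert_module C E \<Longrightarrow> hilbert_cstar_module C E"
  by (intro hilbert_cstar_module.intro cstar_category_axioms)

text \<open>A formal adjoint pair, without extensionality, linearity, naturality or boundedness. The middle two come
for free, since inner products separate vectors; so operators are best constructed as such pairs.\<close>

definition adjoint_pair where
  "adjoint_pair E F t s \<longleftrightarrow>
     (\<forall>x\<in>Ob C. \<forall>e\<in>elts E x. t x e \<in> elts F x) \<and> (\<forall>x\<in>Ob C. \<forall>f\<in>elts F x. s x f \<in> elts E x) \<and>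
     (\<forall>x\<in>Ob C. \<forall>y\<in>Ob C. \<forall>e\<in>elts E y. \<forall>f\<in>elts F x. inn F x y (t y e) f = inn E x y e (s x f))"

lemma adjoint_pairD:
  assumes "adjoint_pair E F t s"
  shows "x \<in> Ob C \<Longrightarrow> e \<in> elts E x \<Longrightarrow> t x e \<in> elts F x"
    "x \<in> Ob C \<Longrightarrow> f \<in> elts F x \<Longrightarrow> s x f \<in> elts E x"
    "\<lbrakk>x \<in> Ob C; y \<in> Ob C; e \<in> elts E y; f \<in> elts F x\<rbrakk> \<Longrightarrow> inn F x y (t y e) f = inn E x y e (s x f)"
  using assms by (auto simp: adjoint_pair_def)

lemma adjoint_pair_sym:
  assumes E: "hilbert_module C E" and F: "hilbert_module C F" and p: "adjoint_pair E F t s"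
  shows "adjoint_pair F E s t"
proof -
  interpret E: hilbert_cstar_module C E by (rule hilbert_cstar_moduleI[OF E])
  interpret F: hilbert_cstar_module C F by (rule hilbert_cstar_moduleI[OF F])
  note pD = adjoint_pairD[OF p]
  have "inn E x y (s y f) e = inn F x y f (t x e)"
    if "x \<in> Ob C" "y \<in> Ob C" "f \<in> elts F y" "e \<in> elts E x" for x y f e
  proof -
    have "inn E x y (s y f) e = star C y x (inn E y x e (s y f))" using that pD by (intro E.inn_star) auto
    also have "inn E y x e (s y f) = inn F y x (t x e) f" using that pD by simp
    also have "star C y x (inn F y x (t x e) f) = inn F x y f (t x e)" using that pD by (intro F.inn_star[symmetric]) auto
    finally show ?thesis .
  qed
  thus ?thesis using pD by (auto simp: adjoint_pair_def)
qed

lemma adjoint_pair_linear: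
  assumes E: "hilbert_module C E" and F: "hilbert_module C F" and p: "adjoint_pair E F t s" and x: "x \<in> Ob C"
  shows "complex_linear (fibre E x) (fibre F x) (t x)"
proof -
  interpret E: hilbert_cstar_module C E by (rule hilbert_cstar_moduleI[OF E])
  interpret F: hilbert_cstar_module C F by (rule hilbert_cstar_moduleI[OF F])
  interpret VE: complex_space "fibre E x" by (rule E.fibre_space[OF x])
  interpret VF: complex_space "fibre F x" by (rule F.fibre_space[OF x])
  note pD = adjoint_pairD[OF p]
  show ?thesis
    unfolding complex_linear_def
  proof (intro conjI ballI allI)
    show "t x \<in> elts E x \<rightarrow> elts F x" using pD(1) x by blast
    fix u assume u: "u \<in> elts E x"
    show "t x (c \<odot>\<^bsub>fibre E x\<^esub> u) = c \<odot>\<^bsub>fibre F x\<^esub> t x u" for c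
      using x u by (intro F.inn_left_eqI[OF x]) (simp_all add: pD F.inn_smult_left E.inn_smult_left)
    show "t x (u \<oplus>\<^bsub>fibre E x\<^esub> v) = t x u \<oplus>\<^bsub>fibre F x\<^esub> t x v" if "v \<in> elts E x" for v
      using x u that by (intro F.inn_left_eqI[OF x]) (simp_all add: pD F.inn_add_left E.inn_add_left)
  qed
qed

lemma adjoint_pair_natural:
  assumes E: "hilbert_module C E" and F: "hilbert_module C F" and p: "adjoint_pair E F t s"
  shows "(\<lambda>x\<in>Ob C. \<lambda>e\<in>elts E x. t x e) \<in> natural_transformations C E F"
proof -
  interpret E: hilbert_cstar_module C E by (rule hilbert_cstar_moduleI[OF E])
  interpret F: hilbert_cstar_module C F by (rule hilbert_cstar_moduleI[OF F])
  note pD = adjoint_pairD[OF p]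
  have lin: "complex_linear (fibre E x) (fibre F x) (restrict (t x) (elts E x))" if x: "x \<in> Ob C" for x
  proof -
    interpret VE: complex_space "fibre E x" by (rule E.fibre_space[OF x])
    show ?thesis using adjoint_pair_linear[OF E F p x] by (simp add: complex_linear_def Pi_iff)
  qed
  have act: "t x (act E x y e a) = act F x y (t y e) a"
    if "x \<in> Ob C" "y \<in> Ob C" "e \<in> elts E y" "a \<in> hom C x y" for x y e a
    using that by (intro F.inn_left_eqI[OF that(1)]) (simp_all add: pD F.inn_act_left E.inn_act_left)
  show ?thesis
    unfolding natural_transformations_def using pD lin act by auto
qed

lemma natural_ext:
  assumes "T \<in> natural_transformations C E F" "S \<in> natural_transformations C E F"
    and "\<And>x e. x \<in> Ob C \<Longrightarrow> e \<in> elts E x \<Longrightarrow> T x e = S x e"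
  shows "T = S"
proof (rule PiE_ext)
  show "T \<in> (\<Pi>\<^sub>E x\<in>Ob C. elts E x \<rightarrow>\<^sub>E elts F x)" "S \<in> (\<Pi>\<^sub>E x\<in>Ob C. elts E x \<rightarrow>\<^sub>E elts F x)"
    using assms by (auto simp: natural_transformations_def)
  fix x assume x: "x \<in> Ob C"
  show "T x = S x"
  proof (rule PiE_ext)
    show "T x \<in> elts E x \<rightarrow>\<^sub>E elts F x" "S x \<in> elts E x \<rightarrow>\<^sub>E elts F x"
      using assms x by (auto simp: natural_transformations_def dest: PiE_mem)
  qed (use assms x in auto)
qed

lemma naturalD:
  assumes "T \<in> natural_transformations C E F"
  shows "x \<in> Ob C \<Longrightarrow> complex_linear (fibre E x) (fibre F x) (T x)"
    "x \<in> Ob C \<Longrightarrow> e \<in> elts E x \<Longrightarrow> T x e \<in> elts F x"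
    "\<lbrakk>x \<in> Ob C; y \<in> Ob C; e \<in> elts E y; a \<in> hom C x y\<rbrakk> \<Longrightarrow> T x (act E x y e a) = act F x y (T y e) a"
    "(\<lambda>x\<in>Ob C. \<lambda>e\<in>elts E x. T x e) = T"
proof -
  show 1: "x \<in> Ob C \<Longrightarrow> complex_linear (fibre E x) (fibre F x) (T x)" for x
    using assms by (auto simp: natural_transformations_def)
  show "x \<in> Ob C \<Longrightarrow> e \<in> elts E x \<Longrightarrow> T x e \<in> elts F x" using complex_linearD(1)[OF 1] .
  show "\<lbrakk>x \<in> Ob C; y \<in> Ob C; e \<in> elts E y; a \<in> hom C x y\<rbrakk> \<Longrightarrow> T x (act E x y e a) = act F x y (T y e) a"
    using assms by (auto simp: natural_transformations_def)
  have T: "T \<in> (\<Pi>\<^sub>E x\<in>Ob C. elts E x \<rightarrow>\<^sub>E elts F x)" using assms by (simp add: natural_transformations_def)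
  hence "restrict (T x) (elts E x) = T x" if "x \<in> Ob C" for x
    using that by (auto intro!: PiE_restrict dest: PiE_mem)
  thus "(\<lambda>x\<in>Ob C. \<lambda>e\<in>elts E x. T x e) = T"
    using T by (auto simp: fun_eq_iff restrict_def PiE_def extensional_def)
qed

lemma is_adjoint_imp_pair:
  assumes "T \<in> natural_transformations C E F" "is_adjoint C E F T S"
  shows "adjoint_pair E F T S"
  using assms naturalD(2) by (auto simp: is_adjoint_def adjoint_pair_def)

lemma adjoint_unique:
  assumes E: "hilbert_module C E" and F: "hilbert_module C F"
    and "is_adjoint C E F T S" "is_adjoint C E F T S'"
  shows "S = S'"
proof -
  interpret E: hilbert_cstar_module C E by (rule hilbert_cstar_moduleI[OF E])
  interpret F: hilbert_cstar_module C F by (rule hilbert_cstar_moduleI[OF F])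
  have S: "S \<in> natural_transformations C F E" "S' \<in> natural_transformations C F E"
    using assms by (auto simp: is_adjoint_def)
  show ?thesis
  proof (rule natural_ext[OF S])
    fix x f assume x: "x \<in> Ob C" "f \<in> elts F x"
    thus "S x f = S' x f"
      using assms(3,4) naturalD(2)[OF S(1) x] naturalD(2)[OF S(2) x]
      by (intro E.inn_right_eqI[OF x(1)]) (auto simp: is_adjoint_def)
  qed
qed

abbreviation "opn \<equiv> module_operator_norm C"
abbreviation "adj \<equiv> adjointable_operators C"

lemma unit_values_bound:
  assumes "\<And>x e. x \<in> Ob C \<Longrightarrow> e \<in> elts E x \<Longrightarrow> module_norm C F x (T x e) \<le> K * module_norm C E x e"
    and "v \<in> unit_values C E F T"
  shows "v \<le> K"
  using assms by (auto simp: unit_values_def) (metis mult.right_neutral)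

lemma adj_natural: "T \<in> adj E F \<Longrightarrow> T \<in> natural_transformations C E F"
  by (simp add: adjointable_operators_def)

lemmas adj_linear = naturalD(1)[OF adj_natural]
  and adj_closed = naturalD(2)[OF adj_natural]
  and adj_act = naturalD(3)[OF adj_natural]
  and adj_restrict = naturalD(4)[OF adj_natural]

lemma adj_ext:
  "\<lbrakk>T \<in> adj E F; S \<in> adj E F; \<And>x e. x \<in> Ob C \<Longrightarrow> e \<in> elts E x \<Longrightarrow> T x e = S x e\<rbrakk> \<Longrightarrow> T = S"
  by (rule natural_ext[OF adj_natural adj_natural])

text \<open>The common way to construct operators below: sums, multiples, composites, limits, inverses and rank one
operators are all given by explicit adjoint pairs.\<close>

lemma adjoint_pair_adj:
  assumes E: "hilbert_module C E" and F: "hilbert_module C F" and p: "adjoint_pair E F t s"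
    and b: "\<And>x e. x \<in> Ob C \<Longrightarrow> e \<in> elts E x \<Longrightarrow> module_norm C F x (t x e) \<le> K * module_norm C E x e"
  shows "(\<lambda>x\<in>Ob C. \<lambda>e\<in>elts E x. t x e) \<in> adj E F"
    and "is_adjoint C E F (\<lambda>x\<in>Ob C. \<lambda>e\<in>elts E x. t x e) (\<lambda>x\<in>Ob C. \<lambda>f\<in>elts F x. s x f)"
proof -
  show adj: "is_adjoint C E F (\<lambda>x\<in>Ob C. \<lambda>e\<in>elts E x. t x e) (\<lambda>x\<in>Ob C. \<lambda>f\<in>elts F x. s x f)"
    using adjoint_pair_natural[OF F E adjoint_pair_sym[OF E F p]] adjoint_pairD[OF p]
    by (simp add: is_adjoint_def)
  have "bdd_above (unit_values C E F (\<lambda>x\<in>Ob C. \<lambda>e\<in>elts E x. t x e))"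
    by (rule bdd_aboveI[of _ K], rule unit_values_bound) (auto simp: b)
  thus "(\<lambda>x\<in>Ob C. \<lambda>e\<in>elts E x. t x e) \<in> adj E F"
    using adj adjoint_pair_natural[OF E F p] by (auto simp: adjointable_operators_def)
qed

lemma adj_bdd: "T \<in> adj E F \<Longrightarrow> bdd_above (insert 0 (unit_values C E F T))"
  by (simp add: adjointable_operators_def)

lemma opn_nonneg: "T \<in> adj E F \<Longrightarrow> 0 \<le> opn E F T"
  unfolding module_operator_norm_def by (rule cSup_upper[OF _ adj_bdd]) auto

lemma opn_le:
  assumes "0 \<le> K" and "\<And>x e. x \<in> Ob C \<Longrightarrow> e \<in> elts E x \<Longrightarrow> module_norm C F x (T x e) \<le> K * module_norm C E x e"
  shows "opn E F T \<le> K"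
  unfolding module_operator_norm_def
  by (rule cSup_least) (use assms(1) unit_values_bound[OF assms(2)] in auto)

lemma opn_bound:
  assumes E: "hilbert_module C E" and F: "hilbert_module C F" and T: "T \<in> adj E F"
    and x: "x \<in> Ob C" and e: "e \<in> elts E x"
  shows "module_norm C F x (T x e) \<le> opn E F T * module_norm C E x e"
proof -
  interpret E: hilbert_cstar_module C E by (rule hilbert_cstar_moduleI[OF E])
  interpret F: hilbert_cstar_module C F by (rule hilbert_cstar_moduleI[OF F])
  interpret VE: carrier_normed_space "fibre E x" "module_norm C E x" by (rule E.fibre_normed[OF x])
  interpret VF: carrier_normed_space "fibre F x" "module_norm C F x" by (rule F.fibre_normed[OF x])
  note lin = adj_linear[OF T x]
  show ?thesis
  proof (cases "module_norm C E x e = 0")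
    case True
    hence "e = \<zero>\<^bsub>fibre E x\<^esub>" using VE.eq_zero[OF e] by simp
    hence "T x e = \<zero>\<^bsub>fibre F x\<^esub>" using complex_linear_zero[OF VE.space VF.space lin] by simp
    thus ?thesis using True by simp
  next
    case False
    define m where "m = module_norm C E x e"
    have m: "m > 0" using False VE.nonneg[OF e] by (simp add: m_def)
    define e' where "e' = complex_of_real (1 / m) \<odot>\<^bsub>fibre E x\<^esub> e"
    have e': "e' \<in> elts E x" "module_norm C E x e' = 1"
      using e m by (auto simp: e'_def VE.scale norm_divide simp flip: m_def)
    hence "module_norm C F x (T x e') \<in> unit_values C E F T" using x by (auto simp: unit_values_def)
    hence "module_norm C F x (T x e') \<le> opn E F T"
      unfolding module_operator_norm_def by (intro cSup_upper[OF _ adj_bdd[OF T]]) auto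
    moreover have "module_norm C F x (T x e') = module_norm C F x (T x e) / m"
      using e m complex_linearD[OF lin] by (simp add: e'_def VF.scale norm_divide)
    ultimately show ?thesis using m by (simp add: field_simps m_def[symmetric])
  qed
qed

definition dagger where "dagger E F T = (THE S. is_adjoint C E F T S)"

lemma dagger_eq: "\<lbrakk>hilbert_module C E; hilbert_module C F; is_adjoint C E F T S\<rbrakk> \<Longrightarrow> dagger E F T = S"
  unfolding dagger_def by (rule the_equality) (auto intro: adjoint_unique)

lemma is_adjoint_dagger:
  assumes "hilbert_module C E" "hilbert_module C F" "T \<in> adj E F"
  shows "is_adjoint C E F T (dagger E F T)"
  using assms dagger_eq[OF assms(1,2)] by (auto simp: adjointable_operators_def)

lemma dagger_pair:
  assumes "hilbert_module C E" "hilbert_module C F" "T \<in> adj E F"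
  shows "adjoint_pair E F T (dagger E F T)"
  using is_adjoint_imp_pair[OF adj_natural[OF assms(3)] is_adjoint_dagger[OF assms]] .

text \<open>Apply the Cauchy-Schwarz inequality to \<open>\<parallel>T\<^sup>* f\<parallel>\<^sup>2 = \<parallel>\<langle>T T\<^sup>* f, f\<rangle>\<parallel>\<close> and cancel \<open>\<parallel>T\<^sup>* f\<parallel>\<close>.\<close>

lemma dagger_bound:
  assumes E: "hilbert_module C E" and F: "hilbert_module C F" and T: "T \<in> adj E F"
    and x: "x \<in> Ob C" and f: "f \<in> elts F x"
  shows "module_norm C E x (dagger E F T x f) \<le> opn E F T * module_norm C F x f"
proof -
  interpret E: hilbert_cstar_module C E by (rule hilbert_cstar_moduleI[OF E])
  interpret F: hilbert_cstar_module C F by (rule hilbert_cstar_moduleI[OF F])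
  note pD = adjoint_pairD[OF dagger_pair[OF E F T]]
  let ?g = "dagger E F T x f"
  have g: "?g \<in> elts E x" using pD x f by blast
  have "(module_norm C E x ?g)\<^sup>2 = nrm (homsp C x x) (inn F x x (T x ?g) f)"
    using x f g pD by (simp add: E.module_norm_square)
  also have "\<dots> \<le> module_norm C F x (T x ?g) * module_norm C F x f"
    using x f g pD by (intro F.cauchy_schwarz) auto
  also have "\<dots> \<le> opn E F T * module_norm C E x ?g * module_norm C F x f"
    using opn_bound[OF E F T x g] x f by (intro mult_right_mono) auto
  finally have "module_norm C E x ?g * module_norm C E x ?g \<le> module_norm C E x ?g * (opn E F T * module_norm C F x f)"
    by (simp add: power2_eq_square mult_ac)
  thus ?thesis using E.module_norm_nonneg[OF x g] opn_nonneg[OF T] F.module_norm_nonneg[OF x f]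
    by (cases "module_norm C E x ?g = 0") auto
qed

lemma dagger_adj:
  assumes E: "hilbert_module C E" and F: "hilbert_module C F" and T: "T \<in> adj E F"
  shows "dagger E F T \<in> adj F E" "is_adjoint C F E (dagger E F T) T"
proof -
  have n: "dagger E F T \<in> natural_transformations C F E"
    using is_adjoint_dagger[OF assms] by (simp add: is_adjoint_def)
  have "is_adjoint C F E (\<lambda>x\<in>Ob C. \<lambda>f\<in>elts F x. dagger E F T x f) (\<lambda>x\<in>Ob C. \<lambda>e\<in>elts E x. T x e)"
    "(\<lambda>x\<in>Ob C. \<lambda>f\<in>elts F x. dagger E F T x f) \<in> adj F E"
    using adjoint_pair_adj[OF F E adjoint_pair_sym[OF E F dagger_pair[OF assms]] dagger_bound[OF assms]] by blast+
  thus "dagger E F T \<in> adj F E" "is_adjoint C F E (dagger E F T) T"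
    unfolding naturalD(4)[OF n] adj_restrict[OF T] by blast+
qed

lemma dagger_dagger:
  "\<lbrakk>hilbert_module C E; hilbert_module C F; T \<in> adj E F\<rbrakk> \<Longrightarrow> dagger F E (dagger E F T) = T"
  by (rule dagger_eq[OF _ _ dagger_adj(2)])

lemma opn_dagger:
  assumes "hilbert_module C E" "hilbert_module C F" "T \<in> adj E F"
  shows "opn F E (dagger E F T) = opn E F T"
proof (rule antisym)
  show "opn F E (dagger E F T) \<le> opn E F T"
    by (rule opn_le[OF opn_nonneg[OF assms(3)] dagger_bound[OF assms]])
  show "opn E F T \<le> opn F E (dagger E F T)"
    using opn_le[OF opn_nonneg dagger_bound, OF _ assms(2,1)] dagger_adj(1)[OF assms] dagger_dagger[OF assms] by metis
qed

definition op_comp where "op_comp E S T = (\<lambda>x\<in>Ob C. \<lambda>e\<in>elts E x. S x (T x e))"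

lemma op_comp_apply [simp]: "x \<in> Ob C \<Longrightarrow> e \<in> elts E x \<Longrightarrow> op_comp E S T x e = S x (T x e)"
  by (simp add: op_comp_def)

lemma op_comp_bound:
  assumes E: "hilbert_module C E" and F: "hilbert_module C F" and G: "hilbert_module C G"
    and T: "T \<in> adj E F" and S: "S \<in> adj F G" and x: "x \<in> Ob C" "e \<in> elts E x"
  shows "module_norm C G x (S x (T x e)) \<le> (opn F G S * opn E F T) * module_norm C E x e"
proof -
  have "module_norm C G x (S x (T x e)) \<le> opn F G S * module_norm C F x (T x e)"
    using opn_bound[OF F G S x(1) adj_closed[OF T x]] .
  also have "\<dots> \<le> opn F G S * (opn E F T * module_norm C E x e)"
    using opn_bound[OF E F T x] opn_nonneg[OF S] by (rule mult_left_mono)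
  finally show ?thesis by (simp add: mult.assoc)
qed

lemma op_comp_adj:
  assumes E: "hilbert_module C E" and F: "hilbert_module C F" and G: "hilbert_module C G"
    and T: "T \<in> adj E F" and S: "S \<in> adj F G"
  shows "op_comp E S T \<in> adj E G"
    and "dagger E G (op_comp E S T) = op_comp G (dagger E F T) (dagger F G S)"
    and "opn E G (op_comp E S T) \<le> opn F G S * opn E F T"
proof -
  note pT = adjoint_pairD[OF dagger_pair[OF E F T]] and pS = adjoint_pairD[OF dagger_pair[OF F G S]]
  have p: "adjoint_pair E G (\<lambda>x e. S x (T x e)) (\<lambda>x g. dagger E F T x (dagger F G S x g))"
    using pT pS by (auto simp: adjoint_pair_def)
  note a = adjoint_pair_adj[OF E G p op_comp_bound[OF assms]]
  show "op_comp E S T \<in> adj E G" unfolding op_comp_def by (rule a(1))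
  show "dagger E G (op_comp E S T) = op_comp G (dagger E F T) (dagger F G S)"
    unfolding op_comp_def by (rule dagger_eq[OF E G a(2)])
  show "opn E G (op_comp E S T) \<le> opn F G S * opn E F T"
    using opn_nonneg[OF T] opn_nonneg[OF S] op_comp_bound[OF assms]
    by (intro opn_le mult_nonneg_nonneg) auto
qed

abbreviation "adjsp \<equiv> adjointable_space C"

lemma adjsp_simps [simp]:
  "carrier (adjsp E F) = adj E F"
  "nrm (adjsp E F) = opn E F"
  "x \<in> Ob C \<Longrightarrow> e \<in> elts E x \<Longrightarrow> (S \<oplus>\<^bsub>adjsp E F\<^esub> T) x e = S x e \<oplus>\<^bsub>fibre F x\<^esub> T x e"
  "x \<in> Ob C \<Longrightarrow> e \<in> elts E x \<Longrightarrow> (c \<odot>\<^bsub>adjsp E F\<^esub> T) x e = c \<odot>\<^bsub>fibre F x\<^esub> T x e"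
  "x \<in> Ob C \<Longrightarrow> e \<in> elts E x \<Longrightarrow> \<zero>\<^bsub>adjsp E F\<^esub> x e = \<zero>\<^bsub>fibre F x\<^esub>"
  by (simp_all add: adjointable_space_def)

context
  fixes E F :: "('o, 'm, 'e) hilbert_module_data"
  assumes E: "hilbert_module C E" and F: "hilbert_module C F"
begin

interpretation E: hilbert_cstar_module C E by (rule hilbert_cstar_moduleI[OF E])
interpretation F: hilbert_cstar_module C F by (rule hilbert_cstar_moduleI[OF F])

lemma adj_add_bound:
  assumes S: "S \<in> adj E F" and T: "T \<in> adj E F" and x: "x \<in> Ob C" "e \<in> elts E x"
  shows "module_norm C F x (S x e \<oplus>\<^bsub>fibre F x\<^esub> T x e) \<le> (opn E F S + opn E F T) * module_norm C E x e"
  using F.module_norm_triangle[OF x(1) adj_closed[OF S x] adj_closed[OF T x]]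
    opn_bound[OF E F S x] opn_bound[OF E F T x] by (simp add: distrib_right)

lemma adj_add:
  assumes S: "S \<in> adj E F" and T: "T \<in> adj E F"
  shows "S \<oplus>\<^bsub>adjsp E F\<^esub> T \<in> adj E F"
    and "dagger E F (S \<oplus>\<^bsub>adjsp E F\<^esub> T) = dagger E F S \<oplus>\<^bsub>adjsp F E\<^esub> dagger E F T"
    and "opn E F (S \<oplus>\<^bsub>adjsp E F\<^esub> T) \<le> opn E F S + opn E F T"
proof -
  note pT = adjoint_pairD[OF dagger_pair[OF E F T]] and pS = adjoint_pairD[OF dagger_pair[OF E F S]]
  have p: "adjoint_pair E F (\<lambda>x e. S x e \<oplus>\<^bsub>fibre F x\<^esub> T x e) (\<lambda>x f. dagger E F S x f \<oplus>\<^bsub>fibre E x\<^esub> dagger E F T x f)"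
    unfolding adjoint_pair_def
    using pT pS complex_space.axioms[OF E.fibre_space] complex_space.axioms[OF F.fibre_space]
    by (auto simp: E.inn_add_right F.inn_add_left intro!: abelian_monoid.a_closed abelian_group.axioms Module.module.axioms)
  note a = adjoint_pair_adj[OF E F p adj_add_bound[OF assms]]
  show "S \<oplus>\<^bsub>adjsp E F\<^esub> T \<in> adj E F" using a(1) by (simp add: adjointable_space_def)
  show "dagger E F (S \<oplus>\<^bsub>adjsp E F\<^esub> T) = dagger E F S \<oplus>\<^bsub>adjsp F E\<^esub> dagger E F T"
    using dagger_eq[OF E F a(2)] by (simp add: adjointable_space_def)
  show "opn E F (S \<oplus>\<^bsub>adjsp E F\<^esub> T) \<le> opn E F S + opn E F T"
    using opn_nonneg[OF T] opn_nonneg[OF S] adj_add_bound[OF assms] by (intro opn_le) auto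
qed

lemma adj_smult:
  assumes T: "T \<in> adj E F"
  shows "c \<odot>\<^bsub>adjsp E F\<^esub> T \<in> adj E F"
    and "dagger E F (c \<odot>\<^bsub>adjsp E F\<^esub> T) = cnj c \<odot>\<^bsub>adjsp F E\<^esub> dagger E F T"
    and "opn E F (c \<odot>\<^bsub>adjsp E F\<^esub> T) \<le> cmod c * opn E F T"
proof -
  note pT = adjoint_pairD[OF dagger_pair[OF E F T]]
  have p: "adjoint_pair E F (\<lambda>x e. c \<odot>\<^bsub>fibre F x\<^esub> T x e) (\<lambda>x f. cnj c \<odot>\<^bsub>fibre E x\<^esub> dagger E F T x f)"
    unfolding adjoint_pair_def
    using pT complex_space.smult_mem[OF E.fibre_space] complex_space.smult_mem[OF F.fibre_space]
    by (auto simp: E.inn_smult_right F.inn_smult_left)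
  have b: "module_norm C F x (c \<odot>\<^bsub>fibre F x\<^esub> T x e) \<le> (cmod c * opn E F T) * module_norm C E x e"
    if x: "x \<in> Ob C" "e \<in> elts E x" for x e
    using opn_bound[OF E F T x] adj_closed[OF T x] x by (simp add: F.module_norm_smult mult.assoc mult_left_mono)
  note a = adjoint_pair_adj[OF E F p b]
  show "c \<odot>\<^bsub>adjsp E F\<^esub> T \<in> adj E F" using a(1) by (simp add: adjointable_space_def)
  show "dagger E F (c \<odot>\<^bsub>adjsp E F\<^esub> T) = cnj c \<odot>\<^bsub>adjsp F E\<^esub> dagger E F T"
    using dagger_eq[OF E F a(2)] by (simp add: adjointable_space_def)
  show "opn E F (c \<odot>\<^bsub>adjsp E F\<^esub> T) \<le> cmod c * opn E F T"
    using opn_nonneg[OF T] b by (intro opn_le) auto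
qed

lemma adj_zero: "\<zero>\<^bsub>adjsp E F\<^esub> \<in> adj E F"
proof -
  have c: "\<zero>\<^bsub>fibre E x\<^esub> \<in> elts E x" "\<zero>\<^bsub>fibre F x\<^esub> \<in> elts F x" if "x \<in> Ob C" for x
  proof -
    interpret VE: complex_space "fibre E x" by (rule E.fibre_space[OF that])
    interpret VF: complex_space "fibre F x" by (rule F.fibre_space[OF that])
    show "\<zero>\<^bsub>fibre E x\<^esub> \<in> elts E x" "\<zero>\<^bsub>fibre F x\<^esub> \<in> elts F x" by simp_all
  qed
  have "inn F x y \<zero>\<^bsub>fibre F y\<^esub> f = inn E x y e \<zero>\<^bsub>fibre E x\<^esub>"
    if "x \<in> Ob C" "y \<in> Ob C" "e \<in> elts E y" "f \<in> elts F x" for x y e f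
    using that F.inn_zero_left complex_linear_zero[OF E.fibre_vector_space hom_space E.inn_linear_right] by simp
  hence p: "adjoint_pair E F (\<lambda>x e. \<zero>\<^bsub>fibre F x\<^esub>) (\<lambda>x f. \<zero>\<^bsub>fibre E x\<^esub>)"
    using c by (auto simp: adjoint_pair_def)
  have "(\<lambda>x\<in>Ob C. \<lambda>e\<in>elts E x. \<zero>\<^bsub>fibre F x\<^esub>) \<in> adj E F"
  proof (rule adjoint_pair_adj(1)[OF E F p])
    show "module_norm C F x \<zero>\<^bsub>fibre F x\<^esub> \<le> 0 * module_norm C E x e" if "x \<in> Ob C" for x e
      using F.module_norm_eq_zero[OF that c(2)[OF that]] by simp
  qed
  thus ?thesis by (simp add: adjointable_space_def)
qed

lemma adj_vector_space: "complex_vector_space (adjsp E F)"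
proof (rule moduleI[OF cring_complex_field])
  note cl = adj_add(1) adj_smult(1) adj_zero
  have VF: "complex_space (fibre F x)" if "x \<in> Ob C" for x by (rule F.fibre_space[OF that])
  note ab = Module.module.axioms(2)[OF complex_space.axioms[OF VF]]
  note am = abelian_group.axioms(1)[OF ab]
  show "abelian_group (adjsp E F)"
  proof (rule abelian_groupI)
    fix S T U assume S: "S \<in> carrier (adjsp E F)" and T: "T \<in> carrier (adjsp E F)" and U: "U \<in> carrier (adjsp E F)"
    show "S \<oplus>\<^bsub>adjsp E F\<^esub> T \<in> carrier (adjsp E F)" using S T cl by simp
    show "S \<oplus>\<^bsub>adjsp E F\<^esub> T \<oplus>\<^bsub>adjsp E F\<^esub> U = S \<oplus>\<^bsub>adjsp E F\<^esub> (T \<oplus>\<^bsub>adjsp E F\<^esub> U)"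
      using S T U cl by (intro adj_ext[of _ E F]) (simp_all add: abelian_monoid.a_assoc[OF am] adj_closed)
    show "S \<oplus>\<^bsub>adjsp E F\<^esub> T = T \<oplus>\<^bsub>adjsp E F\<^esub> S"
      using S T cl by (intro adj_ext[of _ E F]) (simp_all add: abelian_monoid.a_comm[OF am] adj_closed)
    show "\<zero>\<^bsub>adjsp E F\<^esub> \<oplus>\<^bsub>adjsp E F\<^esub> S = S"
      using S cl by (intro adj_ext[of _ E F]) (simp_all add: abelian_monoid.l_zero[OF am] adj_closed)
    show "\<exists>T\<in>carrier (adjsp E F). T \<oplus>\<^bsub>adjsp E F\<^esub> S = \<zero>\<^bsub>adjsp E F\<^esub>"
    proof (intro bexI[of _ "(-1) \<odot>\<^bsub>adjsp E F\<^esub> S"])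
      show "(-1) \<odot>\<^bsub>adjsp E F\<^esub> S \<oplus>\<^bsub>adjsp E F\<^esub> S = \<zero>\<^bsub>adjsp E F\<^esub>"
        using S cl by (intro adj_ext[of _ E F])
          (simp_all add: adj_closed abelian_group.l_neg[OF ab] flip: complex_space.uminus_eq[OF VF])
    qed (use S cl in simp)
  qed (use cl in simp)
  fix a b :: complex and S T assume S: "S \<in> carrier (adjsp E F)"
  show "a \<odot>\<^bsub>adjsp E F\<^esub> S \<in> carrier (adjsp E F)" using S cl by simp
  show "(a \<oplus>\<^bsub>complex_field\<^esub> b) \<odot>\<^bsub>adjsp E F\<^esub> S = a \<odot>\<^bsub>adjsp E F\<^esub> S \<oplus>\<^bsub>adjsp E F\<^esub> b \<odot>\<^bsub>adjsp E F\<^esub> S"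
    using S cl by (intro adj_ext[of _ E F]) (simp_all add: complex_space.smult_add_left[OF VF] adj_closed)
  show "(a \<otimes>\<^bsub>complex_field\<^esub> b) \<odot>\<^bsub>adjsp E F\<^esub> S = a \<odot>\<^bsub>adjsp E F\<^esub> (b \<odot>\<^bsub>adjsp E F\<^esub> S)"
    using S cl by (intro adj_ext[of _ E F]) (simp_all add: complex_space.smult_smult[OF VF] adj_closed)
  show "\<one>\<^bsub>complex_field\<^esub> \<odot>\<^bsub>adjsp E F\<^esub> S = S"
    using S cl by (intro adj_ext[of _ E F]) (simp_all add: complex_space.smult_1[OF VF] adj_closed)
  assume T: "T \<in> carrier (adjsp E F)"
  show "a \<odot>\<^bsub>adjsp E F\<^esub> (S \<oplus>\<^bsub>adjsp E F\<^esub> T) = a \<odot>\<^bsub>adjsp E F\<^esub> S \<oplus>\<^bsub>adjsp E F\<^esub> a \<odot>\<^bsub>adjsp E F\<^esub> T"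
    using S T cl by (intro adj_ext[of _ E F]) (simp_all add: complex_space.smult_add_right[OF VF] adj_closed)
qed

interpretation V: complex_space "adjsp E F" by (rule complex_spaceI[OF adj_vector_space])

lemma adj_diff:
  assumes "S \<in> adj E F" "T \<in> adj E F"
  shows "S \<ominus>\<^bsub>adjsp E F\<^esub> T \<in> adj E F"
    and "\<lbrakk>x \<in> Ob C; e \<in> elts E x\<rbrakk> \<Longrightarrow> (S \<ominus>\<^bsub>adjsp E F\<^esub> T) x e = S x e \<ominus>\<^bsub>fibre F x\<^esub> T x e"
proof -
  show "S \<ominus>\<^bsub>adjsp E F\<^esub> T \<in> adj E F" using V.M.minus_closed[of S T] assms by simp
  assume x: "x \<in> Ob C" "e \<in> elts E x"
  interpret VF: complex_space "fibre F x" by (rule F.fibre_space[OF x(1)])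
  show "(S \<ominus>\<^bsub>adjsp E F\<^esub> T) x e = S x e \<ominus>\<^bsub>fibre F x\<^esub> T x e"
    using assms x adj_closed[OF assms(2) x]
    by (simp add: V.M.minus_eq V.uminus_eq VF.M.minus_eq VF.uminus_eq)
qed

lemma adj_normed: "carrier_normed_space (adjsp E F) (opn E F)"
proof (intro carrier_normed_space.intro carrier_normed_space_axioms.intro V.complex_space_axioms)
  fix S T c assume S: "S \<in> carrier (adjsp E F)"
  show "0 \<le> opn E F S" using S opn_nonneg by simp
  show "opn E F S = 0 \<longleftrightarrow> S = \<zero>\<^bsub>adjsp E F\<^esub>"
  proof
    assume 0: "opn E F S = 0"
    show "S = \<zero>\<^bsub>adjsp E F\<^esub>"
    proof (rule adj_ext[of _ E F])
      fix x e assume x: "x \<in> Ob C" "e \<in> elts E x"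
      have "S x e \<in> elts F x" using S x adj_closed by simp
      moreover have "module_norm C F x (S x e) \<le> 0" using opn_bound[OF E F _ x, of S] S 0 by simp
      ultimately have "S x e = \<zero>\<^bsub>fibre F x\<^esub>"
        using F.module_norm_eq_zero[OF x(1)] F.module_norm_nonneg[OF x(1)] by force
      thus "S x e = \<zero>\<^bsub>adjsp E F\<^esub> x e" using x by simp
    qed (use S adj_zero in auto)
  next
    assume S0: "S = \<zero>\<^bsub>adjsp E F\<^esub>"
    have "opn E F S \<le> 0"
    proof (rule opn_le)
      show "module_norm C F x (S x e) \<le> 0 * module_norm C E x e" if "x \<in> Ob C" "e \<in> elts E x" for x e
      proof -
        have "\<zero>\<^bsub>fibre F x\<^esub> \<in> elts F x" using adj_closed[OF adj_zero that] that by simp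
        hence "module_norm C F x \<zero>\<^bsub>fibre F x\<^esub> = 0" using F.module_norm_eq_zero[OF that(1)] by blast
        thus ?thesis using that by (simp add: S0)
      qed
    qed simp
    thus "opn E F S = 0" using opn_nonneg[of S E F] S by simp
  qed
  show "opn E F (c \<odot>\<^bsub>adjsp E F\<^esub> S) = cmod c * opn E F S"
  proof (cases "c = 0")
    case True
    have "0 \<odot>\<^bsub>adjsp E F\<^esub> S = \<zero>\<^bsub>adjsp E F\<^esub>" using V.smult_0[OF S] .
    thus ?thesis using adj_smult(3)[of S 0] opn_nonneg[OF adj_smult(1), of S 0] S True by simp
  next
    case False
    have "S = (1 / c) \<odot>\<^bsub>adjsp E F\<^esub> (c \<odot>\<^bsub>adjsp E F\<^esub> S)" using V.smult_smult[OF S] V.smult_1[OF S] False by simp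
    hence "opn E F S \<le> cmod (1 / c) * opn E F (c \<odot>\<^bsub>adjsp E F\<^esub> S)"
      using adj_smult(3)[OF adj_smult(1), of S "1 / c" c] S by simp
    thus ?thesis using adj_smult(3)[of S c] S False by (simp add: norm_divide field_simps)
  qed
  assume "T \<in> carrier (adjsp E F)"
  thus "opn E F (S \<oplus>\<^bsub>adjsp E F\<^esub> T) \<le> opn E F S + opn E F T" using S adj_add(3) by simp
qed

end

lemma dagger_diff:
  assumes E: "hilbert_module C E" and F: "hilbert_module C F" and "S \<in> adj E F" "T \<in> adj E F"
  shows "dagger E F (S \<ominus>\<^bsub>adjsp E F\<^esub> T) = dagger E F S \<ominus>\<^bsub>adjsp F E\<^esub> dagger E F T"
proof (rule conjugate_linear_diff[OF adj_vector_space[OF E F] adj_vector_space[OF F E]])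
  show "conjugate_linear (adjsp E F) (adjsp F E) (dagger E F)"
    unfolding conjugate_linear_def using adj_add(2)[OF E F] adj_smult(2)[OF E F] dagger_adj(1)[OF E F] by auto
qed (use assms in auto)

end

section \<open>The \<open>C\<^sup>*\<close>-category of Hilbert modules\<close>

context carrier_normed_space
begin

text \<open>The method of continuity. For large \<open>s\<close> the equation is solved by the Neumann series. If \<open>H - s' l\<close> is onto,
its inverse has norm at most \<open>1 / (s' d)\<close>, and a perturbation argument shows that \<open>H - s l\<close> is onto for
\<open>s = (1 - c) s'\<close>. The factor \<open>1 - c\<close> does not depend on \<open>s'\<close>, so finitely many steps reach any \<open>s > 0\<close>.\<close>

lemma surjective_along_ray:
  assumes comp: "complete_wrt V n" and H: "endo H"
    and M: "\<And>v. v \<in> carrier V \<Longrightarrow> n (H v) \<le> M * n v" and l: "l \<noteq> 0" and d: "d > 0"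
    and lower: "\<And>s v. s > 0 \<Longrightarrow> v \<in> carrier V \<Longrightarrow> s * d * n v \<le> n (H v \<ominus> (of_real s * l) \<odot> v)"
    and s: "s > 0" and w: "w \<in> carrier V"
  shows "\<exists>v\<in>carrier V. H v \<ominus> (of_real s * l) \<odot> v = w"
proof -
  define surj where "surj s \<longleftrightarrow> (\<forall>w\<in>carrier V. \<exists>v\<in>carrier V. H v \<ominus> (of_real s * l) \<odot> v = w)" for s :: real
  \<comment> \<open>Chosen so that the fixed point map below has contraction constant \<open>c \<bar>l\<bar> / d \<le> 1/2\<close>.\<close>
  define c where "c = min (1/2) (d / (2 * cmod l))"
  have l0: "cmod l > 0" using l by simp
  have c: "0 < c" "c \<le> 1/2" "c * cmod l / d \<le> 1/2"
    using d l0 by (auto simp: c_def min_def field_simps)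
  have step: "surj s" if s: "s > 0" and sj: "surj (s / (1 - c))" for s
  proof -
    define s' where "s' = s / (1 - c)"
    have s': "s' > 0" "s' - s = c * s'" using s c by (auto simp: s'_def field_simps)
    define g where "g w = (SOME v. v \<in> carrier V \<and> H v \<ominus> (of_real s' * l) \<odot> v = w)" for w
    have g: "g w \<in> carrier V \<and> H (g w) \<ominus> (of_real s' * l) \<odot> g w = w" if "w \<in> carrier V" for w
    proof -
      have "\<exists>v. v \<in> carrier V \<and> H v \<ominus> (of_real s' * l) \<odot> v = w"
        using sj that by (auto simp: surj_def s'_def)
      thus ?thesis unfolding g_def by (rule someI_ex)
    qed
    show ?thesis
      unfolding surj_def
    proof
      fix w assume w: "w \<in> carrier V"
      \<comment> \<open>A fixed point \<open>v\<close> satisfies \<open>(H - s' l) v = w - k v\<close>, that is, \<open>(H - s l) v = w\<close>.\<close>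
      define k where "k = of_real (s' - s) * l"
      have "\<exists>v\<in>carrier V. g (w \<ominus> k \<odot> v) = v"
      proof (rule contraction_fixed_point[OF comp])
        show "g (w \<ominus> k \<odot> v) \<in> carrier V" if "v \<in> carrier V" for v using g w that by simp
        show "(1/2 :: real) < 1" by simp
        fix u v assume u: "u \<in> carrier V" and v: "v \<in> carrier V"
        define p q where "p = g (w \<ominus> k \<odot> u)" and "q = g (w \<ominus> k \<odot> v)"
        have p: "p \<in> carrier V" "H p \<ominus> (of_real s' * l) \<odot> p = w \<ominus> k \<odot> u"
          using g[of "w \<ominus> k \<odot> u"] w u by (auto simp: p_def)
        have q: "q \<in> carrier V" "H q \<ominus> (of_real s' * l) \<odot> q = w \<ominus> k \<odot> v"
          using g[of "w \<ominus> k \<odot> v"] w v by (auto simp: q_def)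
        have "H (p \<ominus> q) \<ominus> (of_real s' * l) \<odot> (p \<ominus> q) =
            (H p \<ominus> (of_real s' * l) \<odot> p) \<ominus> (H q \<ominus> (of_real s' * l) \<odot> q)"
        proof -
          have "(p' \<ominus> q') \<ominus> a \<odot> (p \<ominus> q) = (p' \<ominus> a \<odot> p) \<ominus> (q' \<ominus> a \<odot> q)"
            if "p' \<in> carrier V" "q' \<in> carrier V" for p' q' a
            using p(1) q(1) that by - (rule linear_identity4[of p q p' q']; simp add: algebra_simps)
          thus ?thesis using p(1) q(1) complex_linearD(1)[OF H] by (simp add: endo_diff[OF H])
        qed
        also have "\<dots> = (- k) \<odot> (u \<ominus> v)"
          unfolding p(2) q(2) using u v w by - (rule linear_identity3[of u v w]; simp)
        finally have "s' * d * n (p \<ominus> q) \<le> n ((- k) \<odot> (u \<ominus> v))"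
          using lower[OF s'(1), of "p \<ominus> q"] p(1) q(1) by simp
        also have "\<dots> = (c * s' * cmod l) * n (u \<ominus> v)"
        proof -
          have "cmod (- k) = \<bar>s' - s\<bar> * cmod l" unfolding k_def norm_minus_cancel norm_mult norm_of_real ..
          also have "\<bar>s' - s\<bar> = c * s'" unfolding s'(2) using c s' by simp
          finally show ?thesis using u v by (simp add: scale)
        qed
        finally have "s' * (d * n (p \<ominus> q)) \<le> s' * (c * cmod l * n (u \<ominus> v))"
          by (simp only: mult_ac)
        hence "d * n (p \<ominus> q) \<le> c * cmod l * n (u \<ominus> v)"
          using s'(1) by (simp only: mult_le_cancel_left_pos)
        with d have "n (p \<ominus> q) \<le> (c * cmod l * n (u \<ominus> v)) / d"
          by (simp only: pos_le_divide_eq mult.commute[of "n (p \<ominus> q)" d])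
        hence "n (p \<ominus> q) \<le> (c * cmod l / d) * n (u \<ominus> v)" by simp
        also have "\<dots> \<le> 1/2 * n (u \<ominus> v)" using c u v by (intro mult_right_mono nonneg) auto
        finally show "n (g (w \<ominus> k \<odot> u) \<ominus> g (w \<ominus> k \<odot> v)) \<le> 1/2 * n (u \<ominus> v)"
          by (simp add: p_def q_def)
      qed
      then obtain v where v: "v \<in> carrier V" "g (w \<ominus> k \<odot> v) = v" by blast
      have 1: "H v \<ominus> (of_real s' * l) \<odot> v = w \<ominus> k \<odot> v" using g[of "w \<ominus> k \<odot> v"] v w by simp
      have "H v \<ominus> (of_real s * l) \<odot> v = (H v \<ominus> (of_real s' * l) \<odot> v) \<oplus> k \<odot> v"
        unfolding k_def using v(1) complex_linearD(1)[OF H v(1)]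
        by - (rule linear_identity2[of v "H v"]; simp add: algebra_simps)
      also have "\<dots> = w" unfolding 1 using v(1) w by (simp add: diff_add_cancel)
      finally show "\<exists>v\<in>carrier V. H v \<ominus> (of_real s * l) \<odot> v = w" using v(1) by blast
    qed
  qed
  have iter: "surj s" if "s > 0" "surj (s / (1 - c) ^ k)" for s k
    using that
  proof (induction k arbitrary: s)
    case (Suc k)
    have "surj (s / (1 - c) / (1 - c) ^ k)" using Suc.prems(2) by simp
    moreover have "s / (1 - c) > 0" using Suc.prems(1) c by simp
    ultimately have "surj (s / (1 - c))" by (rule Suc.IH[rotated])
    thus ?case using step Suc.prems by blast
  qed simp
  have "(\<lambda>k. (1 - c) ^ k) \<longlonglongrightarrow> 0" using c by (intro LIMSEQ_realpow_zero) auto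
  hence "eventually (\<lambda>k. (1 - c) ^ k < s * cmod l / (\<bar>M\<bar> + 1)) sequentially"
    using s l0 by (intro order_tendstoD) (auto intro!: divide_pos_pos)
  then obtain k where k: "(1 - c) ^ k < s * cmod l / (\<bar>M\<bar> + 1)" by (auto simp: eventually_sequentially)
  define S where "S = s / (1 - c) ^ k"
  have c': "(1 - c) ^ k > 0" using c by simp
  have S: "S > 0" using s c' by (simp add: S_def)
  have "(1 - c) ^ k * (\<bar>M\<bar> + 1) < s * cmod l" using k by (simp add: pos_less_divide_eq)
  hence "\<bar>M\<bar> + 1 < (s * cmod l) / (1 - c) ^ k"
    using c' by (simp only: pos_less_divide_eq mult.commute[of "(1 - c) ^ k"])
  hence "\<bar>M\<bar> + 1 < S * cmod l" by (simp add: S_def)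
  moreover have "cmod (of_real S * l) = S * cmod l" using S by (simp add: norm_mult)
  ultimately have "resolvable H (of_real S * l)"
    using S l by (intro resolvable_outside_bound[OF comp H M]) auto
  hence "surj S" by (auto simp: resolvable_def surj_def)
  hence "surj s" using iter[OF s] by (simp add: S_def)
  thus ?thesis using w by (simp add: surj_def)
qed

end

context cstar_category
begin

lemma adj_cauchy_pointwise:
  fixes s :: "nat \<Rightarrow> 'o \<Rightarrow> 'e \<Rightarrow> 'e"
  assumes E: "hilbert_module C E" and F: "hilbert_module C F" and s: "\<And>i. s i \<in> adj E F"
    and c: "\<And>\<epsilon>. \<epsilon> > 0 \<Longrightarrow> \<exists>N. \<forall>i\<ge>N. \<forall>j\<ge>N. opn E F (s i \<ominus>\<^bsub>adjsp E F\<^esub> s j) < \<epsilon>"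
  shows "\<exists>t. \<forall>x\<in>Ob C. \<forall>e\<in>elts E x. t x e \<in> elts F x \<and>
    (\<lambda>i. module_norm C F x (s i x e \<ominus>\<^bsub>fibre F x\<^esub> t x e)) \<longlonglongrightarrow> 0"
proof -
  interpret E: hilbert_cstar_module C E by (rule hilbert_cstar_moduleI[OF E])
  interpret F: hilbert_cstar_module C F by (rule hilbert_cstar_moduleI[OF F])
  have "\<exists>l. l \<in> elts F x \<and> (\<lambda>i. module_norm C F x (s i x e \<ominus>\<^bsub>fibre F x\<^esub> l)) \<longlonglongrightarrow> 0"
    if x: "x \<in> Ob C" and e: "e \<in> elts E x" for x e
  proof -
    have "\<exists>N. \<forall>i\<ge>N. \<forall>j\<ge>N. module_norm C F x (s i x e \<ominus>\<^bsub>fibre F x\<^esub> s j x e) < \<epsilon>" if eps: "\<epsilon> > 0" for \<epsilon>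
    proof -
      have e0: "0 \<le> module_norm C E x e" using x e by simp
      have "\<epsilon> / (module_norm C E x e + 1) > 0" using eps e0 by simp
      then obtain N where N: "\<And>i j. i \<ge> N \<Longrightarrow> j \<ge> N \<Longrightarrow>
          opn E F (s i \<ominus>\<^bsub>adjsp E F\<^esub> s j) < \<epsilon> / (module_norm C E x e + 1)" using c by blast
      have "module_norm C F x (s i x e \<ominus>\<^bsub>fibre F x\<^esub> s j x e) < \<epsilon>" if "i \<ge> N" "j \<ge> N" for i j
      proof -
        have "module_norm C F x (s i x e \<ominus>\<^bsub>fibre F x\<^esub> s j x e) \<le> opn E F (s i \<ominus>\<^bsub>adjsp E F\<^esub> s j) * module_norm C E x e"
          using opn_bound[OF E F adj_diff(1)[OF E F s s] x e] adj_diff(2)[OF E F s s x e] by simp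
        also have "\<dots> \<le> \<epsilon> / (module_norm C E x e + 1) * module_norm C E x e"
          using N[OF that] e0 by (intro mult_right_mono) auto
        also have "\<dots> < \<epsilon>" using eps e0 by (simp add: field_simps)
        finally show ?thesis .
      qed
      thus ?thesis by blast
    qed
    moreover have "range (\<lambda>i. s i x e) \<subseteq> elts F x" using adj_closed[OF s x e] by blast
    ultimately show ?thesis using F.fibre_complete[OF x] unfolding complete_wrt_def
      by (auto dest!: spec[of _ "\<lambda>i. s i x e"])
  qed
  thus ?thesis by metis
qed

text \<open>A Cauchy sequence of operators and the sequence of their adjoints both converge pointwise; the limits
form an adjoint pair because inner products are continuous.\<close>

lemma adj_complete:
  fixes E F :: "('o, 'm, 'e) hilbert_module_data"
  assumes E: "hilbert_module C E" and F: "hilbert_module C F"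
  shows "complete_wrt (adjsp E F) (opn E F)"
  unfolding complete_wrt_def
proof (intro allI impI)
  fix s :: "nat \<Rightarrow> 'o \<Rightarrow> 'e \<Rightarrow> 'e"
  assume "range s \<subseteq> carrier (adjsp E F)"
    and "\<forall>\<epsilon>>0. \<exists>N. \<forall>i\<ge>N. \<forall>j\<ge>N. opn E F (s i \<ominus>\<^bsub>adjsp E F\<^esub> s j) < \<epsilon>"
  hence s: "s i \<in> adj E F" and c: "\<epsilon> > 0 \<Longrightarrow> \<exists>N. \<forall>i\<ge>N. \<forall>j\<ge>N. opn E F (s i \<ominus>\<^bsub>adjsp E F\<^esub> s j) < \<epsilon>" for i \<epsilon>
    by (auto simp: image_subset_iff)
  interpret E: hilbert_cstar_module C E by (rule hilbert_cstar_moduleI[OF E])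
  interpret F: hilbert_cstar_module C F by (rule hilbert_cstar_moduleI[OF F])
  define d where "d i = dagger E F (s i)" for i
  have d: "d i \<in> adj F E" for i unfolding d_def by (rule dagger_adj(1)[OF E F s])
  have "opn F E (d i \<ominus>\<^bsub>adjsp F E\<^esub> d j) = opn E F (s i \<ominus>\<^bsub>adjsp E F\<^esub> s j)" for i j
    unfolding d_def by (simp add: opn_dagger[OF E F adj_diff(1)[OF E F s s]] flip: dagger_diff[OF E F s s])
  hence "\<epsilon> > 0 \<Longrightarrow> \<exists>N. \<forall>i\<ge>N. \<forall>j\<ge>N. opn F E (d i \<ominus>\<^bsub>adjsp F E\<^esub> d j) < \<epsilon>" for \<epsilon>
    using c by simp
  from adj_cauchy_pointwise[OF F E d this] obtain u where
    u: "\<And>x f. x \<in> Ob C \<Longrightarrow> f \<in> elts F x \<Longrightarrow> u x f \<in> elts E x"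
      "\<And>x f. x \<in> Ob C \<Longrightarrow> f \<in> elts F x \<Longrightarrow> (\<lambda>i. module_norm C E x (d i x f \<ominus>\<^bsub>fibre E x\<^esub> u x f)) \<longlonglongrightarrow> 0"
    by blast
  from adj_cauchy_pointwise[OF E F s c] obtain t where
    t: "\<And>x e. x \<in> Ob C \<Longrightarrow> e \<in> elts E x \<Longrightarrow> t x e \<in> elts F x"
      "\<And>x e. x \<in> Ob C \<Longrightarrow> e \<in> elts E x \<Longrightarrow> (\<lambda>i. module_norm C F x (s i x e \<ominus>\<^bsub>fibre F x\<^esub> t x e)) \<longlonglongrightarrow> 0"
    by blast
  have p: "adjoint_pair E F t u"
    unfolding adjoint_pair_def
  proof (intro conjI ballI t(1) u(1))
    fix x y e f assume x: "x \<in> Ob C" and y: "y \<in> Ob C" and e: "e \<in> elts E y" and f: "f \<in> elts F x"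
    interpret B: carrier_normed_space "homsp C x y" "nrm (homsp C x y)" by (rule hom_normed[OF x y])
    have sd: "inn F x y (s i y e) f = inn E x y e (d i x f)" for i
      using adjoint_pairD(3)[OF dagger_pair[OF E F s] x y e f] by (simp add: d_def)
    show "inn F x y (t y e) f = inn E x y e (u x f)"
    proof (rule B.limit_unique)
      show "inn F x y (s i y e) f \<in> hom C x y" for i using x y e f adj_closed[OF s] by simp
      show "(\<lambda>i. nrm (homsp C x y) (inn F x y (s i y e) f \<ominus>\<^bsub>homsp C x y\<^esub> inn F x y (t y e) f)) \<longlonglongrightarrow> 0"
        using F.inn_tendsto_left[OF x y f adj_closed[OF s y e] t(1)[OF y e] t(2)[OF y e]] .
      show "(\<lambda>i. nrm (homsp C x y) (inn F x y (s i y e) f \<ominus>\<^bsub>homsp C x y\<^esub> inn E x y e (u x f))) \<longlonglongrightarrow> 0"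
        unfolding sd using E.inn_tendsto_right[OF x y e adj_closed[OF d x f] u(1)[OF x f] u(2)[OF x f]] .
    qed (use x y e f t u in auto)
  qed
  have unif: "module_norm C F x (s i x e \<ominus>\<^bsub>fibre F x\<^esub> t x e) \<le> \<epsilon> * module_norm C E x e"
    if N: "\<And>i j. i \<ge> N \<Longrightarrow> j \<ge> N \<Longrightarrow> opn E F (s i \<ominus>\<^bsub>adjsp E F\<^esub> s j) < \<epsilon>" and i: "i \<ge> N"
      and x: "x \<in> Ob C" and e: "e \<in> elts E x" for N \<epsilon> i x e
  proof -
    interpret VF: carrier_normed_space "fibre F x" "module_norm C F x" by (rule F.fibre_normed[OF x])
    have lim: "(\<lambda>j. \<epsilon> * module_norm C E x e + module_norm C F x (s j x e \<ominus>\<^bsub>fibre F x\<^esub> t x e)) \<longlonglongrightarrow> \<epsilon> * module_norm C E x e + 0"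
      by (intro tendsto_intros t(2) x e)
    have "\<exists>N. \<forall>j\<ge>N. module_norm C F x (s i x e \<ominus>\<^bsub>fibre F x\<^esub> t x e) \<le>
        \<epsilon> * module_norm C E x e + module_norm C F x (s j x e \<ominus>\<^bsub>fibre F x\<^esub> t x e)"
    proof (intro exI allI impI)
      fix j assume j: "j \<ge> N"
      have "module_norm C F x (s i x e \<ominus>\<^bsub>fibre F x\<^esub> t x e) \<le>
          module_norm C F x (s i x e \<ominus>\<^bsub>fibre F x\<^esub> s j x e) + module_norm C F x (s j x e \<ominus>\<^bsub>fibre F x\<^esub> t x e)"
        using adj_closed[OF s x e] t(1)[OF x e] by (intro VF.dist_triangle) auto
      also have "module_norm C F x (s i x e \<ominus>\<^bsub>fibre F x\<^esub> s j x e) \<le> opn E F (s i \<ominus>\<^bsub>adjsp E F\<^esub> s j) * module_norm C E x e"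
        using opn_bound[OF E F adj_diff(1)[OF E F s s] x e] adj_diff(2)[OF E F s s x e] by simp
      also have "\<dots> \<le> \<epsilon> * module_norm C E x e"
        using N[OF i j] x e by (intro mult_right_mono) auto
      finally show "module_norm C F x (s i x e \<ominus>\<^bsub>fibre F x\<^esub> t x e) \<le>
        \<epsilon> * module_norm C E x e + module_norm C F x (s j x e \<ominus>\<^bsub>fibre F x\<^esub> t x e)" by simp
    qed
    from LIMSEQ_le_const[OF lim this] show ?thesis by simp
  qed
  obtain N1 where N1: "\<And>i j. i \<ge> N1 \<Longrightarrow> j \<ge> N1 \<Longrightarrow> opn E F (s i \<ominus>\<^bsub>adjsp E F\<^esub> s j) < 1"
    using c[of 1] by auto
  have b: "module_norm C F x (t x e) \<le> (opn E F (s N1) + 1) * module_norm C E x e"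
    if x: "x \<in> Ob C" and e: "e \<in> elts E x" for x e
  proof -
    interpret VF: carrier_normed_space "fibre F x" "module_norm C F x" by (rule F.fibre_normed[OF x])
    have "module_norm C F x (t x e) \<le> module_norm C F x (s N1 x e) + module_norm C F x (t x e \<ominus>\<^bsub>fibre F x\<^esub> s N1 x e)"
      using adj_closed[OF s x e] t(1)[OF x e] by (intro VF.norm_le_diff)
    also have "module_norm C F x (t x e \<ominus>\<^bsub>fibre F x\<^esub> s N1 x e) = module_norm C F x (s N1 x e \<ominus>\<^bsub>fibre F x\<^esub> t x e)"
      using adj_closed[OF s x e] t(1)[OF x e] by (intro VF.norm_diff_commute)
    also have "\<dots> \<le> 1 * module_norm C E x e" by (rule unif[OF N1 order_refl x e])
    also have "module_norm C F x (s N1 x e) \<le> opn E F (s N1) * module_norm C E x e" by (rule opn_bound[OF E F s x e])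
    finally show ?thesis by (simp add: distrib_right)
  qed
  define T where "T = (\<lambda>x\<in>Ob C. \<lambda>e\<in>elts E x. t x e)"
  have T: "T \<in> adj E F" unfolding T_def by (rule adjoint_pair_adj(1)[OF E F p b])
  have "(\<lambda>i. opn E F (s i \<ominus>\<^bsub>adjsp E F\<^esub> T)) \<longlonglongrightarrow> 0"
  proof (rule LIMSEQ_I)
    fix r :: real assume r: "r > 0"
    then obtain N where N: "\<And>i j. i \<ge> N \<Longrightarrow> j \<ge> N \<Longrightarrow> opn E F (s i \<ominus>\<^bsub>adjsp E F\<^esub> s j) < r / 2"
      using c[of "r / 2"] by auto
    have "norm (opn E F (s i \<ominus>\<^bsub>adjsp E F\<^esub> T) - 0) < r" if i: "i \<ge> N" for i
    proof -
      have "opn E F (s i \<ominus>\<^bsub>adjsp E F\<^esub> T) \<le> r / 2"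
      proof (rule opn_le)
        fix x e assume x: "x \<in> Ob C" "e \<in> elts E x"
        have "(s i \<ominus>\<^bsub>adjsp E F\<^esub> T) x e = s i x e \<ominus>\<^bsub>fibre F x\<^esub> t x e"
          using adj_diff(2)[OF E F s T x] x by (simp add: T_def)
        thus "module_norm C F x ((s i \<ominus>\<^bsub>adjsp E F\<^esub> T) x e) \<le> r / 2 * module_norm C E x e"
          using unif[OF N i x] by simp
      qed (use r in simp)
      thus ?thesis using r opn_nonneg[OF adj_diff(1)[OF E F s T], of i] by simp
    qed
    thus "\<exists>N. \<forall>i\<ge>N. norm (opn E F (s i \<ominus>\<^bsub>adjsp E F\<^esub> T) - 0) < r" by blast
  qed
  thus "\<exists>l\<in>carrier (adjsp E F). (\<lambda>i. opn E F (s i \<ominus>\<^bsub>adjsp E F\<^esub> l)) \<longlonglongrightarrow> 0" using T by auto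
qed

lemma adj_banach:
  assumes E: "hilbert_module C E" and F: "hilbert_module C F"
  shows "complex_banach_space (adjsp E F)"
proof -
  interpret V: carrier_normed_space "adjsp E F" "opn E F" by (rule adj_normed[OF E F])
  show ?thesis
    by unfold_locales (simp_all add: V.nonneg[simplified] V.eq_zero[simplified] V.scale[simplified]
        V.triangle[simplified] adj_complete[OF E F])
qed

definition op_id where "op_id E = (\<lambda>x\<in>Ob C. \<lambda>e\<in>elts E x. e)"

lemma op_id_apply [simp]: "x \<in> Ob C \<Longrightarrow> e \<in> elts E x \<Longrightarrow> op_id E x e = e"
  by (simp add: op_id_def)

lemma op_id_adj: "hilbert_module C E \<Longrightarrow> op_id E \<in> adj E E"
  unfolding op_id_def by (rule adjoint_pair_adj(1)[of E E "\<lambda>x e. e" "\<lambda>x e. e" 1]) (auto simp: adjoint_pair_def)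

lemma op_comp_id:
  assumes E: "hilbert_module C E" and F: "hilbert_module C F" and T: "T \<in> adj E F"
  shows "op_comp E T (op_id E) = T" "op_comp E (op_id F) T = T"
  by (rule adj_ext[OF op_comp_adj(1)[OF E E F op_id_adj[OF E] T] T], simp)
     (rule adj_ext[OF op_comp_adj(1)[OF E F F T op_id_adj[OF F]] T], simp add: adj_closed[OF T])

lemma op_comp_linear_left:
  assumes E: "hilbert_module C E" and F: "hilbert_module C F" and G: "hilbert_module C G" and T: "T \<in> adj E F"
  shows "complex_linear (adjsp F G) (adjsp E G) (\<lambda>S. op_comp E S T)"
  unfolding complex_linear_def
  using op_comp_adj(1)[OF E F G T] adj_add(1)[OF F G] adj_smult(1)[OF F G] adj_add(1)[OF E G] adj_smult(1)[OF E G]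
  by (auto intro!: adj_ext[of _ E G] simp: adj_closed[OF T])

lemma op_comp_linear_right:
  assumes E: "hilbert_module C E" and F: "hilbert_module C F" and G: "hilbert_module C G" and S: "S \<in> adj F G"
  shows "complex_linear (adjsp E F) (adjsp E G) (\<lambda>T. op_comp E S T)"
  unfolding complex_linear_def
  using op_comp_adj(1)[OF E F G _ S] adj_add(1)[OF E F] adj_smult(1)[OF E F] adj_add(1)[OF E G] adj_smult(1)[OF E G]
  by (auto intro!: adj_ext[of _ E G] simp: adj_closed complex_linearD[OF adj_linear[OF S]])

lemma op_comp_assoc:
  assumes "hilbert_module C E" "hilbert_module C F" "hilbert_module C G" "hilbert_module C G'"
    and "T \<in> adj E F" "S \<in> adj F G" "R \<in> adj G G'"
  shows "op_comp E (op_comp F R S) T = op_comp E R (op_comp E S T)"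
  using assms by (intro adj_ext[of _ E G'] op_comp_adj(1)) (auto simp: adj_closed intro: op_comp_adj(1))

lemma opn_dagger_comp:
  assumes E: "hilbert_module C E" and F: "hilbert_module C F" and T: "T \<in> adj E F"
  shows "opn E E (op_comp E (dagger E F T) T) = (opn E F T)\<^sup>2"
proof (rule antisym)
  interpret E: hilbert_cstar_module C E by (rule hilbert_cstar_moduleI[OF E])
  interpret F: hilbert_cstar_module C F by (rule hilbert_cstar_moduleI[OF F])
  note D = dagger_adj(1)[OF E F T]
  let ?H = "op_comp E (dagger E F T) T"
  have H: "?H \<in> adj E E" by (rule op_comp_adj(1)[OF E F E T D])
  show "opn E E ?H \<le> (opn E F T)\<^sup>2"
    using op_comp_adj(3)[OF E F E T D] by (simp add: opn_dagger[OF E F T] power2_eq_square)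
  have "opn E F T \<le> sqrt (opn E E ?H)"
  proof (rule opn_le)
    show "0 \<le> sqrt (opn E E ?H)" using opn_nonneg[OF H] by simp
    fix x e assume x: "x \<in> Ob C" and e: "e \<in> elts E x"
    have Te: "T x e \<in> elts F x" by (rule adj_closed[OF T x e])
    have "(module_norm C F x (T x e))\<^sup>2 = nrm (homsp C x x) (inn E x x e (?H x e))"
      using x e Te adjoint_pairD(3)[OF dagger_pair[OF E F T] x x e Te] by (simp add: F.module_norm_square)
    also have "\<dots> \<le> module_norm C E x e * module_norm C E x (?H x e)"
      using E.cauchy_schwarz[OF x x e adj_closed[OF H x e]] .
    also have "\<dots> \<le> module_norm C E x e * (opn E E ?H * module_norm C E x e)"
      using opn_bound[OF E E H x e] x e by (intro mult_left_mono) auto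
    also have "\<dots> = (sqrt (opn E E ?H) * module_norm C E x e)\<^sup>2"
      using opn_nonneg[OF H] by (simp add: power2_eq_square[of "module_norm C E x e"] power_mult_distrib)
    finally show "module_norm C F x (T x e) \<le> sqrt (opn E E ?H) * module_norm C E x e"
      by (rule power2_le_imp_le) (use x e opn_nonneg[OF H] in auto)
  qed
  hence "(opn E F T)\<^sup>2 \<le> (sqrt (opn E E ?H))\<^sup>2" using opn_nonneg[OF T] by (rule power_mono)
  thus "(opn E F T)\<^sup>2 \<le> opn E E ?H" using opn_nonneg[OF H] by simp
qed

text \<open>The square of \<open>H e + r e\<close> is the sum of the positive elements \<open>\<langle>r e, r e\<rangle>\<close>, \<open>\<langle>H e, H e\<rangle>\<close> and \<open>2 r \<langle>e, H e\<rangle>\<close>. Any two of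
them can be dropped at the cost of decreasing the norm.\<close>

lemma shifted_positive_operator_norms:
  assumes E: "hilbert_module C E" and x: "x \<in> Ob C"
    and lin: "complex_linear (fibre E x) (fibre E x) H"
    and sym: "\<And>e f. e \<in> elts E x \<Longrightarrow> f \<in> elts E x \<Longrightarrow> inn E x x (H e) f = inn E x x e (H f)"
    and pos: "\<And>e. e \<in> elts E x \<Longrightarrow> norm_positive x (inn E x x e (H e))"
    and r: "r > 0" and e: "e \<in> elts E x"
  shows "r * module_norm C E x e \<le> module_norm C E x (H e \<oplus>\<^bsub>fibre E x\<^esub> complex_of_real r \<odot>\<^bsub>fibre E x\<^esub> e)"
    and "module_norm C E x (H e) \<le> module_norm C E x (H e \<oplus>\<^bsub>fibre E x\<^esub> complex_of_real r \<odot>\<^bsub>fibre E x\<^esub> e)"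
proof -
  interpret E: hilbert_cstar_module C E by (rule hilbert_cstar_moduleI[OF E])
  interpret VE: carrier_normed_space "fibre E x" "module_norm C E x" by (rule E.fibre_normed[OF x])
  interpret B: carrier_normed_space "homsp C x x" "nrm (homsp C x x)" by (rule hom_normed[OF x x])
  let ?B = "homsp C x x" and ?V = "fibre E x"
  note ls = complex_linearD[OF lin]
  have He: "H e \<in> elts E x" by (rule ls(1)[OF e])
  define k where "k = complex_of_real (sqrt (2 * r))"
  have "cnj k * k = complex_of_real (sqrt (2 * r) * sqrt (2 * r))"
    by (simp only: k_def complex_cnj_complex_of_real of_real_mult)
  also have "sqrt (2 * r) * sqrt (2 * r) = 2 * r" using r by simp
  finally have kk: "cnj k * k = 2 * complex_of_real r" by simp
  define e1 e2 where "e1 = complex_of_real r \<odot>\<^bsub>?V\<^esub> e" and "e2 = k \<odot>\<^bsub>?V\<^esub> e"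
  have e1: "e1 \<in> elts E x" and e2: "e2 \<in> elts E x" using e by (simp_all add: e1_def e2_def)
  define w where "w = H e \<oplus>\<^bsub>?V\<^esub> e1"
  have w: "w \<in> elts E x" using He e1 by (simp add: w_def)
  have 2: "inn E x x e2 (H e2) = (2 * complex_of_real r) \<odot>\<^bsub>?B\<^esub> inn E x x e (H e)"
    unfolding e2_def kk[symmetric] using x e He
    by (simp add: E.inn_smult_left E.inn_smult_right ls B.smult_smult mult.commute)
  have "inn E x x e1 (H e) = complex_of_real r \<odot>\<^bsub>?B\<^esub> inn E x x e (H e)"
    "inn E x x (H e) e1 = complex_of_real r \<odot>\<^bsub>?B\<^esub> inn E x x e (H e)"
    unfolding e1_def using x e He sym[OF e e] by (simp_all add: E.inn_smult_left E.inn_smult_right)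
  hence "inn E x x w w = (inn E x x (H e) (H e) \<oplus>\<^bsub>?B\<^esub> complex_of_real r \<odot>\<^bsub>?B\<^esub> inn E x x e (H e)) \<oplus>\<^bsub>?B\<^esub>
     (complex_of_real r \<odot>\<^bsub>?B\<^esub> inn E x x e (H e) \<oplus>\<^bsub>?B\<^esub> inn E x x e1 e1)"
    unfolding w_def using x e1 He by (simp add: E.inn_add_left E.inn_add_right)
  moreover have "(p \<oplus>\<^bsub>?B\<^esub> complex_of_real r \<odot>\<^bsub>?B\<^esub> q) \<oplus>\<^bsub>?B\<^esub> (complex_of_real r \<odot>\<^bsub>?B\<^esub> q \<oplus>\<^bsub>?B\<^esub> t) =
     t \<oplus>\<^bsub>?B\<^esub> (p \<oplus>\<^bsub>?B\<^esub> (2 * complex_of_real r) \<odot>\<^bsub>?B\<^esub> q)"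
    "(p \<oplus>\<^bsub>?B\<^esub> complex_of_real r \<odot>\<^bsub>?B\<^esub> q) \<oplus>\<^bsub>?B\<^esub> (complex_of_real r \<odot>\<^bsub>?B\<^esub> q \<oplus>\<^bsub>?B\<^esub> t) =
     p \<oplus>\<^bsub>?B\<^esub> ((2 * complex_of_real r) \<odot>\<^bsub>?B\<^esub> q \<oplus>\<^bsub>?B\<^esub> t)"
    if "p \<in> hom C x x" "q \<in> hom C x x" "t \<in> hom C x x" for p q t
    using that by - (rule B.linear_identity3[of p q t]; simp)+
  ultimately have
    w1: "inn E x x w w = inn E x x e1 e1 \<oplus>\<^bsub>?B\<^esub> (inn E x x (H e) (H e) \<oplus>\<^bsub>?B\<^esub> inn E x x e2 (H e2))" and
    w2: "inn E x x w w = inn E x x (H e) (H e) \<oplus>\<^bsub>?B\<^esub> (inn E x x e2 (H e2) \<oplus>\<^bsub>?B\<^esub> inn E x x e1 e1)"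
    unfolding 2 using x e e1 He by simp_all
  have "module_norm C E x e1 \<le> module_norm C E x w"
    using x w
    by (intro E.module_norm_le_of_inn[OF x e1 norm_positive_add[OF x E.norm_positive_inn[OF x He] pos[OF e2]]])
      (auto simp: E.module_norm_square simp flip: w1)
  thus "r * module_norm C E x e \<le> module_norm C E x (H e \<oplus>\<^bsub>?V\<^esub> complex_of_real r \<odot>\<^bsub>?V\<^esub> e)"
    using e r unfolding w_def e1_def by (simp add: VE.scale)
  have "module_norm C E x (H e) \<le> module_norm C E x w"
    using x w
    by (intro E.module_norm_le_of_inn[OF x He norm_positive_add[OF x pos[OF e2] E.norm_positive_inn[OF x e1]]])
      (auto simp: E.module_norm_square simp flip: w2)
  thus "module_norm C E x (H e) \<le> module_norm C E x (H e \<oplus>\<^bsub>?V\<^esub> complex_of_real r \<odot>\<^bsub>?V\<^esub> e)"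
    unfolding w_def e1_def .
qed

text \<open>If \<open>l\<close> is not real, the square of \<open>(H - s l) e\<close> is that of \<open>(H - s Re l) e\<close> plus \<open>(s Im l)\<^sup>2 \<langle>e, e\<rangle>\<close>. If \<open>l\<close> is real and
negative, the preceding lemma applies.\<close>

lemma positive_operator_lower_bound:
  assumes E: "hilbert_module C E"
    and H: "\<And>x e. x \<in> Ob C \<Longrightarrow> e \<in> elts E x \<Longrightarrow> H x e \<in> elts E x"
    and lin: "\<And>x. x \<in> Ob C \<Longrightarrow> complex_linear (fibre E x) (fibre E x) (H x)"
    and sym: "\<And>x e f. x \<in> Ob C \<Longrightarrow> e \<in> elts E x \<Longrightarrow> f \<in> elts E x \<Longrightarrow> inn E x x (H x e) f = inn E x x e (H x f)"
    and pos: "\<And>x e. x \<in> Ob C \<Longrightarrow> e \<in> elts E x \<Longrightarrow> norm_positive x (inn E x x e (H x e))"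
    and l: "l \<notin> \<real>\<^sub>\<ge>\<^sub>0"
  shows "\<exists>d>0. \<forall>s>0. \<forall>x\<in>Ob C. \<forall>e\<in>elts E x.
    s * d * module_norm C E x e \<le> module_norm C E x (H x e \<ominus>\<^bsub>fibre E x\<^esub> (of_real s * l) \<odot>\<^bsub>fibre E x\<^esub> e)"
proof -
  interpret E: hilbert_cstar_module C E by (rule hilbert_cstar_moduleI[OF E])
  show ?thesis
  proof (cases "Im l = 0")
    case False
    show ?thesis
    proof (intro exI[of _ "\<bar>Im l\<bar>"] conjI allI impI ballI)
      show "\<bar>Im l\<bar> > 0" using False by simp
      fix s :: real and x e assume s: "s > 0" and x: "x \<in> Ob C" and e: "e \<in> elts E x"
      interpret VE: carrier_normed_space "fibre E x" "module_norm C E x" by (rule E.fibre_normed[OF x])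
      interpret B: carrier_normed_space "homsp C x x" "nrm (homsp C x x)" by (rule hom_normed[OF x x])
      have He: "H x e \<in> elts E x" by (rule H[OF x e])
      define b where "b = complex_of_real (s * Im l)"
      define v where "v = H x e \<ominus>\<^bsub>fibre E x\<^esub> of_real (s * Re l) \<odot>\<^bsub>fibre E x\<^esub> e"
      define w where "w = H x e \<ominus>\<^bsub>fibre E x\<^esub> (of_real s * l) \<odot>\<^bsub>fibre E x\<^esub> e"
      have v: "v \<in> elts E x" and w: "w \<in> elts E x" using He e by (simp_all add: v_def w_def)
      have l: "of_real s * l = of_real (s * Re l) + \<i> * b" by (simp add: b_def complex_eq_iff)
      have wv: "w = v \<ominus>\<^bsub>fibre E x\<^esub> (\<i> * b) \<odot>\<^bsub>fibre E x\<^esub> e"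
        unfolding w_def v_def l using He e by - (rule VE.linear_identity2[of "H x e" e]; simp)
      have ve: "inn E x x v e = inn E x x e v"
        unfolding v_def using x e He sym[OF x e e]
        by (simp add: E.inn_diff_left E.inn_diff_right E.inn_smult_left E.inn_smult_right)
      have "inn E x x w w = inn E x x (b \<odot>\<^bsub>fibre E x\<^esub> e) (b \<odot>\<^bsub>fibre E x\<^esub> e) \<oplus>\<^bsub>homsp C x x\<^esub> inn E x x v v"
      proof -
        have "cnj b = b" by (simp add: b_def)
        hence "inn E x x w w = (inn E x x v v \<ominus>\<^bsub>homsp C x x\<^esub> (- (\<i> * b)) \<odot>\<^bsub>homsp C x x\<^esub> inn E x x e v)
           \<ominus>\<^bsub>homsp C x x\<^esub> (\<i> * b) \<odot>\<^bsub>homsp C x x\<^esub> (inn E x x e v \<ominus>\<^bsub>homsp C x x\<^esub> (- (\<i> * b)) \<odot>\<^bsub>homsp C x x\<^esub> inn E x x e e)"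
          and bb: "inn E x x (b \<odot>\<^bsub>fibre E x\<^esub> e) (b \<odot>\<^bsub>fibre E x\<^esub> e) = (b * b) \<odot>\<^bsub>homsp C x x\<^esub> inn E x x e e"
          unfolding wv using x e v
          by (simp_all add: E.inn_diff_left E.inn_diff_right E.inn_smult_left E.inn_smult_right ve B.smult_smult)
        moreover have "(p \<ominus>\<^bsub>homsp C x x\<^esub> (- (\<i> * b)) \<odot>\<^bsub>homsp C x x\<^esub> q)
           \<ominus>\<^bsub>homsp C x x\<^esub> (\<i> * b) \<odot>\<^bsub>homsp C x x\<^esub> (q \<ominus>\<^bsub>homsp C x x\<^esub> (- (\<i> * b)) \<odot>\<^bsub>homsp C x x\<^esub> r) =
           (b * b) \<odot>\<^bsub>homsp C x x\<^esub> r \<oplus>\<^bsub>homsp C x x\<^esub> p"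
          if "p \<in> hom C x x" "q \<in> hom C x x" "r \<in> hom C x x" for p q r
          using that by - (rule B.linear_identity3[of p q r]; simp add: algebra_simps)
        ultimately show ?thesis using x e v by simp
      qed
      hence "module_norm C E x (b \<odot>\<^bsub>fibre E x\<^esub> e) \<le> module_norm C E x w"
        using x e v w by (intro E.module_norm_le_of_inn[OF x _ E.norm_positive_inn[OF x v]]) (auto simp: E.module_norm_square)
      moreover have "cmod b = s * \<bar>Im l\<bar>" unfolding b_def norm_of_real using s by (simp add: abs_mult)
      ultimately show "s * \<bar>Im l\<bar> * module_norm C E x e \<le>
         module_norm C E x (H x e \<ominus>\<^bsub>fibre E x\<^esub> (of_real s * l) \<odot>\<^bsub>fibre E x\<^esub> e)"
        using e by (simp add: VE.scale w_def)
    qed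
  next
    case True
    have lr: "l = complex_of_real (Re l)" using True by (simp add: complex_eq_iff)
    have neg: "Re l < 0" using l unfolding complex_nonneg_Reals_iff using True by simp
    show ?thesis
    proof (intro exI[of _ "- Re l"] conjI allI impI ballI)
      show "- Re l > 0" using neg by simp
      fix s :: real and x e assume s: "s > 0" and x: "x \<in> Ob C" and e: "e \<in> elts E x"
      interpret VE: carrier_normed_space "fibre E x" "module_norm C E x" by (rule E.fibre_normed[OF x])
      have He: "H x e \<in> elts E x" by (rule H[OF x e])
      define r where "r = s * (- Re l)"
      have r: "r > 0" using s neg by (simp add: r_def mult_pos_neg)
      have l: "of_real s * l = - complex_of_real r" by (subst lr) (simp add: r_def)
      have "H x e \<ominus>\<^bsub>fibre E x\<^esub> (of_real s * l) \<odot>\<^bsub>fibre E x\<^esub> e =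
          H x e \<oplus>\<^bsub>fibre E x\<^esub> complex_of_real r \<odot>\<^bsub>fibre E x\<^esub> e"
        unfolding l using He e by - (rule VE.linear_identity2[of "H x e" e]; simp)
      thus "s * (- Re l) * module_norm C E x e \<le>
         module_norm C E x (H x e \<ominus>\<^bsub>fibre E x\<^esub> (of_real s * l) \<odot>\<^bsub>fibre E x\<^esub> e)"
        using shifted_positive_operator_norms(1)[OF E x lin[OF x] sym[OF x] pos[OF x] r e] by (simp only: r_def)
    qed
  qed
qed

text \<open>The adjoint of \<open>(H - l)\<^sup>-\<^sup>1\<close> must be the inverse of \<open>H\<close> minus the conjugate of \<open>l\<close>, which lies outside
\<open>[0, \<infinity>)\<close> together with \<open>l\<close>; the two inverses are constructed at the same time.\<close>

theorem positive_operator_resolvent: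
  assumes E: "hilbert_module C E" and HA: "H \<in> adj E E" and self: "dagger E E H = H"
    and pos: "\<And>x e. x \<in> Ob C \<Longrightarrow> e \<in> elts E x \<Longrightarrow> norm_positive x (inn E x x e (H x e))"
    and l: "l \<notin> \<real>\<^sub>\<ge>\<^sub>0"
  shows "\<exists>G\<in>adj E E. (\<forall>x\<in>Ob C. \<forall>w\<in>elts E x. H x (G x w) \<ominus>\<^bsub>fibre E x\<^esub> l \<odot>\<^bsub>fibre E x\<^esub> G x w = w) \<and>
    (\<forall>x\<in>Ob C. \<forall>v\<in>elts E x. G x (H x v \<ominus>\<^bsub>fibre E x\<^esub> l \<odot>\<^bsub>fibre E x\<^esub> v) = v)"
proof -
  interpret E: hilbert_cstar_module C E by (rule hilbert_cstar_moduleI[OF E])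
  have sym: "inn E x y (H y e) f = inn E x y e (H x f)"
    if "x \<in> Ob C" "y \<in> Ob C" "e \<in> elts E y" "f \<in> elts E x" for x y e f
    using adjoint_pairD(3)[OF dagger_pair[OF E E HA]] that by (simp add: self)
  have ex: "\<exists>d>0. \<forall>x\<in>Ob C. (\<forall>v\<in>elts E x. d * module_norm C E x v \<le>
        module_norm C E x (H x v \<ominus>\<^bsub>fibre E x\<^esub> l \<odot>\<^bsub>fibre E x\<^esub> v)) \<and>
      (\<forall>w\<in>elts E x. \<exists>v\<in>elts E x. H x v \<ominus>\<^bsub>fibre E x\<^esub> l \<odot>\<^bsub>fibre E x\<^esub> v = w)"
    if l: "l \<notin> \<real>\<^sub>\<ge>\<^sub>0" for l
  proof -
    obtain d where d: "d > 0" "\<And>s x e. s > 0 \<Longrightarrow> x \<in> Ob C \<Longrightarrow> e \<in> elts E x \<Longrightarrow>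
      s * d * module_norm C E x e \<le> module_norm C E x (H x e \<ominus>\<^bsub>fibre E x\<^esub> (of_real s * l) \<odot>\<^bsub>fibre E x\<^esub> e)"
      using positive_operator_lower_bound[OF E adj_closed[OF HA] adj_linear[OF HA] sym pos l] by blast
    have l0: "l \<noteq> 0" using l by auto
    have "\<exists>v\<in>elts E x. H x v \<ominus>\<^bsub>fibre E x\<^esub> l \<odot>\<^bsub>fibre E x\<^esub> v = w" if x: "x \<in> Ob C" and w: "w \<in> elts E x" for x w
    proof -
      interpret VE: carrier_normed_space "fibre E x" "module_norm C E x" by (rule E.fibre_normed[OF x])
      show ?thesis
        using VE.surjective_along_ray[OF E.fibre_complete[OF x] adj_linear[OF HA x] opn_bound[OF E E HA x] l0 d(1) d(2)[OF _ x] zero_less_one w]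
        by simp
    qed
    moreover have "d * module_norm C E x v \<le> module_norm C E x (H x v \<ominus>\<^bsub>fibre E x\<^esub> l \<odot>\<^bsub>fibre E x\<^esub> v)"
      if "x \<in> Ob C" "v \<in> elts E x" for x v using d(2)[OF zero_less_one that] by simp
    ultimately show ?thesis using d(1) by blast
  qed
  have cl: "cnj l \<notin> \<real>\<^sub>\<ge>\<^sub>0" using l by (simp add: complex_nonneg_Reals_iff)
  define g where "g l x w = (SOME v. v \<in> elts E x \<and> H x v \<ominus>\<^bsub>fibre E x\<^esub> l \<odot>\<^bsub>fibre E x\<^esub> v = w)" for l x w
  have g: "g l x w \<in> elts E x" "H x (g l x w) \<ominus>\<^bsub>fibre E x\<^esub> l \<odot>\<^bsub>fibre E x\<^esub> g l x w = w"
    if l: "l \<notin> \<real>\<^sub>\<ge>\<^sub>0" and x: "x \<in> Ob C" and w: "w \<in> elts E x" for l x w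
  proof -
    have "\<exists>v. v \<in> elts E x \<and> H x v \<ominus>\<^bsub>fibre E x\<^esub> l \<odot>\<^bsub>fibre E x\<^esub> v = w" using ex[OF l] x w by blast
    from someI_ex[OF this] show "g l x w \<in> elts E x" "H x (g l x w) \<ominus>\<^bsub>fibre E x\<^esub> l \<odot>\<^bsub>fibre E x\<^esub> g l x w = w"
      by (auto simp: g_def)
  qed
  obtain d where d: "d > 0" "\<And>x v. x \<in> Ob C \<Longrightarrow> v \<in> elts E x \<Longrightarrow>
    d * module_norm C E x v \<le> module_norm C E x (H x v \<ominus>\<^bsub>fibre E x\<^esub> l \<odot>\<^bsub>fibre E x\<^esub> v)"
    using ex[OF l] by blast
  have shift: "inn E x y (H y u \<ominus>\<^bsub>fibre E y\<^esub> l \<odot>\<^bsub>fibre E y\<^esub> u) v = inn E x y u (H x v \<ominus>\<^bsub>fibre E x\<^esub> cnj l \<odot>\<^bsub>fibre E x\<^esub> v)"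
    if x: "x \<in> Ob C" and y: "y \<in> Ob C" and u: "u \<in> elts E y" and v: "v \<in> elts E x" for x y u v
  proof -
    interpret VE: complex_space "fibre E x" by (rule E.fibre_space[OF x])
    interpret VE': complex_space "fibre E y" by (rule E.fibre_space[OF y])
    show ?thesis using x y u v adj_closed[OF HA]
      by (simp add: E.inn_diff_left E.inn_diff_right E.inn_smult_left E.inn_smult_right sym)
  qed
  have p: "adjoint_pair E E (g l) (g (cnj l))"
    unfolding adjoint_pair_def
  proof (intro conjI ballI g(1) l cl)
    fix x y w f assume x: "x \<in> Ob C" and y: "y \<in> Ob C" and w: "w \<in> elts E y" and f: "f \<in> elts E x"
    have "inn E x y (g l y w) f = inn E x y (g l y w) (H x (g (cnj l) x f) \<ominus>\<^bsub>fibre E x\<^esub> cnj l \<odot>\<^bsub>fibre E x\<^esub> g (cnj l) x f)"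
      by (simp add: g(2)[OF cl x f])
    also have "\<dots> = inn E x y w (g (cnj l) x f)"
      using shift[OF x y g(1)[OF l y w] g(1)[OF cl x f]] by (simp add: g(2)[OF l y w])
    finally show "inn E x y (g l y w) f = inn E x y w (g (cnj l) x f)" .
  qed
  have b: "module_norm C E x (g l x w) \<le> (1 / d) * module_norm C E x w" if x: "x \<in> Ob C" and w: "w \<in> elts E x" for x w
    using d(2)[OF x g(1)[OF l x w]] d(1) by (simp add: g(2)[OF l x w] field_simps)
  define G where "G = (\<lambda>x\<in>Ob C. \<lambda>w\<in>elts E x. g l x w)"
  have G: "G \<in> adj E E" unfolding G_def by (rule adjoint_pair_adj(1)[OF E E p b])
  show ?thesis
  proof (intro bexI[OF _ G] conjI ballI)
    show "H x (G x w) \<ominus>\<^bsub>fibre E x\<^esub> l \<odot>\<^bsub>fibre E x\<^esub> G x w = w" if "x \<in> Ob C" "w \<in> elts E x" for x w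
      using that g(2)[OF l that] by (simp add: G_def)
    fix x v assume x: "x \<in> Ob C" and v: "v \<in> elts E x"
    interpret VE: carrier_normed_space "fibre E x" "module_norm C E x" by (rule E.fibre_normed[OF x])
    define w where "w = H x v \<ominus>\<^bsub>fibre E x\<^esub> l \<odot>\<^bsub>fibre E x\<^esub> v"
    have w: "w \<in> elts E x" using v adj_closed[OF HA x v] by (simp add: w_def)
    define u where "u = g l x w \<ominus>\<^bsub>fibre E x\<^esub> v"
    have u: "u \<in> elts E x" using g(1)[OF l x w] v by (simp add: u_def)
    have "H x u \<ominus>\<^bsub>fibre E x\<^esub> l \<odot>\<^bsub>fibre E x\<^esub> u =
       (H x (g l x w) \<ominus>\<^bsub>fibre E x\<^esub> l \<odot>\<^bsub>fibre E x\<^esub> g l x w) \<ominus>\<^bsub>fibre E x\<^esub> (H x v \<ominus>\<^bsub>fibre E x\<^esub> l \<odot>\<^bsub>fibre E x\<^esub> v)"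
    proof -
      have "(p' \<ominus>\<^bsub>fibre E x\<^esub> q') \<ominus>\<^bsub>fibre E x\<^esub> l \<odot>\<^bsub>fibre E x\<^esub> (p \<ominus>\<^bsub>fibre E x\<^esub> q) =
         (p' \<ominus>\<^bsub>fibre E x\<^esub> l \<odot>\<^bsub>fibre E x\<^esub> p) \<ominus>\<^bsub>fibre E x\<^esub> (q' \<ominus>\<^bsub>fibre E x\<^esub> l \<odot>\<^bsub>fibre E x\<^esub> q)"
        if "p \<in> elts E x" "q \<in> elts E x" "p' \<in> elts E x" "q' \<in> elts E x" for p q p' q'
        using that by - (rule VE.linear_identity4[of p q p' q']; simp add: algebra_simps)
      thus ?thesis using g(1)[OF l x w] v adj_closed[OF HA x]
        by (simp add: u_def VE.endo_diff[OF adj_linear[OF HA x]])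
    qed
    also have "\<dots> = \<zero>\<^bsub>fibre E x\<^esub>" using w by (simp add: g(2)[OF l x w] VE.diff_eq_zero_iff flip: w_def)
    finally have "d * module_norm C E x u \<le> 0" using d(2)[OF x u] by simp
    hence "module_norm C E x u = 0" using d(1) VE.nonneg[OF u] by (simp add: mult_le_0_iff)
    hence "g l x w = v" unfolding u_def using VE.dist_eq_zero[OF g(1)[OF l x w] v] by simp
    thus "G x (H x v \<ominus>\<^bsub>fibre E x\<^esub> l \<odot>\<^bsub>fibre E x\<^esub> v) = v" using x w by (simp add: G_def w_def)
  qed
qed

lemma Hilb_simps [simp]:
  "Ob (Hilb C) = {E. hilbert_module C E}" "homsp (Hilb C) = adjsp"
  "comp (Hilb C) E F G S T = op_comp E S T" "star (Hilb C) E F T = dagger E F T"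
  by (simp_all add: Hilb_def op_comp_def dagger_def)

lemma Hilb_unit:
  assumes "hilbert_module C E"
  shows "algebra_unit (Hilb C) E (op_id E)"
  using op_comp_id[OF assms assms] op_id_adj[OF assms] by (simp add: algebra_unit_def)

text \<open>Endomorphism algebras of Hilbert modules are unital, so the spectrum is the ordinary one, and \<open>T\<^sup>* T\<close> is a positive
operator by \<open>\<langle>e, T\<^sup>* T e\<rangle> = \<langle>T e, T e\<rangle>\<close>.\<close>

lemma Hilb_spectrum_star_comp:
  assumes E: "hilbert_module C E" and F: "hilbert_module C F" and T: "T \<in> adj E F"
  shows "spectrum (Hilb C) E (op_comp E (dagger E F T) T) \<subseteq> \<real>\<^sub>\<ge>\<^sub>0"
proof -
  interpret E: hilbert_cstar_module C E by (rule hilbert_cstar_moduleI[OF E])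
  interpret F: hilbert_cstar_module C F by (rule hilbert_cstar_moduleI[OF F])
  let ?D = "dagger E F T"
  let ?H = "op_comp E ?D T"
  note D = dagger_adj(1)[OF E F T]
  have H: "?H \<in> adj E E" by (rule op_comp_adj(1)[OF E F E T D])
  show ?thesis
  proof
    fix l assume l: "l \<in> spectrum (Hilb C) E ?H"
    show "l \<in> \<real>\<^sub>\<ge>\<^sub>0"
    proof (rule ccontr)
      assume nl: "l \<notin> \<real>\<^sub>\<ge>\<^sub>0"
      have self: "dagger E E ?H = ?H"
        using op_comp_adj(2)[OF E F E T D] by (simp add: dagger_dagger[OF E F T])
      have pos: "norm_positive x (inn E x x e (?H x e))" if x: "x \<in> Ob C" and e: "e \<in> elts E x" for x e
        using F.norm_positive_inn[OF x adj_closed[OF T x e]]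
          adjoint_pairD(3)[OF dagger_pair[OF E F T] x x e adj_closed[OF T x e]] x e by simp
      obtain G where G: "G \<in> adj E E"
        "\<And>x w. x \<in> Ob C \<Longrightarrow> w \<in> elts E x \<Longrightarrow> ?H x (G x w) \<ominus>\<^bsub>fibre E x\<^esub> l \<odot>\<^bsub>fibre E x\<^esub> G x w = w"
        "\<And>x v. x \<in> Ob C \<Longrightarrow> v \<in> elts E x \<Longrightarrow> G x (?H x v \<ominus>\<^bsub>fibre E x\<^esub> l \<odot>\<^bsub>fibre E x\<^esub> v) = v"
        using positive_operator_resolvent[OF E H self pos nl] by blast
      note I = op_id_adj[OF E] and lI = adj_smult(1)[OF E E op_id_adj[OF E]]
      let ?K = "?H \<ominus>\<^bsub>adjsp E E\<^esub> l \<odot>\<^bsub>adjsp E E\<^esub> op_id E"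
      have K: "?K \<in> adj E E" by (rule adj_diff(1)[OF E E H lI])
      have Kx: "?K x e = ?H x e \<ominus>\<^bsub>fibre E x\<^esub> l \<odot>\<^bsub>fibre E x\<^esub> e" if "x \<in> Ob C" "e \<in> elts E x" for x e
        using that by (simp add: adj_diff(2)[OF E E H lI])
      have "op_comp E G ?K = op_id E"
      proof (rule adj_ext[OF op_comp_adj(1)[OF E E E K G(1)] I])
        fix x e assume x: "x \<in> Ob C" "e \<in> elts E x"
        show "op_comp E G ?K x e = op_id E x e"
          unfolding op_comp_apply[OF x, of G ?K] Kx[OF x] G(3)[OF x] using x by simp
      qed
      moreover have "op_comp E ?K G = op_id E"
      proof (rule adj_ext[OF op_comp_adj(1)[OF E E E G(1) K] I])
        fix x e assume x: "x \<in> Ob C" "e \<in> elts E x"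
        show "op_comp E ?K G x e = op_id E x e"
          unfolding op_comp_apply[OF x, of ?K G] Kx[OF x(1) adj_closed[OF G(1) x]] G(2)[OF x] using x by simp
      qed
      moreover have "l \<in> spectrum (Hilb C) E ?H \<longleftrightarrow> \<not> (\<exists>G\<in>adj E E. op_comp E G ?K = op_id E \<and> op_comp E ?K G = op_id E)"
        using spectrum_unital[of "Hilb C" E "op_id E" ?H l] adj_vector_space[OF E E] op_comp_linear_left[OF E E E]
          Hilb_unit[OF E] H by simp
      ultimately show False using l G(1) by auto
    qed
  qed
qed

theorem Hilb_cstar_category: "cstar_category (Hilb C)"
proof (rule cstar_category.intro, unfold Hilb_simps mem_Collect_eq adjsp_simps)
  fix E F G G' :: "('o, 'm, 'e) hilbert_module_data" and R S T
  assume E: "hilbert_module C E" and F: "hilbert_module C F"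
  show "complex_banach_space (adjsp E F)" by (rule adj_banach[OF E F])
  show "conjugate_linear (adjsp E F) (adjsp F E) (dagger E F)"
    unfolding conjugate_linear_def
    using adj_add(2)[OF E F] adj_smult(2)[OF E F] dagger_adj(1)[OF E F] by auto
  {
    assume T: "T \<in> adj E F"
    show "dagger F E (dagger E F T) = T" by (rule dagger_dagger[OF E F T])
    show "opn E E (op_comp E (dagger E F T) T) = (opn E F T)\<^sup>2" by (rule opn_dagger_comp[OF E F T])
    show "spectrum (Hilb C) E (op_comp E (dagger E F T) T) \<subseteq> \<real>\<^sub>\<ge>\<^sub>0"
      by (rule Hilb_spectrum_star_comp[OF E F T])
    assume G: "hilbert_module C G"
    show "complex_linear (adjsp F G) (adjsp E G) (\<lambda>S. op_comp E S T)" by (rule op_comp_linear_left[OF E F G T])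
    assume S: "S \<in> adj F G"
    show "opn E G (op_comp E S T) \<le> opn F G S * opn E F T" by (rule op_comp_adj(3)[OF E F G T S])
    show "dagger E G (op_comp E S T) = op_comp G (dagger E F T) (dagger F G S)" by (rule op_comp_adj(2)[OF E F G T S])
    assume "hilbert_module C G'" "R \<in> adj G G'"
    thus "op_comp E (op_comp F R S) T = op_comp E R (op_comp E S T)" by (rule op_comp_assoc[OF E F G _ T S])
  }
  assume G: "hilbert_module C G" and S: "S \<in> adj F G"
  show "complex_linear (adjsp E F) (adjsp E G) (\<lambda>T. op_comp E S T)" by (rule op_comp_linear_right[OF E F G S])
qed

end

section \<open>Compact operators\<close>

context complex_space
begin

lemma linear_combinations_zero: "\<zero> \<in> linear_combinations V S"
  unfolding linear_combinations_def by (intro CollectI exI[of _ "{}"] exI[of _ "\<lambda>_. 0"]) simp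

lemma linear_combinations_insert:
  assumes S: "S \<subseteq> carrier V" and s: "s \<in> S" and v: "v \<in> linear_combinations V S"
  shows "k \<odot> s \<oplus> v \<in> linear_combinations V S"
proof -
  obtain F c where F: "finite F" "F \<subseteq> S" "v = (\<Oplus>r\<in>F. c r \<odot> r)"
    using v by (auto simp: linear_combinations_def)
  have sc: "s \<in> carrier V" using S s by blast
  define c' where "c' = (\<lambda>r. if r = s then k + (if s \<in> F then c s else 0) else c r)"
  have fc: "(\<lambda>r. c r \<odot> r) \<in> F' \<rightarrow> carrier V" "(\<lambda>r. c' r \<odot> r) \<in> F' \<rightarrow> carrier V" if "F' \<subseteq> S" for F'
    using that S by auto
  have rest: "(\<Oplus>r\<in>F - {s}. c' r \<odot> r) = (\<Oplus>r\<in>F - {s}. c r \<odot> r)"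
    by (rule M.finsum_cong') (use F S in \<open>auto simp: c'_def\<close>)
  have rc: "(\<Oplus>r\<in>F - {s}. c r \<odot> r) \<in> carrier V" by (rule M.finsum_closed) (use F S in auto)
  have "(\<Oplus>r\<in>insert s (F - {s}). c' r \<odot> r) = c' s \<odot> s \<oplus> (\<Oplus>r\<in>F - {s}. c' r \<odot> r)"
    using F S sc by (intro M.finsum_insert) auto
  also have "\<dots> = c' s \<odot> s \<oplus> (\<Oplus>r\<in>F - {s}. c r \<odot> r)" by (simp only: rest)
  also have "\<dots> = k \<odot> s \<oplus> v"
  proof (cases "s \<in> F")
    case True
    have "v = (\<Oplus>r\<in>insert s (F - {s}). c r \<odot> r)" using True F(3) by (simp add: insert_absorb)
    also have "\<dots> = c s \<odot> s \<oplus> (\<Oplus>r\<in>F - {s}. c r \<odot> r)"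
      using F S sc by (intro M.finsum_insert) auto
    finally show ?thesis using True sc rc by (simp add: c'_def smult_add_left M.a_assoc)
  next
    case False
    thus ?thesis using F sc rc by (simp add: c'_def)
  qed
  finally show ?thesis
    unfolding linear_combinations_def using F s
    by (intro CollectI exI[of _ "insert s (F - {s})"] exI[of _ c']) auto
qed

lemma linear_combinations_induct:
  assumes S: "S \<subseteq> carrier V" and v: "v \<in> linear_combinations V S"
    and z: "P \<zero>" and i: "\<And>k s v. s \<in> S \<Longrightarrow> v \<in> linear_combinations V S \<Longrightarrow> P v \<Longrightarrow> P (k \<odot> s \<oplus> v)"
  shows "P v"
proof -
  obtain F c where F: "finite F" "F \<subseteq> S" "v = (\<Oplus>r\<in>F. c r \<odot> r)"
    using v by (auto simp: linear_combinations_def)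
  have "P (\<Oplus>r\<in>F. c r \<odot> r)" using F(1,2)
  proof (induction F)
    case empty
    thus ?case using z by simp
  next
    case (insert s F)
    have "(\<Oplus>r\<in>insert s F. c r \<odot> r) = c s \<odot> s \<oplus> (\<Oplus>r\<in>F. c r \<odot> r)"
      using insert S by (intro M.finsum_insert) auto
    moreover have "(\<Oplus>r\<in>F. c r \<odot> r) \<in> linear_combinations V S"
      using insert by (auto simp: linear_combinations_def)
    ultimately show ?case using i insert by auto
  qed
  thus ?thesis using F(3) by simp
qed

lemma linear_combinations_closed:
  assumes S: "S \<subseteq> carrier V" and v: "v \<in> linear_combinations V S"
  shows "v \<in> carrier V"
  by (rule linear_combinations_induct[OF S v]) (use S in auto)

lemma linear_combinations_add:
  assumes S: "S \<subseteq> carrier V" and u: "u \<in> linear_combinations V S" and v: "v \<in> linear_combinations V S"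
  shows "u \<oplus> v \<in> linear_combinations V S"
proof (rule linear_combinations_induct[OF S u])
  show "\<zero> \<oplus> v \<in> linear_combinations V S" using v linear_combinations_closed[OF S v] by simp
  fix k s u assume s: "s \<in> S" and u: "u \<in> linear_combinations V S" and uv: "u \<oplus> v \<in> linear_combinations V S"
  have "s \<in> carrier V" "u \<in> carrier V" "v \<in> carrier V" using S s linear_combinations_closed[OF S] u v by auto
  hence "k \<odot> s \<oplus> u \<oplus> v = k \<odot> s \<oplus> (u \<oplus> v)" by (simp add: M.a_assoc)
  thus "k \<odot> s \<oplus> u \<oplus> v \<in> linear_combinations V S" using linear_combinations_insert[OF S s uv] by simp
qed

lemma linear_combinations_base: "S \<subseteq> carrier V \<Longrightarrow> s \<in> S \<Longrightarrow> s \<in> linear_combinations V S"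
  using linear_combinations_insert[OF _ _ linear_combinations_zero, of S s 1] by auto

lemma linear_combinations_smult:
  assumes S: "S \<subseteq> carrier V" and v: "v \<in> linear_combinations V S"
  shows "c \<odot> v \<in> linear_combinations V S"
proof (rule linear_combinations_induct[OF S v])
  show "c \<odot> \<zero> \<in> linear_combinations V S" using linear_combinations_zero by simp
  fix k s v assume s: "s \<in> S" and v: "v \<in> linear_combinations V S" and cv: "c \<odot> v \<in> linear_combinations V S"
  have "s \<in> carrier V" "v \<in> carrier V" using S s linear_combinations_closed[OF S v] by auto
  hence "c \<odot> (k \<odot> s \<oplus> v) = (c * k) \<odot> s \<oplus> c \<odot> v" by (simp add: smult_add_right smult_smult)
  thus "c \<odot> (k \<odot> s \<oplus> v) \<in> linear_combinations V S" using linear_combinations_insert[OF S s cv] by simp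
qed

end

context cstar_category
begin

abbreviation "cpt \<equiv> compact_operators C"

definition ranks where
  "ranks E F = {single_rank C E F x f e | x f e. x \<in> Ob C \<and> f \<in> elts F x \<and> e \<in> elts E x}"

abbreviation "finite_rank E F \<equiv> linear_combinations (adjsp E F) (ranks E F)"

lemma single_rank_apply [simp]:
  "w \<in> Ob C \<Longrightarrow> e' \<in> elts E w \<Longrightarrow> single_rank C E F x f e w e' = act F w x f (inn E w x e e')"
  by (simp add: single_rank_def)

lemma single_rank_adj:
  assumes E: "hilbert_module C E" and F: "hilbert_module C F"
    and x: "x \<in> Ob C" and f: "f \<in> elts F x" and e: "e \<in> elts E x"
  shows "single_rank C E F x f e \<in> adj E F"
    and "dagger E F (single_rank C E F x f e) = single_rank C F E x e f"
proof -
  interpret E: hilbert_cstar_module C E by (rule hilbert_cstar_moduleI[OF E])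
  interpret F: hilbert_cstar_module C F by (rule hilbert_cstar_moduleI[OF F])
  have p: "adjoint_pair E F (\<lambda>w e'. act F w x f (inn E w x e e')) (\<lambda>w f'. act E w x e (inn F w x f f'))"
    unfolding adjoint_pair_def
  proof (intro conjI ballI)
    fix v w e' f' assume v: "v \<in> Ob C" and w: "w \<in> Ob C" and e': "e' \<in> elts E w" and f': "f' \<in> elts F v"
    have "inn F v w (act F w x f (inn E w x e e')) f' = comp C v x w (star C w x (inn E w x e e')) (inn F v x f f')"
      using x v w e f e' f' by (intro F.inn_act_left) auto
    also have "star C w x (inn E w x e e') = inn E x w e' e"
      using x w e e' by (intro E.inn_star[symmetric]) auto
    also have "comp C v x w (inn E x w e' e) (inn F v x f f') = inn E v w e' (act E v x e (inn F v x f f'))"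
      using x v w e f e' f' by (intro E.inn_act) auto
    finally show "inn F v w (act F w x f (inn E w x e e')) f' = inn E v w e' (act E v x e (inn F v x f f'))" .
  qed (use x e f in auto)
  have b: "module_norm C F w (act F w x f (inn E w x e e')) \<le> (module_norm C F x f * module_norm C E x e) * module_norm C E w e'"
    if w: "w \<in> Ob C" and e': "e' \<in> elts E w" for w e'
  proof -
    have "module_norm C F w (act F w x f (inn E w x e e')) \<le> module_norm C F x f * nrm (homsp C w x) (inn E w x e e')"
      using x w e f e' by (intro F.module_norm_act) auto
    also have "\<dots> \<le> module_norm C F x f * (module_norm C E x e * module_norm C E w e')"
      using x w e f e' by (intro mult_left_mono E.cauchy_schwarz) auto
    finally show ?thesis by (simp add: mult.assoc)
  qed
  note a = adjoint_pair_adj[OF E F p b, folded single_rank_def]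
  show "single_rank C E F x f e \<in> adj E F" by (rule a(1))
  show "dagger E F (single_rank C E F x f e) = single_rank C F E x e f" by (rule dagger_eq[OF E F a(2)])
qed

lemma ranks_adj: "hilbert_module C E \<Longrightarrow> hilbert_module C F \<Longrightarrow> ranks E F \<subseteq> adj E F"
  by (auto simp: ranks_def single_rank_adj)

lemma finite_rank_adj:
  assumes "hilbert_module C E" "hilbert_module C F" "S \<in> finite_rank E F"
  shows "S \<in> adj E F"
proof -
  interpret V: complex_space "adjsp E F" by (rule complex_spaceI[OF adj_vector_space[OF assms(1,2)]])
  show ?thesis using V.linear_combinations_closed[OF _ assms(3)] ranks_adj[OF assms(1,2)] by simp
qed

lemma compact_iff:
  assumes E: "hilbert_module C E" and F: "hilbert_module C F"
  shows "T \<in> cpt E F \<longleftrightarrow> T \<in> adj E F \<and> (\<forall>\<epsilon>>0. \<exists>S\<in>finite_rank E F. opn E F (S \<ominus>\<^bsub>adjsp E F\<^esub> T) < \<epsilon>)"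
    (is "_ \<longleftrightarrow> _ \<and> ?R")
proof -
  have def: "T \<in> cpt E F \<longleftrightarrow> T \<in> adj E F \<and> (\<exists>s :: nat \<Rightarrow> _. range s \<subseteq> finite_rank E F \<and>
      (\<lambda>n. opn E F (s n \<ominus>\<^bsub>adjsp E F\<^esub> T)) \<longlonglongrightarrow> 0)"
    by (simp add: compact_operators_def Let_def ranks_def)
  show ?thesis
  proof
    assume "T \<in> cpt E F"
    then obtain s :: "nat \<Rightarrow> _" where T: "T \<in> adj E F" and s: "range s \<subseteq> finite_rank E F" "(\<lambda>n. opn E F (s n \<ominus>\<^bsub>adjsp E F\<^esub> T)) \<longlonglongrightarrow> 0"
      unfolding def by blast
    have ?R
    proof (intro allI impI)
      fix \<epsilon> :: real assume "\<epsilon> > 0"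
      hence "eventually (\<lambda>n. opn E F (s n \<ominus>\<^bsub>adjsp E F\<^esub> T) < \<epsilon>) sequentially"
        using s(2) by (intro order_tendstoD) auto
      then obtain n where "opn E F (s n \<ominus>\<^bsub>adjsp E F\<^esub> T) < \<epsilon>" by (auto simp: eventually_sequentially)
      thus "\<exists>S\<in>finite_rank E F. opn E F (S \<ominus>\<^bsub>adjsp E F\<^esub> T) < \<epsilon>" using s(1) by blast
    qed
    with T show "T \<in> adj E F \<and> ?R" by blast
  next
    assume a: "T \<in> adj E F \<and> ?R"
    hence "\<exists>S\<in>finite_rank E F. opn E F (S \<ominus>\<^bsub>adjsp E F\<^esub> T) < 1 / real (Suc n)" for n by simp
    then obtain s where s: "\<And>n. s n \<in> finite_rank E F" "\<And>n. opn E F (s n \<ominus>\<^bsub>adjsp E F\<^esub> T) < 1 / real (Suc n)" by metis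
    have "(\<lambda>n. opn E F (s n \<ominus>\<^bsub>adjsp E F\<^esub> T)) \<longlonglongrightarrow> 0"
    proof (rule tendsto_sandwich[OF _ _ tendsto_const LIMSEQ_Suc[OF lim_1_over_n]])
      show "eventually (\<lambda>n. 0 \<le> opn E F (s n \<ominus>\<^bsub>adjsp E F\<^esub> T)) sequentially"
        using opn_nonneg[OF adj_diff(1)[OF E F finite_rank_adj[OF E F s(1)]]] a by (intro always_eventually) blast
      show "eventually (\<lambda>n. opn E F (s n \<ominus>\<^bsub>adjsp E F\<^esub> T) \<le> 1 / of_nat (Suc n)) sequentially"
        using s(2) by (intro always_eventually allI less_imp_le) simp
    qed
    thus "T \<in> cpt E F" unfolding def using a s(1) by blast
  qed
qed

lemma compact_adj: "T \<in> cpt E F \<Longrightarrow> T \<in> adj E F"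
  by (simp add: compact_operators_def Let_def)

lemma finite_rank_compact:
  assumes E: "hilbert_module C E" and F: "hilbert_module C F" and S: "S \<in> finite_rank E F"
  shows "S \<in> cpt E F"
proof -
  interpret V: carrier_normed_space "adjsp E F" "opn E F" by (rule adj_normed[OF E F])
  have SA: "S \<in> adj E F" by (rule finite_rank_adj[OF E F S])
  hence "opn E F (S \<ominus>\<^bsub>adjsp E F\<^esub> S) = 0" using V.dist_eq_zero[of S S] by simp
  thus ?thesis using S SA by (auto simp: compact_iff[OF E F] intro!: bexI[of _ S])
qed

lemma single_rank_compact:
  assumes E: "hilbert_module C E" and F: "hilbert_module C F"
    and "x \<in> Ob C" "f \<in> elts F x" "e \<in> elts E x"
  shows "single_rank C E F x f e \<in> cpt E F"
proof -
  interpret V: complex_space "adjsp E F" by (rule complex_spaceI[OF adj_vector_space[OF E F]])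
  have "single_rank C E F x f e \<in> ranks E F" using assms by (auto simp: ranks_def)
  thus ?thesis using V.linear_combinations_base ranks_adj[OF E F] by (intro finite_rank_compact[OF E F]) auto
qed

lemma compact_zero:
  assumes E: "hilbert_module C E" and F: "hilbert_module C F"
  shows "\<zero>\<^bsub>adjsp E F\<^esub> \<in> cpt E F"
proof -
  interpret V: complex_space "adjsp E F" by (rule complex_spaceI[OF adj_vector_space[OF E F]])
  show ?thesis by (intro finite_rank_compact[OF E F] V.linear_combinations_zero)
qed

lemma compact_add:
  assumes E: "hilbert_module C E" and F: "hilbert_module C F" and S: "S \<in> cpt E F" and T: "T \<in> cpt E F"
  shows "S \<oplus>\<^bsub>adjsp E F\<^esub> T \<in> cpt E F"
  unfolding compact_iff[OF E F]
proof (intro conjI allI impI)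
  interpret V: carrier_normed_space "adjsp E F" "opn E F" by (rule adj_normed[OF E F])
  have SA: "S \<in> adj E F" and TA: "T \<in> adj E F" using S T by (auto intro: compact_adj)
  thus "S \<oplus>\<^bsub>adjsp E F\<^esub> T \<in> adj E F" by (rule adj_add(1)[OF E F])
  fix \<epsilon> :: real assume \<epsilon>: "\<epsilon> > 0"
  obtain S' where S': "S' \<in> finite_rank E F" "opn E F (S' \<ominus>\<^bsub>adjsp E F\<^esub> S) < \<epsilon> / 2"
    using S \<epsilon> half_gt_zero unfolding compact_iff[OF E F] by blast
  obtain T' where T': "T' \<in> finite_rank E F" "opn E F (T' \<ominus>\<^bsub>adjsp E F\<^esub> T) < \<epsilon> / 2"
    using T \<epsilon> half_gt_zero unfolding compact_iff[OF E F] by blast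
  note A = finite_rank_adj[OF E F S'(1)] finite_rank_adj[OF E F T'(1)]
  have "(S' \<oplus>\<^bsub>adjsp E F\<^esub> T') \<ominus>\<^bsub>adjsp E F\<^esub> (S \<oplus>\<^bsub>adjsp E F\<^esub> T) = (S' \<ominus>\<^bsub>adjsp E F\<^esub> S) \<oplus>\<^bsub>adjsp E F\<^esub> (T' \<ominus>\<^bsub>adjsp E F\<^esub> T)"
    using A SA TA by - (rule V.linear_identity4[of S S' T T']; simp)
  hence "opn E F ((S' \<oplus>\<^bsub>adjsp E F\<^esub> T') \<ominus>\<^bsub>adjsp E F\<^esub> (S \<oplus>\<^bsub>adjsp E F\<^esub> T)) \<le> opn E F (S' \<ominus>\<^bsub>adjsp E F\<^esub> S) + opn E F (T' \<ominus>\<^bsub>adjsp E F\<^esub> T)"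
    using V.triangle[of "S' \<ominus>\<^bsub>adjsp E F\<^esub> S" "T' \<ominus>\<^bsub>adjsp E F\<^esub> T"] A SA TA adj_diff(1)[OF E F] by simp
  thus "\<exists>R\<in>finite_rank E F. opn E F (R \<ominus>\<^bsub>adjsp E F\<^esub> (S \<oplus>\<^bsub>adjsp E F\<^esub> T)) < \<epsilon>"
    using S' T' V.linear_combinations_add[OF _ S'(1) T'(1)] ranks_adj[OF E F] by force
qed

text \<open>Covers adjoints, scalar multiples and composition at once; \<open>\<Psi>\<close> may be conjugate-linear, which is why
scalars only enter through rank one operators.\<close>

lemma compact_image:
  assumes E: "hilbert_module C E" and F: "hilbert_module C F"
    and E': "hilbert_module C E'" and F': "hilbert_module C F'"
    and T: "T \<in> cpt E F"
    and cl: "\<And>S. S \<in> adj E F \<Longrightarrow> \<Psi> S \<in> adj E' F'"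
    and add: "\<And>S T. S \<in> adj E F \<Longrightarrow> T \<in> adj E F \<Longrightarrow> \<Psi> (S \<oplus>\<^bsub>adjsp E F\<^esub> T) = \<Psi> S \<oplus>\<^bsub>adjsp E' F'\<^esub> \<Psi> T"
    and diff: "\<And>S T. S \<in> adj E F \<Longrightarrow> T \<in> adj E F \<Longrightarrow> \<Psi> (S \<ominus>\<^bsub>adjsp E F\<^esub> T) = \<Psi> S \<ominus>\<^bsub>adjsp E' F'\<^esub> \<Psi> T"
    and rank: "\<And>k S. S \<in> ranks E F \<Longrightarrow> \<Psi> (k \<odot>\<^bsub>adjsp E F\<^esub> S) \<in> finite_rank E' F'"
    and b: "\<And>S. S \<in> adj E F \<Longrightarrow> opn E' F' (\<Psi> S) \<le> c * opn E F S"
  shows "\<Psi> T \<in> cpt E' F'"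
proof -
  interpret V: carrier_normed_space "adjsp E F" "opn E F" by (rule adj_normed[OF E F])
  interpret V': carrier_normed_space "adjsp E' F'" "opn E' F'" by (rule adj_normed[OF E' F'])
  have TA: "T \<in> adj E F" by (rule compact_adj[OF T])
  have z: "\<Psi> \<zero>\<^bsub>adjsp E F\<^esub> = \<zero>\<^bsub>adjsp E' F'\<^esub>"
  proof -
    have "\<Psi> \<zero>\<^bsub>adjsp E F\<^esub> = \<Psi> (T \<ominus>\<^bsub>adjsp E F\<^esub> T)" using V.diff_eq_zero_iff[of T T] TA by simp
    thus ?thesis using diff[OF TA TA] V'.diff_eq_zero_iff[of "\<Psi> T" "\<Psi> T"] cl[OF TA] by simp
  qed
  have fr: "\<Psi> S \<in> finite_rank E' F'" if "S \<in> finite_rank E F" for S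
  proof -
    have R: "ranks E F \<subseteq> carrier (adjsp E F)" "ranks E' F' \<subseteq> carrier (adjsp E' F')"
      using ranks_adj[OF E F] ranks_adj[OF E' F'] by auto
    show ?thesis
    proof (rule V.linear_combinations_induct[OF R(1) that])
      show "\<Psi> \<zero>\<^bsub>adjsp E F\<^esub> \<in> finite_rank E' F'" using z V'.linear_combinations_zero by simp
      fix k s v assume s: "s \<in> ranks E F" and v: "v \<in> finite_rank E F" and Pv: "\<Psi> v \<in> finite_rank E' F'"
      have "s \<in> adj E F" "v \<in> adj E F" using s v R(1) finite_rank_adj[OF E F] by auto
      hence "\<Psi> (k \<odot>\<^bsub>adjsp E F\<^esub> s \<oplus>\<^bsub>adjsp E F\<^esub> v) = \<Psi> (k \<odot>\<^bsub>adjsp E F\<^esub> s) \<oplus>\<^bsub>adjsp E' F'\<^esub> \<Psi> v"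
        using add adj_smult(1)[OF E F] by simp
      thus "\<Psi> (k \<odot>\<^bsub>adjsp E F\<^esub> s \<oplus>\<^bsub>adjsp E F\<^esub> v) \<in> finite_rank E' F'"
        using V'.linear_combinations_add[OF R(2) rank[OF s] Pv] by simp
    qed
  qed
  show ?thesis
    unfolding compact_iff[OF E' F']
  proof (intro conjI allI impI)
    show "\<Psi> T \<in> adj E' F'" by (rule cl[OF TA])
    fix \<epsilon> :: real assume \<epsilon>: "\<epsilon> > 0"
    have "\<epsilon> / (\<bar>c\<bar> + 1) > 0" using \<epsilon> by simp
    then obtain S where S: "S \<in> finite_rank E F" "opn E F (S \<ominus>\<^bsub>adjsp E F\<^esub> T) < \<epsilon> / (\<bar>c\<bar> + 1)"
      using T unfolding compact_iff[OF E F] by blast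
    have SA: "S \<in> adj E F" by (rule finite_rank_adj[OF E F S(1)])
    have p: "0 \<le> opn E F (S \<ominus>\<^bsub>adjsp E F\<^esub> T)" by (rule opn_nonneg[OF adj_diff(1)[OF E F SA TA]])
    have "opn E' F' (\<Psi> S \<ominus>\<^bsub>adjsp E' F'\<^esub> \<Psi> T) \<le> c * opn E F (S \<ominus>\<^bsub>adjsp E F\<^esub> T)"
      using b[OF adj_diff(1)[OF E F SA TA]] by (simp add: diff[OF SA TA])
    also have "\<dots> \<le> (\<bar>c\<bar> + 1) * opn E F (S \<ominus>\<^bsub>adjsp E F\<^esub> T)" using p by (intro mult_right_mono) auto
    also have "\<dots> < \<epsilon>" using S(2) by (simp add: field_simps)
    finally show "\<exists>S\<in>finite_rank E' F'. opn E' F' (S \<ominus>\<^bsub>adjsp E' F'\<^esub> \<Psi> T) < \<epsilon>" using fr[OF S(1)] by blast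
  qed
qed

lemma finite_rank_smult:
  assumes E: "hilbert_module C E" and F: "hilbert_module C F" and "x \<in> Ob C" "f \<in> elts F x" "e \<in> elts E x"
  shows "k \<odot>\<^bsub>adjsp E F\<^esub> single_rank C E F x f e \<in> finite_rank E F"
proof -
  interpret V: complex_space "adjsp E F" by (rule complex_spaceI[OF adj_vector_space[OF E F]])
  have "single_rank C E F x f e \<in> ranks E F" using assms by (auto simp: ranks_def)
  thus ?thesis using ranks_adj[OF E F] by (intro V.linear_combinations_smult V.linear_combinations_base) auto
qed

lemma compact_smult:
  assumes E: "hilbert_module C E" and F: "hilbert_module C F" and T: "T \<in> cpt E F"
  shows "c \<odot>\<^bsub>adjsp E F\<^esub> T \<in> cpt E F"
proof (rule compact_image[OF E F E F T])
  interpret V: complex_space "adjsp E F" by (rule complex_spaceI[OF adj_vector_space[OF E F]])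
  fix S k assume S: "S \<in> ranks E F"
  hence "S \<in> adj E F" using ranks_adj[OF E F] by blast
  hence "c \<odot>\<^bsub>adjsp E F\<^esub> (k \<odot>\<^bsub>adjsp E F\<^esub> S) = (c * k) \<odot>\<^bsub>adjsp E F\<^esub> S" by (simp add: V.smult_smult)
  thus "c \<odot>\<^bsub>adjsp E F\<^esub> (k \<odot>\<^bsub>adjsp E F\<^esub> S) \<in> finite_rank E F"
    using S finite_rank_smult[OF E F] by (auto simp: ranks_def)
next
  interpret V: complex_space "adjsp E F" by (rule complex_spaceI[OF adj_vector_space[OF E F]])
  fix S T assume ST: "S \<in> adj E F" "T \<in> adj E F"
  show "c \<odot>\<^bsub>adjsp E F\<^esub> (S \<oplus>\<^bsub>adjsp E F\<^esub> T) = c \<odot>\<^bsub>adjsp E F\<^esub> S \<oplus>\<^bsub>adjsp E F\<^esub> c \<odot>\<^bsub>adjsp E F\<^esub> T"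
    using ST by (simp add: V.smult_add_right)
  show "c \<odot>\<^bsub>adjsp E F\<^esub> (S \<ominus>\<^bsub>adjsp E F\<^esub> T) = c \<odot>\<^bsub>adjsp E F\<^esub> S \<ominus>\<^bsub>adjsp E F\<^esub> c \<odot>\<^bsub>adjsp E F\<^esub> T"
    using ST by - (rule V.linear_identity2[of S T]; simp add: algebra_simps)
qed (use adj_smult[OF E F] in auto)

lemma op_comp_single_rank:
  assumes E: "hilbert_module C E" and F: "hilbert_module C F" and G: "hilbert_module C G"
    and x: "x \<in> Ob C" and f: "f \<in> elts F x" and e: "e \<in> elts E x" and T: "T \<in> adj F G"
  shows "op_comp E T (single_rank C E F x f e) = single_rank C E G x (T x f) e"
proof -
  interpret E: hilbert_cstar_module C E by (rule hilbert_cstar_moduleI[OF E])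
  show ?thesis
    using adj_closed[OF T x f] x f e
    by (intro adj_ext[OF op_comp_adj(1)[OF E F G single_rank_adj(1)[OF E F x f e] T] single_rank_adj(1)[OF E G x _ e]])
       (auto simp: adj_act[OF T])
qed

lemma dagger_smult_single_rank:
  assumes E: "hilbert_module C E" and F: "hilbert_module C F" and S: "S \<in> ranks E F"
  shows "dagger E F (k \<odot>\<^bsub>adjsp E F\<^esub> S) \<in> finite_rank F E"
proof -
  obtain x f e where x: "x \<in> Ob C" "f \<in> elts F x" "e \<in> elts E x" and S: "S = single_rank C E F x f e"
    using S by (auto simp: ranks_def)
  show ?thesis unfolding S
    using x by (simp add: adj_smult(2)[OF E F single_rank_adj(1)[OF E F x]] single_rank_adj(2)[OF E F x] finite_rank_smult[OF F E])
qed

lemma compact_dagger: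
  assumes E: "hilbert_module C E" and F: "hilbert_module C F" and T: "T \<in> cpt E F"
  shows "dagger E F T \<in> cpt F E"
  by (rule compact_image[OF E F F E T, of _ 1])
     (simp_all add: dagger_adj[OF E F] adj_add(2)[OF E F] dagger_diff[OF E F] dagger_smult_single_rank[OF E F] opn_dagger[OF E F])

lemma compact_comp_left:
  assumes E: "hilbert_module C E" and F: "hilbert_module C F" and G: "hilbert_module C G"
    and T: "T \<in> cpt E F" and S: "S \<in> adj F G"
  shows "op_comp E S T \<in> cpt E G"
proof (rule compact_image[OF E F E G T])
  note lin = op_comp_linear_right[OF E F G S]
  note L = complex_linearD[OF lin, simplified]
  note D = complex_linear_diff[OF adj_vector_space[OF E F] adj_vector_space[OF E G] lin, simplified]
  show "op_comp E S R \<in> adj E G" if "R \<in> adj E F" for R using L(1) that by blast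
  show "opn E G (op_comp E S R) \<le> opn F G S * opn E F R" if "R \<in> adj E F" for R
    by (rule op_comp_adj(3)[OF E F G that S])
  show "op_comp E S (k \<odot>\<^bsub>adjsp E F\<^esub> R) \<in> finite_rank E G" if R: "R \<in> ranks E F" for k R
  proof -
    obtain x f e where x: "x \<in> Ob C" "f \<in> elts F x" "e \<in> elts E x" and R': "R = single_rank C E F x f e"
      using R by (auto simp: ranks_def)
    have "op_comp E S (k \<odot>\<^bsub>adjsp E F\<^esub> R) = k \<odot>\<^bsub>adjsp E G\<^esub> op_comp E S R"
      using L(3) ranks_adj[OF E F] R by blast
    thus ?thesis
      unfolding R' op_comp_single_rank[OF E F G x S]
      using finite_rank_smult[OF E G x(1) adj_closed[OF S x(1,2)] x(3)] by simp
  qed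
qed (use op_comp_linear_right[OF E F G S] in \<open>simp_all add: complex_linear_def
      complex_linear_diff[OF adj_vector_space[OF E F] adj_vector_space[OF E G] op_comp_linear_right[OF E F G S]]\<close>)

lemma compact_comp_right:
  assumes E: "hilbert_module C E" and F: "hilbert_module C F" and G: "hilbert_module C G"
    and T: "T \<in> adj E F" and S: "S \<in> cpt F G"
  shows "op_comp E S T \<in> cpt E G"
proof -
  have SA: "S \<in> adj F G" by (rule compact_adj[OF S])
  have "dagger G E (op_comp G (dagger E F T) (dagger F G S)) \<in> cpt E G"
    by (intro compact_dagger[OF G E] compact_comp_left[OF G F E] compact_dagger[OF F G S] dagger_adj(1)[OF E F T])
  also have "dagger G E (op_comp G (dagger E F T) (dagger F G S)) = op_comp E S T"
    using op_comp_adj(2)[OF E F G T SA] dagger_dagger[OF E G op_comp_adj(1)[OF E F G T SA]] by simp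
  finally show ?thesis .
qed

section \<open>Approximate units\<close>

text \<open>Let \<open>P = \<theta>\<^bsup>f,f\<^esup>\<close>, \<open>G = (P + \<epsilon>)\<^sup>-\<^sup>1\<close>, \<open>u = G f\<close> and \<open>K = \<theta>\<^bsup>f,u\<^esup> = P G\<close>. Contractivity is the inequality
\<open>\<parallel>P v\<parallel> \<le> \<parallel>(P + \<epsilon>) v\<parallel>\<close>. The error is \<open>K f - f = - \<epsilon> u\<close>. To estimate it, let \<open>s = \<langle>f, u\<rangle>\<close>; pairing \<open>f = P u + \<epsilon> u\<close> with \<open>u\<close> gives
\<open>s\<^sup>* = s\<^sup>* s + \<epsilon> \<langle>u, u\<rangle>\<close>. Dropping the second summand shows \<open>\<parallel>s\<parallel> \<le> 1\<close>; dropping the first one then shows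
\<open>\<epsilon> \<parallel>u\<parallel>\<^sup>2 \<le> 1\<close>.\<close>

lemma compact_approximate_unit:
  assumes F: "hilbert_module C F" and x: "x \<in> Ob C" and f: "f \<in> elts F x" and \<epsilon>: "\<epsilon> > 0"
  shows "\<exists>K\<in>cpt F F. opn F F K \<le> 1 \<and> (module_norm C F x (K x f \<ominus>\<^bsub>fibre F x\<^esub> f))\<^sup>2 \<le> \<epsilon>"
proof -
  let ?V = "fibre F x"
  let ?B = "homsp C x x"
  interpret F: hilbert_cstar_module C F by (rule hilbert_cstar_moduleI[OF F])
  interpret VF: carrier_normed_space "?V" "module_norm C F x" by (rule F.fibre_normed[OF x])
  interpret B: carrier_normed_space "?B" "nrm (?B)" by (rule hom_normed[OF x x])
  define P where "P = single_rank C F F x f f"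
  have P: "P \<in> adj F F" and self: "dagger F F P = P"
    unfolding P_def using single_rank_adj[OF F F x f f] by auto
  have Psym: "inn F y z (P z e) g = inn F y z e (P y g)"
    if "y \<in> Ob C" "z \<in> Ob C" "e \<in> elts F z" "g \<in> elts F y" for y z e g
    using adjoint_pairD(3)[OF dagger_pair[OF F F P] that] by (simp add: self)
  have inner: "inn F w w e (P w e) = comp C w x w (star C w x (inn F w x f e)) (inn F w x f e)"
    if w: "w \<in> Ob C" and e: "e \<in> elts F w" for w e
  proof -
    have "inn F w w e (P w e) = comp C w x w (inn F x w e f) (inn F w x f e)"
      using x f w e by (simp add: P_def F.inn_act)
    thus ?thesis using F.inn_star[OF x w e f] by simp
  qed
  have pos: "positive C w (inn F w w e (P w e))" if "w \<in> Ob C" "e \<in> elts F w" for w e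
    using positive_star_comp[OF that(1) x, of "inn F w x f e"] inner[OF that] that x f by simp
  have npos: "norm_positive w (inn F w w e (P w e))" if "w \<in> Ob C" "e \<in> elts F w" for w e
    by (rule positive_imp_norm_positive[OF that(1) pos[OF that]])
  define l where "l = - complex_of_real \<epsilon>"
  have l: "l \<notin> \<real>\<^sub>\<ge>\<^sub>0" using \<epsilon> by (simp add: l_def complex_nonneg_Reals_iff)
  obtain G where G: "G \<in> adj F F"
    and G1: "\<And>y w. y \<in> Ob C \<Longrightarrow> w \<in> elts F y \<Longrightarrow> P y (G y w) \<ominus>\<^bsub>fibre F y\<^esub> l \<odot>\<^bsub>fibre F y\<^esub> G y w = w"
    using positive_operator_resolvent[OF F P self npos l] by blast
  have G2: "P y (G y w) \<oplus>\<^bsub>fibre F y\<^esub> complex_of_real \<epsilon> \<odot>\<^bsub>fibre F y\<^esub> G y w = w"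
    if y: "y \<in> Ob C" and w: "w \<in> elts F y" for y w
  proof -
    interpret Vy: complex_space "fibre F y" by (rule F.fibre_space[OF y])
    have Gw: "G y w \<in> elts F y" "P y (G y w) \<in> elts F y" using adj_closed[OF G y w] adj_closed[OF P y] by auto
    have "P y (G y w) \<oplus>\<^bsub>fibre F y\<^esub> complex_of_real \<epsilon> \<odot>\<^bsub>fibre F y\<^esub> G y w =
        P y (G y w) \<ominus>\<^bsub>fibre F y\<^esub> l \<odot>\<^bsub>fibre F y\<^esub> G y w"
      unfolding l_def using Gw by - (rule Vy.linear_identity2[of "P y (G y w)" "G y w"]; simp)
    thus ?thesis using G1[OF y w] by simp
  qed
  define u where "u = G x f"
  have u: "u \<in> elts F x" using adj_closed[OF G x f] by (simp add: u_def)
  \<comment> \<open>That is, \<open>\<langle>G f, e\<rangle> = \<langle>f, G e\<rangle>\<close>: insert \<open>e = (P + \<epsilon>) G e\<close> and move \<open>P + \<epsilon>\<close> across.\<close>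
  have Gsym: "inn F w x u e = inn F w x f (G w e)" if w: "w \<in> Ob C" and e: "e \<in> elts F w" for w e
  proof -
    have Ge: "G w e \<in> elts F w" "P w (G w e) \<in> elts F w" using adj_closed[OF G w e] adj_closed[OF P w] by auto
    have Pu: "P x u \<in> elts F x" by (rule adj_closed[OF P x u])
    interpret Vw: complex_space "fibre F w" by (rule F.fibre_space[OF w])
    have "inn F w x u e = inn F w x u (P w (G w e) \<oplus>\<^bsub>fibre F w\<^esub> complex_of_real \<epsilon> \<odot>\<^bsub>fibre F w\<^esub> G w e)"
      using G2[OF w e] by simp
    also have "\<dots> = inn F w x (P x u \<oplus>\<^bsub>?V\<^esub> complex_of_real \<epsilon> \<odot>\<^bsub>?V\<^esub> u) (G w e)"
      using w x u Ge Pu by (simp add: F.inn_add_left F.inn_add_right F.inn_smult_left F.inn_smult_right Psym)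
    also have "\<dots> = inn F w x f (G w e)" using G2[OF x f] by (simp add: u_def)
    finally show ?thesis .
  qed
  define K where "K = single_rank C F F x f u"
  have K: "K \<in> cpt F F" unfolding K_def by (rule single_rank_compact[OF F F x f u])
  have KG: "K w e = P w (G w e)" if "w \<in> Ob C" "e \<in> elts F w" for w e
    using that adj_closed[OF G that] by (simp add: K_def P_def Gsym)
  have contr: "module_norm C F w (K w e) \<le> 1 * module_norm C F w e" if w: "w \<in> Ob C" and e: "e \<in> elts F w" for w e
  proof -
    define v where "v = G w e"
    have v: "v \<in> elts F w" using adj_closed[OF G w e] by (simp add: v_def)
    have "module_norm C F w (P w v) \<le> module_norm C F w (P w v \<oplus>\<^bsub>fibre F w\<^esub> complex_of_real \<epsilon> \<odot>\<^bsub>fibre F w\<^esub> v)"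
      by (rule shifted_positive_operator_norms(2)[OF F w adj_linear[OF P w] Psym[OF w w] npos[OF w] \<epsilon> v])
    thus ?thesis using KG[OF w e] G2[OF w e] by (simp add: v_def)
  qed
  have opK: "opn F F K \<le> 1" by (rule opn_le[OF _ contr]) simp
  define s where "s = inn F x x f u"
  have s: "s \<in> hom C x x" using x f u by (simp add: s_def)
  define q where "q = complex_of_real (sqrt \<epsilon>) \<odot>\<^bsub>?V\<^esub> u"
  have q: "q \<in> elts F x" using u by (simp add: q_def)
  have Pu: "P x u \<in> elts F x" by (rule adj_closed[OF P x u])
  have f': "f = P x u \<oplus>\<^bsub>?V\<^esub> complex_of_real \<epsilon> \<odot>\<^bsub>?V\<^esub> u" using G2[OF x f] by (simp add: u_def)
  have qq: "inn F x x q q = complex_of_real \<epsilon> \<odot>\<^bsub>?B\<^esub> inn F x x u u"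
  proof -
    have "complex_of_real (sqrt \<epsilon>) * complex_of_real (sqrt \<epsilon>) = complex_of_real \<epsilon>"
      using \<epsilon> by (simp flip: of_real_mult)
    thus ?thesis unfolding q_def using x u by (simp add: F.inn_smult_left F.inn_smult_right B.smult_smult)
  qed
  have "star C x x s = inn F x x u f" using F.inn_star[OF x x u f] by (simp add: s_def)
  also have "\<dots> = inn F x x u (P x u) \<oplus>\<^bsub>?B\<^esub> complex_of_real \<epsilon> \<odot>\<^bsub>?B\<^esub> inn F x x u u"
    by (subst f') (use x u Pu in \<open>simp add: F.inn_add_right F.inn_smult_right\<close>)
  finally have ss: "star C x x s = inn F x x u (P x u) \<oplus>\<^bsub>?B\<^esub> inn F x x q q" by (simp add: qq)
  have "nrm (?B) (inn F x x u (P x u)) \<le> nrm (?B) (star C x x s)"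
    unfolding ss by (rule norm_mono_positive[OF x pos[OF x u] F.norm_positive_inn[OF x q]])
  moreover have "nrm (?B) (inn F x x u (P x u)) = (nrm (?B) s)\<^sup>2"
    unfolding inner[OF x u] s_def[symmetric] by (rule cstar_identity[OF x x s])
  ultimately have "(nrm (?B) s)\<^sup>2 \<le> nrm (?B) s" using norm_star[OF x x s] by simp
  hence s1: "nrm (?B) s \<le> 1" using B.nonneg[OF s]
    by (cases "nrm (?B) s = 0") (auto simp: power2_eq_square)
  have "nrm (?B) (inn F x x q q \<oplus>\<^bsub>?B\<^esub> inn F x x u (P x u)) \<le> 1\<^sup>2"
  proof -
    have "inn F x x q q \<oplus>\<^bsub>?B\<^esub> inn F x x u (P x u) = star C x x s"
      unfolding ss using x q u Pu by (simp add: B.M.a_comm)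
    thus ?thesis using s1 norm_star[OF x x s] by simp
  qed
  hence "module_norm C F x q \<le> 1"
    by (intro F.module_norm_le_of_inn[OF x q npos[OF x u]]) auto
  hence "sqrt \<epsilon> * module_norm C F x u \<le> 1" using u \<epsilon> by (simp add: q_def VF.scale)
  hence "(sqrt \<epsilon> * module_norm C F x u)\<^sup>2 \<le> 1" using u x \<epsilon> by (intro power_le_one) auto
  hence le: "\<epsilon> * (module_norm C F x u)\<^sup>2 \<le> 1" using \<epsilon> by (simp add: power_mult_distrib)
  have "K x f \<ominus>\<^bsub>?V\<^esub> f = (- complex_of_real \<epsilon>) \<odot>\<^bsub>?V\<^esub> u"
  proof -
    have "P x u \<ominus>\<^bsub>?V\<^esub> (P x u \<oplus>\<^bsub>?V\<^esub> complex_of_real \<epsilon> \<odot>\<^bsub>?V\<^esub> u) = (- complex_of_real \<epsilon>) \<odot>\<^bsub>?V\<^esub> u"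
      using u Pu by - (rule VF.linear_identity2[of "P x u" u]; simp)
    moreover have "K x f = P x u" using KG[OF x f] by (simp add: u_def)
    ultimately show ?thesis using f' by metis
  qed
  hence "module_norm C F x (K x f \<ominus>\<^bsub>?V\<^esub> f) = \<epsilon> * module_norm C F x u"
    using u \<epsilon> by (simp add: VF.scale)
  hence "(module_norm C F x (K x f \<ominus>\<^bsub>?V\<^esub> f))\<^sup>2 = \<epsilon> * (\<epsilon> * (module_norm C F x u)\<^sup>2)"
    by (simp add: power_mult_distrib power2_eq_square)
  also have "\<dots> \<le> \<epsilon> * 1" using le \<epsilon> by (intro mult_left_mono) auto
  finally show ?thesis using K opK by auto
qed

end

section \<open>Transport of the axioms along an isomorphism\<close>

lemma complex_banach_space_transport:
  fixes V :: "('v, 'y) normed_space_scheme" and W :: "('w, 'z) normed_space_scheme"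
  assumes V: "complex_banach_space V" and bij: "bij_betw \<phi> (carrier V) (carrier W)"
    and zero: "\<phi> \<zero>\<^bsub>V\<^esub> = \<zero>\<^bsub>W\<^esub>"
    and add: "\<And>u v. u \<in> carrier V \<Longrightarrow> v \<in> carrier V \<Longrightarrow> \<phi> (u \<oplus>\<^bsub>V\<^esub> v) = \<phi> u \<oplus>\<^bsub>W\<^esub> \<phi> v"
    and smult: "\<And>c u. u \<in> carrier V \<Longrightarrow> \<phi> (c \<odot>\<^bsub>V\<^esub> u) = c \<odot>\<^bsub>W\<^esub> \<phi> u"
    and nrm: "\<And>u. u \<in> carrier V \<Longrightarrow> nrm W (\<phi> u) = nrm V u"
  shows "complex_banach_space W"
proof -
  interpret V: complex_banach_space V by (rule V)
  interpret VN: carrier_normed_space V "nrm V" by (rule V.normed_space)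
  have cl: "\<phi> u \<in> carrier W" if "u \<in> carrier V" for u using bij that by (auto simp: bij_betw_def)
  have ex: "\<exists>u\<in>carrier V. w = \<phi> u" if "w \<in> carrier W" for w using bij that by (auto simp: bij_betw_def)
  have inj: "u = v" if "\<phi> u = \<phi> v" "u \<in> carrier V" "v \<in> carrier V" for u v
    using bij that by (auto simp: bij_betw_def inj_on_def)
  have zW: "\<zero>\<^bsub>W\<^esub> \<in> carrier W" using cl[OF V.M.zero_closed] zero by simp
  have vs: "complex_vector_space W"
  proof (rule moduleI[OF cring_complex_field])
    show "abelian_group W"
    proof (rule abelian_groupI)
      fix a b c assume "a \<in> carrier W" "b \<in> carrier W" "c \<in> carrier W"
      then obtain u v w where u: "u \<in> carrier V" "v \<in> carrier V" "w \<in> carrier V" "a = \<phi> u" "b = \<phi> v" "c = \<phi> w"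
        using ex by metis
      show "a \<oplus>\<^bsub>W\<^esub> b \<in> carrier W" using u cl by (simp flip: add)
      show "a \<oplus>\<^bsub>W\<^esub> b \<oplus>\<^bsub>W\<^esub> c = a \<oplus>\<^bsub>W\<^esub> (b \<oplus>\<^bsub>W\<^esub> c)" using u by (simp add: V.M.a_assoc flip: add)
      show "a \<oplus>\<^bsub>W\<^esub> b = b \<oplus>\<^bsub>W\<^esub> a" using u by (simp add: V.M.a_comm flip: add)
      show "\<zero>\<^bsub>W\<^esub> \<oplus>\<^bsub>W\<^esub> a = a" using u by (simp flip: add zero)
      show "\<exists>y\<in>carrier W. y \<oplus>\<^bsub>W\<^esub> a = \<zero>\<^bsub>W\<^esub>"
        using u cl by (intro bexI[of _ "\<phi> (\<ominus>\<^bsub>V\<^esub> u)"]) (simp_all add: V.M.l_neg zero flip: add)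
    qed (rule zW)
    fix k l :: complex and a b assume "a \<in> carrier W"
    then obtain u where u: "u \<in> carrier V" "a = \<phi> u" using ex by blast
    show "k \<odot>\<^bsub>W\<^esub> a \<in> carrier W" using u cl by (simp flip: smult)
    show "(k \<oplus>\<^bsub>complex_field\<^esub> l) \<odot>\<^bsub>W\<^esub> a = k \<odot>\<^bsub>W\<^esub> a \<oplus>\<^bsub>W\<^esub> l \<odot>\<^bsub>W\<^esub> a"
      using u by (simp add: VN.smult_add_left flip: smult add)
    show "(k \<otimes>\<^bsub>complex_field\<^esub> l) \<odot>\<^bsub>W\<^esub> a = k \<odot>\<^bsub>W\<^esub> (l \<odot>\<^bsub>W\<^esub> a)"
      using u by (simp add: VN.smult_smult flip: smult)
    show "\<one>\<^bsub>complex_field\<^esub> \<odot>\<^bsub>W\<^esub> a = a" using u by (simp flip: smult)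
    assume "b \<in> carrier W"
    then obtain v where v: "v \<in> carrier V" "b = \<phi> v" using ex by blast
    show "k \<odot>\<^bsub>W\<^esub> (a \<oplus>\<^bsub>W\<^esub> b) = k \<odot>\<^bsub>W\<^esub> a \<oplus>\<^bsub>W\<^esub> k \<odot>\<^bsub>W\<^esub> b"
      using u v by (simp add: VN.smult_add_right flip: smult add)
  qed
  have lin: "complex_linear V W \<phi>" using cl add smult by (auto simp: complex_linear_def)
  have diff: "\<phi> (u \<ominus>\<^bsub>V\<^esub> v) = \<phi> u \<ominus>\<^bsub>W\<^esub> \<phi> v" if "u \<in> carrier V" "v \<in> carrier V" for u v
    by (rule complex_linear_diff[OF VN.space vs lin that])
  have compl: "complete_wrt W (nrm W)"
    unfolding complete_wrt_def
  proof (intro allI impI)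
    fix s :: "nat \<Rightarrow> 'w" assume s: "range s \<subseteq> carrier W"
      and c: "\<forall>\<epsilon>>0. \<exists>N. \<forall>i\<ge>N. \<forall>j\<ge>N. nrm W (s i \<ominus>\<^bsub>W\<^esub> s j) < \<epsilon>"
    have "\<exists>u. u \<in> carrier V \<and> s i = \<phi> u" for i using s ex by (meson range_subsetD)
    then obtain t where t: "\<And>i. t i \<in> carrier V" "\<And>i. s i = \<phi> (t i)" by metis
    have "nrm W (s i \<ominus>\<^bsub>W\<^esub> s j) = nrm V (t i \<ominus>\<^bsub>V\<^esub> t j)" for i j
      using t by (simp add: nrm flip: diff)
    hence "\<forall>\<epsilon>>0. \<exists>N. \<forall>i\<ge>N. \<forall>j\<ge>N. nrm V (t i \<ominus>\<^bsub>V\<^esub> t j) < \<epsilon>" using c by simp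
    moreover have "range t \<subseteq> carrier V" using t by blast
    ultimately obtain l where l: "l \<in> carrier V" "(\<lambda>i. nrm V (t i \<ominus>\<^bsub>V\<^esub> l)) \<longlonglongrightarrow> 0"
      using V.complete unfolding complete_wrt_def by blast
    have "(\<lambda>i. nrm W (s i \<ominus>\<^bsub>W\<^esub> \<phi> l)) \<longlonglongrightarrow> 0" using l t by (simp add: nrm flip: diff)
    thus "\<exists>l\<in>carrier W. (\<lambda>i. nrm W (s i \<ominus>\<^bsub>W\<^esub> l)) \<longlonglongrightarrow> 0" using cl[OF l(1)] by blast
  qed
  show ?thesis
  proof (intro complex_banach_space.intro[OF vs] complex_banach_space_axioms.intro compl)
    fix a b c assume "a \<in> carrier W"
    then obtain u where u: "u \<in> carrier V" "a = \<phi> u" using ex by blast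
    show "0 \<le> nrm W a" using u VN.nonneg by (simp add: nrm)
    show "nrm W a = 0 \<longleftrightarrow> a = \<zero>\<^bsub>W\<^esub>" using u inj[of u "\<zero>\<^bsub>V\<^esub>"] by (auto simp: nrm VN.eq_zero zero)
    show "nrm W (c \<odot>\<^bsub>W\<^esub> a) = cmod c * nrm W a" using u by (simp add: nrm VN.scale flip: smult)
    assume "b \<in> carrier W"
    then obtain v where v: "v \<in> carrier V" "b = \<phi> v" using ex by blast
    show "nrm W (a \<oplus>\<^bsub>W\<^esub> b) \<le> nrm W a + nrm W b" using u v VN.triangle by (simp add: nrm flip: add)
  qed
qed

text \<open>The target is a mere record of operations: that it is a \<open>C\<^sup>*\<close>-category is a conclusion. The maps
are required to be bijective and compatible with the operations and the norms. Units in the source are assumed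
because they identify both spectra with the ordinary ones.\<close>

locale star_category_isomorphism = C: cstar_category C
  for C :: "('o, 'm) star_category" and D :: "('o, 'n) star_category" +
  fixes \<phi> :: "'o \<Rightarrow> 'o \<Rightarrow> 'm \<Rightarrow> 'n" and u :: "'o \<Rightarrow> 'm"
  assumes Ob [simp]: "Ob D = Ob C"
    and bij: "\<lbrakk>x \<in> Ob C; y \<in> Ob C\<rbrakk> \<Longrightarrow> bij_betw (\<phi> x y) (hom C x y) (hom D x y)"
    and zero: "\<lbrakk>x \<in> Ob C; y \<in> Ob C\<rbrakk> \<Longrightarrow> \<phi> x y \<zero>\<^bsub>homsp C x y\<^esub> = \<zero>\<^bsub>homsp D x y\<^esub>"
    and add: "\<lbrakk>x \<in> Ob C; y \<in> Ob C; f \<in> hom C x y; g \<in> hom C x y\<rbrakk> \<Longrightarrow>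
      \<phi> x y (f \<oplus>\<^bsub>homsp C x y\<^esub> g) = \<phi> x y f \<oplus>\<^bsub>homsp D x y\<^esub> \<phi> x y g"
    and smult: "\<lbrakk>x \<in> Ob C; y \<in> Ob C; f \<in> hom C x y\<rbrakk> \<Longrightarrow>
      \<phi> x y (c \<odot>\<^bsub>homsp C x y\<^esub> f) = c \<odot>\<^bsub>homsp D x y\<^esub> \<phi> x y f"
    and norm: "\<lbrakk>x \<in> Ob C; y \<in> Ob C; f \<in> hom C x y\<rbrakk> \<Longrightarrow> nrm (homsp D x y) (\<phi> x y f) = nrm (homsp C x y) f"
    and comp: "\<lbrakk>x \<in> Ob C; y \<in> Ob C; z \<in> Ob C; f \<in> hom C x y; g \<in> hom C y z\<rbrakk> \<Longrightarrow>
      \<phi> x z (comp C x y z g f) = comp D x y z (\<phi> y z g) (\<phi> x y f)"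
    and star: "\<lbrakk>x \<in> Ob C; y \<in> Ob C; f \<in> hom C x y\<rbrakk> \<Longrightarrow> \<phi> y x (star C x y f) = star D x y (\<phi> x y f)"
    and identity: "x \<in> Ob C \<Longrightarrow> identity_arrow C x (u x)"
begin

lemma closed: "\<lbrakk>x \<in> Ob C; y \<in> Ob C; f \<in> hom C x y\<rbrakk> \<Longrightarrow> \<phi> x y f \<in> hom D x y"
  using bij[of x y] by (auto simp: bij_betw_def)

lemma preimage: "\<lbrakk>x \<in> Ob C; y \<in> Ob C; a \<in> hom D x y\<rbrakk> \<Longrightarrow> \<exists>f\<in>hom C x y. a = \<phi> x y f"
  using bij[of x y] by (auto simp: bij_betw_def)

lemma injective: "\<lbrakk>x \<in> Ob C; y \<in> Ob C; f \<in> hom C x y; g \<in> hom C x y\<rbrakk> \<Longrightarrow> \<phi> x y f = \<phi> x y g \<longleftrightarrow> f = g"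
  using bij[of x y] by (auto simp: bij_betw_def inj_on_def)

lemma target_banach: "\<lbrakk>x \<in> Ob C; y \<in> Ob C\<rbrakk> \<Longrightarrow> complex_banach_space (homsp D x y)"
  by (rule complex_banach_space_transport[OF C.hom_banach bij zero add smult norm])

lemma target_space: "\<lbrakk>x \<in> Ob C; y \<in> Ob C\<rbrakk> \<Longrightarrow> complex_vector_space (homsp D x y)"
  using target_banach complex_banach_space.axioms(1) by blast

lemma map_linear: "\<lbrakk>x \<in> Ob C; y \<in> Ob C\<rbrakk> \<Longrightarrow> complex_linear (homsp C x y) (homsp D x y) (\<phi> x y)"
  using closed add smult by (auto simp: complex_linear_def)

lemma map_diff: "\<lbrakk>x \<in> Ob C; y \<in> Ob C; f \<in> hom C x y; g \<in> hom C x y\<rbrakk> \<Longrightarrow>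
    \<phi> x y (f \<ominus>\<^bsub>homsp C x y\<^esub> g) = \<phi> x y f \<ominus>\<^bsub>homsp D x y\<^esub> \<phi> x y g"
  by (rule complex_linear_diff[OF C.hom_space target_space map_linear])

lemma target_comp_linear_left:
  assumes x: "x \<in> Ob C" "y \<in> Ob C" "z \<in> Ob C" and f: "f \<in> hom D x y"
  shows "complex_linear (homsp D y z) (homsp D x z) (\<lambda>g. comp D x y z g f)"
proof -
  obtain f' where f': "f' \<in> hom C x y" "f = \<phi> x y f'" using preimage x f by blast
  note L = complex_linearD[OF C.comp_linear_left[OF x f'(1)]]
  show ?thesis
    unfolding complex_linear_def
  proof (intro conjI ballI allI Pi_I)
    fix a b c assume "a \<in> hom D y z"
    then obtain a' where a: "a' \<in> hom C y z" "a = \<phi> y z a'" using preimage x by blast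
    show "comp D x y z a f \<in> hom D x z" using a f' x closed by (simp flip: comp)
    show "comp D x y z (c \<odot>\<^bsub>homsp D y z\<^esub> a) f = c \<odot>\<^bsub>homsp D x z\<^esub> comp D x y z a f"
    proof -
      interpret N: complex_space "homsp C y z" by (rule complex_spaceI[OF C.hom_space[OF x(2,3)]])
      have "c \<odot>\<^bsub>homsp D y z\<^esub> a = \<phi> y z (c \<odot>\<^bsub>homsp C y z\<^esub> a')" using a x by (simp add: smult)
      thus ?thesis using a f' x L by (simp flip: comp smult)
    qed
    assume "b \<in> hom D y z"
    then obtain b' where b: "b' \<in> hom C y z" "b = \<phi> y z b'" using preimage x by blast
    show "comp D x y z (a \<oplus>\<^bsub>homsp D y z\<^esub> b) f = comp D x y z a f \<oplus>\<^bsub>homsp D x z\<^esub> comp D x y z b f"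
    proof -
      interpret N: complex_space "homsp C y z" by (rule complex_spaceI[OF C.hom_space[OF x(2,3)]])
      have "a \<oplus>\<^bsub>homsp D y z\<^esub> b = \<phi> y z (a' \<oplus>\<^bsub>homsp C y z\<^esub> b')" using a b x by (simp add: add)
      thus ?thesis using a b f' x L by (simp flip: comp add)
    qed
  qed
qed

lemma target_comp_linear_right:
  assumes x: "x \<in> Ob C" "y \<in> Ob C" "z \<in> Ob C" and g: "g \<in> hom D y z"
  shows "complex_linear (homsp D x y) (homsp D x z) (\<lambda>f. comp D x y z g f)"
proof -
  obtain g' where g': "g' \<in> hom C y z" "g = \<phi> y z g'" using preimage x g by blast
  note L = complex_linearD[OF C.comp_linear_right[OF x g'(1)]]
  show ?thesis
    unfolding complex_linear_def
  proof (intro conjI ballI allI Pi_I)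
    interpret N: complex_space "homsp C x y" by (rule complex_spaceI[OF C.hom_space[OF x(1,2)]])
    fix a b c assume "a \<in> hom D x y"
    then obtain a' where a: "a' \<in> hom C x y" "a = \<phi> x y a'" using preimage x by blast
    show "comp D x y z g a \<in> hom D x z" using a g' x closed by (simp flip: comp)
    have "c \<odot>\<^bsub>homsp D x y\<^esub> a = \<phi> x y (c \<odot>\<^bsub>homsp C x y\<^esub> a')" using a x by (simp add: smult)
    thus "comp D x y z g (c \<odot>\<^bsub>homsp D x y\<^esub> a) = c \<odot>\<^bsub>homsp D x z\<^esub> comp D x y z g a"
      using a g' x L by (simp flip: comp smult)
    assume "b \<in> hom D x y"
    then obtain b' where b: "b' \<in> hom C x y" "b = \<phi> x y b'" using preimage x by blast
    have "a \<oplus>\<^bsub>homsp D x y\<^esub> b = \<phi> x y (a' \<oplus>\<^bsub>homsp C x y\<^esub> b')" using a b x by (simp add: add)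
    thus "comp D x y z g (a \<oplus>\<^bsub>homsp D x y\<^esub> b) = comp D x y z g a \<oplus>\<^bsub>homsp D x z\<^esub> comp D x y z g b"
      using a b g' x L by (simp flip: comp add)
  qed
qed

lemma target_identity: "x \<in> Ob C \<Longrightarrow> identity_arrow D x (\<phi> x x (u x))"
proof -
  assume x: "x \<in> Ob C"
  have ux: "u x \<in> hom C x x" using identity[OF x] by (simp add: identity_arrow_def)
  show ?thesis
    unfolding identity_arrow_def Ob
  proof (intro conjI ballI closed x ux)
    fix y f assume y: "y \<in> Ob C"
    show "comp D x x y f (\<phi> x x (u x)) = f" if f: "f \<in> hom D x y"
    proof -
      obtain f' where f': "f' \<in> hom C x y" "f = \<phi> x y f'" using preimage x y f by blast
      thus ?thesis using identity[OF x] x y ux by (simp add: identity_arrow_def flip: comp)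
    qed
    show "comp D y x x (\<phi> x x (u x)) f = f" if f: "f \<in> hom D y x"
    proof -
      obtain f' where f': "f' \<in> hom C y x" "f = \<phi> y x f'" using preimage x y f by blast
      thus ?thesis using identity[OF x] x y ux by (simp add: identity_arrow_def flip: comp)
    qed
  qed
qed

lemma spectrum_eq:
  assumes x: "x \<in> Ob C" and a: "a \<in> hom C x x"
  shows "spectrum D x (\<phi> x x a) = spectrum C x a"
proof -
  interpret N: complex_space "homsp C x x" by (rule complex_spaceI[OF C.hom_space[OF x x]])
  have ux: "u x \<in> hom C x x" using identity[OF x] by (simp add: identity_arrow_def)
  have uC: "algebra_unit C x (u x)" using identity[OF x] x by (auto simp: identity_arrow_def algebra_unit_def)
  have uD: "algebra_unit D x (\<phi> x x (u x))" using target_identity[OF x] x by (auto simp: identity_arrow_def algebra_unit_def)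
  have "l \<in> spectrum D x (\<phi> x x a) \<longleftrightarrow> l \<in> spectrum C x a" for l
  proof -
    let ?k = "a \<ominus>\<^bsub>homsp C x x\<^esub> l \<odot>\<^bsub>homsp C x x\<^esub> u x"
    have k: "?k \<in> hom C x x" using a ux by simp
    have k': "\<phi> x x a \<ominus>\<^bsub>homsp D x x\<^esub> l \<odot>\<^bsub>homsp D x x\<^esub> \<phi> x x (u x) = \<phi> x x ?k"
      using a ux x by (simp add: map_diff smult)
    have "(\<exists>c\<in>hom D x x. comp D x x x c (\<phi> x x ?k) = \<phi> x x (u x) \<and> comp D x x x (\<phi> x x ?k) c = \<phi> x x (u x)) \<longleftrightarrow>
        (\<exists>c\<in>hom C x x. comp C x x x c ?k = u x \<and> comp C x x x ?k c = u x)" (is "?L \<longleftrightarrow> ?R")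
    proof
      assume ?L
      then obtain c where c: "c \<in> hom D x x" "comp D x x x c (\<phi> x x ?k) = \<phi> x x (u x)" "comp D x x x (\<phi> x x ?k) c = \<phi> x x (u x)"
        by blast
      obtain c' where c': "c' \<in> hom C x x" "c = \<phi> x x c'" using preimage[OF x x c(1)] by blast
      have "comp C x x x c' ?k = u x" "comp C x x x ?k c' = u x"
        using c(2,3) c' k x ux by (simp_all add: injective flip: comp)
      thus ?R using c'(1) by blast
    next
      assume ?R
      then obtain c where "c \<in> hom C x x" "comp C x x x c ?k = u x" "comp C x x x ?k c = u x" by blast
      thus ?L using k x closed by (intro bexI[of _ "\<phi> x x c"]) (simp_all flip: comp)
    qed
    thus ?thesis
      using spectrum_unital[OF C.hom_space[OF x x] C.comp_linear_left[OF x x x] uC a, of l]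
        spectrum_unital[OF target_space[OF x x] target_comp_linear_left[OF x x x] uD closed[OF x x a], of l]
      by (simp only: k')
  qed
  thus ?thesis by blast
qed

theorem target_cstar_category: "cstar_category D"
proof (rule cstar_category.intro, unfold Ob)
  fix w x y z f g h assume x: "x \<in> Ob C" and y: "y \<in> Ob C"
  show "complex_banach_space (homsp D x y)" by (rule target_banach[OF x y])
  show "conjugate_linear (homsp D x y) (homsp D y x) (star D x y)"
    unfolding conjugate_linear_def
  proof (intro conjI ballI allI Pi_I)
    interpret N: complex_space "homsp C x y" by (rule complex_spaceI[OF C.hom_space[OF x y]])
    fix a b c assume "a \<in> hom D x y"
    then obtain a' where a: "a' \<in> hom C x y" "a = \<phi> x y a'" using preimage x y by blast
    show "star D x y a \<in> hom D y x" using a x y closed by (simp flip: star)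
    have "c \<odot>\<^bsub>homsp D x y\<^esub> a = \<phi> x y (c \<odot>\<^bsub>homsp C x y\<^esub> a')" using a x y by (simp add: smult)
    hence "star D x y (c \<odot>\<^bsub>homsp D x y\<^esub> a) = \<phi> y x (star C x y (c \<odot>\<^bsub>homsp C x y\<^esub> a'))"
      using a(1) x y by (simp add: star)
    thus "star D x y (c \<odot>\<^bsub>homsp D x y\<^esub> a) = cnj c \<odot>\<^bsub>homsp D y x\<^esub> star D x y a"
      using a x y by (simp add: C.star_smult smult star)
    assume "b \<in> hom D x y"
    then obtain b' where b: "b' \<in> hom C x y" "b = \<phi> x y b'" using preimage x y by blast
    have "a \<oplus>\<^bsub>homsp D x y\<^esub> b = \<phi> x y (a' \<oplus>\<^bsub>homsp C x y\<^esub> b')" using a b x y by (simp add: add)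
    hence "star D x y (a \<oplus>\<^bsub>homsp D x y\<^esub> b) = \<phi> y x (star C x y (a' \<oplus>\<^bsub>homsp C x y\<^esub> b'))"
      using a(1) b(1) x y by (simp add: star)
    thus "star D x y (a \<oplus>\<^bsub>homsp D x y\<^esub> b) = star D x y a \<oplus>\<^bsub>homsp D y x\<^esub> star D x y b"
      using a b x y by (simp add: C.star_add add star)
  qed
  {
    assume z: "z \<in> Ob C" and g: "g \<in> hom D y z"
    show "complex_linear (homsp D x y) (homsp D x z) (comp D x y z g)"
      by (rule target_comp_linear_right[OF x y z g])
  }
  assume f: "f \<in> hom D x y"
  then obtain f' where f': "f' \<in> hom C x y" "f = \<phi> x y f'" using preimage x y by blast
  show "star D y x (star D x y f) = f" using f' x y by (simp add: C.star_star flip: star)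
  show "nrm (homsp D x x) (comp D x y x (star D x y f) f) = (nrm (homsp D x y) f)\<^sup>2"
    using f' x y by (simp add: norm C.cstar_identity flip: star comp)
  have "comp D x y x (star D x y f) f = \<phi> x x (comp C x y x (star C x y f') f')"
    using f' x y by (simp add: comp star)
  thus "spectrum D x (comp D x y x (star D x y f) f) \<subseteq> \<real>\<^sub>\<ge>\<^sub>0"
    using C.spectrum_star_comp[OF x y f'(1)] spectrum_eq[OF x] f' x y by simp
  assume z: "z \<in> Ob C"
  show "complex_linear (homsp D y z) (homsp D x z) (\<lambda>g. comp D x y z g f)"
    by (rule target_comp_linear_left[OF x y z f])
  assume "g \<in> hom D y z"
  then obtain g' where g': "g' \<in> hom C y z" "g = \<phi> y z g'" using preimage y z by blast
  show "nrm (homsp D x z) (comp D x y z g f) \<le> nrm (homsp D y z) g * nrm (homsp D x y) f"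
    using f' g' x y z by (simp add: norm C.norm_comp_le flip: comp)
  show "star D x z (comp D x y z g f) = comp D z y x (star D x y f) (star D y z g)"
    using f' g' x y z by (simp add: C.star_comp flip: comp star)
next
  fix w x y z f g h
  assume x: "w \<in> Ob C" "x \<in> Ob C" "y \<in> Ob C" "z \<in> Ob C"
    and "f \<in> hom D w x" "g \<in> hom D x y" "h \<in> hom D y z"
  then obtain f' g' h' where "f' \<in> hom C w x" "f = \<phi> w x f'" "g' \<in> hom C x y" "g = \<phi> x y g'"
    "h' \<in> hom C y z" "h = \<phi> y z h'" using preimage by metis
  thus "comp D w x z (comp D x y z h g) f = comp D w y z h (comp D w x y g f)"
    using x by (simp add: C.comp_assoc flip: comp)
qed

theorem target_equivalent: "cstar_equivalent D C"
proof -
  define \<psi> where "\<psi> x y = the_inv_into (hom C x y) (\<phi> x y)" for x y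
  have inj: "inj_on (\<phi> x y) (hom C x y)" if "x \<in> Ob C" "y \<in> Ob C" for x y using bij[OF that] by (simp add: bij_betw_def)
  have \<psi>\<phi>: "\<psi> x y (\<phi> x y f) = f" if "x \<in> Ob C" "y \<in> Ob C" "f \<in> hom C x y" for x y f
    using inj that by (simp add: \<psi>_def the_inv_into_f_f)
  have \<phi>\<psi>: "\<phi> x y (\<psi> x y a) = a" "\<psi> x y a \<in> hom C x y" if "x \<in> Ob C" "y \<in> Ob C" "a \<in> hom D x y" for x y a
    using preimage[OF that] \<psi>\<phi> that by auto
  have \<psi>I: "\<psi> x y a = f" if "x \<in> Ob C" "y \<in> Ob C" "f \<in> hom C x y" "a = \<phi> x y f" for x y a f
    using \<psi>\<phi> that by simp
  define F where "F = \<lparr>obj_map = (\<lambda>x. x), arr_map = \<psi>\<rparr>"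
  define G where "G = \<lparr>obj_map = (\<lambda>x. x), arr_map = \<phi>\<rparr>"
  have "cstar_functor D C F"
  proof (intro cstar_functor.intro cstar_functor_axioms.intro target_cstar_category C.cstar_category_axioms, unfold Ob)
    fix x y z f g assume x: "x \<in> Ob C"
    show "obj_map F x \<in> Ob C" using x by (simp add: F_def)
    assume y: "y \<in> Ob C"
    interpret N: complex_space "homsp C x y" by (rule complex_spaceI[OF C.hom_space[OF x y]])
    show "complex_linear (homsp D x y) (homsp C (obj_map F x) (obj_map F y)) (arr_map F x y)"
      unfolding complex_linear_def F_def
      using x y by (auto intro!: \<psi>I simp: \<phi>\<psi> add smult)
    assume f: "f \<in> hom D x y"
    show "arr_map F y x (star D x y f) = star C (obj_map F x) (obj_map F y) (arr_map F x y f)"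
      using x y f by (auto intro!: \<psi>I simp: F_def \<phi>\<psi> star)
    assume z: "z \<in> Ob C" and g: "g \<in> hom D y z"
    show "arr_map F x z (comp D x y z g f) = comp C (obj_map F x) (obj_map F y) (obj_map F z) (arr_map F y z g) (arr_map F x y f)"
      using x y z f g by (auto intro!: \<psi>I simp: F_def \<phi>\<psi> comp)
  qed
  moreover have "cstar_functor C D G"
    by (intro cstar_functor.intro cstar_functor_axioms.intro target_cstar_category C.cstar_category_axioms)
       (auto simp: G_def map_linear comp star)
  moreover have "naturally_isomorphic D D (comp_functor G F) id_functor"
    unfolding naturally_isomorphic_def
  proof (intro exI[of _ "\<lambda>x. \<phi> x x (u x)"] conjI ballI, unfold Ob)
    fix x y f assume x: "x \<in> Ob C"
    note i = target_identity[OF x]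
    have "comp D x x x (\<phi> x x (u x)) (\<phi> x x (u x)) = \<phi> x x (u x)" using i x by (simp add: identity_arrow_def)
    thus "isomorphism D (obj_map (comp_functor G F) x) (obj_map id_functor x) (\<phi> x x (u x))"
      using i x by (auto simp: isomorphism_def comp_functor_def id_functor_def F_def G_def identity_arrow_def)
    assume y: "y \<in> Ob C" and f: "f \<in> hom D x y"
    show "comp D (obj_map (comp_functor G F) x) (obj_map (comp_functor G F) y) (obj_map id_functor y) (\<phi> y y (u y))
        (arr_map (comp_functor G F) x y f) =
      comp D (obj_map (comp_functor G F) x) (obj_map id_functor x) (obj_map id_functor y) (arr_map id_functor x y f) (\<phi> x x (u x))"
      using i target_identity[OF y] x y f
      by (simp add: comp_functor_def id_functor_def F_def G_def \<phi>\<psi> identity_arrow_def)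
  qed
  moreover have "naturally_isomorphic C C (comp_functor F G) id_functor"
    unfolding naturally_isomorphic_def
  proof (intro exI[of _ u] conjI ballI)
    fix x y f assume x: "x \<in> Ob C"
    note i = identity[OF x]
    have "comp C x x x (u x) (u x) = u x" using i x by (simp add: identity_arrow_def)
    thus "isomorphism C (obj_map (comp_functor F G) x) (obj_map id_functor x) (u x)"
      using i x by (auto simp: isomorphism_def comp_functor_def id_functor_def F_def G_def identity_arrow_def)
    assume y: "y \<in> Ob C" and f: "f \<in> hom C x y"
    show "comp C (obj_map (comp_functor F G) x) (obj_map (comp_functor F G) y) (obj_map id_functor y) (u y)
        (arr_map (comp_functor F G) x y f) =
      comp C (obj_map (comp_functor F G) x) (obj_map id_functor x) (obj_map id_functor y) (arr_map id_functor x y f) (u x)"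
      using i identity[OF y] x y f
      by (simp add: comp_functor_def id_functor_def F_def G_def \<psi>\<phi> identity_arrow_def)
  qed
  ultimately show ?thesis
    unfolding cstar_equivalent_def using target_cstar_category C.cstar_category_axioms by blast
qed

end

section \<open>Multipliers of the compact operators\<close>

context cstar_category
begin

lemma approximate_unit_norm:
  assumes F: "hilbert_module C F" and x: "x \<in> Ob C" and f: "f \<in> elts F x" and \<delta>: "\<delta> > 0"
  obtains K where "K \<in> cpt F F" "opn F F K \<le> 1" "module_norm C F x (K x f \<ominus>\<^bsub>fibre F x\<^esub> f) \<le> \<delta>"
proof -
  interpret F: hilbert_cstar_module C F by (rule hilbert_cstar_moduleI[OF F])
  interpret VF: carrier_normed_space "fibre F x" "module_norm C F x" by (rule F.fibre_normed[OF x])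
  have "\<delta>\<^sup>2 > 0" using \<delta> by simp
  then obtain K where K: "K \<in> cpt F F" "opn F F K \<le> 1" "(module_norm C F x (K x f \<ominus>\<^bsub>fibre F x\<^esub> f))\<^sup>2 \<le> \<delta>\<^sup>2"
    using compact_approximate_unit[OF F x f] by blast
  from K(3) have "module_norm C F x (K x f \<ominus>\<^bsub>fibre F x\<^esub> f) \<le> \<delta>"
    by (rule power2_le_imp_le) (use \<delta> in simp)
  thus ?thesis using that K by blast
qed

text \<open>Compact contractions see the full norm of a vector, as an approximate unit consists of them.\<close>

lemma compact_norm_le:
  assumes F: "hilbert_module C F" and x: "x \<in> Ob C" and d: "d \<in> elts F x"
    and b: "\<And>K. K \<in> cpt F F \<Longrightarrow> opn F F K \<le> 1 \<Longrightarrow> module_norm C F x (K x d) \<le> b"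
  shows "module_norm C F x d \<le> b"
proof (rule field_le_epsilon)
  interpret F: hilbert_cstar_module C F by (rule hilbert_cstar_moduleI[OF F])
  interpret VF: carrier_normed_space "fibre F x" "module_norm C F x" by (rule F.fibre_normed[OF x])
  fix \<delta> :: real assume "\<delta> > 0"
  then obtain K where K: "K \<in> cpt F F" "opn F F K \<le> 1" "module_norm C F x (K x d \<ominus>\<^bsub>fibre F x\<^esub> d) \<le> \<delta>"
    using approximate_unit_norm[OF F x d] by blast
  have Kd: "K x d \<in> elts F x" by (rule adj_closed[OF compact_adj[OF K(1)] x d])
  show "module_norm C F x d \<le> b + \<delta>"
    using VF.norm_le_diff[OF d Kd] VF.norm_diff_commute[OF d Kd] b[OF K(1,2)] K(3) by linarith
qed

lemma compact_separates:
  assumes F: "hilbert_module C F" and x: "x \<in> Ob C" and g: "g \<in> elts F x" "g' \<in> elts F x"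
    and e: "\<And>K. K \<in> cpt F F \<Longrightarrow> K x g = K x g'"
  shows "g = g'"
proof -
  interpret F: hilbert_cstar_module C F by (rule hilbert_cstar_moduleI[OF F])
  interpret VF: carrier_normed_space "fibre F x" "module_norm C F x" by (rule F.fibre_normed[OF x])
  have "module_norm C F x (g \<ominus>\<^bsub>fibre F x\<^esub> g') \<le> 0"
  proof (rule compact_norm_le[OF F x])
    fix K assume K: "K \<in> cpt F F"
    have "K x (g \<ominus>\<^bsub>fibre F x\<^esub> g') = K x g' \<ominus>\<^bsub>fibre F x\<^esub> K x g'"
      using VF.endo_diff[OF adj_linear[OF compact_adj[OF K] x] g] e[OF K] by simp
    also have "\<dots> = \<zero>\<^bsub>fibre F x\<^esub>"
      using VF.diff_eq_zero_iff[of "K x g'" "K x g'"] adj_closed[OF compact_adj[OF K] x g(2)] by simp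
    finally show "module_norm C F x (K x (g \<ominus>\<^bsub>fibre F x\<^esub> g')) \<le> 0" by simp
  qed (use g in simp)
  thus ?thesis using VF.dist_eq_zero[OF g] VF.nonneg[of "g \<ominus>\<^bsub>fibre F x\<^esub> g'"] g by simp
qed

text \<open>The vector \<open>t x e\<close> is characterized by \<open>K (t x e) = \<rho> K e\<close> for all compact \<open>K\<close>, and obtained as the limit of \<open>\<mu> K\<^sub>n e\<close> for an
approximate unit \<open>K\<^sub>n\<close> at \<open>e\<close>. That sequence is Cauchy, because applying a compact contraction \<open>K\<close> to the
difference of two terms gives \<open>\<rho> K (K\<^sub>i e - K\<^sub>j e)\<close>. The maps \<open>\<rho>\<close> and \<open>\<mu>\<close> are arbitrary
functions, so that the lemma can also be used for the conjugated maps below.\<close>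

lemma multiplier_pointwise:
  fixes E F :: "('o, 'm, 'e) hilbert_module_data"
  assumes E: "hilbert_module C E" and F: "hilbert_module C F"
    and \<rho>: "\<And>K. K \<in> cpt F F \<Longrightarrow> \<rho> K \<in> adj E F"
    and \<mu>: "\<And>K. K \<in> cpt E E \<Longrightarrow> \<mu> K \<in> adj E F"
    and rel: "\<And>K K'. K \<in> cpt E E \<Longrightarrow> K' \<in> cpt F F \<Longrightarrow> op_comp E K' (\<mu> K) = op_comp E (\<rho> K') K"
    and b: "\<And>K. K \<in> cpt F F \<Longrightarrow> opn E F (\<rho> K) \<le> c * opn F F K" and c: "c \<ge> 0"
  obtains t where
    "\<And>x e. x \<in> Ob C \<Longrightarrow> e \<in> elts E x \<Longrightarrow> t x e \<in> elts F x"
    "\<And>x e. x \<in> Ob C \<Longrightarrow> e \<in> elts E x \<Longrightarrow> module_norm C F x (t x e) \<le> c * module_norm C E x e"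
    "\<And>x e K. x \<in> Ob C \<Longrightarrow> e \<in> elts E x \<Longrightarrow> K \<in> cpt F F \<Longrightarrow> K x (t x e) = \<rho> K x e"
    "\<And>x e K. x \<in> Ob C \<Longrightarrow> e \<in> elts E x \<Longrightarrow> K \<in> cpt E E \<Longrightarrow> t x (K x e) = \<mu> K x e"
    "\<And>x e e'. x \<in> Ob C \<Longrightarrow> e \<in> elts E x \<Longrightarrow> e' \<in> elts E x \<Longrightarrow>
      module_norm C F x (t x e \<ominus>\<^bsub>fibre F x\<^esub> t x e') \<le> c * module_norm C E x (e \<ominus>\<^bsub>fibre E x\<^esub> e')"
proof -
  interpret E: hilbert_cstar_module C E by (rule hilbert_cstar_moduleI[OF E])
  interpret F: hilbert_cstar_module C F by (rule hilbert_cstar_moduleI[OF F])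
  have contr: "module_norm C F x (\<rho> K x d) \<le> c * module_norm C E x d"
    if x: "x \<in> Ob C" and d: "d \<in> elts E x" and K: "K \<in> cpt F F" "opn F F K \<le> 1" for x d K
  proof -
    have "module_norm C F x (\<rho> K x d) \<le> opn E F (\<rho> K) * module_norm C E x d" by (rule opn_bound[OF E F \<rho>[OF K(1)] x d])
    also have "\<dots> \<le> c * module_norm C E x d"
      using b[OF K(1)] K(2) c x d mult_left_mono[OF K(2) c] by (intro mult_right_mono) auto
    finally show ?thesis .
  qed
  have ex: "\<exists>g. g \<in> elts F x \<and> (\<forall>K\<in>cpt F F. K x g = \<rho> K x e)" if x: "x \<in> Ob C" and e: "e \<in> elts E x" for x e
  proof -
    interpret VE: carrier_normed_space "fibre E x" "module_norm C E x" by (rule E.fibre_normed[OF x])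
    interpret VF: carrier_normed_space "fibre F x" "module_norm C F x" by (rule F.fibre_normed[OF x])
    have "\<exists>K\<in>cpt E E. module_norm C E x (K x e \<ominus>\<^bsub>fibre E x\<^esub> e) \<le> 1 / real (Suc n)" for n
      using approximate_unit_norm[OF E x e, of "1 / real (Suc n)"] by auto
    then obtain K where K: "\<And>n. K n \<in> cpt E E" "\<And>n. module_norm C E x (K n x e \<ominus>\<^bsub>fibre E x\<^esub> e) \<le> 1 / real (Suc n)" by metis
    have Ke: "K n x e \<in> elts E x" for n by (rule adj_closed[OF compact_adj[OF K(1)] x e])
    have Klim: "(\<lambda>n. module_norm C E x (K n x e \<ominus>\<^bsub>fibre E x\<^esub> e)) \<longlonglongrightarrow> 0"
    proof (rule tendsto_sandwich[OF _ _ tendsto_const LIMSEQ_Suc[OF lim_1_over_n]])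
      show "eventually (\<lambda>n. 0 \<le> module_norm C E x (K n x e \<ominus>\<^bsub>fibre E x\<^esub> e)) sequentially"
        using Ke e by (intro always_eventually allI VE.nonneg) auto
      show "eventually (\<lambda>n. module_norm C E x (K n x e \<ominus>\<^bsub>fibre E x\<^esub> e) \<le> 1 / of_nat (Suc n)) sequentially"
        using K(2) by (intro always_eventually allI) simp
    qed
    define g where "g n = \<mu> (K n) x e" for n
    have g: "g n \<in> elts F x" for n unfolding g_def by (rule adj_closed[OF \<mu>[OF K(1)] x e])
    have Kg: "K' x (g n) = \<rho> K' x (K n x e)" if "K' \<in> cpt F F" for K' n
      using fun_cong[OF fun_cong[OF rel[OF K(1)[of n] that]], of x e] x e by (simp add: g_def)
    have gdiff: "module_norm C F x (g i \<ominus>\<^bsub>fibre F x\<^esub> g j) \<le> c * module_norm C E x (K i x e \<ominus>\<^bsub>fibre E x\<^esub> K j x e)" for i j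
    proof (rule compact_norm_le[OF F x])
      fix K' assume K': "K' \<in> cpt F F" "opn F F K' \<le> 1"
      have "K' x (g i \<ominus>\<^bsub>fibre F x\<^esub> g j) = \<rho> K' x (K i x e) \<ominus>\<^bsub>fibre F x\<^esub> \<rho> K' x (K j x e)"
        using VF.endo_diff[OF adj_linear[OF compact_adj[OF K'(1)] x] g g] Kg[OF K'(1)] by simp
      also have "\<dots> = \<rho> K' x (K i x e \<ominus>\<^bsub>fibre E x\<^esub> K j x e)"
        by (rule complex_linear_diff[OF VE.space VF.space adj_linear[OF \<rho>[OF K'(1)] x] Ke Ke, symmetric])
      finally show "module_norm C F x (K' x (g i \<ominus>\<^bsub>fibre F x\<^esub> g j)) \<le> c * module_norm C E x (K i x e \<ominus>\<^bsub>fibre E x\<^esub> K j x e)"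
        using contr[OF x _ K'] Ke by simp
    qed (use g in simp)
    have "\<exists>N. \<forall>i\<ge>N. \<forall>j\<ge>N. module_norm C F x (g i \<ominus>\<^bsub>fibre F x\<^esub> g j) < \<epsilon>" if \<epsilon>: "\<epsilon> > 0" for \<epsilon>
    proof -
      have "\<epsilon> / (2 * (c + 1)) > 0" using \<epsilon> c by simp
      hence "eventually (\<lambda>n. module_norm C E x (K n x e \<ominus>\<^bsub>fibre E x\<^esub> e) < \<epsilon> / (2 * (c + 1))) sequentially"
        using Klim by (intro order_tendstoD) auto
      then obtain N where N: "\<And>n. n \<ge> N \<Longrightarrow> module_norm C E x (K n x e \<ominus>\<^bsub>fibre E x\<^esub> e) < \<epsilon> / (2 * (c + 1))"
        by (auto simp: eventually_sequentially)
      have "module_norm C F x (g i \<ominus>\<^bsub>fibre F x\<^esub> g j) < \<epsilon>" if ij: "i \<ge> N" "j \<ge> N" for i j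
      proof -
        have "module_norm C E x (K i x e \<ominus>\<^bsub>fibre E x\<^esub> K j x e) \<le> \<epsilon> / (2 * (c + 1)) + \<epsilon> / (2 * (c + 1))"
          using VE.dist_triangle[OF Ke[of i] e Ke[of j]] VE.norm_diff_commute[OF e Ke[of j]] N[OF ij(1)] N[OF ij(2)] by linarith
        also have "\<epsilon> / (2 * (c + 1)) + \<epsilon> / (2 * (c + 1)) = \<epsilon> / (c + 1)"
        proof -
          have "\<epsilon> / (2 * d) = \<epsilon> / d / 2" for d :: real by simp
          thus ?thesis by (simp only: field_sum_of_halves)
        qed
        finally have "c * module_norm C E x (K i x e \<ominus>\<^bsub>fibre E x\<^esub> K j x e) \<le> c * (\<epsilon> / (c + 1))"
          using c by (rule mult_left_mono)
        also have "\<dots> < \<epsilon>" using c \<epsilon> by (simp add: pos_divide_less_eq)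
        finally show ?thesis using gdiff[of i j] by linarith
      qed
      thus ?thesis by blast
    qed
    moreover have "range g \<subseteq> elts F x" using g by blast
    ultimately obtain h where h: "h \<in> elts F x" "(\<lambda>n. module_norm C F x (g n \<ominus>\<^bsub>fibre F x\<^esub> h)) \<longlonglongrightarrow> 0"
      using F.fibre_complete[OF x] unfolding complete_wrt_def by blast
    have lim: "(\<lambda>n. module_norm C F x (R x (s n) \<ominus>\<^bsub>fibre F x\<^esub> R x l)) \<longlonglongrightarrow> 0"
      if R: "R \<in> adj G F" and G: "hilbert_module C G" and s: "\<And>n. s n \<in> elts G x" and l: "l \<in> elts G x"
        and lim: "(\<lambda>n. module_norm C G x (s n \<ominus>\<^bsub>fibre G x\<^esub> l)) \<longlonglongrightarrow> 0"
      for R and G :: "('o, 'm, 'e) hilbert_module_data" and s :: "nat \<Rightarrow> 'e" and l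
    proof (rule tendsto_sandwich[OF _ _ tendsto_const])
      interpret G: hilbert_cstar_module C G by (rule hilbert_cstar_moduleI[OF G])
      interpret VG: carrier_normed_space "fibre G x" "module_norm C G x" by (rule G.fibre_normed[OF x])
      have d: "R x (s n) \<ominus>\<^bsub>fibre F x\<^esub> R x l = R x (s n \<ominus>\<^bsub>fibre G x\<^esub> l)" for n
        by (rule complex_linear_diff[OF VG.space VF.space adj_linear[OF R x] s l, symmetric])
      show "eventually (\<lambda>n. 0 \<le> module_norm C F x (R x (s n) \<ominus>\<^bsub>fibre F x\<^esub> R x l)) sequentially"
        using adj_closed[OF R x] s l by (intro always_eventually allI VF.nonneg) auto
      show "(\<lambda>n. opn G F R * module_norm C G x (s n \<ominus>\<^bsub>fibre G x\<^esub> l)) \<longlonglongrightarrow> 0"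
        by (rule tendsto_mult_right_zero[OF lim])
      show "eventually (\<lambda>n. module_norm C F x (R x (s n) \<ominus>\<^bsub>fibre F x\<^esub> R x l) \<le> opn G F R * module_norm C G x (s n \<ominus>\<^bsub>fibre G x\<^esub> l)) sequentially"
        unfolding d using s l by (intro always_eventually allI opn_bound[OF G F R x]) auto
    qed
    have "K' x h = \<rho> K' x e" if K': "K' \<in> cpt F F" for K'
    proof (rule VF.limit_unique)
      show "K' x (g n) \<in> elts F x" for n by (rule adj_closed[OF compact_adj[OF K'] x g])
      show "(\<lambda>n. module_norm C F x (K' x (g n) \<ominus>\<^bsub>fibre F x\<^esub> K' x h)) \<longlonglongrightarrow> 0"
        by (rule lim[OF compact_adj[OF K'] F g h])
      show "(\<lambda>n. module_norm C F x (K' x (g n) \<ominus>\<^bsub>fibre F x\<^esub> \<rho> K' x e)) \<longlonglongrightarrow> 0"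
        unfolding Kg[OF K'] by (rule lim[OF \<rho>[OF K'] E Ke e Klim])
    qed (use adj_closed[OF compact_adj[OF K'] x h(1)] adj_closed[OF \<rho>[OF K'] x e] in auto)
    thus ?thesis using h(1) by blast
  qed
  then obtain t where t: "\<And>x e. x \<in> Ob C \<Longrightarrow> e \<in> elts E x \<Longrightarrow> t x e \<in> elts F x"
    "\<And>x e K. x \<in> Ob C \<Longrightarrow> e \<in> elts E x \<Longrightarrow> K \<in> cpt F F \<Longrightarrow> K x (t x e) = \<rho> K x e" by metis
  have 1: "module_norm C F x (t x e) \<le> c * module_norm C E x e" if x: "x \<in> Ob C" and e: "e \<in> elts E x" for x e
    by (rule compact_norm_le[OF F x t(1)[OF x e]]) (simp add: t(2)[OF x e] contr[OF x e])
  have 2: "t x (K x e) = \<mu> K x e" if x: "x \<in> Ob C" and e: "e \<in> elts E x" and K: "K \<in> cpt E E" for x e K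
  proof (rule compact_separates[OF F x])
    have Ke: "K x e \<in> elts E x" by (rule adj_closed[OF compact_adj[OF K] x e])
    show "t x (K x e) \<in> elts F x" by (rule t(1)[OF x Ke])
    show "\<mu> K x e \<in> elts F x" by (rule adj_closed[OF \<mu>[OF K] x e])
    show "K' x (t x (K x e)) = K' x (\<mu> K x e)" if "K' \<in> cpt F F" for K'
      using fun_cong[OF fun_cong[OF rel[OF K that]], of x e] x e t(2)[OF x Ke that] by simp
  qed
  have 3: "module_norm C F x (t x e \<ominus>\<^bsub>fibre F x\<^esub> t x e') \<le> c * module_norm C E x (e \<ominus>\<^bsub>fibre E x\<^esub> e')"
    if x: "x \<in> Ob C" and e: "e \<in> elts E x" and e': "e' \<in> elts E x" for x e e'
  proof -
    interpret VE: carrier_normed_space "fibre E x" "module_norm C E x" by (rule E.fibre_normed[OF x])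
    interpret VF: carrier_normed_space "fibre F x" "module_norm C F x" by (rule F.fibre_normed[OF x])
    show ?thesis
    proof (rule compact_norm_le[OF F x])
      fix K' assume K': "K' \<in> cpt F F" "opn F F K' \<le> 1"
      have "K' x (t x e \<ominus>\<^bsub>fibre F x\<^esub> t x e') = \<rho> K' x e \<ominus>\<^bsub>fibre F x\<^esub> \<rho> K' x e'"
        using VF.endo_diff[OF adj_linear[OF compact_adj[OF K'(1)] x] t(1)[OF x e] t(1)[OF x e']]
          t(2)[OF x e K'(1)] t(2)[OF x e' K'(1)] by simp
      also have "\<dots> = \<rho> K' x (e \<ominus>\<^bsub>fibre E x\<^esub> e')"
        by (rule complex_linear_diff[OF VE.space VF.space adj_linear[OF \<rho>[OF K'(1)] x] e e', symmetric])
      finally show "module_norm C F x (K' x (t x e \<ominus>\<^bsub>fibre F x\<^esub> t x e')) \<le> c * module_norm C E x (e \<ominus>\<^bsub>fibre E x\<^esub> e')"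
        using contr[OF x _ K'] e e' by simp
    qed (use t(1)[OF x e] t(1)[OF x e'] in simp)
  qed
  show thesis by (rule that[OF t(1) 1 t(2) 2 3])
qed

text \<open>The pair \<open>(\<mu>, \<rho>)\<close> gives a map \<open>t\<close>, and the pair of its adjoints \<open>K \<mapsto> \<rho>(K\<^sup>*)\<^sup>*\<close>, \<open>K \<mapsto> \<mu>(K\<^sup>*)\<^sup>*\<close> a map \<open>t'\<close> in the opposite direction.
For compact \<open>K\<close>, \<open>\<langle>t (K e), f\<rangle> = \<langle>\<mu> K e, f\<rangle> = \<langle>e, (\<mu> K)\<^sup>* f\<rangle> = \<langle>e, K\<^sup>* (t' f)\<rangle> = \<langle>K e, t' f\<rangle>\<close>, and with \<open>K\<close> running through
an approximate unit this extends to all vectors.\<close>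

theorem adjointable_of_multiplier:
  fixes E F :: "('o, 'm, 'e) hilbert_module_data"
  assumes E: "hilbert_module C E" and F: "hilbert_module C F"
    and \<rho>: "\<And>K. K \<in> cpt F F \<Longrightarrow> \<rho> K \<in> adj E F"
    and \<mu>: "\<And>K. K \<in> cpt E E \<Longrightarrow> \<mu> K \<in> adj E F"
    and rel: "\<And>K K'. K \<in> cpt E E \<Longrightarrow> K' \<in> cpt F F \<Longrightarrow> op_comp E K' (\<mu> K) = op_comp E (\<rho> K') K"
    and b: "\<And>K. K \<in> cpt F F \<Longrightarrow> opn E F (\<rho> K) \<le> c * opn F F K"
    and b': "\<And>K. K \<in> cpt E E \<Longrightarrow> opn E F (\<mu> K) \<le> c * opn E E K" and c: "c \<ge> 0"
  shows "\<exists>T\<in>adj E F. (\<forall>K\<in>cpt F F. op_comp E K T = \<rho> K) \<and> (\<forall>K\<in>cpt E E. op_comp E T K = \<mu> K)"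
proof -
  interpret E: hilbert_cstar_module C E by (rule hilbert_cstar_moduleI[OF E])
  interpret F: hilbert_cstar_module C F by (rule hilbert_cstar_moduleI[OF F])
  obtain t where t: "\<And>x e. x \<in> Ob C \<Longrightarrow> e \<in> elts E x \<Longrightarrow> t x e \<in> elts F x"
      "\<And>x e. x \<in> Ob C \<Longrightarrow> e \<in> elts E x \<Longrightarrow> module_norm C F x (t x e) \<le> c * module_norm C E x e"
      "\<And>x e K. x \<in> Ob C \<Longrightarrow> e \<in> elts E x \<Longrightarrow> K \<in> cpt F F \<Longrightarrow> K x (t x e) = \<rho> K x e"
      "\<And>x e K. x \<in> Ob C \<Longrightarrow> e \<in> elts E x \<Longrightarrow> K \<in> cpt E E \<Longrightarrow> t x (K x e) = \<mu> K x e"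
      "\<And>x e e'. x \<in> Ob C \<Longrightarrow> e \<in> elts E x \<Longrightarrow> e' \<in> elts E x \<Longrightarrow>
        module_norm C F x (t x e \<ominus>\<^bsub>fibre F x\<^esub> t x e') \<le> c * module_norm C E x (e \<ominus>\<^bsub>fibre E x\<^esub> e')"
    by (rule multiplier_pointwise[OF E F \<rho> \<mu> rel b c]) (assumption | rule that | blast)+
  define \<rho>2 where "\<rho>2 K = dagger E F (\<mu> (dagger E E K))" for K
  define \<mu>2 where "\<mu>2 K = dagger E F (\<rho> (dagger F F K))" for K
  note DE = compact_dagger[OF E E] and DF = compact_dagger[OF F F]
  have \<rho>2: "\<rho>2 K \<in> adj F E" if "K \<in> cpt E E" for K unfolding \<rho>2_def by (rule dagger_adj(1)[OF E F \<mu>[OF DE[OF that]]])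
  have \<mu>2: "\<mu>2 K \<in> adj F E" if "K \<in> cpt F F" for K unfolding \<mu>2_def by (rule dagger_adj(1)[OF E F \<rho>[OF DF[OF that]]])
  have rel2: "op_comp F K' (\<mu>2 K) = op_comp F (\<rho>2 K') K" if K: "K \<in> cpt F F" and K': "K' \<in> cpt E E" for K K'
  proof -
    have "dagger E F (op_comp E (dagger F F K) (\<mu> (dagger E E K'))) = dagger E F (op_comp E (\<rho> (dagger F F K)) (dagger E E K'))"
      using rel[OF DE[OF K'] DF[OF K]] by simp
    thus ?thesis
      using op_comp_adj(2)[OF E F F \<mu>[OF DE[OF K']] compact_adj[OF DF[OF K]]]
        op_comp_adj(2)[OF E E F compact_adj[OF DE[OF K']] \<rho>[OF DF[OF K]]]
        dagger_dagger[OF F F compact_adj[OF K]] dagger_dagger[OF E E compact_adj[OF K']]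
      by (simp add: \<rho>2_def \<mu>2_def)
  qed
  have b2: "opn F E (\<rho>2 K) \<le> c * opn E E K" if K: "K \<in> cpt E E" for K
    using b'[OF DE[OF K]] by (simp add: \<rho>2_def opn_dagger[OF E F \<mu>[OF DE[OF K]]] opn_dagger[OF E E compact_adj[OF K]])
  obtain t' where t': "\<And>x e. x \<in> Ob C \<Longrightarrow> e \<in> elts F x \<Longrightarrow> t' x e \<in> elts E x"
      "\<And>x e K. x \<in> Ob C \<Longrightarrow> e \<in> elts F x \<Longrightarrow> K \<in> cpt E E \<Longrightarrow> K x (t' x e) = \<rho>2 K x e"
    by (rule multiplier_pointwise[OF F E \<rho>2 \<mu>2 rel2 b2 c]) (assumption | rule that | blast)+
  have p: "adjoint_pair E F t t'"
    unfolding adjoint_pair_def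
  proof (intro conjI ballI t(1) t'(1))
    fix x y e f assume x: "x \<in> Ob C" and y: "y \<in> Ob C" and e: "e \<in> elts E y" and f: "f \<in> elts F x"
    interpret VE: carrier_normed_space "fibre E y" "module_norm C E y" by (rule E.fibre_normed[OF y])
    interpret VF: carrier_normed_space "fibre F y" "module_norm C F y" by (rule F.fibre_normed[OF y])
    interpret B: carrier_normed_space "homsp C x y" "nrm (homsp C x y)" by (rule hom_normed[OF x y])
    have on_range: "inn F x y (t y (K y e)) f = inn E x y (K y e) (t' x f)" if K: "K \<in> cpt E E" for K
    proof -
      note KA = compact_adj[OF K] and DA = compact_adj[OF DE[OF K]]
      have "inn F x y (t y (K y e)) f = inn F x y (\<mu> K y e) f" using t(4)[OF y e K] by simp
      also have "\<dots> = inn E x y e (dagger E F (\<mu> K) x f)"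
        by (rule adjoint_pairD(3)[OF dagger_pair[OF E F \<mu>[OF K]] x y e f])
      also have "dagger E F (\<mu> K) = \<rho>2 (dagger E E K)" by (simp add: \<rho>2_def dagger_dagger[OF E E KA])
      also have "\<rho>2 (dagger E E K) x f = dagger E E K x (t' x f)" by (rule t'(2)[OF x f DE[OF K], symmetric])
      also have "inn E x y e (dagger E E K x (t' x f)) = inn E x y (K y e) (t' x f)"
        by (rule adjoint_pairD(3)[OF dagger_pair[OF E E KA] x y e t'(1)[OF x f], symmetric])
      finally show ?thesis .
    qed
    have te: "t y e \<in> elts F y" and tf: "t' x f \<in> elts E x" using t(1)[OF y e] t'(1)[OF x f] by auto
    have "nrm (homsp C x y) (inn F x y (t y e) f \<ominus>\<^bsub>homsp C x y\<^esub> inn E x y e (t' x f)) \<le> 0"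
    proof (rule field_le_epsilon)
      fix r :: real assume r: "r > 0"
      define M where "M = c * module_norm C F x f + module_norm C E x (t' x f)"
      have M: "M \<ge> 0" using c x f tf by (simp add: M_def)
      have "r / (M + 1) > 0" using r M by simp
      then obtain K where K: "K \<in> cpt E E" and Ke: "module_norm C E y (K y e \<ominus>\<^bsub>fibre E y\<^esub> e) \<le> r / (M + 1)"
        using approximate_unit_norm[OF E y e] by blast
      have KeE: "K y e \<in> elts E y" by (rule adj_closed[OF compact_adj[OF K] y e])
      have tKe: "t y (K y e) \<in> elts F y" by (rule t(1)[OF y KeE])
      let ?d = "module_norm C E y (K y e \<ominus>\<^bsub>fibre E y\<^esub> e)"
      have "inn F x y (t y e) f \<ominus>\<^bsub>homsp C x y\<^esub> inn E x y e (t' x f) =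
         inn F x y (t y e \<ominus>\<^bsub>fibre F y\<^esub> t y (K y e)) f \<oplus>\<^bsub>homsp C x y\<^esub> inn E x y (K y e \<ominus>\<^bsub>fibre E y\<^esub> e) (t' x f)"
      proof -
        have "p \<ominus>\<^bsub>homsp C x y\<^esub> q = (p \<ominus>\<^bsub>homsp C x y\<^esub> s) \<oplus>\<^bsub>homsp C x y\<^esub> (s \<ominus>\<^bsub>homsp C x y\<^esub> q)"
          if "p \<in> hom C x y" "q \<in> hom C x y" "s \<in> hom C x y" for p q s
          using that by - (rule B.linear_identity3[of p q s]; simp)
        from this[of "inn F x y (t y e) f" "inn E x y e (t' x f)" "inn F x y (t y (K y e)) f"]
        show ?thesis using x y e f te tf tKe KeE on_range[OF K]
          by (simp add: F.inn_diff_left E.inn_diff_left)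
      qed
      hence "nrm (homsp C x y) (inn F x y (t y e) f \<ominus>\<^bsub>homsp C x y\<^esub> inn E x y e (t' x f)) \<le>
         nrm (homsp C x y) (inn F x y (t y e \<ominus>\<^bsub>fibre F y\<^esub> t y (K y e)) f) +
         nrm (homsp C x y) (inn E x y (K y e \<ominus>\<^bsub>fibre E y\<^esub> e) (t' x f))"
        using x y e f te tf tKe KeE by (simp add: B.triangle)
      also have "\<dots> \<le> (c * ?d) * module_norm C F x f + ?d * module_norm C E x (t' x f)"
      proof (rule add_mono)
        have "nrm (homsp C x y) (inn F x y (t y e \<ominus>\<^bsub>fibre F y\<^esub> t y (K y e)) f) \<le>
          module_norm C F y (t y e \<ominus>\<^bsub>fibre F y\<^esub> t y (K y e)) * module_norm C F x f"
          using te tKe f by (intro F.cauchy_schwarz[OF x y]) auto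
        also have "\<dots> \<le> (c * ?d) * module_norm C F x f"
          using t(5)[OF y e KeE] VE.norm_diff_commute[OF e KeE] x f by (intro mult_right_mono) auto
        finally show "nrm (homsp C x y) (inn F x y (t y e \<ominus>\<^bsub>fibre F y\<^esub> t y (K y e)) f) \<le> (c * ?d) * module_norm C F x f" .
        show "nrm (homsp C x y) (inn E x y (K y e \<ominus>\<^bsub>fibre E y\<^esub> e) (t' x f)) \<le> ?d * module_norm C E x (t' x f)"
          using KeE e tf by (intro E.cauchy_schwarz[OF x y]) auto
      qed
      also have "\<dots> = ?d * M" by (simp add: M_def algebra_simps)
      also have "\<dots> \<le> r / (M + 1) * M" using Ke M by (rule mult_right_mono)
      also have "\<dots> \<le> r" using r M by (simp add: field_simps)
      finally show "nrm (homsp C x y) (inn F x y (t y e) f \<ominus>\<^bsub>homsp C x y\<^esub> inn E x y e (t' x f)) \<le> 0 + r" by simp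
    qed
    thus "inn F x y (t y e) f = inn E x y e (t' x f)"
      using B.dist_eq_zero[of "inn F x y (t y e) f" "inn E x y e (t' x f)"]
        B.nonneg[of "inn F x y (t y e) f \<ominus>\<^bsub>homsp C x y\<^esub> inn E x y e (t' x f)"] x y e f te tf by simp
  qed
  define T where "T = (\<lambda>x\<in>Ob C. \<lambda>e\<in>elts E x. t x e)"
  have T: "T \<in> adj E F" unfolding T_def by (rule adjoint_pair_adj(1)[OF E F p t(2)])
  show ?thesis
  proof (intro bexI[OF _ T] conjI ballI)
    show "op_comp E K T = \<rho> K" if K: "K \<in> cpt F F" for K
      by (rule adj_ext[OF op_comp_adj(1)[OF E F F T compact_adj[OF K]] \<rho>[OF K]]) (simp add: T_def t(3) K)
    show "op_comp E T K = \<mu> K" if K: "K \<in> cpt E E" for K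
      by (rule adj_ext[OF op_comp_adj(1)[OF E E F compact_adj[OF K] T] \<mu>[OF K]])
         (simp add: T_def t(4) K adj_closed[OF compact_adj[OF K]])
  qed
qed

end

context cstar_category
begin

abbreviation "Mods \<equiv> {E. hilbert_module C E}"

lemma KHilb_simps [simp]:
  "Ob (KHilb C) = Mods"
  "carrier (homsp (KHilb C) E F) = cpt E F"
  "nrm (homsp (KHilb C) E F) = opn E F"
  "S \<oplus>\<^bsub>homsp (KHilb C) E F\<^esub> T = S \<oplus>\<^bsub>adjsp E F\<^esub> T"
  "c \<odot>\<^bsub>homsp (KHilb C) E F\<^esub> T = c \<odot>\<^bsub>adjsp E F\<^esub> T"
  "\<zero>\<^bsub>homsp (KHilb C) E F\<^esub> = \<zero>\<^bsub>adjsp E F\<^esub>"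
  "comp (KHilb C) E F G S T = op_comp E S T"
  "star (KHilb C) E F T = dagger E F T"
  using Hilb_simps by (simp_all add: KHilb_def Hilb_def op_comp_def dagger_def)

definition to_multiplier where
  "to_multiplier E F T =
    (\<lambda>G\<in>Mods. \<lambda>K\<in>cpt G E. op_comp G T K, \<lambda>G\<in>Mods. \<lambda>K\<in>cpt F G. op_comp E K T)"

lemma to_multiplier_multiplier:
  fixes E F :: "('o, 'm, 'e) hilbert_module_data"
  assumes E: "hilbert_module C E" and F: "hilbert_module C F" and T: "T \<in> adj E F"
  shows "to_multiplier E F T \<in> multipliers (KHilb C) E F"
proof -
  have L: "bounded_map (homsp (KHilb C) G E) (homsp (KHilb C) G F) (\<lambda>K\<in>cpt G E. op_comp G T K)"
    if G: "hilbert_module C G" for G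
  proof -
    note l = complex_linearD[OF op_comp_linear_right[OF G E F T], simplified]
    have "opn G F (op_comp G T K) \<le> opn E F T * opn G E K" if "K \<in> cpt G E" for K
      by (rule op_comp_adj(3)[OF G E F compact_adj[OF that] T])
    thus ?thesis
      unfolding bounded_map_def complex_linear_def
      using compact_comp_left[OF G E F _ T] compact_add[OF G E] compact_smult[OF G E] l compact_adj[of _ G E]
      by auto
  qed
  have R: "bounded_map (homsp (KHilb C) F G) (homsp (KHilb C) E G) (\<lambda>K\<in>cpt F G. op_comp E K T)"
    if G: "hilbert_module C G" for G
  proof -
    note l = complex_linearD[OF op_comp_linear_left[OF E F G T], simplified]
    have "opn E G (op_comp E K T) \<le> opn E F T * opn F G K" if "K \<in> cpt F G" for K
      using op_comp_adj(3)[OF E F G T compact_adj[OF that]] by (simp add: mult.commute)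
    thus ?thesis
      unfolding bounded_map_def complex_linear_def
      using compact_comp_right[OF E F G T] compact_add[OF F G] compact_smult[OF F G] l compact_adj[of _ F G]
      by auto
  qed
  show ?thesis
    unfolding multipliers_def to_multiplier_def mem_Collect_eq prod.case
  proof (intro conjI ballI, unfold KHilb_simps mem_Collect_eq)
    show "(\<lambda>G\<in>Mods. \<lambda>K\<in>cpt G E. op_comp G T K) \<in> (\<Pi>\<^sub>E G\<in>Mods. cpt G E \<rightarrow>\<^sub>E cpt G F)"
      using compact_comp_left[OF _ E F _ T] by auto
    show "(\<lambda>G\<in>Mods. \<lambda>K\<in>cpt F G. op_comp E K T) \<in> (\<Pi>\<^sub>E G\<in>Mods. cpt F G \<rightarrow>\<^sub>E cpt E G)"
      using compact_comp_right[OF E F _ T] by auto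
  next
    fix G :: "('o, 'm, 'e) hilbert_module_data" assume G: "hilbert_module C G"
    show "bounded_map (homsp (KHilb C) G E) (homsp (KHilb C) G F) ((\<lambda>G\<in>Mods. \<lambda>K\<in>cpt G E. op_comp G T K) G)"
      using L[OF G] G by simp
    show "bounded_map (homsp (KHilb C) F G) (homsp (KHilb C) E G) ((\<lambda>G\<in>Mods. \<lambda>K\<in>cpt F G. op_comp E K T) G)"
      using R[OF G] G by simp
    fix G' :: "('o, 'm, 'e) hilbert_module_data" and K H assume G': "hilbert_module C G'"
    show "op_comp G' ((\<lambda>G\<in>Mods. \<lambda>K\<in>cpt G E. op_comp G T K) G K) H =
        (\<lambda>G\<in>Mods. \<lambda>K\<in>cpt G E. op_comp G T K) G' (op_comp G' K H)"
      if K: "K \<in> cpt G E" and H: "H \<in> cpt G' G"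
      using G G' K H compact_comp_left[OF G' G E H compact_adj[OF K]]
        op_comp_assoc[OF G' G E F compact_adj[OF H] compact_adj[OF K] T] by simp
    show "op_comp E H ((\<lambda>G\<in>Mods. \<lambda>K\<in>cpt F G. op_comp E K T) G K) =
        (\<lambda>G\<in>Mods. \<lambda>K\<in>cpt F G. op_comp E K T) G' (op_comp F H K)"
      if K: "K \<in> cpt F G" and H: "H \<in> cpt G G'"
      using G G' K H compact_comp_left[OF F G G' K compact_adj[OF H]]
        op_comp_assoc[OF E F G G' T compact_adj[OF K] compact_adj[OF H]] by simp
    show "op_comp G ((\<lambda>G\<in>Mods. \<lambda>K\<in>cpt F G. op_comp E K T) G' H) K =
        op_comp G H ((\<lambda>G\<in>Mods. \<lambda>K\<in>cpt G E. op_comp G T K) G K)"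
      if K: "K \<in> cpt G E" and H: "H \<in> cpt F G'"
      using G G' K H op_comp_assoc[OF G E F G' compact_adj[OF K] T compact_adj[OF H]] by simp
  qed
qed

lemma multipliersD:
  fixes L R :: "('o, 'm, 'e) hilbert_module_data \<Rightarrow> ('o \<Rightarrow> 'e \<Rightarrow> 'e) \<Rightarrow> ('o \<Rightarrow> 'e \<Rightarrow> 'e)"
  assumes "(L, R) \<in> multipliers (KHilb C) E F"
  shows "L \<in> (\<Pi>\<^sub>E G\<in>Mods. cpt G E \<rightarrow>\<^sub>E cpt G F)" "R \<in> (\<Pi>\<^sub>E G\<in>Mods. cpt F G \<rightarrow>\<^sub>E cpt E G)"
    and "hilbert_module C G \<Longrightarrow> \<exists>c. \<forall>K\<in>cpt G E. opn G F (L G K) \<le> c * opn G E K"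
    and "hilbert_module C G \<Longrightarrow> \<exists>c. \<forall>K\<in>cpt F G. opn E G (R G K) \<le> c * opn F G K"
    and "\<lbrakk>hilbert_module C G; hilbert_module C G'; K \<in> cpt G E; H \<in> cpt F G'\<rbrakk> \<Longrightarrow>
      op_comp G (R G' H) K = op_comp G H (L G K)"
  using assms unfolding multipliers_def bounded_map_def by (auto simp: Pi_iff)

lemma op_comp_left_cancel:
  assumes E: "hilbert_module C E" and F: "hilbert_module C F" and S: "S \<in> adj E F" and T: "T \<in> adj E F"
    and eq: "\<And>K. K \<in> cpt F F \<Longrightarrow> op_comp E K S = op_comp E K T"
  shows "S = T"
proof (rule adj_ext[OF S T])
  fix x e assume x: "x \<in> Ob C" and e: "e \<in> elts E x"
  show "S x e = T x e"
  proof (rule compact_separates[OF F x adj_closed[OF S x e] adj_closed[OF T x e]])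
    show "K x (S x e) = K x (T x e)" if "K \<in> cpt F F" for K
      using fun_cong[OF fun_cong[OF eq[OF that]], of x e] x e by simp
  qed
qed

lemma op_comp_right_cancel:
  assumes E: "hilbert_module C E" and F: "hilbert_module C F" and S: "S \<in> adj E F" and T: "T \<in> adj E F"
    and eq: "\<And>K. K \<in> cpt E E \<Longrightarrow> op_comp E S K = op_comp E T K"
  shows "S = T"
proof -
  have "dagger E F S = dagger E F T"
  proof (rule op_comp_left_cancel[OF F E dagger_adj(1)[OF E F S] dagger_adj(1)[OF E F T]])
    fix K assume K: "K \<in> cpt E E"
    note DK = compact_dagger[OF E E K]
    have "dagger E F (op_comp E S (dagger E E K)) = dagger E F (op_comp E T (dagger E E K))" using eq[OF DK] by simp
    thus "op_comp F K (dagger E F S) = op_comp F K (dagger E F T)"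
      using op_comp_adj(2)[OF E E F compact_adj[OF DK] S] op_comp_adj(2)[OF E E F compact_adj[OF DK] T]
      by (simp add: dagger_dagger[OF E E compact_adj[OF K]])
  qed
  thus ?thesis using dagger_dagger[OF E F S] dagger_dagger[OF E F T] by metis
qed

lemma to_multiplier_inj:
  assumes E: "hilbert_module C E" and F: "hilbert_module C F" and S: "S \<in> adj E F" and T: "T \<in> adj E F"
    and eq: "to_multiplier E F S = to_multiplier E F T"
  shows "S = T"
proof (rule op_comp_left_cancel[OF E F S T])
  fix K assume K: "K \<in> cpt F F"
  have "snd (to_multiplier E F S) F K = snd (to_multiplier E F T) F K" by (simp add: eq)
  thus "op_comp E K S = op_comp E K T" using K F by (simp add: to_multiplier_def)
qed

text \<open>The components of a multiplier at \<open>E\<close> and \<open>F\<close> determine the operator. Its other components are then forced by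
\<open>R(H) K = H L(K)\<close>, since compact operators can be cancelled from either side.\<close>

lemma to_multiplier_surj:
  assumes E: "hilbert_module C E" and F: "hilbert_module C F" and m: "m \<in> multipliers (KHilb C) E F"
  shows "\<exists>T\<in>adj E F. m = to_multiplier E F T"
proof -
  obtain L R where m_eq: "m = (L, R)" by (cases m)
  note D = multipliersD[OF m[unfolded m_eq]]
  have Lc: "L G K \<in> cpt G F" if "hilbert_module C G" "K \<in> cpt G E" for G K
    using D(1) that by (auto dest!: PiE_mem)
  have Rc: "R G K \<in> cpt E G" if "hilbert_module C G" "K \<in> cpt F G" for G K
    using D(2) that by (auto dest!: PiE_mem)
  obtain c1 where c1: "\<And>K. K \<in> cpt E E \<Longrightarrow> opn E F (L E K) \<le> c1 * opn E E K" using D(3)[OF E] by blast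
  obtain c2 where c2: "\<And>K. K \<in> cpt F F \<Longrightarrow> opn E F (R F K) \<le> c2 * opn F F K" using D(4)[OF F] by blast
  \<comment> \<open>A common nonnegative bound, as the given bounds may be negative on zero modules.\<close>
  define c where "c = max 0 (max c1 c2)"
  have cc: "c \<ge> 0" "c1 \<le> c" "c2 \<le> c" by (auto simp: c_def)
  have b1: "opn E F (L E K) \<le> c * opn E E K" if "K \<in> cpt E E" for K
    using c1[OF that] mult_right_mono[OF cc(2) opn_nonneg[OF compact_adj[OF that]]] by linarith
  have b2: "opn E F (R F K) \<le> c * opn F F K" if "K \<in> cpt F F" for K
    using c2[OF that] mult_right_mono[OF cc(3) opn_nonneg[OF compact_adj[OF that]]] by linarith
  have rel: "op_comp E K' (L E K) = op_comp E (R F K') K" if "K \<in> cpt E E" "K' \<in> cpt F F" for K K'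
    using D(5)[OF E F that] by simp
  obtain T where T: "T \<in> adj E F" and TR: "\<And>K. K \<in> cpt F F \<Longrightarrow> op_comp E K T = R F K"
    and TL: "\<And>K. K \<in> cpt E E \<Longrightarrow> op_comp E T K = L E K"
    using adjointable_of_multiplier[OF E F compact_adj[OF Rc[OF F]] compact_adj[OF Lc[OF E]] rel b2 b1 cc(1)] by metis
  have L: "L G K = op_comp G T K" if G: "hilbert_module C G" and K: "K \<in> cpt G E" for G K
  proof (rule op_comp_left_cancel[OF G F compact_adj[OF Lc[OF G K]] op_comp_adj(1)[OF G E F compact_adj[OF K] T]])
    fix K' assume K': "K' \<in> cpt F F"
    have "op_comp G K' (L G K) = op_comp G (op_comp E K' T) K"
      using D(5)[OF G F K K'] by (simp add: TR[OF K'])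
    thus "op_comp G K' (L G K) = op_comp G K' (op_comp G T K)"
      by (simp add: op_comp_assoc[OF G E F F compact_adj[OF K] T compact_adj[OF K']])
  qed
  have R: "R G K = op_comp E K T" if G: "hilbert_module C G" and K: "K \<in> cpt F G" for G K
  proof (rule op_comp_right_cancel[OF E G compact_adj[OF Rc[OF G K]] op_comp_adj(1)[OF E F G T compact_adj[OF K]]])
    fix K' assume K': "K' \<in> cpt E E"
    have "op_comp E (R G K) K' = op_comp E K (op_comp E T K')"
      using D(5)[OF E G K' K] by (simp add: TL[OF K'])
    thus "op_comp E (R G K) K' = op_comp E (op_comp E K T) K'"
      by (simp add: op_comp_assoc[OF E E F G compact_adj[OF K'] T compact_adj[OF K]])
  qed
  have "m = to_multiplier E F T"
    unfolding m_eq to_multiplier_def prod.inject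
  proof
    show "L = (\<lambda>G\<in>Mods. \<lambda>K\<in>cpt G E. op_comp G T K)"
    proof (rule ext, rule ext)
      show "L G K = (\<lambda>G\<in>Mods. \<lambda>K\<in>cpt G E. op_comp G T K) G K" for G K
        using D(1) L[of G K] by (auto simp: restrict_def PiE_def extensional_def Pi_iff)
    qed
    show "R = (\<lambda>G\<in>Mods. \<lambda>K\<in>cpt F G. op_comp E K T)"
    proof (rule ext, rule ext)
      show "R G K = (\<lambda>G\<in>Mods. \<lambda>K\<in>cpt F G. op_comp E K T) G K" for G K
        using D(2) R[of G K] by (auto simp: restrict_def PiE_def extensional_def Pi_iff)
    qed
  qed
  thus ?thesis using T by blast
qed

text \<open>The norm of a multiplier is computed on compact operators on \<open>E\<close> alone; letting these run through an
approximate unit at \<open>e\<close> recovers \<open>\<parallel>T e\<parallel>\<close>.\<close>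

lemma operator_norm_to_multiplier:
  assumes E: "hilbert_module C E" and F: "hilbert_module C F" and T: "T \<in> adj E F"
  shows "operator_norm (homsp (KHilb C) E E) (homsp (KHilb C) E F) (fst (to_multiplier E F T) E) = opn E F T"
proof -
  interpret E: hilbert_cstar_module C E by (rule hilbert_cstar_moduleI[OF E])
  interpret F: hilbert_cstar_module C F by (rule hilbert_cstar_moduleI[OF F])
  let ?B = "{K \<in> cpt E E. opn E E K \<le> 1}"
  let ?N = "SUP K\<in>?B. opn E F (op_comp E T K)"
  have e: "operator_norm (homsp (KHilb C) E E) (homsp (KHilb C) E F) (fst (to_multiplier E F T) E) = ?N"
    unfolding operator_norm_def using E by (intro SUP_cong) (auto simp: to_multiplier_def)
  have le: "opn E F (op_comp E T K) \<le> opn E F T" if "K \<in> ?B" for K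
  proof -
    have "opn E F (op_comp E T K) \<le> opn E F T * opn E E K"
      using op_comp_adj(3)[OF E E F compact_adj T] that by blast
    also have "\<dots> \<le> opn E F T * 1" using that opn_nonneg[OF T] by (intro mult_left_mono) auto
    finally show ?thesis by simp
  qed
  have bdd: "bdd_above ((\<lambda>K. opn E F (op_comp E T K)) ` ?B)"
    by (rule bdd_aboveI2[of _ _ "opn E F T"]) (rule le)
  interpret V: carrier_normed_space "adjsp E E" "opn E E" by (rule adj_normed[OF E E])
  have z: "\<zero>\<^bsub>adjsp E E\<^esub> \<in> ?B" using compact_zero[OF E E] V.norm_zero by simp
  have N0: "0 \<le> ?N"
    using cSUP_upper[OF z bdd] opn_nonneg[OF op_comp_adj(1)[OF E E F adj_zero[OF E E] T]] by linarith
  have "opn E F T \<le> ?N"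
  proof (rule opn_le[OF N0])
    fix x e assume x: "x \<in> Ob C" and e: "e \<in> elts E x"
    interpret VE: carrier_normed_space "fibre E x" "module_norm C E x" by (rule E.fibre_normed[OF x])
    interpret VF: carrier_normed_space "fibre F x" "module_norm C F x" by (rule F.fibre_normed[OF x])
    have Te: "T x e \<in> elts F x" by (rule adj_closed[OF T x e])
    have t0: "opn E F T \<ge> 0" by (rule opn_nonneg[OF T])
    show "module_norm C F x (T x e) \<le> ?N * module_norm C E x e"
    proof (rule field_le_epsilon)
      fix r :: real assume r: "r > 0"
      have "r / (opn E F T + 1) > 0" using r t0 by simp
      then obtain K where K: "K \<in> cpt E E" "opn E E K \<le> 1"
        "module_norm C E x (K x e \<ominus>\<^bsub>fibre E x\<^esub> e) \<le> r / (opn E F T + 1)"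
        using approximate_unit_norm[OF E x e] by blast
      have Ke: "K x e \<in> elts E x" by (rule adj_closed[OF compact_adj[OF K(1)] x e])
      have TKe: "T x (K x e) \<in> elts F x" by (rule adj_closed[OF T x Ke])
      have "module_norm C F x (T x (K x e)) \<le> opn E F (op_comp E T K) * module_norm C E x e"
        using opn_bound[OF E F op_comp_adj(1)[OF E E F compact_adj[OF K(1)] T] x e] x e by simp
      also have "\<dots> \<le> ?N * module_norm C E x e"
        using K bdd x e by (intro mult_right_mono cSUP_upper) auto
      finally have 1: "module_norm C F x (T x (K x e)) \<le> ?N * module_norm C E x e" .
      have "module_norm C F x (T x (K x e) \<ominus>\<^bsub>fibre F x\<^esub> T x e) = module_norm C F x (T x (K x e \<ominus>\<^bsub>fibre E x\<^esub> e))"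
        by (simp add: complex_linear_diff[OF VE.space VF.space adj_linear[OF T x] Ke e])
      also have "\<dots> \<le> opn E F T * module_norm C E x (K x e \<ominus>\<^bsub>fibre E x\<^esub> e)"
        using Ke e by (intro opn_bound[OF E F T x]) auto
      also have "\<dots> \<le> opn E F T * (r / (opn E F T + 1))" using K(3) t0 by (rule mult_left_mono)
      also have "\<dots> \<le> r" using r t0 by (simp add: field_simps)
      finally show "module_norm C F x (T x e) \<le> ?N * module_norm C E x e + r"
        using 1 VF.norm_le_diff[OF Te TKe] VF.norm_diff_commute[OF Te TKe] by linarith
    qed
  qed
  moreover have "?N \<le> opn E F T" using z le by (intro cSUP_least) auto
  ultimately show ?thesis unfolding e by simp
qed

theorem Hilb_multiplier_isomorphism:
  "star_category_isomorphism (Hilb C :: (('o, 'm, 'e) hilbert_module_data, 'o \<Rightarrow> 'e \<Rightarrow> 'e) star_category)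
     (multiplier_category (KHilb C)) to_multiplier op_id"
proof (intro star_category_isomorphism.intro star_category_isomorphism_axioms.intro Hilb_cstar_category,
    unfold Hilb_simps mem_Collect_eq adjsp_simps)
  show "Ob (multiplier_category (KHilb C :: (('o, 'm, 'e) hilbert_module_data, 'o \<Rightarrow> 'e \<Rightarrow> 'e) star_category)) = Mods"
    by (simp add: multiplier_category_def)
  fix E :: "('o, 'm, 'e) hilbert_module_data" assume E: "hilbert_module C E"
  show "identity_arrow (Hilb C) E (op_id E)"
    using op_id_adj[OF E] op_comp_id(1)[OF E] op_comp_id(2)[OF _ E] by (simp add: identity_arrow_def)
  fix F :: "('o, 'm, 'e) hilbert_module_data" assume F: "hilbert_module C F"
  show "bij_betw (to_multiplier E F) (adj E F) (carrier (homsp (multiplier_category (KHilb C)) E F))"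
    unfolding bij_betw_def
  proof
    show "inj_on (to_multiplier E F) (adj E F)"
      using to_multiplier_inj[OF E F] by (auto intro!: inj_onI)
    show "to_multiplier E F ` adj E F = carrier (homsp (multiplier_category (KHilb C)) E F)"
    proof -
      have "to_multiplier E F ` adj E F = multipliers (KHilb C) E F"
        using to_multiplier_multiplier[OF E F] to_multiplier_surj[OF E F] by blast
      thus ?thesis by (simp add: multiplier_category_def multiplier_space_def)
    qed
  qed
  show "to_multiplier E F \<zero>\<^bsub>adjsp E F\<^esub> = \<zero>\<^bsub>homsp (multiplier_category (KHilb C)) E F\<^esub>"
  proof -
    have 1: "\<zero>\<^bsub>adjsp G F\<^esub> = op_comp G \<zero>\<^bsub>adjsp E F\<^esub> K" if G: "hilbert_module C G" and K: "K \<in> cpt G E" for G K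
      using complex_linear_zero[OF adj_vector_space[OF E F] adj_vector_space[OF G F] op_comp_linear_left[OF G E F compact_adj[OF K]]] by simp
    have 2: "\<zero>\<^bsub>adjsp E G\<^esub> = op_comp E K \<zero>\<^bsub>adjsp E F\<^esub>" if G: "hilbert_module C G" and K: "K \<in> cpt F G" for G K
      using complex_linear_zero[OF adj_vector_space[OF E F] adj_vector_space[OF E G] op_comp_linear_right[OF E F G compact_adj[OF K]]] by simp
    show ?thesis
      by (auto simp: 1 2 multiplier_category_def multiplier_space_def to_multiplier_def restrict_def fun_eq_iff)
  qed
  fix T assume T: "T \<in> adj E F"
  show "to_multiplier E F (c \<odot>\<^bsub>adjsp E F\<^esub> T) = c \<odot>\<^bsub>homsp (multiplier_category (KHilb C)) E F\<^esub> to_multiplier E F T" for c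
  proof -
    have 1: "c \<odot>\<^bsub>adjsp G F\<^esub> op_comp G T K = op_comp G (c \<odot>\<^bsub>adjsp E F\<^esub> T) K" if G: "hilbert_module C G" and K: "K \<in> cpt G E" for G K
      using complex_linearD(3)[OF op_comp_linear_left[OF G E F compact_adj[OF K]]] T by simp
    have 2: "c \<odot>\<^bsub>adjsp E G\<^esub> op_comp E K T = op_comp E K (c \<odot>\<^bsub>adjsp E F\<^esub> T)" if G: "hilbert_module C G" and K: "K \<in> cpt F G" for G K
      using complex_linearD(3)[OF op_comp_linear_right[OF E F G compact_adj[OF K]]] T by simp
    show ?thesis
      by (auto simp: 1 2 multiplier_category_def multiplier_space_def to_multiplier_def restrict_def fun_eq_iff)
  qed
  show "nrm (homsp (multiplier_category (KHilb C)) E F) (to_multiplier E F T) = opn E F T"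
    using operator_norm_to_multiplier[OF E F T]
    by (simp add: multiplier_category_def multiplier_space_def case_prod_unfold)
  show "to_multiplier F E (dagger E F T) = star (multiplier_category (KHilb C)) E F (to_multiplier E F T)"
  proof -
    have 1: "dagger E G (op_comp E (dagger G F K) T) = op_comp G (dagger E F T) K"
      if G: "hilbert_module C G" and K: "K \<in> cpt G F" for G K
      using op_comp_adj(2)[OF E F G T dagger_adj(1)[OF G F compact_adj[OF K]]] dagger_dagger[OF G F compact_adj[OF K]] by simp
    have 2: "dagger G F (op_comp G T (dagger E G K)) = op_comp F K (dagger E F T)"
      if G: "hilbert_module C G" and K: "K \<in> cpt E G" for G K
      using op_comp_adj(2)[OF G E F dagger_adj(1)[OF E G compact_adj[OF K]] T] dagger_dagger[OF E G compact_adj[OF K]] by simp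
    show ?thesis
      using compact_dagger[OF _ F] compact_dagger[OF E]
      by (auto simp: 1 2 multiplier_category_def to_multiplier_def restrict_def fun_eq_iff)
  qed
  {
    fix S assume S: "S \<in> adj E F"
    have 1: "op_comp G T K \<oplus>\<^bsub>adjsp G F\<^esub> op_comp G S K = op_comp G (T \<oplus>\<^bsub>adjsp E F\<^esub> S) K" if G: "hilbert_module C G" and K: "K \<in> cpt G E" for G K
      using complex_linearD(2)[OF op_comp_linear_left[OF G E F compact_adj[OF K]]] T S by simp
    have 2: "op_comp E K T \<oplus>\<^bsub>adjsp E G\<^esub> op_comp E K S = op_comp E K (T \<oplus>\<^bsub>adjsp E F\<^esub> S)" if G: "hilbert_module C G" and K: "K \<in> cpt F G" for G K
      using complex_linearD(2)[OF op_comp_linear_right[OF E F G compact_adj[OF K]]] T S by simp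
    show "to_multiplier E F (T \<oplus>\<^bsub>adjsp E F\<^esub> S) =
        to_multiplier E F T \<oplus>\<^bsub>homsp (multiplier_category (KHilb C)) E F\<^esub> to_multiplier E F S"
      by (auto simp: 1 2 multiplier_category_def multiplier_space_def to_multiplier_def restrict_def fun_eq_iff)
  }
  fix G S assume G: "hilbert_module C G" and S: "S \<in> adj F G"
  show "to_multiplier E G (op_comp E S T) = comp (multiplier_category (KHilb C)) E F G (to_multiplier F G S) (to_multiplier E F T)"
  proof -
    have 1: "op_comp H S (op_comp H T K) = op_comp H (op_comp E S T) K" if H: "hilbert_module C H" and K: "K \<in> cpt H E" for H K
      by (rule op_comp_assoc[OF H E F G compact_adj[OF K] T S, symmetric])
    have 2: "op_comp E (op_comp F K S) T = op_comp E K (op_comp E S T)" if H: "hilbert_module C H" and K: "K \<in> cpt G H" for H K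
      by (rule op_comp_assoc[OF E F G H T S compact_adj[OF K]])
    show ?thesis
      using compact_comp_left[OF _ E F _ T] compact_comp_right[OF F G _ S]
      by (auto simp: 1 2 multiplier_category_def to_multiplier_def restrict_def fun_eq_iff)
  qed
qed

end

theorem proposition3p38:
  fixes A :: "('o, 'm) star_category"
  assumes "cstar_category A"
  shows "cstar_equivalent
    (multiplier_category
      (KHilb A :: (('o, 'm, 'e) hilbert_module_data, 'o \<Rightarrow> 'e \<Rightarrow> 'e) star_category))
    (Hilb A :: (('o, 'm, 'e) hilbert_module_data, 'o \<Rightarrow> 'e \<Rightarrow> 'e) star_category)"
  by (rule star_category_isomorphism.target_equivalent[OF cstar_category.Hilb_multiplier_isomorphism[OF assms]])

end
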